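(* Let $M/F$ be a PAC extension. Then Dirichlet's theorem holds for $F[X]$ and ${\mathcal N}(M)$: for any relatively prime $a(X),b(X)\in F[X]$ there exists $n_0>0$ such that for every integer $n\ge n_0$ with $n\in{\mathcal N}(M)$ there are infinitely many $c(X)\in F[X]$ such that $a(X)+b(X)c(X)$ is irreducible over $F$ of degree $n$.
   Context: A field extension $M/F$ is a PAC extension if for every nonempty variety $V$ of dimension $r$ defined over $M$ and every dominating separable rational map $\phi\colon V\to\mathbb{A}^r$ over $M$ there exists $a\in V(M)$ with $\phi(a)\in F^r$. ${\mathcal N}(M)$ denotes the set of positive integers $n$ such that $M$ has a separable extension of degree $n$.
   Formalization: The polynomial b(X) is assumed nonzero; for b = 0 and a = 1, which are relatively prime, a + bc = 1 is never irreducible, so the claim fails whenever N(M) is unbounded. *)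

theory Defs
  imports
    "HOL-Library.Poly_Mapping"
    "HOL-Library.FuncSet"
    "HOL-Computational_Algebra.Computational_Algebra"
    "HOL-Algebra.Algebraic_Closure_Type"
begin

section \<open>A universal domain\<close>

text \<open>
  Varieties are treated in the style of Weil: all points have coordinates in one algebraically
  closed field that has infinite transcendence degree over the base field \<open>M\<close>, here the algebraic
  closure of \<open>M(X\<^sub>0, X\<^sub>1, \<dots>)\<close>. Every finitely generated field extension of \<open>M\<close> embeds into it
  over \<open>M\<close>, so every variety defined over \<open>M\<close> has a generic point over \<open>M\<close> in it.
\<close>

type_synonym 'a mpol = "(nat \<Rightarrow>\<^sub>0 nat) \<Rightarrow>\<^sub>0 'a"

type_synonym 'm univ_dom = "'m mpol fract alg_closure"

definition to_univ :: "'m::field \<Rightarrow> 'm univ_dom" where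
  "to_univ c = to_ac (Fract (Poly_Mapping.single 0 c) 1)"

section \<open>Polynomials in finitely many variables\<close>

definition eval_mpol :: "(nat \<Rightarrow> 'u) \<Rightarrow> 'u::comm_ring_1 mpol \<Rightarrow> 'u" where
  "eval_mpol x p = (\<Sum>m\<in>Poly_Mapping.keys p.
     Poly_Mapping.lookup p m * (\<Prod>i\<in>Poly_Mapping.keys m. x i ^ Poly_Mapping.lookup m i))"

text \<open>\<open>mpols K n\<close> is \<open>K[X\<^sub>0, \<dots>, X\<^bsub>n-1\<^esub>]\<close>, as a subset of the polynomials over the big field.\<close>

definition mpols :: "'u::comm_ring_1 set \<Rightarrow> nat \<Rightarrow> 'u mpol set" where
  "mpols K n = {p. \<forall>m\<in>Poly_Mapping.keys p.
     Poly_Mapping.lookup p m \<in> K \<and> Poly_Mapping.keys m \<subseteq> {..<n}}"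

text \<open>\<open>gen_field K n x\<close> is \<open>K(x\<^sub>0, \<dots>, x\<^bsub>n-1\<^esub>)\<close>, for a subfield \<open>K\<close>.\<close>

definition gen_field :: "'u::field set \<Rightarrow> nat \<Rightarrow> (nat \<Rightarrow> 'u) \<Rightarrow> 'u set" where
  "gen_field K n x =
     {eval_mpol x p / eval_mpol x q | p q. p \<in> mpols K n \<and> q \<in> mpols K n \<and> eval_mpol x q \<noteq> 0}"

section \<open>Algebraic and separable elements, transcendence degree\<close>

definition alg_over :: "'u::field set \<Rightarrow> 'u \<Rightarrow> bool" where
  "alg_over K y \<longleftrightarrow> (\<exists>P. (\<forall>i. coeff P i \<in> K) \<and> P \<noteq> 0 \<and> poly P y = 0)"

text \<open>
  Over an algebraically closed field \<open>rsquarefree P\<close> says that \<open>P\<close> has no multiple root in an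
  algebraic closure, i.e. that \<open>P\<close> is a separable polynomial.
\<close>

definition separable_over :: "'u::alg_closed_field set \<Rightarrow> 'u \<Rightarrow> bool" where
  "separable_over K y \<longleftrightarrow> (\<exists>P. (\<forall>i. coeff P i \<in> K) \<and> rsquarefree P \<and> poly P y = 0)"

definition alg_indep :: "'u::field set \<Rightarrow> nat \<Rightarrow> (nat \<Rightarrow> 'u) \<Rightarrow> bool" where
  "alg_indep K r t \<longleftrightarrow> (\<forall>g\<in>mpols K r. eval_mpol t g = 0 \<longrightarrow> g = 0)"

definition has_trdeg :: "'u::field set \<Rightarrow> 'u set \<Rightarrow> nat \<Rightarrow> bool" where
  "has_trdeg K L r \<longleftrightarrow>
     (\<exists>t. (\<forall>i<r. t i \<in> L) \<and> alg_indep K r t \<and> (\<forall>y\<in>L. alg_over (gen_field K r t) y))"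

section \<open>Affine varieties\<close>

text \<open>Affine \<open>n\<close>-space is \<open>{..<n} \<rightarrow>\<^sub>E UNIV\<close>.\<close>

definition zariski_closed :: "nat \<Rightarrow> (nat \<Rightarrow> 'u::field) set \<Rightarrow> bool" where
  "zariski_closed n V \<longleftrightarrow>
     (\<exists>S\<subseteq>mpols UNIV n. V = {x \<in> {..<n} \<rightarrow>\<^sub>E UNIV. \<forall>p\<in>S. eval_mpol x p = 0})"

definition zariski_irreducible :: "nat \<Rightarrow> (nat \<Rightarrow> 'u::field) set \<Rightarrow> bool" where
  "zariski_irreducible n V \<longleftrightarrow> V \<noteq> {} \<and>
     (\<forall>A B. zariski_closed n A \<and> zariski_closed n B \<and> V = A \<union> B \<longrightarrow> V = A \<or> V = B)"

definition vanishing_ideal :: "nat \<Rightarrow> (nat \<Rightarrow> 'u::field) set \<Rightarrow> 'u mpol set" where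
  "vanishing_ideal n V = {p \<in> mpols UNIV n. \<forall>x\<in>V. eval_mpol x p = 0}"

text \<open>
  \<open>K\<close> is a field of definition: the vanishing ideal over the big field is generated by polynomials
  with coefficients in \<open>K\<close>. (It is not enough that \<open>V\<close> is the zero set of such polynomials,
  as the point \<open>X\<^sup>p = t\<close> in characteristic \<open>p\<close> shows.)
\<close>

definition defined_over :: "'u::field set \<Rightarrow> nat \<Rightarrow> (nat \<Rightarrow> 'u) set \<Rightarrow> bool" where
  "defined_over K n V \<longleftrightarrow>
     (\<forall>f\<in>vanishing_ideal n V. \<exists>H g. finite H \<and> H \<subseteq> vanishing_ideal n V \<inter> mpols K n \<and>
        (\<forall>h\<in>H. g h \<in> mpols UNIV n) \<and> f = (\<Sum>h\<in>H. g h * h))"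

definition variety_over :: "'u::alg_closed_field set \<Rightarrow> nat \<Rightarrow> (nat \<Rightarrow> 'u) set \<Rightarrow> bool" where
  "variety_over K n V \<longleftrightarrow> zariski_closed n V \<and> zariski_irreducible n V \<and> defined_over K n V"

text \<open>
  If \<open>x\<close> is a generic point of \<open>V\<close> over \<open>K\<close>, then \<open>K[X]/(I(V) \<inter> K[X])\<close> is isomorphic to \<open>K[x]\<close>, so
  \<open>gen_field K n x\<close> is the function field \<open>K(V)\<close>; its transcendence degree is \<open>dim V\<close>.
\<close>

definition generic_point :: "'u::field set \<Rightarrow> nat \<Rightarrow> (nat \<Rightarrow> 'u) set \<Rightarrow> (nat \<Rightarrow> 'u) \<Rightarrow> bool" where
  "generic_point K n V x \<longleftrightarrow>
     x \<in> V \<and> (\<forall>p\<in>mpols K n. eval_mpol x p = 0 \<longrightarrow> p \<in> vanishing_ideal n V)"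

section \<open>Rational maps to affine space\<close>

text \<open>
  \<open>rat_value K n x a y c\<close>: the rational function \<open>y \<in> K(x) = K(V)\<close> is defined at the point \<open>a\<close> of \<open>V\<close>
  and has the value \<open>c\<close> there. A rational map \<open>V \<rightarrow> \<bbbA>\<^sup>r\<close> over \<open>K\<close> is a family \<open>\<phi>\<close> of \<open>r\<close> such functions.
\<close>

definition rat_value ::
  "'u::field set \<Rightarrow> nat \<Rightarrow> (nat \<Rightarrow> 'u) \<Rightarrow> (nat \<Rightarrow> 'u) \<Rightarrow> 'u \<Rightarrow> 'u \<Rightarrow> bool" where
  "rat_value K n x a y c \<longleftrightarrow>
     (\<exists>p\<in>mpols K n. \<exists>q\<in>mpols K n. eval_mpol x q \<noteq> 0 \<and> y = eval_mpol x p / eval_mpol x q \<and>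
        eval_mpol a q \<noteq> 0 \<and> c = eval_mpol a p / eval_mpol a q)"

definition rat_map :: "'u::field set \<Rightarrow> nat \<Rightarrow> (nat \<Rightarrow> 'u) \<Rightarrow> nat \<Rightarrow> (nat \<Rightarrow> 'u) \<Rightarrow> bool" where
  "rat_map K n x r \<phi> \<longleftrightarrow> (\<forall>i<r. \<phi> i \<in> gen_field K n x)"

definition rat_map_value ::
  "'u::field set \<Rightarrow> nat \<Rightarrow> (nat \<Rightarrow> 'u) \<Rightarrow> nat \<Rightarrow> (nat \<Rightarrow> 'u) \<Rightarrow> (nat \<Rightarrow> 'u) \<Rightarrow> (nat \<Rightarrow> 'u) \<Rightarrow> bool" where
  "rat_map_value K n x r \<phi> a b \<longleftrightarrow> (\<forall>i<r. rat_value K n x a (\<phi> i) (b i))"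

text \<open>Dominating: the image is Zariski dense.\<close>

definition dominating ::
  "'u::field set \<Rightarrow> nat \<Rightarrow> (nat \<Rightarrow> 'u) set \<Rightarrow> (nat \<Rightarrow> 'u) \<Rightarrow> nat \<Rightarrow> (nat \<Rightarrow> 'u) \<Rightarrow> bool" where
  "dominating K n V x r \<phi> \<longleftrightarrow>
     (\<forall>W. zariski_closed r W \<and> {b \<in> {..<r} \<rightarrow>\<^sub>E UNIV. \<exists>a\<in>V. rat_map_value K n x r \<phi> a b} \<subseteq> W
        \<longrightarrow> W = {..<r} \<rightarrow>\<^sub>E UNIV)"

text \<open>
  Separable: the function field \<open>K(x)\<close> is a separable extension of \<open>K(\<phi>\<^sub>1, \<dots>, \<phi>\<^sub>r)\<close>. For a dominating
  map from a variety of dimension \<open>r\<close> to \<open>\<bbbA>\<^sup>r\<close>, the only case used, this extension is algebraic.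
\<close>

definition separable_map ::
  "'u::alg_closed_field set \<Rightarrow> nat \<Rightarrow> (nat \<Rightarrow> 'u) \<Rightarrow> nat \<Rightarrow> (nat \<Rightarrow> 'u) \<Rightarrow> bool" where
  "separable_map K n x r \<phi> \<longleftrightarrow> (\<forall>y\<in>gen_field K n x. separable_over (gen_field K r \<phi>) y)"

section \<open>PAC extensions\<close>

text \<open>
  The extension \<open>M/F\<close> is given by a field embedding \<open>j\<close> of \<open>F\<close> into \<open>M\<close> (a homomorphism of fields is
  automatically injective). Nonemptiness of \<open>V\<close> is part of irreducibility.
\<close>

definition pac_extension :: "('f::field \<Rightarrow> 'm::field) \<Rightarrow> bool" where
  "pac_extension j \<longleftrightarrow>
     j \<in> ring_hom ring_of_type_algebra ring_of_type_algebra \<and>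
     (\<forall>n r V x \<phi>.
        variety_over (range (to_univ :: 'm \<Rightarrow> _)) n V \<and>
        generic_point (range to_univ) n V x \<and>
        has_trdeg (range to_univ) (gen_field (range to_univ) n x) r \<and>
        rat_map (range to_univ) n x r \<phi> \<and>
        dominating (range to_univ) n V x r \<phi> \<and>
        separable_map (range to_univ) n x r \<phi> \<longrightarrow>
        (\<exists>a\<in>V. (\<forall>i<n. a i \<in> range to_univ) \<and>
           (\<exists>c. rat_map_value (range to_univ) n x r \<phi> a (\<lambda>i. to_univ (j (c i))))))"

section \<open>Degrees of separable extensions\<close>

text \<open>
  Every finite extension of \<open>M\<close> embeds into the algebraic closure of \<open>M\<close>. As \<open>n > 0\<close> and \<open>dim\<close> is \<open>0\<close>
  for spaces without a finite basis, the extension \<open>L\<close> is finite.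
\<close>

definition separable_degrees :: "'m::field itself \<Rightarrow> nat set" where
  "separable_degrees _ =
     {n. n > 0 \<and> (\<exists>L :: 'm alg_closure set.
        subfield L ring_of_type_algebra \<and> range to_ac \<subseteq> L \<and>
        (\<forall>y\<in>L. separable_over (range to_ac) y) \<and>
        vector_space.dim (\<lambda>(c::'m) y. to_ac c * y) L = n)}"

end

(*
  Let f_t = A + b (t_0 + t_1 (X - xi)) with A = (X - xi)^2 g congruent to a modulo b, where g is monic and
  separable of degree n - 2 and g(xi) is not 0. Over the rational function field in t_0, t_1 the Galois
  group of f_t is the full symmetric group, also geometrically: two roots of f_t determine t_0 and t_1, so
  any two roots are algebraically independent and the group is doubly transitive; and modulo t_0, t_1 the
  polynomial degenerates to (X - xi)^2 g, so that the inertia group contains a transposition.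

  Let p over M be separable and irreducible of degree n. The points (t, Y, U) with p | f_t(Y) and
  p | U(Y) - X form a twisted form of the splitting cover of f_t, in which the roots of f_t are permuted as
  those of p. Since the geometric group is the symmetric group, this is an absolutely irreducible variety,
  defined over M, and its projection to the t-plane is separable and dominating. By the PAC property it has
  an M-rational point with t in F^2, for which Y identifies the roots of p with the roots of f_t. Hence f_t
  is irreducible over M, a fortiori over F, and f_t = a + b c with c in F[X]. Infinitely many g are possible.
*)

theory Submission
  imports Defs "HOL-Combinatorics.Permutations"
begin

text \<open>A field of definition is a condition on the vanishing ideal, so knowing the zero set
  does not suffice: the equations have to generate the whole ideal. Over the universal domain, where
  \<open>p\<close> splits, the coordinates are recovered from the values Z_k = Y(\<theta>_k), and
  modulo the equations the coordinate ring is a splitting algebra of f_t over k[t_0, t_1], up to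
  denominators that are units. A root count in one Z_k after another shows that functions vanishing
  at enough points lie in the ideal. The polynomial U makes the differences Z_i - Z_k units; without
  it Y could merge roots of \<open>p\<close>, and the zero set would acquire further components.
  Galois groups enter only as permutations of the roots that preserve all polynomial relations; such
  maps extend along algebraic elements into any algebraically closed field. The ideal is prime
  because a single point with transcendental parameters decides membership in it, and this is where
  all permutations are needed. Since \<xi> and infinitely many g are chosen in F, the field F must
  be infinite; this is itself a consequence of the PAC property.\<close>

section \<open>Homomorphisms of commutative rings and their effect on polynomials\<close>

locale rhom =
  fixes h :: "'a::comm_ring_1 \<Rightarrow> 'b::comm_ring_1"
  assumes zero [simp]: "h 0 = 0" and one [simp]: "h 1 = 1"
    and add [simp]: "h (x + y) = h x + h y" and mult [simp]: "h (x * y) = h x * h y"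
begin

lemma uminus [simp]: "h (- x) = - h x"
  by (metis add.right_inverse add zero minus_unique)

lemma diff [simp]: "h (x - y) = h x - h y"
  using add[of x "- y"] by simp

lemma sum: "h (sum f A) = (\<Sum>i\<in>A. h (f i))"
  by (induction A rule: infinite_finite_induct) auto

lemma prod: "h (prod f A) = (\<Prod>i\<in>A. h (f i))"
  by (induction A rule: infinite_finite_induct) auto

lemma power [simp]: "h (x ^ n) = h x ^ n"
  by (induction n) auto

lemma coeff [simp]: "coeff (map_poly h p) i = h (coeff p i)"
  by (simp add: coeff_map_poly)

lemma map_poly_add [simp]: "map_poly h (p + q) = map_poly h p + map_poly h q"
  by (rule poly_eqI) simp

lemma map_poly_diff [simp]: "map_poly h (p - q) = map_poly h p - map_poly h q"
  by (rule poly_eqI) simp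

lemma map_poly_smult [simp]: "map_poly h (smult c p) = smult (h c) (map_poly h p)"
  by (rule poly_eqI) simp

lemma map_poly_pCons' [simp]: "map_poly h (pCons c p) = pCons (h c) (map_poly h p)"
  by (rule poly_eqI) (simp add: coeff_pCons split: nat.split)

lemma map_poly_mult [simp]: "map_poly h (p * q) = map_poly h p * map_poly h q"
  by (rule poly_eqI) (simp add: coeff_mult sum)

lemma map_poly_one [simp]: "map_poly h 1 = 1"
  by (rule poly_eqI) (simp add: coeff_1)

lemma map_poly_power [simp]: "map_poly h (p ^ n) = map_poly h p ^ n"
  by (induction n) auto

lemma poly [simp]: "poly (map_poly h p) (h x) = h (poly p x)"
  by (induction p) auto

lemma map_poly_pcompose [simp]: "map_poly h (pcompose p q) = pcompose (map_poly h p) (map_poly h q)"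
  by (induction p) (auto simp: pcompose_pCons)

lemma of_nat [simp]: "h (of_nat n) = of_nat n"
  by (induction n) auto

lemma map_poly_sum: "map_poly h (sum f A) = (\<Sum>i\<in>A. map_poly h (f i))"
  by (induction A rule: infinite_finite_induct) auto

lemma map_poly_prod: "map_poly h (prod f A) = (\<Prod>i\<in>A. map_poly h (f i))"
  by (induction A rule: infinite_finite_induct) auto

lemma map_poly_monom [simp]: "map_poly h (monom c n) = monom (h c) n"
  by (rule poly_eqI) (simp add: coeff_monom)

end

lemma map_poly_pderiv:
  fixes h :: "'a::idom \<Rightarrow> 'b::idom"
  assumes "rhom h"
  shows "map_poly h (pderiv p) = pderiv (map_poly h p)"
proof -
  interpret rhom h by fact
  show ?thesis by (rule poly_eqI) (simp add: coeff_pderiv)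
qed

lemma rhom_id: "rhom id" "rhom (\<lambda>x. x)"
  by unfold_locales auto

lemma rhom_comp: "rhom g \<Longrightarrow> rhom h \<Longrightarrow> rhom (\<lambda>x. g (h x))"
  by (simp add: rhom_def)

lemma rhom_inverse:
  fixes h :: "'a::field \<Rightarrow> 'b::field"
  assumes "rhom h"
  shows "h (inverse x) = inverse (h x)"
proof (cases "x = 0")
  case False
  interpret rhom h by fact
  have "h x * h (inverse x) = 1" using False by (simp flip: mult)
  thus ?thesis by (metis inverse_unique)
qed (use assms in \<open>simp add: rhom_def\<close>)

lemma rhom_eq_0_iff:
  fixes h :: "'a::field \<Rightarrow> 'b::field"
  assumes "rhom h"
  shows "h x = 0 \<longleftrightarrow> x = 0"
proof (cases "x = 0")
  case False
  have "h x * h (inverse x) = 1" using False assms by (simp add: rhom.mult[symmetric] rhom.one)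
  thus ?thesis using False by auto
qed (use assms in \<open>simp add: rhom_def\<close>)

lemma rhom_eq_iff:
  fixes h :: "'a::field \<Rightarrow> 'b::field"
  assumes "rhom h"
  shows "h x = h y \<longleftrightarrow> x = y"
  using rhom_eq_0_iff[OF assms, of "x - y"] rhom.diff[OF assms] by simp

lemma degree_map_poly_rhom:
  fixes h :: "'a::field \<Rightarrow> 'b::field"
  assumes "rhom h"
  shows "degree (map_poly h p) = degree p"
  by (intro degree_map_poly) (simp_all add: rhom_eq_0_iff assms)

lemma map_poly_rhom_eq_0_iff:
  fixes h :: "'a::field \<Rightarrow> 'b::field"
  assumes "rhom h"
  shows "map_poly h p = 0 \<longleftrightarrow> p = 0"
  using assms by (intro map_poly_eq_0_iff) (simp_all add: rhom_eq_0_iff)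

lemma rhom_iff_ring_hom:
  "h \<in> ring_hom ring_of_type_algebra ring_of_type_algebra \<Longrightarrow> h 0 = 0 \<Longrightarrow> rhom h"
  by (auto simp: ring_hom_def ring_of_type_algebra_def rhom_def)

subsection \<open>Evaluation of polynomials\<close>

text \<open>Coefficients travel along \<open>h\<close>, so that one polynomial over a small field
  can be evaluated in two different big fields and the vanishing of its values compared.\<close>

definition ev :: "('a::comm_ring_1 \<Rightarrow> 'b::comm_ring_1) \<Rightarrow> (nat \<Rightarrow> 'b) \<Rightarrow> 'a mpol \<Rightarrow> 'b" where
  "ev h x p = (\<Sum>m\<in>Poly_Mapping.keys p. h (Poly_Mapping.lookup p m) *
     (\<Prod>i\<in>Poly_Mapping.keys m. x i ^ Poly_Mapping.lookup m i))"

definition Var :: "nat \<Rightarrow> 'a::comm_ring_1 mpol" where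
  "Var i = Poly_Mapping.single (Poly_Mapping.single i 1) 1"

definition Cst :: "'a::comm_ring_1 \<Rightarrow> 'a mpol" where
  "Cst c = Poly_Mapping.single 0 c"

lemma eval_mpol_ev: "eval_mpol x p = ev id x p" "eval_mpol x p = ev (\<lambda>c. c) x p"
  by (simp_all add: eval_mpol_def ev_def)

lemma rhom_Cst: "rhom Cst"
  by unfold_locales (simp_all add: Cst_def single_add mult_single)

lemma monomial_value_add:
  fixes x :: "nat \<Rightarrow> 'b::comm_ring_1"
  shows "(\<Prod>i\<in>Poly_Mapping.keys (m + m'). x i ^ Poly_Mapping.lookup (m + m') i) =
    (\<Prod>i\<in>Poly_Mapping.keys m. x i ^ Poly_Mapping.lookup m i) *
    (\<Prod>i\<in>Poly_Mapping.keys m'. x i ^ Poly_Mapping.lookup m' i)"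
proof -
  let ?A = "Poly_Mapping.keys m \<union> Poly_Mapping.keys m'"
  have *: "(\<Prod>i\<in>Poly_Mapping.keys l. x i ^ Poly_Mapping.lookup l i) =
      (\<Prod>i\<in>?A. x i ^ Poly_Mapping.lookup l i)" if "Poly_Mapping.keys l \<subseteq> ?A" for l
    using that by (intro prod.mono_neutral_left) (auto simp: in_keys_iff)
  have "Poly_Mapping.keys (m + m') \<subseteq> ?A" by (rule Poly_Mapping.keys_add)
  from *[OF this] *[of m] *[of m'] show ?thesis
    by (simp add: lookup_add power_add prod.distrib)
qed

context rhom
begin

lemma ev_superset:
  assumes "finite A" "Poly_Mapping.keys p \<subseteq> A"
  shows "ev h x p = (\<Sum>m\<in>A. h (Poly_Mapping.lookup p m) *
     (\<Prod>i\<in>Poly_Mapping.keys m. x i ^ Poly_Mapping.lookup m i))"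
  unfolding ev_def using assms by (intro sum.mono_neutral_left) (auto simp: in_keys_iff)

lemma ev_add: "ev h x (p + q) = ev h x p + ev h x q"
proof -
  let ?A = "Poly_Mapping.keys p \<union> Poly_Mapping.keys q"
  have "Poly_Mapping.keys (p + q) \<subseteq> ?A" by (rule Poly_Mapping.keys_add)
  thus ?thesis
    by (simp add: ev_superset[of ?A] lookup_add distrib_right sum.distrib)
qed

lemma ev_single: "ev h x (Poly_Mapping.single m c) =
    h c * (\<Prod>i\<in>Poly_Mapping.keys m. x i ^ Poly_Mapping.lookup m i)"
  by (subst ev_superset[of "{m}"]) auto

lemma ev_sum: "ev h x (sum f A) = (\<Sum>i\<in>A. ev h x (f i))"
proof (induction A rule: infinite_finite_induct)
  case (insert i A)
  thus ?case by (simp add: ev_add)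
qed (simp_all add: ev_def)

lemma mpol_sum_singles:
  "(p :: 'a mpol) = (\<Sum>m\<in>Poly_Mapping.keys p. Poly_Mapping.single m (Poly_Mapping.lookup p m))"
proof (rule poly_mapping_eqI)
  fix k
  have "(\<Sum>m\<in>Poly_Mapping.keys p. Poly_Mapping.lookup (Poly_Mapping.single m (Poly_Mapping.lookup p m)) k)
      = (\<Sum>m\<in>Poly_Mapping.keys p. if m = k then Poly_Mapping.lookup p k else 0)"
    by (intro sum.cong refl) (auto simp: lookup_single when_def)
  also have "\<dots> = Poly_Mapping.lookup p k"
    by (auto simp: sum.delta in_keys_iff)
  finally show "Poly_Mapping.lookup p k = Poly_Mapping.lookup
      (\<Sum>m\<in>Poly_Mapping.keys p. Poly_Mapping.single m (Poly_Mapping.lookup p m)) k"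
    by (simp add: lookup_sum)
qed

lemma ev_mult: "ev h x (p * q) = ev h x p * ev h x q"
proof -
  have 1: "ev h x (Poly_Mapping.single m c * Poly_Mapping.single m' c') =
     ev h x (Poly_Mapping.single m c) * ev h x (Poly_Mapping.single m' c')" for m c m' c'
    by (simp add: mult_single ev_single monomial_value_add)
  have "ev h x (p * q) = ev h x ((\<Sum>m\<in>Poly_Mapping.keys p. Poly_Mapping.single m (Poly_Mapping.lookup p m)) *
      (\<Sum>m\<in>Poly_Mapping.keys q. Poly_Mapping.single m (Poly_Mapping.lookup q m)))"
    using mpol_sum_singles[of p] mpol_sum_singles[of q] by simp
  also have "\<dots> = ev h x (\<Sum>m\<in>Poly_Mapping.keys p. Poly_Mapping.single m (Poly_Mapping.lookup p m)) *
      ev h x (\<Sum>m\<in>Poly_Mapping.keys q. Poly_Mapping.single m (Poly_Mapping.lookup q m))"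
    by (simp add: sum_product ev_sum 1)
  finally show ?thesis using mpol_sum_singles[of p] mpol_sum_singles[of q] by simp
qed

lemma ev_Cst [simp]: "ev h x (Cst c) = h c"
  by (simp add: Cst_def ev_single)

lemma ev_Var [simp]: "ev h x (Var i) = x i"
  by (simp add: Var_def ev_single)

lemma rhom_ev: "rhom (ev h x)"
proof
  show "ev h x 1 = 1" using ev_Cst[of x 1] by (simp add: Cst_def)
qed (simp_all add: ev_add ev_mult, simp add: ev_def)

end

subsection \<open>Subrings and subfields\<close>

text \<open>Subrings and subfields are plain sets in a type-class ring, which keeps calculations in
  ordinary arithmetic; \<open>subfield_iff_is_subfield\<close> links them to the structures with
  carriers, whose field theory is used for algebraic elements.\<close>

definition is_subring :: "'a::comm_ring_1 set \<Rightarrow> bool" where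
  "is_subring K \<longleftrightarrow> 0 \<in> K \<and> 1 \<in> K \<and> (\<forall>x\<in>K. \<forall>y\<in>K. x + y \<in> K \<and> x * y \<in> K) \<and> (\<forall>x\<in>K. - x \<in> K)"

definition is_subfield :: "'a::field set \<Rightarrow> bool" where
  "is_subfield K \<longleftrightarrow> is_subring K \<and> (\<forall>x\<in>K. inverse x \<in> K)"

lemma is_subfield_subring: "is_subfield K \<Longrightarrow> is_subring K"
  by (simp add: is_subfield_def)

lemma is_subringD:
  assumes "is_subring K"
  shows "0 \<in> K" "1 \<in> K" "x \<in> K \<Longrightarrow> y \<in> K \<Longrightarrow> x + y \<in> K" "x \<in> K \<Longrightarrow> y \<in> K \<Longrightarrow> x * y \<in> K"
    "x \<in> K \<Longrightarrow> - x \<in> K" "x \<in> K \<Longrightarrow> y \<in> K \<Longrightarrow> x - y \<in> K" "x \<in> K \<Longrightarrow> x ^ n \<in> K"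
proof -
  show *: "0 \<in> K" "1 \<in> K" "x \<in> K \<Longrightarrow> y \<in> K \<Longrightarrow> x + y \<in> K" "x \<in> K \<Longrightarrow> y \<in> K \<Longrightarrow> x * y \<in> K"
    "x \<in> K \<Longrightarrow> - x \<in> K" for x y
    using assms by (auto simp: is_subring_def)
  show "x \<in> K \<Longrightarrow> y \<in> K \<Longrightarrow> x - y \<in> K" using *(3)[of x "- y"] *(5) by auto
  show "x \<in> K \<Longrightarrow> x ^ n \<in> K" by (induction n) (auto intro: *)
qed

lemma is_subring_sum:
  assumes "is_subring K" "\<And>i. i \<in> A \<Longrightarrow> f i \<in> K"
  shows "sum f A \<in> K"
  using assms(2) by (induction A rule: infinite_finite_induct) (auto intro: is_subringD[OF assms(1)])

lemma is_subring_prod: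
  assumes "is_subring K" "\<And>i. i \<in> A \<Longrightarrow> f i \<in> K"
  shows "prod f A \<in> K"
  using assms(2) by (induction A rule: infinite_finite_induct) (auto intro: is_subringD[OF assms(1)])

lemma is_subring_UNIV [simp]: "is_subring UNIV"
  by (simp add: is_subring_def)

lemma is_subfieldD:
  assumes "is_subfield K"
  shows "x \<in> K \<Longrightarrow> inverse x \<in> K" "x \<in> K \<Longrightarrow> y \<in> K \<Longrightarrow> x / y \<in> K"
  using assms is_subringD(4)[OF is_subfield_subring[OF assms]]
  by (auto simp: is_subfield_def divide_inverse)

lemma is_subring_range: "rhom h \<Longrightarrow> is_subring (range h)"
  unfolding is_subring_def using rhom.zero rhom.one rhom.add[symmetric] rhom.mult[symmetric]
    rhom.uminus[symmetric]
  by (smt (verit, best) image_iff rangeI)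

lemma is_subfield_range:
  fixes h :: "'a::field \<Rightarrow> 'b::field"
  assumes "rhom h"
  shows "is_subfield (range h)"
  using is_subring_range[OF assms] rhom_inverse[OF assms, symmetric] by (auto simp: is_subfield_def)

lemma is_subring_poly:
  assumes "is_subring K" "\<And>i. coeff P i \<in> K" "x \<in> K"
  shows "poly P x \<in> K"
  unfolding poly_altdef using assms by (intro is_subring_sum is_subringD) auto

definition polys_over :: "'a::comm_ring_1 set \<Rightarrow> 'a poly set" where
  "polys_over K = {P. \<forall>i. coeff P i \<in> K}"

lemma is_subring_polys_over:
  assumes "is_subring K"
  shows "is_subring (polys_over K)"
  unfolding is_subring_def polys_over_def
  using assms by (auto simp: coeff_mult coeff_1 intro!: is_subring_sum is_subringD)

lemma is_subring_mpols:
  assumes "is_subring K"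
  shows "is_subring (mpols K n)"
proof -
  note [simp] = is_subringD[OF assms]
  have add: "p + q \<in> mpols K n" if "p \<in> mpols K n" "q \<in> mpols K n" for p q
  proof -
    have "Poly_Mapping.lookup (p + q) m \<in> K \<and> Poly_Mapping.keys m \<subseteq> {..<n}"
      if m: "m \<in> Poly_Mapping.keys (p + q)" for m
    proof -
      have *: "Poly_Mapping.lookup r m \<in> K" if "r \<in> mpols K n" for r
        using that by (cases "m \<in> Poly_Mapping.keys r") (auto simp: mpols_def in_keys_iff)
      have "m \<in> Poly_Mapping.keys p \<union> Poly_Mapping.keys q"
        by (rule subsetD[OF Poly_Mapping.keys_add m])
      hence "Poly_Mapping.keys m \<subseteq> {..<n}"
        using \<open>p \<in> _\<close> \<open>q \<in> _\<close> by (auto simp: mpols_def)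
      thus ?thesis
        using *[OF \<open>p \<in> _\<close>] *[OF \<open>q \<in> _\<close>] by (simp add: lookup_add)
    qed
    thus ?thesis by (simp add: mpols_def)
  qed
  have zero: "0 \<in> mpols K n" by (simp add: mpols_def)
  have sums: "sum f A \<in> mpols K n" if "\<And>i. i \<in> A \<Longrightarrow> f i \<in> mpols K n" for f and A :: "'x set"
    using that by (induction A rule: infinite_finite_induct) (auto intro: add zero)
  have mono: "Poly_Mapping.single m c \<in> mpols K n" if "c \<in> K" "Poly_Mapping.keys m \<subseteq> {..<n}" for m c
    using that by (auto simp: mpols_def)
  have mult: "p * q \<in> mpols K n" if "p \<in> mpols K n" "q \<in> mpols K n" for p q
  proof -
    have "p * q = (\<Sum>m\<in>Poly_Mapping.keys p. Poly_Mapping.single m (Poly_Mapping.lookup p m)) *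
      (\<Sum>m\<in>Poly_Mapping.keys q. Poly_Mapping.single m (Poly_Mapping.lookup q m))"
      using rhom.mpol_sum_singles[OF rhom_id(1), of p] rhom.mpol_sum_singles[OF rhom_id(1), of q] by simp
    also have "\<dots> \<in> mpols K n"
      unfolding sum_product mult_single using that
      by (intro sums mono) (auto simp: mpols_def dest!: subsetD[OF Poly_Mapping.keys_add])
    finally show ?thesis .
  qed
  have one: "1 \<in> mpols K n" using mono[of 1 0] by simp
  have uminus: "- p \<in> mpols K n" if "p \<in> mpols K n" for p
    using mult[OF _ that, of "Poly_Mapping.single 0 (- 1)"] mono[of "- 1" 0]
    by (simp add: single_uminus)
  show ?thesis unfolding is_subring_def using add mult zero one uminus by auto
qed

lemma Cst_in_mpols: "c \<in> K \<Longrightarrow> Cst c \<in> mpols K n"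
  by (simp add: mpols_def Cst_def)

lemma Var_in_mpols: "is_subring K \<Longrightarrow> i < n \<Longrightarrow> Var i \<in> mpols K n"
  by (simp add: mpols_def Var_def is_subring_def)

lemma mpols_mono: "K \<subseteq> L \<Longrightarrow> m \<le> n \<Longrightarrow> mpols K m \<subseteq> mpols L n"
  unfolding mpols_def by fastforce

lemma single_eq_monomial:
  "Poly_Mapping.single m c = Cst c * (\<Prod>i\<in>Poly_Mapping.keys m. Var i ^ Poly_Mapping.lookup m i)"
proof -
  have pow: "Var i ^ k = Poly_Mapping.single (Poly_Mapping.single i k) (1::'a)" for i k
    by (induction k) (auto simp: Var_def mult_single single_add[symmetric])
  have pr: "(\<Prod>i\<in>A. Poly_Mapping.single (f i) (1::'a)) = Poly_Mapping.single (\<Sum>i\<in>A. f i) 1"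
    for A :: "nat set" and f :: "nat \<Rightarrow> nat \<Rightarrow>\<^sub>0 nat"
    by (induction A rule: infinite_finite_induct) (auto simp: mult_single)
  have m: "(\<Sum>i\<in>Poly_Mapping.keys m. Poly_Mapping.single i (Poly_Mapping.lookup m i)) = m"
  proof (rule poly_mapping_eqI)
    fix k
    have "(\<Sum>i\<in>Poly_Mapping.keys m. Poly_Mapping.lookup (Poly_Mapping.single i (Poly_Mapping.lookup m i)) k)
      = (\<Sum>i\<in>Poly_Mapping.keys m. if i = k then Poly_Mapping.lookup m k else 0)"
      by (intro sum.cong refl) (auto simp: lookup_single when_def)
    also have "\<dots> = Poly_Mapping.lookup m k" by (auto simp: sum.delta in_keys_iff)
    finally show "Poly_Mapping.lookup (\<Sum>i\<in>Poly_Mapping.keys m. Poly_Mapping.single i (Poly_Mapping.lookup m i)) k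
      = Poly_Mapping.lookup m k" by (simp add: lookup_sum)
  qed
  show ?thesis
    by (simp add: pow pr m Cst_def mult_single)
qed

text \<open>The premise \<open>0 \<in> K\<close> covers the zero polynomial, the empty sum of
  monomials.\<close>

lemma mpols_induct [consumes 2, case_names Cst Var add mult]:
  assumes "p \<in> mpols K n" "0 \<in> K"
    and C: "\<And>c. c \<in> K \<Longrightarrow> P (Cst c)" and V: "\<And>i. i < n \<Longrightarrow> P (Var i)"
    and A: "\<And>p q. P p \<Longrightarrow> P q \<Longrightarrow> P (p + q)" and M: "\<And>p q. P p \<Longrightarrow> P q \<Longrightarrow> P (p * q)"
  shows "P p"
proof -
  have pw: "P (q * Var i ^ k)" if "P q" "i < n" for q i k
    using that by (induction k arbitrary: q) (auto simp: mult.assoc[symmetric] intro: M V)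
  have pr: "P (Cst c * (\<Prod>i\<in>B. Var i ^ f i))" if "c \<in> K" "B \<subseteq> {..<n}" for c B f
    using finite_subset[OF that(2) finite_lessThan] that(2)
  proof (induction B rule: finite_induct)
    case (insert i B)
    thus ?case using pw[of "Cst c * (\<Prod>i\<in>B. Var i ^ f i)" i "f i"] by (simp add: ac_simps)
  qed (simp add: C that)
  have s: "P (sum f B)" if "\<And>i. i \<in> B \<Longrightarrow> P (f i)" for f and B :: "(nat \<Rightarrow>\<^sub>0 nat) set"
    using that
  proof (induction B rule: infinite_finite_induct)
    case (insert i B)
    thus ?case by (auto intro!: A)
  qed (use C[OF assms(2)] in \<open>simp_all add: Cst_def\<close>)
  have "P (\<Sum>m\<in>Poly_Mapping.keys p. Poly_Mapping.single m (Poly_Mapping.lookup p m))"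
    using assms(1) by (intro s, subst single_eq_monomial) (auto simp: mpols_def intro!: pr)
  thus ?thesis using rhom.mpol_sum_singles[OF rhom_id(1), of p] by simp
qed

lemma mpols_UNIV_exists: "\<exists>n. p \<in> mpols UNIV n"
proof -
  have "finite (\<Union>m\<in>Poly_Mapping.keys p. Poly_Mapping.keys m)" by simp
  then obtain n where "(\<Union>m\<in>Poly_Mapping.keys p. Poly_Mapping.keys m) \<subseteq> {..<n}"
    using finite_nat_iff_bounded by blast
  hence "p \<in> mpols UNIV n" by (auto simp: mpols_def)
  thus ?thesis ..
qed

lemma rhom_mpols_cong:
  fixes f g :: "'a::comm_ring_1 mpol \<Rightarrow> 'b::comm_ring_1"
  assumes "rhom f" "rhom g" "p \<in> mpols K n" "is_subring K"
    and "\<And>c. c \<in> K \<Longrightarrow> f (Cst c) = g (Cst c)" "\<And>i. i < n \<Longrightarrow> f (Var i) = g (Var i)"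
  shows "f p = g p"
  using assms(3) is_subringD(1)[OF assms(4)]
proof (induction rule: mpols_induct)
qed (use assms in \<open>simp_all add: rhom.add rhom.mult\<close>)

lemma ev_cong:
  assumes "p \<in> mpols UNIV n" "\<And>i. i < n \<Longrightarrow> x i = y i"
  shows "ev h x p = ev h y p"
proof -
  have "x i = y i" if "m \<in> Poly_Mapping.keys p" "i \<in> Poly_Mapping.keys m" for m i
    using that assms by (auto simp: mpols_def)
  thus ?thesis
    unfolding ev_def by (intro sum.cong prod.cong arg_cong2[where f = "(*)"] refl) simp
qed

lemma ev_in_subring:
  assumes "is_subring K" "p \<in> mpols L n" "rhom h" "0 \<in> L" "\<And>c. c \<in> L \<Longrightarrow> h c \<in> K" "\<And>i. i < n \<Longrightarrow> x i \<in> K"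
  shows "ev h x p \<in> K"
  using assms(2,4)
proof (induction rule: mpols_induct)
qed (use assms in \<open>auto simp: rhom.ev_Cst rhom.ev_Var rhom.ev_add rhom.ev_mult intro: is_subringD\<close>)

text \<open>Change of coefficients, obtained as an evaluation at the variables themselves, so that
  its homomorphism laws are those of \<open>ev\<close>.\<close>

definition mapc :: "('a::comm_ring_1 \<Rightarrow> 'b::comm_ring_1) \<Rightarrow> 'a mpol \<Rightarrow> 'b mpol" where
  "mapc h = ev (\<lambda>c. Cst (h c)) Var"

lemma rhom_mapc: "rhom h \<Longrightarrow> rhom (mapc h)"
  unfolding mapc_def using rhom.rhom_ev[OF rhom_comp[OF rhom_Cst]] by blast

lemma mapc_Cst [simp]: "rhom h \<Longrightarrow> mapc h (Cst c) = Cst (h c)"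
  and mapc_Var [simp]: "rhom h \<Longrightarrow> mapc h (Var i) = Var i"
  unfolding mapc_def using rhom.ev_Cst[OF rhom_comp[OF rhom_Cst]] rhom.ev_Var[OF rhom_comp[OF rhom_Cst]]
  by blast+

lemma ev_mapc:
  assumes "rhom g" "rhom h"
  shows "ev g x (mapc h p) = ev (\<lambda>c. g (h c)) x p"
proof -
  obtain n where "p \<in> mpols UNIV n" using mpols_UNIV_exists by blast
  have "rhom (\<lambda>p. ev g x (mapc h p))"
    by (rule rhom_comp[OF rhom.rhom_ev[OF assms(1)] rhom_mapc[OF assms(2)]])
  moreover have "rhom (ev (\<lambda>c. g (h c)) x)"
    by (rule rhom.rhom_ev[OF rhom_comp[OF assms]])
  moreover note \<open>p \<in> mpols UNIV n\<close> is_subring_UNIV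
  moreover have "ev g x (mapc h (Cst c)) = ev (\<lambda>c. g (h c)) x (Cst c)" for c
    by (simp add: assms rhom.ev_Cst rhom.ev_Cst[OF rhom_comp[OF assms]])
  moreover have "ev g x (mapc h (Var i)) = ev (\<lambda>c. g (h c)) x (Var i)" for i
    by (simp add: assms rhom.ev_Var rhom.ev_Var[OF rhom_comp[OF assms]])
  ultimately show ?thesis by (rule rhom_mpols_cong)
qed

lemma mapc_in_mpols:
  assumes "rhom h" "p \<in> mpols K n" "0 \<in> K"
  shows "mapc h p \<in> mpols (range h) n"
  using assms(2,3)
proof (induction rule: mpols_induct)
qed (use assms is_subring_mpols[OF is_subring_range[OF assms(1)]] in
    \<open>auto simp: rhom.add[OF rhom_mapc] rhom.mult[OF rhom_mapc]
      intro: Cst_in_mpols Var_in_mpols is_subring_range is_subringD(3,4)\<close>)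

text \<open>Descent of coefficients: statements about the subfield \<open>range h\<close> of a big
  field become statements about polynomials over the type of the small field.\<close>

lemma mpols_range:
  assumes "rhom h" "p \<in> mpols (range h) n"
  obtains q where "q \<in> mpols UNIV n" "p = mapc h q"
proof -
  have 0: "0 \<in> range h" using is_subringD(1)[OF is_subring_range[OF assms(1)]] .
  have "\<exists>q\<in>mpols UNIV n. p = mapc h q"
    using assms(2) 0
  proof (induction rule: mpols_induct)
    case (Cst c)
    then obtain d where "c = h d" by auto
    thus ?case using assms(1) by (intro bexI[of _ "Cst d"]) (auto intro: Cst_in_mpols)
  next
    case (Var i)
    thus ?case using assms(1) by (intro bexI[of _ "Var i"]) (auto intro: Var_in_mpols)
  next
    case (add p q)
    then obtain p' q' where "p' \<in> mpols UNIV n" "q' \<in> mpols UNIV n" "p = mapc h p'" "q = mapc h q'" by auto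
    thus ?case using is_subringD(3)[OF is_subring_mpols[OF is_subring_UNIV]]
      by (intro bexI[of _ "p' + q'"]) (auto simp: rhom.add[OF rhom_mapc[OF assms(1)]])
  next
    case (mult p q)
    then obtain p' q' where "p' \<in> mpols UNIV n" "q' \<in> mpols UNIV n" "p = mapc h p'" "q = mapc h q'" by auto
    thus ?case using is_subringD(4)[OF is_subring_mpols[OF is_subring_UNIV]]
      by (intro bexI[of _ "p' * q'"]) (auto simp: rhom.mult[OF rhom_mapc[OF assms(1)]])
  qed
  thus ?thesis using that by auto
qed

text \<open>Isolating the last variable reduces questions about several variables to polynomials in
  one variable over a smaller polynomial ring.\<close>

lemma mpols_Suc:
  assumes "p \<in> mpols K (Suc n)" "is_subring K"
  obtains P where "P \<in> polys_over (mpols K n)" "p = poly P (Var n)"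
proof -
  note R = is_subring_polys_over[OF is_subring_mpols[OF assms(2), of n]]
  have "\<exists>P\<in>polys_over (mpols K n). p = poly P (Var n)"
    using assms(1) is_subringD(1)[OF assms(2)]
  proof (induction rule: mpols_induct)
    case (Cst c)
    thus ?case using is_subringD(1)[OF is_subring_mpols[OF assms(2)]]
      by (intro bexI[of _ "[:Cst c:]"])
        (auto simp: polys_over_def coeff_pCons intro: Cst_in_mpols split: nat.split)
  next
    case (Var i)
    show ?case
    proof (cases "i = n")
      case True
      thus ?thesis using is_subringD(1,2)[OF is_subring_mpols[OF assms(2)]]
        by (intro bexI[of _ "[:0, 1:]"]) (auto simp: polys_over_def coeff_pCons split: nat.split)
    next
      case False
      thus ?thesis using is_subringD(1)[OF is_subring_mpols[OF assms(2)]] Var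
        by (intro bexI[of _ "[:Var i:]"])
          (auto simp: polys_over_def coeff_pCons assms intro: Var_in_mpols split: nat.split)
    qed
  next
    case (add p q)
    then obtain P Q where "P \<in> polys_over (mpols K n)" "Q \<in> polys_over (mpols K n)"
      "p = poly P (Var n)" "q = poly Q (Var n)" by auto
    thus ?case by (intro bexI[of _ "P + Q"]) (auto intro: is_subringD(3)[OF R])
  next
    case (mult p q)
    then obtain P Q where "P \<in> polys_over (mpols K n)" "Q \<in> polys_over (mpols K n)"
      "p = poly P (Var n)" "q = poly Q (Var n)" by auto
    thus ?case by (intro bexI[of _ "P * Q"]) (auto intro: is_subringD(4)[OF R])
  qed
  thus ?thesis using that by auto
qed

lemma ev_poly: "rhom h \<Longrightarrow> ev h x (poly P q) = poly (map_poly (ev h x) P) (ev h x q)"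
  by (simp add: rhom.poly rhom.rhom_ev)

text \<open>Once all variables but the last have values, a univariate polynomial with infinitely
  many roots remains; hence its coefficients vanish at every point, and induction applies to
  them.\<close>

lemma mpols_eq_0I:
  fixes p :: "'a::field mpol" and h :: "'a \<Rightarrow> 'b::field"
  assumes "p \<in> mpols UNIV n" "rhom h" "infinite (UNIV :: 'b set)" "\<And>x. ev h x p = 0"
  shows "p = 0"
  using assms(1,4)
proof (induction n arbitrary: p)
  case 0
  have "\<exists>c. p = Cst c"
    using 0(1) UNIV_I
  proof (induction rule: mpols_induct)
    case (add p q)
    thus ?case by (metis rhom.add rhom_Cst)
  next
    case (mult p q)
    thus ?case by (metis rhom.mult rhom_Cst)
  qed auto
  thus ?case using 0(2) rhom.ev_Cst[OF assms(2)]
    by (metis assms(2) rhom.zero[OF rhom_Cst] rhom_eq_0_iff)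
next
  case (Suc n)
  obtain P where P: "P \<in> polys_over (mpols UNIV n)" "p = poly P (Var n)"
    using mpols_Suc[OF Suc.prems(1)] by auto
  have "coeff P i = 0" for i
  proof (rule Suc.IH)
    show ci: "coeff P i \<in> mpols UNIV n" for i using P by (auto simp: polys_over_def)
    fix x :: "nat \<Rightarrow> 'b"
    have "poly (map_poly (ev h x) P) t = 0" for t
    proof -
      have "0 = ev h (x(n := t)) p" using Suc.prems(2) by simp
      also have "\<dots> = poly (map_poly (ev h (x(n := t))) P) t"
        by (simp add: P ev_poly assms(2) rhom.ev_Var)
      also have "map_poly (ev h (x(n := t))) P = map_poly (ev h x) P"
      proof (rule poly_eqI)
        fix j
        have "ev h (x(n := t)) (coeff P j) = ev h x (coeff P j)"
          by (rule ev_cong[OF ci]) simp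
        thus "coeff (map_poly (ev h (x(n := t))) P) j = coeff (map_poly (ev h x) P) j"
          by (simp add: rhom.coeff[OF rhom.rhom_ev[OF assms(2)]])
      qed
      finally show ?thesis by simp
    qed
    hence roots: "{t. poly (map_poly (ev h x) P) t = 0} = UNIV" by blast
    have "map_poly (ev h x) P = 0"
    proof (rule ccontr)
      assume "map_poly (ev h x) P \<noteq> 0"
      from poly_roots_finite[OF this] show False using assms(3) unfolding roots by blast
    qed
    hence "coeff (map_poly (ev h x) P) i = 0" by simp
    thus "ev h x (coeff P i) = 0"
      by (simp add: rhom.coeff[OF rhom.rhom_ev[OF assms(2)]])
  qed
  hence "P = 0" by (intro poly_eqI) simp
  thus ?case using P by simp
qed

subsection \<open>Algebraic elements\<close>

lemma subfield_iff_is_subfield: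
  "subfield K (ring_of_type_algebra :: 'a::field ring) \<longleftrightarrow> is_subfield K"
proof -
  interpret R: field "ring_of_type_algebra :: 'a ring" ..
  have simps: "carrier (ring_of_type_algebra :: 'a ring) = UNIV"
    "x \<otimes>\<^bsub>ring_of_type_algebra\<^esub> y = x * y" "x \<oplus>\<^bsub>ring_of_type_algebra\<^esub> y = x + y"
    "\<one>\<^bsub>ring_of_type_algebra\<^esub> = (1 :: 'a)" "\<zero>\<^bsub>ring_of_type_algebra\<^esub> = (0 :: 'a)" for x y :: 'a
    by (simp_all add: ring_of_type_algebra_def)
  have am: "\<ominus>\<^bsub>ring_of_type_algebra\<^esub> x = - x" for x :: 'a
    using R.minus_equality[of "- x" x] by (simp add: simps)
  have inv: "inv\<^bsub>ring_of_type_algebra\<^esub> x = inverse x" if "x \<noteq> 0" for x :: 'a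
    using R.inv_unique'[of x "inverse x"] that by (simp add: simps)
  show ?thesis
  proof
    assume K: "subfield K (ring_of_type_algebra :: 'a ring)"
    have "is_subring K"
      using subringE[OF subfieldE(1)[OF K]] by (simp add: is_subring_def simps am)
    moreover have "inverse x \<in> K" if "x \<in> K" for x
      using R.subfield_m_inv(1)[OF K, of x] that by (cases "x = 0") (auto simp: simps inv)
    ultimately show "is_subfield K" by (simp add: is_subfield_def)
  next
    assume K: "is_subfield K"
    note D = is_subringD[OF is_subfield_subring[OF K]] is_subfieldD[OF K]
    show "subfield K (ring_of_type_algebra :: 'a ring)"
      by (rule R.subfieldI'[OF R.subringI]) (auto simp: simps am inv D)
  qed
qed

text \<open>On the right-hand side a polynomial is a coefficient list with the leading coefficient
  first, hence the reversals. The equivalence gives access to the theory of algebraic elements and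
  finite extensions.\<close>

lemma alg_over_iff_algebraic:
  fixes y :: "'a::field"
  assumes "is_subfield K"
  shows "alg_over K y \<longleftrightarrow> ((\<lambda>K x. \<not> ring.transcendental ring_of_type_algebra K x) over K) y"
proof -
  let ?R = "ring_of_type_algebra :: 'a ring"
  interpret R: field ?R ..
  have simps: "carrier ?R = UNIV" "x \<otimes>\<^bsub>?R\<^esub> y = x * y" "x \<oplus>\<^bsub>?R\<^esub> y = x + y"
    "\<one>\<^bsub>?R\<^esub> = 1" "\<zero>\<^bsub>?R\<^esub> = 0" for x y :: 'a
    by (simp_all add: ring_of_type_algebra_def)
  have pow: "x [^]\<^bsub>?R\<^esub> n = x ^ n" for x :: 'a and n :: nat
    by (induction n) (simp_all add: simps)
  have ev: "R.eval p x = poly (Poly (rev p)) x" for p x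
    by (induction p) (simp_all add: simps pow Poly_append poly_monom)
  have K: "subfield K ?R" using assms by (simp add: subfield_iff_is_subfield)
  note D = is_subringD[OF is_subfield_subring[OF assms]]
  show ?thesis
  proof
    assume "alg_over K y"
    then obtain P where P: "\<And>i. coeff P i \<in> K" "P \<noteq> 0" "poly P y = 0" by (auto simp: alg_over_def)
    define p where "p = rev (coeffs P)"
    have "p \<in> carrier (K[X]\<^bsub>?R\<^esub>)" "p \<noteq> []"
      using P by (auto simp: p_def univ_poly_def polynomial_def hd_rev simps last_coeffs_eq_coeff_degree
          coeffs_def)
    moreover have "R.eval p y = \<zero>\<^bsub>?R\<^esub>" using P by (simp add: ev simps p_def)
    ultimately show "((\<lambda>K x. \<not> ring.transcendental ring_of_type_algebra K x) over K) y"
      by (rule R.algebraicI)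
  next
    assume "((\<lambda>K x. \<not> ring.transcendental ring_of_type_algebra K x) over K) y"
    then obtain p where p: "p \<in> carrier (K[X]\<^bsub>?R\<^esub>)" "p \<noteq> []" "R.eval p y = \<zero>\<^bsub>?R\<^esub>"
      using R.algebraicE[OF subfieldE(1)[OF K], of y] by (auto simp: simps)
    define P where "P = Poly (rev p)"
    have sub: "set p \<subseteq> K" and hd: "hd p \<noteq> 0" using p by (auto simp: univ_poly_def polynomial_def simps)
    have "coeff P i \<in> K" for i
      using sub D(1) by (auto simp: P_def nth_default_def rev_nth)
    moreover have "P \<noteq> 0"
    proof
      assume "P = 0"
      then obtain n where "rev p = replicate n 0" by (auto simp: P_def Poly_eq_0)
      hence "set p \<subseteq> {0}" by (metis set_replicate_conv_if set_rev subset_refl empty_subsetI)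
      thus False using hd p(2) by (cases p) auto
    qed
    moreover have "poly P y = 0" using p by (simp add: ev P_def simps)
    ultimately show "alg_over K y" by (auto simp: alg_over_def)
  qed
qed

lemma is_subfield_algebraics:
  assumes "is_subfield K"
  shows "is_subfield {y. alg_over K y}"
proof -
  interpret R: field "ring_of_type_algebra :: 'a ring" ..
  have "subfield {x \<in> carrier ring_of_type_algebra. (R.algebraic over K) x} (ring_of_type_algebra :: 'a ring)"
    using assms by (intro R.subfield_of_algebraics) (simp add: subfield_iff_is_subfield)
  also have "{x \<in> carrier ring_of_type_algebra. (R.algebraic over K) x} = {y. alg_over K y}"
    by (auto simp: alg_over_iff_algebraic assms ring_of_type_algebra_def)
  finally show ?thesis by (simp add: subfield_iff_is_subfield)
qed

lemma alg_over_mono: "K \<subseteq> L \<Longrightarrow> alg_over K y \<Longrightarrow> alg_over L y"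
  unfolding alg_over_def by blast

lemma alg_over_self:
  assumes "is_subfield K" "y \<in> K"
  shows "alg_over K y"
  unfolding alg_over_def using is_subringD[OF is_subfield_subring[OF assms(1)]] assms(2)
  by (intro exI[of _ "[:-y, 1:]"]) (auto simp: coeff_pCons split: nat.split)

text \<open>The finitely many coefficients of an equation for \<open>z\<close> generate a finite
  extension \<open>L\<close> of \<open>K\<close>; adjoining \<open>z\<close> to \<open>L\<close>
  gives a field of finite dimension over \<open>K\<close>.\<close>

lemma alg_over_trans:
  fixes z :: "'a::field"
  assumes K: "is_subfield K" and z: "alg_over {y. alg_over K y} z"
  shows "alg_over K z"
proof -
  let ?R = "ring_of_type_algebra :: 'a ring"
  interpret R: field ?R ..
  have c: "carrier ?R = UNIV" by (simp add: ring_of_type_algebra_def)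
  have K': "subfield K ?R" using K by (simp add: subfield_iff_is_subfield)
  obtain P where P: "\<And>i. alg_over K (coeff P i)" "P \<noteq> 0" "poly P z = 0" using z by (auto simp: alg_over_def)
  define xs where "xs = coeffs P"
  have xs: "\<And>x. x \<in> set xs \<Longrightarrow> (R.algebraic over K) x"
    using P(1) by (auto simp: xs_def coeffs_def alg_over_iff_algebraic[OF K] split: if_splits)
  have xc: "set xs \<subseteq> carrier ?R" by (simp add: c)
  define L where "L = R.finite_extension K xs"
  have L: "subfield L ?R" unfolding L_def by (rule R.finite_extension_is_subfield[OF K' xc xs])
  have fL: "R.finite_dimension K L"
    unfolding L_def by (rule R.finite_extension_finite_dimension(1)[OF K' xc xs])
  have L': "is_subfield L" using L by (simp add: subfield_iff_is_subfield)
  have "set xs \<subseteq> L" unfolding L_def by (rule R.finite_extension_mem[OF subfieldE(1)[OF K'] xc])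
  moreover have "coeff P i \<in> insert 0 (set xs)" for i
    using range_coeff[of P] by (auto simp: xs_def)
  ultimately have "coeff P i \<in> L" for i
    using is_subringD(1)[OF is_subfield_subring[OF L']] by (metis insertE subsetD)
  hence "alg_over L z" using P by (auto simp: alg_over_def)
  hence "R.finite_dimension L (R.simple_extension L z)"
    by (subst R.finite_dimension_simple_extension) (auto simp: L c alg_over_iff_algebraic L')
  from R.telescopic_base_dim(1)[OF K' L fL this] have "R.finite_dimension K (R.simple_extension L z)" .
  from R.finite_dimension_imp_algebraic[OF K' R.simple_extension_is_subring[OF subfieldE(1)[OF L]] this]
  have "(R.algebraic over K) z"
    using R.simple_extension_mem[OF subfieldE(1)[OF L], of z] by (simp add: c)
  thus ?thesis using alg_over_iff_algebraic[OF K] by simp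
qed

subsection \<open>Generated fields\<close>

context
  fixes K :: "'u::field set"
  assumes K: "is_subfield K"
begin

lemma gen_field_subset:
  assumes "is_subfield L" "K \<subseteq> L" "\<And>i. i < n \<Longrightarrow> x i \<in> L"
  shows "gen_field K n x \<subseteq> L"
proof -
  have "eval_mpol x p \<in> L" if "p \<in> mpols K n" for p
    unfolding eval_mpol_ev
    by (rule ev_in_subring[OF is_subfield_subring[OF assms(1)] that rhom_id(1)])
      (use assms is_subringD(1)[OF is_subfield_subring[OF K]] in auto)
  thus ?thesis unfolding gen_field_def using is_subfieldD(2)[OF assms(1)] by blast
qed

lemma gen_fieldI: "p \<in> mpols K n \<Longrightarrow> q \<in> mpols K n \<Longrightarrow> eval_mpol x q \<noteq> 0 \<Longrightarrow>
    eval_mpol x p / eval_mpol x q \<in> gen_field K n x"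
  unfolding gen_field_def by blast

lemma eval_in_gen_field: "p \<in> mpols K n \<Longrightarrow> eval_mpol x p \<in> gen_field K n x"
  using gen_fieldI[of p n 1 x] is_subringD(2)[OF is_subring_mpols[OF is_subfield_subring[OF K]]]
  by (simp add: eval_mpol_ev rhom.one[OF rhom.rhom_ev[OF rhom_id(1)]])

lemma const_in_gen_field: "c \<in> K \<Longrightarrow> c \<in> gen_field K n x"
  using eval_in_gen_field[of "Cst c" n x] Cst_in_mpols[of c K n]
  by (simp add: eval_mpol_ev rhom.ev_Cst[OF rhom_id(1)])

lemma var_in_gen_field: "i < n \<Longrightarrow> x i \<in> gen_field K n x"
  using eval_in_gen_field[of "Var i" n x] Var_in_mpols[OF is_subfield_subring[OF K], of i n]
  by (simp add: eval_mpol_ev rhom.ev_Var[OF rhom_id(1)])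

lemma is_subfield_gen_field: "is_subfield (gen_field K n x)"
proof -
  let ?e = "eval_mpol x"
  note M = is_subringD[OF is_subring_mpols[OF is_subfield_subring[OF K], of n]]
  interpret rhom ?e unfolding eval_mpol_ev[abs_def] by (rule rhom.rhom_ev[OF rhom_id(1)])
  have "a + b \<in> gen_field K n x \<and> a * b \<in> gen_field K n x"
    if ab: "a \<in> gen_field K n x" "b \<in> gen_field K n x" for a b
  proof -
    obtain p q r s where pq: "p \<in> mpols K n" "q \<in> mpols K n" "?e q \<noteq> 0" "a = ?e p / ?e q"
      and rs: "r \<in> mpols K n" "s \<in> mpols K n" "?e s \<noteq> 0" "b = ?e r / ?e s"
      using ab unfolding gen_field_def by blast
    have "a + b = ?e (p * s + r * q) / ?e (q * s)" "a * b = ?e (p * r) / ?e (q * s)"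
      using pq rs by (auto simp: field_simps)
    moreover have "?e (q * s) \<noteq> 0" using pq rs by simp
    ultimately show ?thesis
      using gen_fieldI[of "p * s + r * q" n "q * s" x] gen_fieldI[of "p * r" n "q * s" x] pq rs M(3,4)
      by metis
  qed
  moreover have "- a \<in> gen_field K n x \<and> inverse a \<in> gen_field K n x" if a: "a \<in> gen_field K n x" for a
  proof -
    obtain p q where pq: "p \<in> mpols K n" "q \<in> mpols K n" "?e q \<noteq> 0" "a = ?e p / ?e q"
      using a unfolding gen_field_def by blast
    have "- a = ?e (- p) / ?e q" using pq by simp
    hence "- a \<in> gen_field K n x" using pq M(5) by (metis gen_fieldI)
    moreover have "inverse a \<in> gen_field K n x"
    proof (cases "?e p = 0")
      case True
      thus ?thesis using pq const_in_gen_field[OF is_subringD(1)[OF is_subfield_subring[OF K]]] by simp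
    next
      case False
      thus ?thesis using pq gen_fieldI[of q n p x] by simp
    qed
    ultimately show ?thesis ..
  qed
  ultimately show ?thesis
    unfolding is_subfield_def is_subring_def
    using const_in_gen_field is_subringD(1,2)[OF is_subfield_subring[OF K]] by blast
qed

lemma alg_over_gen_fieldE:
  assumes "alg_over (gen_field K n x) y"
  obtains P where "P \<in> polys_over (mpols K n)" "map_poly (eval_mpol x) P \<noteq> 0"
    "poly (map_poly (eval_mpol x) P) y = 0"
proof -
  let ?e = "eval_mpol x"
  note M = is_subring_mpols[OF is_subfield_subring[OF K], of n]
  interpret rhom ?e unfolding eval_mpol_ev[abs_def] by (rule rhom.rhom_ev[OF rhom_id(1)])
  obtain F where F: "\<And>i. coeff F i \<in> gen_field K n x" "F \<noteq> 0" "poly F y = 0"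
    using assms by (auto simp: alg_over_def)
  have "\<forall>i. \<exists>p q. p \<in> mpols K n \<and> q \<in> mpols K n \<and> ?e q \<noteq> 0 \<and> coeff F i = ?e p / ?e q"
    using F(1) unfolding gen_field_def by blast
  then obtain p q where pq: "\<And>i. p i \<in> mpols K n" "\<And>i. q i \<in> mpols K n" "\<And>i. ?e (q i) \<noteq> 0"
    "\<And>i. coeff F i = ?e (p i) / ?e (q i)" by metis
  define d where "d = degree F"
  \<comment> \<open>Multiplying each numerator by the denominators of the other coefficients clears
    all denominators at once; the result evaluates to \<open>c\<close> times
    \<open>F\<close>.\<close>
  define P where "P = (\<Sum>i\<le>d. monom (p i * (\<Prod>j\<in>{..d} - {i}. q j)) i)"
  define c where "c = ?e (\<Prod>j\<le>d. q j)"
  have c: "c \<noteq> 0" using pq(3) by (simp add: c_def prod)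
  have *: "?e (p i * (\<Prod>j\<in>{..d} - {i}. q j)) = c * coeff F i" if "i \<le> d" for i
    using that pq(3)[of i] by (simp add: c_def prod pq(4) prod.remove[of "{..d}" i "\<lambda>j. ?e (q j)"])
  have cP: "coeff P i = (if i \<le> d then p i * (\<Prod>j\<in>{..d} - {i}. q j) else 0)" for i
    by (auto simp: P_def coeff_sum coeff_monom)
  have eP: "map_poly ?e P = smult c F"
    by (rule poly_eqI) (use * in \<open>auto simp: cP d_def coeff_eq_0\<close>)
  show ?thesis
  proof (rule that[of P])
    show "P \<in> polys_over (mpols K n)"
      using pq by (auto simp: polys_over_def cP intro!: is_subringD[OF M] is_subring_prod[OF M])
  qed (use F c in \<open>simp_all add: eP\<close>)
qed

end

lemma mpols_one:
  fixes p :: "'u::field mpol"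
  assumes "is_subring K" "p \<in> mpols K 1"
  obtains u where "u \<in> polys_over K" "\<And>x. eval_mpol x p = poly u (x 0)"
proof -
  obtain P where P: "P \<in> polys_over (mpols K 0)" "p = poly P (Var 0)"
    using mpols_Suc[of p K 0] assms by auto
  let ?u = "map_poly (eval_mpol (\<lambda>_. 0)) P"
  have h: "rhom (eval_mpol x)" for x :: "nat \<Rightarrow> 'u"
    unfolding eval_mpol_ev[abs_def] by (rule rhom.rhom_ev[OF rhom_id(1)])
  have "eval_mpol x p = poly ?u (x 0)" for x
  proof -
    have "eval_mpol x p = poly (map_poly (eval_mpol x) P) (eval_mpol x (Var 0))"
      by (simp add: P rhom.poly[OF h])
    also have "map_poly (eval_mpol x) P = ?u"
    proof (rule poly_eqI)
      fix i
      have "coeff P i \<in> mpols UNIV 0" using P mpols_mono[of K UNIV 0 0] by (auto simp: polys_over_def)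
      hence "eval_mpol x (coeff P i) = eval_mpol (\<lambda>_. 0) (coeff P i)"
        unfolding eval_mpol_ev by (rule ev_cong) simp
      thus "coeff (map_poly (eval_mpol x) P) i = coeff ?u i" by (simp add: rhom.coeff[OF h])
    qed
    finally show ?thesis by (simp add: eval_mpol_ev rhom.ev_Var[OF rhom_id(1)])
  qed
  moreover have "?u \<in> polys_over K"
  proof -
    have "eval_mpol (\<lambda>_. 0) (coeff P i) \<in> K" for i
      unfolding eval_mpol_ev
      by (rule ev_in_subring[OF assms(1) _ rhom_id(1), of _ K 0])
        (use P is_subringD(1)[OF assms(1)] in \<open>auto simp: polys_over_def\<close>)
    thus ?thesis by (simp add: polys_over_def rhom.coeff[OF h])
  qed
  ultimately show ?thesis using that by blast
qed

lemma poly_in_mpols: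
  assumes "is_subring K" "u \<in> polys_over K" "i < n"
  shows "poly (map_poly Cst u) (Var i) \<in> mpols K n"
  by (rule is_subring_poly[OF is_subring_mpols[OF assms(1)]])
    (use assms in \<open>auto simp: rhom.coeff[OF rhom_Cst] polys_over_def intro: Cst_in_mpols Var_in_mpols\<close>)

lemma ev_poly_Cst:
  assumes "rhom h"
  shows "ev h x (poly (map_poly Cst u) q) = poly (map_poly h u) (ev h x q)"
proof -
  have "map_poly (ev h x) (map_poly Cst u) = map_poly h u"
    by (rule poly_eqI) (simp add: rhom.coeff[OF rhom.rhom_ev[OF assms]] rhom.coeff[OF rhom_Cst]
        rhom.coeff[OF assms] rhom.ev_Cst[OF assms])
  thus ?thesis by (simp add: ev_poly assms)
qed

definition adj :: "'u::field set \<Rightarrow> 'u \<Rightarrow> 'u set" where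
  "adj K y = gen_field K 1 (\<lambda>_. y)"

lemma adj_facts:
  assumes "is_subfield K"
  shows "is_subfield (adj K y)" "K \<subseteq> adj K y" "y \<in> adj K y"
    "is_subfield L \<Longrightarrow> K \<subseteq> L \<Longrightarrow> y \<in> L \<Longrightarrow> adj K y \<subseteq> L"
  unfolding adj_def using is_subfield_gen_field[OF assms] const_in_gen_field[OF assms]
    var_in_gen_field[OF assms, of 0 1 "\<lambda>_. y"] gen_field_subset[OF assms, of L 1 "\<lambda>_. y"] by auto

lemma in_adjE:
  assumes "is_subfield K" "z \<in> adj K y"
  obtains u v where "u \<in> polys_over K" "v \<in> polys_over K" "poly v y \<noteq> 0" "z = poly u y / poly v y"
proof -
  note R = is_subfield_subring[OF assms(1)]
  obtain p q where pq: "p \<in> mpols K 1" "q \<in> mpols K 1" "eval_mpol (\<lambda>_. y) q \<noteq> 0"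
    "z = eval_mpol (\<lambda>_. y) p / eval_mpol (\<lambda>_. y) q" using assms(2) unfolding adj_def gen_field_def by blast
  obtain u where u: "u \<in> polys_over K" "\<And>x. eval_mpol x p = poly u (x 0)" using mpols_one[OF R pq(1)] by blast
  obtain v where v: "v \<in> polys_over K" "\<And>x. eval_mpol x q = poly v (x 0)" using mpols_one[OF R pq(2)] by blast
  show ?thesis by (rule that[of u v]) (use u v pq in auto)
qed

text \<open>The relation between \<open>x\<close> and \<open>y\<close> is kept as a sum, because
  \<open>alg_indep_exchange\<close> rereads it as a polynomial in \<open>x\<close> with powers of
  \<open>y\<close> in the coefficients.\<close>

lemma alg_over_adj:
  assumes "is_subfield K" "alg_over (adj K x) y"
  shows "\<exists>u N k. (\<forall>i. u i \<in> polys_over K) \<and> k \<le> N \<and> poly (u k) x \<noteq> (0::'u::field) \<and>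
    (\<Sum>i\<le>N. poly (u i) x * y ^ i) = 0"
proof -
  have R: "is_subring K" using is_subfield_subring[OF assms(1)] .
  have h: "rhom (eval_mpol (\<lambda>_::nat. x))"
    unfolding eval_mpol_ev[abs_def] by (rule rhom.rhom_ev[OF rhom_id(1)])
  obtain P where P: "P \<in> polys_over (mpols K 1)" "map_poly (eval_mpol (\<lambda>_. x)) P \<noteq> 0"
    "poly (map_poly (eval_mpol (\<lambda>_. x)) P) y = 0"
    using alg_over_gen_fieldE[OF assms(1)] assms(2) unfolding adj_def by blast
  have "\<exists>u. u \<in> polys_over K \<and> eval_mpol (\<lambda>_. x) (coeff P i) = poly u x" for i
  proof -
    have "coeff P i \<in> mpols K 1" using P by (simp add: polys_over_def)
    then obtain u where "u \<in> polys_over K" "\<And>x. eval_mpol x (coeff P i) = poly u (x 0)"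
      using mpols_one[OF R] by blast
    thus ?thesis by (intro exI[of _ u]) auto
  qed
  then obtain u where u: "\<And>i. u i \<in> polys_over K" "\<And>i. eval_mpol (\<lambda>_. x) (coeff P i) = poly (u i) x"
    by metis
  let ?Q = "map_poly (eval_mpol (\<lambda>_. x)) P"
  have cQ: "coeff ?Q i = poly (u i) x" for i by (simp add: rhom.coeff[OF h] u)
  have "poly (u (degree ?Q)) x \<noteq> 0" using P(2) cQ[of "degree ?Q"] leading_coeff_neq_0 by metis
  moreover have "(\<Sum>i\<le>degree ?Q. poly (u i) x * y ^ i) = 0"
    using P(3) by (subst (asm) poly_altdef) (simp only: cQ)
  ultimately show ?thesis
    using u(1) by (intro exI[of _ u] exI[of _ "degree ?Q"]) auto
qed

subsection \<open>Minimal polynomials\<close>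

lemma pCons_in_polys_over [simp]: "pCons a w \<in> polys_over K \<longleftrightarrow> a \<in> K \<and> w \<in> polys_over K"
  unfolding polys_over_def by (force simp: coeff_pCons split: nat.split)

lemma zero_in_polys_over: "is_subring K \<Longrightarrow> 0 \<in> polys_over K"
  by (simp add: polys_over_def is_subring_def)

lemma pcompose_in_polys_over:
  assumes "is_subring K" "w \<in> polys_over K" "q \<in> polys_over K"
  shows "pcompose w q \<in> polys_over K"
  using assms(2)
proof (induction w)
  case (pCons a w)
  note R = is_subringD[OF is_subring_polys_over[OF assms(1)]]
  show ?case using pCons R(3)[of "[:a:]" "q * pcompose w q"] R(4)[OF assms(3)] zero_in_polys_over[OF assms(1)]
    by (simp add: pcompose_pCons)
qed (use zero_in_polys_over[OF assms(1)] in simp)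

lemma monom_in_polys_over: "is_subring K \<Longrightarrow> c \<in> K \<Longrightarrow> monom c n \<in> polys_over K"
  by (simp add: polys_over_def coeff_monom is_subring_def)

text \<open>Over a subring the leading coefficient need not be invertible, so a power of it
  multiplies \<open>f\<close>; in return quotient and remainder stay over \<open>S\<close>. The
  condition on \<open>g\<close> says that it is not zero.\<close>

lemma pseudo_division:
  fixes g :: "'a::comm_ring_1 poly"
  assumes S: "is_subring S" and g: "g \<in> polys_over S" "0 < degree g \<or> coeff g 0 \<noteq> 0" and f: "f \<in> polys_over S"
  obtains N q r where "q \<in> polys_over S" "r \<in> polys_over S"
    "smult (lead_coeff g ^ N) f = g * q + r" "r = 0 \<or> degree r < degree g"
proof -
  note R = is_subringD[OF is_subring_polys_over[OF S]]
  define l where "l = lead_coeff g"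
  have l: "l \<in> S" using g by (auto simp: l_def polys_over_def)
  have "\<exists>N q r. q \<in> polys_over S \<and> r \<in> polys_over S \<and> smult (l ^ N) f = g * q + r \<and> (r = 0 \<or> degree r < degree g)"
    using f
  proof (induction "degree f" arbitrary: f rule: less_induct)
    case less
    show ?case
    proof (cases "degree f < degree g \<or> f = 0")
      case True
      thus ?thesis using less.prems R(1) by (intro exI[of _ 0] exI[of _ "0::'a poly"] exI[of _ f]) auto
    next
      case False
      let ?t = "monom (lead_coeff f) (degree f - degree g)"
      define f' where "f' = smult l f - g * ?t"
      have tS: "?t \<in> polys_over S"
        using less.prems is_subringD(1)[OF S] by (auto simp: polys_over_def coeff_monom)
      have lf: "smult l f \<in> polys_over S" using less.prems l is_subringD(4)[OF S] by (auto simp: polys_over_def)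
      have f'S: "f' \<in> polys_over S" unfolding f'_def using lf tS g R by auto
      have dg: "degree (g * ?t) \<le> degree f"
        by (rule order.trans[OF degree_mult_le]) (use False degree_monom_le[of "lead_coeff f" "degree f - degree g"] in linarith)
      have d: "degree f' \<le> degree f"
        unfolding f'_def by (rule degree_diff_le[OF degree_smult_le dg])
      have "coeff (g * ?t) (degree f) = lead_coeff f * l"
        using False by (simp add: mult.commute[of g] coeff_monom_mult l_def)
      hence c: "coeff f' (degree f) = 0" by (simp add: f'_def)
      have d': "f' = 0 \<or> degree f' < degree f"
        using d c by (metis leading_coeff_0_iff le_neq_implies_less)
      have ex: "\<exists>N q r. q \<in> polys_over S \<and> r \<in> polys_over S \<and> smult (l ^ N) f' = g * q + r \<and> (r = 0 \<or> degree r < degree g)"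
      proof (cases "f' = 0")
        case True
        thus ?thesis using R(1) by (intro exI[of _ 0] exI[of _ "0::'a poly"]) auto
      next
        case False
        thus ?thesis using less.hyps[OF _ f'S] d' by blast
      qed
      from ex obtain N q r where qr: "q \<in> polys_over S" "r \<in> polys_over S" "smult (l ^ N) f' = g * q + r"
        "r = 0 \<or> degree r < degree g" by blast
      have "smult (l ^ Suc N) f = smult (l ^ N) f' + smult (l ^ N) (g * ?t)"
        by (simp add: f'_def smult_diff_right mult.commute)
      also have "\<dots> = g * (q + smult (l ^ N) ?t) + r" by (simp add: qr algebra_simps)
      finally have "smult (l ^ Suc N) f = g * (q + smult (l ^ N) ?t) + r" .
      moreover have "smult (l ^ N) ?t \<in> polys_over S"
        using tS is_subringD(4,7)[OF S] l by (auto simp: polys_over_def simp del: smult_monom)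
      ultimately show ?thesis using qr R(3) by blast
    qed
  qed
  thus ?thesis using that unfolding l_def by blast
qed

lemma min_poly_exists:
  fixes y :: "'a::field"
  assumes K: "is_subfield K" and y: "alg_over K y"
  obtains m where "m \<in> polys_over K" "lead_coeff m = 1" "poly m y = 0" "0 < degree m"
    "\<And>q. q \<in> polys_over K \<Longrightarrow> poly q y = 0 \<Longrightarrow> degree q < degree m \<Longrightarrow> q = 0"
    "\<And>q. q \<in> polys_over K \<Longrightarrow> poly q y = 0 \<Longrightarrow> \<exists>s\<in>polys_over K. q = m * s"
proof -
  note R = is_subfield_subring[OF K]
  let ?P = "\<lambda>m. m \<in> polys_over K \<and> m \<noteq> 0 \<and> poly m y = 0"
  obtain m0 where "?P m0" using y by (auto simp: alg_over_def polys_over_def)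
  from ex_has_least_nat[of ?P, OF this, of degree]
  obtain m1 where m1: "?P m1" and least: "\<And>q. ?P q \<Longrightarrow> degree m1 \<le> degree q" by blast
  define m where "m = smult (inverse (lead_coeff m1)) m1"
  have m: "m \<in> polys_over K" "lead_coeff m = 1" "poly m y = 0" "degree m = degree m1"
    using m1 is_subringD(4)[OF R] is_subfieldD(1)[OF K] by (auto simp: m_def polys_over_def)
  have pos: "0 < degree m"
  proof (rule ccontr)
    assume "\<not> 0 < degree m"
    then obtain c where "m = [:c:]" using degree_eq_zeroE by blast
    thus False using m by simp
  qed
  have small: "q = 0" if "q \<in> polys_over K" "poly q y = 0" "degree q < degree m" for q
    using least[of q] that m(4) by (cases "q = 0") auto
  have dv: "\<exists>s\<in>polys_over K. q = m * s" if q: "q \<in> polys_over K" "poly q y = 0" for q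
  proof -
    obtain N s r where "s \<in> polys_over K" "r \<in> polys_over K"
      "smult (lead_coeff m ^ N) q = m * s + r" "r = 0 \<or> degree r < degree m"
      using pseudo_division[OF R m(1) _ q(1)] pos by blast
    moreover from this have "poly r y = 0" using q m by (auto dest!: arg_cong[of _ _ "\<lambda>p. poly p y"])
    ultimately have "r = 0" using small by blast
    thus ?thesis using \<open>smult _ _ = _\<close> \<open>s \<in> _\<close> m(2) by auto
  qed
  show ?thesis by (rule that[of m]) (use m pos small dv in auto)
qed

subsection \<open>Separable elements\<close>

lemma rsquarefree_iff_no_double_root:
  fixes p :: "'a::field poly"
  shows "rsquarefree p \<longleftrightarrow> p \<noteq> 0 \<and> (\<forall>a. \<not> (poly p a = 0 \<and> poly (pderiv p) a = 0))"
proof (cases "p = 0")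
  case False
  have "order a p = 0 \<or> order a p = 1 \<longleftrightarrow> \<not> (poly p a = 0 \<and> poly (pderiv p) a = 0)" for a
  proof (cases "poly p a = 0")
    case True
    then obtain q where q: "p = [:-a, 1:] * q" using poly_eq_0_iff_dvd by blast
    have "order a p = 1 + order a q"
      using False q order_mult[of "[:-a, 1:]" q a] order_power_n_n[of a 1] by simp
    moreover have "poly (pderiv p) a = poly q a" by (simp add: q pderiv_mult pderiv_pCons del: mult_pCons_left)
    ultimately show ?thesis using True False q by (auto simp: order_root)
  qed (simp add: order_0I)
  thus ?thesis using False by (simp add: rsquarefree_def)
qed (simp add: rsquarefree_def)

lemma rsquarefree_factorization:
  fixes m :: "'a::alg_closed_field poly"
  assumes "rsquarefree m"
  shows "card {x. poly m x = 0} = degree m"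
    "m = smult (lead_coeff m) (\<Prod>x\<in>{x. poly m x = 0}. [:- x, 1:])"
proof -
  have m0: "m \<noteq> 0" using assms by (simp add: rsquarefree_def)
  obtain A where A: "size A = degree m" "m = smult (lead_coeff m) (\<Prod>x\<in>#A. [:- x, 1:])"
    using alg_closed_imp_factorization[OF m0] by blast
  have nz: "(\<Prod>x\<in>#A. [:- x, 1:]) \<noteq> 0" for A :: "'a multiset"
    by (induction A) (auto simp del: mult_pCons_left)
  have "proots (\<Prod>x\<in>#A. [:- x, 1:]) = A" for A :: "'a multiset"
  proof (induction A)
    case (add x A)
    have "proots ([:- x, 1:] * (\<Prod>x\<in>#A. [:- x, 1:])) = proots [:- x, 1:] + proots (\<Prod>x\<in>#A. [:- x, 1:])"
      by (rule proots_mult[OF _ nz]) simp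
    thus ?case using add by (simp del: mult_pCons_left)
  qed simp
  hence "proots m = A" using m0 by (subst A(2)) simp
  hence cA: "count A x = order x m" for x using m0 by (metis count_proots)
  have "set_mset A = {x. poly m x = 0}"
    using cA m0 by (auto simp: order_root simp flip: count_greater_zero_iff)
  moreover have "A = mset_set (set_mset A)"
  proof (rule multiset_eqI)
    fix x
    have "count A x = 0 \<or> count A x = 1" using assms cA by (simp add: rsquarefree_def)
    thus "count A x = count (mset_set (set_mset A)) x"
      by (metis count_eq_zero_iff count_mset_set(1,3) finite_set_mset)
  qed
  ultimately have "A = mset_set {x. poly m x = 0}" by simp
  thus "card {x. poly m x = 0} = degree m"
    "m = smult (lead_coeff m) (\<Prod>x\<in>{x. poly m x = 0}. [:- x, 1:])"
    using A by (simp_all add: prod_unfold_prod_mset)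
qed

lemma pderiv_in_polys_over:
  assumes "is_subring K" "p \<in> polys_over K"
  shows "pderiv p \<in> polys_over (K :: 'a::idom set)"
proof -
  have "of_nat n \<in> K" for n by (induction n) (auto intro: is_subringD[OF assms(1)])
  thus ?thesis using assms is_subringD(4)[OF assms(1)]
    by (auto simp: polys_over_def coeff_pderiv simp del: of_nat_Suc)
qed

text \<open>The minimal polynomial of a multiple root divides both \<open>m\<close> and
  \<open>pderiv m\<close>, so it is a proper factor of \<open>m\<close>; one of the two resulting
  factors vanishes at \<open>y\<close>, against minimality.\<close>

lemma min_poly_rsquarefree:
  fixes y :: "'a::field"
  assumes K: "is_subfield K" and m: "m \<in> polys_over K" "poly m y = 0"
    "\<And>q. q \<in> polys_over K \<Longrightarrow> poly q y = 0 \<Longrightarrow> degree q < degree m \<Longrightarrow> q = 0" "pderiv m \<noteq> 0"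
  shows "rsquarefree m"
  unfolding rsquarefree_iff_no_double_root
proof (intro conjI allI notI)
  show "m = 0 \<Longrightarrow> False" using m(4) by simp
  fix a assume a: "poly m a = 0 \<and> poly (pderiv m) a = 0"
  have "m \<noteq> 0" using m(4) by auto
  hence "alg_over K a" using a m(1) by (auto simp: alg_over_def polys_over_def)
  then obtain m' where m': "m' \<in> polys_over K" "0 < degree m'"
    "\<And>q. q \<in> polys_over K \<Longrightarrow> poly q a = 0 \<Longrightarrow> \<exists>s\<in>polys_over K. q = m' * s"
    using min_poly_exists[OF K] by metis
  obtain s where s: "s \<in> polys_over K" "m = m' * s" using m'(3) m(1) a by blast
  obtain s' where s': "pderiv m = m' * s'"
    using m'(3)[OF pderiv_in_polys_over[OF is_subfield_subring[OF K] m(1)]] a by blast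
  have "degree (pderiv m) < degree m"
  proof -
    have "degree m \<noteq> 0"
    proof
      assume "degree m = 0"
      then obtain c where "m = [:c:]" by (rule degree_eq_zeroE)
      thus False using m(4) by (simp add: pderiv_pCons)
    qed
    moreover have "degree (pderiv m) \<le> degree m - 1"
      by (rule degree_le) (auto simp: coeff_pderiv coeff_eq_0)
    ultimately show ?thesis by simp
  qed
  moreover have "degree m' \<le> degree (pderiv m)" using s' m(4) by (auto intro: dvd_imp_degree_le)
  ultimately have "degree m' < degree m" by simp
  moreover have "degree s < degree m" using s \<open>m \<noteq> 0\<close> m'(2) by (auto simp: degree_mult_eq)
  moreover have "poly m' y = 0 \<or> poly s y = 0" using m(2) s by auto
  ultimately show False using m(3) m'(1) s \<open>m \<noteq> 0\<close> by auto
qed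

text \<open>By \<open>min_poly_rsquarefree\<close> the derivative of the minimal polynomial
  vanishes, which kills every coefficient whose exponent is not divisible by the
  characteristic.\<close>

lemma inseparable_imp_min_poly:
  fixes y :: "'a::alg_closed_field"
  assumes K: "is_subfield K" and y: "alg_over K y" "\<not> separable_over K y"
    and m: "m \<in> polys_over K" "lead_coeff m = 1" "poly m y = 0" "0 < degree m"
    "\<And>q. q \<in> polys_over K \<Longrightarrow> poly q y = 0 \<Longrightarrow> degree q < degree m \<Longrightarrow> q = 0"
  obtains h where "prime CHAR('a)" "h \<in> polys_over K" "m = pcompose h (monom 1 CHAR('a))"
    "degree m = CHAR('a) * degree h" "lead_coeff h = 1"
proof -
  let ?p = "CHAR('a)"
  have "pderiv m = 0"
    using min_poly_rsquarefree[OF K m(1,3,5)] y(2) m(1,3) by (auto simp: separable_over_def polys_over_def)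
  hence c: "coeff m i = 0" if "\<not> ?p dvd i" for i
  proof (cases i)
    case (Suc j)
    have "of_nat (Suc j) * coeff m (Suc j) = 0"
      using \<open>pderiv m = 0\<close> coeff_pderiv[of m j] by simp
    moreover have "of_nat (Suc j) \<noteq> (0::'a)" using that Suc of_nat_eq_0_iff_char_dvd by blast
    ultimately show ?thesis using Suc by (simp del: of_nat_Suc)
  qed (use that in auto)
  have dv: "?p dvd degree m" using c[of "degree m"] m(2) by auto
  \<comment> \<open>Characteristic 0 is excluded here: 0 does not divide a positive degree.\<close>
  hence "?p > 0" using m(4) by (auto intro!: Nat.gr0I)
  hence prime: "prime ?p" by (rule prime_CHAR_semidom)
  define h where "h = (\<Sum>i\<le>degree m div ?p. monom (coeff m (?p * i)) i)"
  have ch: "coeff h i = (if i \<le> degree m div ?p then coeff m (?p * i) else 0)" for i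
    by (simp add: h_def coeff_sum coeff_monom)
  have hK: "h \<in> polys_over K" using m(1) is_subringD(1)[OF is_subfield_subring[OF K]]
    by (auto simp: polys_over_def ch)
  have pc: "pcompose h (monom 1 ?p) = (\<Sum>i\<le>degree m div ?p. monom (coeff m (?p * i)) (?p * i))"
  proof -
    have "pcompose (monom c i) (monom 1 ?p) = monom c (?p * i)" for c :: 'a and i
      by (induction i) (auto simp: monom_Suc pcompose_pCons mult_monom monom_0)
    thus ?thesis by (simp add: h_def pcompose_sum)
  qed
  have "m = pcompose h (monom 1 ?p)"
  proof (rule poly_eqI)
    fix k
    show "coeff m k = coeff (pcompose h (monom 1 ?p)) k"
    proof (cases "?p dvd k")
      case False
      hence "coeff (pcompose h (monom 1 ?p)) k = 0"
        unfolding pc coeff_sum coeff_monom by (intro sum.neutral) auto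
      thus ?thesis using c[OF False] by simp
    next
      case True
      then obtain j where j: "k = ?p * j" by blast
      have "coeff (pcompose h (monom 1 ?p)) k =
          (\<Sum>i\<le>degree m div ?p. if i = j then coeff m k else 0)"
        unfolding pc coeff_sum coeff_monom using \<open>?p > 0\<close> by (intro sum.cong) (auto simp: j)
      also have "\<dots> = coeff m k"
        using j \<open>?p > 0\<close> by (auto simp: coeff_eq_0 not_le div_less_iff_less_mult mult.commute)
      finally show ?thesis by simp
    qed
  qed
  moreover have "degree h = degree m div ?p"
  proof (rule antisym)
    show "degree h \<le> degree m div ?p" by (rule degree_le) (simp add: ch)
    show "degree m div ?p \<le> degree h" by (rule le_degree) (use dv m(2) in \<open>simp add: ch\<close>)
  qed
  ultimately show ?thesis using that[of h] prime hK dv m(2) by (simp add: ch)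
qed

text \<open>If \<open>y \<in> K(y\<^sup>p)\<close>, comparing exponents modulo \<open>p\<close> in a minimal relation excludes inseparability.\<close>

lemma separable_if_in_adj_power:
  fixes y :: "'a::alg_closed_field"
  assumes K: "is_subfield K" and y: "alg_over K y" "prime CHAR('a) \<Longrightarrow> y \<in> adj K (y ^ CHAR('a))"
  shows "separable_over K y"
proof (rule ccontr)
  let ?p = "CHAR('a)"
  note R = is_subfield_subring[OF K]
  note RP = is_subringD[OF is_subring_polys_over[OF R]]
  assume ns: "\<not> separable_over K y"
  obtain m where m: "m \<in> polys_over K" "lead_coeff m = 1" "poly m y = 0" "0 < degree m"
    "\<And>q. q \<in> polys_over K \<Longrightarrow> poly q y = 0 \<Longrightarrow> degree q < degree m \<Longrightarrow> q = 0"
    using min_poly_exists[OF K y(1)] by metis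
  obtain h where h: "prime ?p" "h \<in> polys_over K" "m = pcompose h (monom 1 ?p)"
    "degree m = ?p * degree h" "lead_coeff h = 1"
    using inseparable_imp_min_poly[OF K y(1) ns m] by blast
  have p2: "?p \<ge> 2" using h(1) prime_ge_2_nat by blast
  have hy: "poly h (y ^ ?p) = 0" using m(3) by (simp add: h(3) poly_pcompose poly_monom)
  have dh: "0 < degree h" using m(4) h(4) by auto
  \<comment> \<open>Reduction modulo \<open>h\<close> brings numerator and denominator of
    \<open>y\<close> below \<open>degree h\<close>, so that the relation \<open>q\<close> formed
    from them has degree less than \<open>degree m\<close> and must be zero.\<close>
  have red: "\<exists>r\<in>polys_over K. (r = 0 \<or> degree r < degree h) \<and> poly r (y ^ ?p) = poly u (y ^ ?p)"
    if u: "u \<in> polys_over K" for u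
  proof -
    obtain N q r where r: "r \<in> polys_over K" "smult (lead_coeff h ^ N) u = h * q + r" "r = 0 \<or> degree r < degree h"
      using pseudo_division[OF R h(2) _ u] dh by blast
    hence "u = h * q + r" using h(5) by simp
    hence "poly u (y ^ ?p) = poly r (y ^ ?p)" using hy by simp
    thus ?thesis using r by metis
  qed
  obtain u0 v0 where uv0: "u0 \<in> polys_over K" "v0 \<in> polys_over K" "poly v0 (y ^ ?p) \<noteq> 0"
    "y = poly u0 (y ^ ?p) / poly v0 (y ^ ?p)"
    using in_adjE[OF K y(2)[OF h(1)]] by blast
  obtain u where u: "u \<in> polys_over K" "u = 0 \<or> degree u < degree h" "poly u (y ^ ?p) = poly u0 (y ^ ?p)"
    using red[OF uv0(1)] by blast
  obtain v where v: "v \<in> polys_over K" "v = 0 \<or> degree v < degree h" "poly v (y ^ ?p) = poly v0 (y ^ ?p)"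
    using red[OF uv0(2)] by blast
  let ?F = "\<lambda>w. pcompose w (monom 1 ?p)"
  have XK: "monom 1 k \<in> polys_over K" for k using is_subringD[OF R] by (auto simp: polys_over_def coeff_monom)
  have FK: "?F w \<in> polys_over K" if "w \<in> polys_over K" for w
    by (rule pcompose_in_polys_over[OF R that XK])
  have dF: "degree (?F w) = ?p * degree w" for w :: "'a poly"
    using degree_pcompose[of w "monom 1 ?p"] by (simp add: degree_monom_eq mult.commute)
  define q where "q = monom 1 1 * ?F v - ?F u"
  have qK: "q \<in> polys_over K" unfolding q_def by (intro RP XK FK u v)
  have "poly v (y ^ ?p) \<noteq> 0" using v(3) uv0(3) by simp
  hence "v \<noteq> 0" by auto
  hence dv: "degree v < degree h" using v by auto
  have bound: "?p * d + 1 < degree m" if "d < degree h" for d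
  proof -
    have "?p * Suc d \<le> degree m" unfolding h(4) using that by (intro mult_le_mono2) simp
    thus ?thesis using p2 by simp
  qed
  have "degree (monom 1 1 * ?F v) \<le> 1 + ?p * degree v"
    by (rule order.trans[OF degree_mult_le]) (simp add: dF degree_monom_eq)
  hence d1: "degree (monom 1 1 * ?F v) < degree m" using bound[OF dv] by simp
  have d2: "degree (?F u) < degree m"
  proof (cases "u = 0")
    case False
    thus ?thesis using bound[of "degree u"] u(2) dF[of u] by simp
  qed (use m(4) in simp)
  have "degree q < degree m" unfolding q_def using d1 d2 by (rule degree_diff_less)
  moreover have "poly q y = 0"
    using uv0 u v by (simp add: q_def poly_pcompose poly_monom field_simps)
  ultimately have "q = 0" using m(5)[OF qK] by blast
  hence "monom 1 1 * ?F v = ?F u" by (simp add: q_def)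
  hence "degree (monom 1 1 * ?F v) = degree (?F u)" by simp
  moreover have "?F v \<noteq> 0" using \<open>v \<noteq> 0\<close> \<open>?p \<ge> 2\<close> by (subst pcompose_eq_0_iff) (auto simp: degree_monom_eq)
  ultimately have "1 + ?p * degree v = ?p * degree u"
    by (subst (asm) degree_mult_eq) (auto simp: dF degree_monom_eq monom_eq_0_iff)
  hence "?p dvd 1 + ?p * degree v" by simp
  hence "?p dvd 1" using dvd_add_left_iff[of ?p "?p * degree v" 1] by (metis dvd_add_right_iff dvd_triv_left add.commute)
  thus False using p2 by simp
qed

text \<open>Both minimal polynomials of \<open>\<gamma>\<close>, over \<open>K\<close> and over \<open>K(y)\<close>, have the same roots, hence the same degree.\<close>

lemma in_subfield_if_power_in_subfield:
  fixes y \<gamma> :: "'a::alg_closed_field"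
  assumes K: "is_subfield K" and p: "prime CHAR('a)" and y: "y ^ CHAR('a) \<in> K" "y \<in> adj K \<gamma>"
    and \<gamma>: "separable_over K \<gamma>"
  shows "y \<in> K"
proof -
  let ?p = "CHAR('a)"
  note R = is_subfield_subring[OF K]
  define L where "L = adj K y"
  note Lf = adj_facts[OF K, where y = y, folded L_def]
  note RL = is_subfield_subring[OF Lf(1)]
  obtain P where P: "P \<in> polys_over K" "rsquarefree P" "poly P \<gamma> = 0"
    using \<gamma> by (auto simp: separable_over_def polys_over_def)
  have alg: "alg_over K \<gamma>" using P by (auto simp: alg_over_def polys_over_def rsquarefree_def)
  obtain m where m: "m \<in> polys_over K" "lead_coeff m = 1" "poly m \<gamma> = 0" "0 < degree m"
    "\<And>q. q \<in> polys_over K \<Longrightarrow> poly q \<gamma> = 0 \<Longrightarrow> \<exists>s\<in>polys_over K. q = m * s"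
    using min_poly_exists[OF K alg] by metis
  obtain m1 where m1: "m1 \<in> polys_over L" "lead_coeff m1 = 1" "poly m1 \<gamma> = 0" "0 < degree m1"
    "\<And>q. q \<in> polys_over L \<Longrightarrow> poly q \<gamma> = 0 \<Longrightarrow> degree q < degree m1 \<Longrightarrow> q = 0"
    using min_poly_exists[OF Lf(1) alg_over_mono[OF Lf(2) alg]] by metis
  have "{c. c ^ ?p \<in> K} \<supseteq> L" unfolding L_def
  proof (rule adj_facts(4)[OF K])
    show "K \<subseteq> {c. c ^ ?p \<in> K}" using is_subringD(7)[OF R] by auto
    have neg: "(- x) ^ ?p = - (x ^ ?p)" for x :: 'a
      using freshmans_dream[OF p refl, of x "- x"] prime_gt_0_nat[OF p]
      by (simp add: power_0_left add_eq_0_iff)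
    show "is_subfield {c. c ^ ?p \<in> K}"
      unfolding is_subfield_def is_subring_def
      using is_subringD[OF R] is_subfieldD[OF K] prime_gt_0_nat[OF p]
      by (auto simp: freshmans_dream[OF p refl] power_mult_distrib power_inverse neg power_0_left)
  qed (use y in auto)
  hence pw: "coeff m1 i ^ ?p \<in> K" for i using m1(1) by (auto simp: polys_over_def)
  have fr: "rhom (\<lambda>c::'a. c ^ ?p)"
    by unfold_locales (use prime_gt_0_nat[OF p] in \<open>simp_all add: freshmans_dream[OF p refl] power_mult_distrib\<close>)
  \<comment> \<open>The values of \<open>q\<close> are the p-th powers of those of
    \<open>m1\<close>. Its coefficients are p-th powers of elements of \<open>L\<close>, which lie
    in \<open>K\<close>; hence \<open>m\<close> divides \<open>q\<close>, and \<open>m1\<close> has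
    all the roots of the separable polynomial \<open>m\<close>.\<close>
  define q where "q = pcompose (map_poly (\<lambda>c. c ^ ?p) m1) (monom 1 ?p)"
  have q: "poly q x = poly m1 x ^ ?p" for x
    unfolding q_def poly_pcompose poly_monom using rhom.poly[OF fr, of m1 x] by simp
  have "q \<in> polys_over K" unfolding q_def
    by (rule pcompose_in_polys_over[OF R _ monom_in_polys_over[OF R is_subringD(2)[OF R]]])
      (use pw in \<open>simp add: polys_over_def rhom.coeff[OF fr]\<close>)
  moreover have "poly q \<gamma> = 0" using m1(3) q p by (simp add: prime_gt_0_nat)
  ultimately obtain s where s: "q = m * s" using m(5) by blast
  obtain s' where s': "P = m * s'" using m(5) P by blast
  have m0: "m \<noteq> 0" using m(2) by auto
  have sqf: "rsquarefree m"
    unfolding rsquarefree_iff_no_double_root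
    using P(2) m0 unfolding s' rsquarefree_iff_no_double_root by (auto simp: pderiv_mult)
  have roots: "poly m x = 0 \<Longrightarrow> poly m1 x = 0" for x
  proof -
    assume "poly m x = 0"
    hence "poly q x = 0" by (simp add: s)
    thus "poly m1 x = 0" using q by simp
  qed
  have "degree m = card {x. poly m x = 0}"
    using rsquarefree_factorization(1)[OF sqf] by simp
  also have "\<dots> \<le> card {x. poly m1 x = 0}"
    using m1(2) roots by (intro card_mono poly_roots_finite) auto
  also have "\<dots> \<le> degree m1" using m1(2) by (intro card_poly_roots_bound) auto
  finally have deg: "degree m \<le> degree m1" .
  obtain u0 v0 where uv0: "u0 \<in> polys_over K" "v0 \<in> polys_over K" "poly v0 \<gamma> \<noteq> 0"
    "y = poly u0 \<gamma> / poly v0 \<gamma>" using in_adjE[OF K y(2)] by blast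
  have red: "\<exists>r\<in>polys_over K. degree r < degree m \<and> poly r \<gamma> = poly u \<gamma>"
    if u: "u \<in> polys_over K" for u
  proof -
    obtain N q r where r: "r \<in> polys_over K" "smult (lead_coeff m ^ N) u = m * q + r" "r = 0 \<or> degree r < degree m"
      using pseudo_division[OF R m(1) _ u] m(4) by blast
    hence "u = m * q + r" using m(2) by simp
    hence "poly u \<gamma> = poly r \<gamma>" using m(3) by simp
    moreover have "degree r < degree m" using r(3) m(4) by auto
    ultimately show ?thesis using r by metis
  qed
  obtain u where u: "u \<in> polys_over K" "degree u < degree m" "poly u \<gamma> = poly u0 \<gamma>"
    using red[OF uv0(1)] by blast
  obtain v where v: "v \<in> polys_over K" "degree v < degree m" "poly v \<gamma> = poly v0 \<gamma>"
    using red[OF uv0(2)] by blast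
  have "u \<in> polys_over L" using u(1) Lf(2) by (auto simp: polys_over_def)
  moreover have "smult y v \<in> polys_over L"
    using v(1) Lf(2,3) is_subringD(4)[OF RL] by (auto simp: polys_over_def subset_iff)
  \<comment> \<open>A relation for \<open>\<gamma>\<close> over \<open>L\<close> of degree below
    \<open>degree m1\<close> is trivial; comparing one coefficient exhibits \<open>y\<close> as a
    quotient in \<open>K\<close>.\<close>
  ultimately have "smult y v - u \<in> polys_over L"
    by (intro is_subringD(6)[OF is_subring_polys_over[OF RL]])
  moreover have "poly (smult y v - u) \<gamma> = 0" using uv0 u v by simp
  moreover have "degree (smult y v - u) < degree m1"
    using u(2) v(2) deg by (intro degree_diff_less) (auto intro: le_less_trans[OF degree_smult_le])
  ultimately have "smult y v - u = 0" using m1(5) by blast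
  moreover have "v \<noteq> 0" using v(3) uv0(3) by auto
  ultimately have "y * lead_coeff v = coeff u (degree v)" "lead_coeff v \<noteq> 0"
    by (auto simp: poly_eq_iff)
  hence "y = coeff u (degree v) / lead_coeff v" by (simp add: field_simps)
  thus ?thesis using u(1) v(1) is_subfieldD(2)[OF K] by (auto simp: polys_over_def)
qed

lemma separable_over_mono: "K \<subseteq> L \<Longrightarrow> separable_over K y \<Longrightarrow> separable_over L y"
  unfolding separable_over_def by blast

lemma separable_imp_alg: "separable_over K y \<Longrightarrow> alg_over K y"
  unfolding separable_over_def alg_over_def rsquarefree_def by blast

lemma gen_field_Suc_subset:
  assumes "is_subfield K"
  shows "gen_field K (Suc n) x \<subseteq> adj (gen_field K n x) (x n)"
proof -
  note A = adj_facts[OF is_subfield_gen_field[OF assms, of n x], where y = "x n"]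
  show ?thesis
    by (rule gen_field_subset[OF assms A(1)])
      (use A(2,3) const_in_gen_field[OF assms] var_in_gen_field[OF assms] in \<open>auto simp: less_Suc_eq\<close>)
qed

text \<open>Let \<open>L\<close> be generated by the p-th power of \<open>y\<close>. Then
  \<open>y\<close> is a p-th root over \<open>L\<close>, and
  \<open>in_subfield_if_power_in_subfield\<close> removes the separable generators one at a time
  from a field containing \<open>y\<close>, until \<open>y \<in> L\<close> remains.\<close>

lemma separable_gen_field:
  fixes y :: "'a::alg_closed_field"
  assumes K: "is_subfield K" and x: "\<And>i. i < n \<Longrightarrow> separable_over K (x i)" and y: "y \<in> gen_field K n x"
  shows "separable_over K y"
proof (rule separable_if_in_adj_power[OF K])
  have "gen_field K n x \<subseteq> {y. alg_over K y}"
    by (rule gen_field_subset[OF K is_subfield_algebraics[OF K]])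
      (use x separable_imp_alg alg_over_self[OF K] in auto)
  thus "alg_over K y" using y by blast
  assume p: "prime CHAR('a)"
  define L where "L = adj K (y ^ CHAR('a))"
  note Lf = adj_facts[OF K, where y = "y ^ CHAR('a)", folded L_def]
  have "y \<in> gen_field L n x"
    using gen_field_subset[OF K is_subfield_gen_field[OF Lf(1)], of n x n x] y
      const_in_gen_field[OF Lf(1)] var_in_gen_field[OF Lf(1)] Lf(2) by blast
  hence "y \<in> L" using x
  proof (induction n)
    case 0
    thus ?case using gen_field_subset[OF Lf(1) Lf(1), of 0 x] by auto
  next
    case (Suc n)
    note G = is_subfield_gen_field[OF Lf(1), of n x]
    have sub: "L \<subseteq> gen_field L n x" using const_in_gen_field[OF Lf(1)] by blast
    have "y \<in> gen_field L n x"
    proof (rule in_subfield_if_power_in_subfield[OF G p])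
      show "y ^ CHAR('a) \<in> gen_field L n x" using sub Lf(3) by blast
      show "y \<in> adj (gen_field L n x) (x n)" using gen_field_Suc_subset[OF Lf(1)] Suc.prems(1) by blast
      show "separable_over (gen_field L n x) (x n)"
        by (rule separable_over_mono[OF _ Suc.prems(2)]) (use sub Lf(2) in auto)
    qed
    thus ?case using Suc by simp
  qed
  thus "y \<in> adj K (y ^ CHAR('a))" by (simp add: L_def)
qed

text \<open>Over a finite field, 1 plus the product of all X - x has no root.\<close>

lemma infinite_UNIV_alg_closed: "infinite (UNIV :: 'a::alg_closed_field set)"
proof
  assume fin: "finite (UNIV :: 'a set)"
  define p :: "'a poly" where "p = 1 + (\<Prod>x\<in>UNIV. [:- x, 1:])"
  have d: "degree (\<Prod>x\<in>(UNIV :: 'a set). [:- x, 1:]) = card (UNIV :: 'a set)"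
    by (subst degree_prod_eq_sum_degree) auto
  have "degree p = card (UNIV :: 'a set)"
    unfolding p_def using fin d by (subst degree_add_eq_right) (auto simp: card_gt_0_iff)
  then obtain x where "poly p x = 0"
    using alg_closed_imp_poly_has_root[of p] fin by (auto simp: card_gt_0_iff)
  moreover have "(\<Prod>y\<in>UNIV. x - y) = 0" using fin by (intro prod_zero) auto
  ultimately show False by (simp add: p_def poly_prod)
qed

subsection \<open>Algebraic independence\<close>

lemma alg_indep_transcendental:
  fixes t :: "nat \<Rightarrow> 'a::alg_closed_field"
  assumes "is_subring K" "alg_indep K n t" "i < n" "u \<in> polys_over K" "poly u (t i) = 0"
  shows "u = 0"
proof (rule ccontr)
  assume "u \<noteq> 0"
  have "eval_mpol t (poly (map_poly Cst u) (Var i)) = 0"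
    unfolding eval_mpol_ev using assms(5)
    by (simp add: ev_poly_Cst[OF rhom_id(1)] rhom.ev_Var[OF rhom_id(1)] map_poly_id)
  hence z: "poly (map_poly Cst u) (Var i) = (0 :: 'a mpol)"
    using assms(2) poly_in_mpols[OF assms(1,4,3)] by (auto simp: alg_indep_def)
  have "poly u s = 0" for s
  proof -
    have "0 = ev id (\<lambda>_. s) (poly (map_poly Cst u) (Var i))"
      using z by (simp add: rhom.zero[OF rhom.rhom_ev[OF rhom_id(1)]])
    thus ?thesis by (simp add: ev_poly_Cst[OF rhom_id(1)] rhom.ev_Var[OF rhom_id(1)] map_poly_id)
  qed
  hence "{s. poly u s = 0} = UNIV" by blast
  thus False using poly_roots_finite[OF \<open>u \<noteq> 0\<close>] infinite_UNIV_alg_closed by metis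
qed

text \<open>The exchange property: as \<open>t 0\<close> is transcendental over \<open>K\<close>, a
  relation making it algebraic over \<open>K(x)\<close> also makes \<open>x\<close> algebraic over
  \<open>K(t 0)\<close>. If \<open>t 1\<close> is algebraic over \<open>K(x)\<close>, it is then
  algebraic over \<open>K(t 0)\<close>, a contradiction.\<close>

lemma alg_indep_exchange:
  fixes t :: "nat \<Rightarrow> 'a::alg_closed_field"
  assumes K: "is_subfield K" and ind: "alg_indep K 2 t"
  shows "\<not> (alg_over (adj K x) (t 0) \<and> alg_over (adj K x) (t 1))"
proof
  assume alg: "alg_over (adj K x) (t 0) \<and> alg_over (adj K x) (t 1)"
  note R = is_subfield_subring[OF K]
  define L where "L = adj K (t 0)"
  note Lf = adj_facts[OF K, where y = "t 0", folded L_def]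
  note RL = is_subfield_subring[OF Lf(1)]
  obtain u N k where "\<forall>i. u i \<in> polys_over K" and u: "k \<le> N" "poly (u k) x \<noteq> 0"
    "(\<Sum>i\<le>N. poly (u i) x * t 0 ^ i) = 0" using alg_over_adj[OF K conjunct1[OF alg]] by (elim exE conjE)
  hence uK: "u i \<in> polys_over K" for i by simp
  \<comment> \<open>The same relation, read as a polynomial in \<open>x\<close> over
    \<open>K(t 0)\<close>.\<close>
  define F where "F = (\<Sum>i\<le>N. smult (t 0 ^ i) (u i))"
  have "poly F x = 0" using u(3) by (simp add: F_def poly_sum mult.commute)
  moreover have "F \<in> polys_over L"
  proof -
    have "smult (t 0 ^ i) (u i) \<in> polys_over L" for i
      using uK[of i] Lf(2,3) is_subringD(4,7)[OF RL] by (auto simp: polys_over_def subset_iff)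
    thus ?thesis unfolding F_def by (intro is_subring_sum is_subring_polys_over[OF RL])
  qed
  moreover have "F \<noteq> 0"
  proof
    assume "F = 0"
    obtain j where j: "coeff (u k) j \<noteq> 0" using u(2) by (metis leading_coeff_0_iff poly_0)
    \<comment> \<open>A vanishing coefficient of \<open>F\<close> is a polynomial relation of
      \<open>t 0\<close> over \<open>K\<close>, nontrivial by the choice of
      \<open>j\<close>.\<close>
    define w where "w = (\<Sum>i\<le>N. monom (coeff (u i) j) i)"
    have "poly w (t 0) = coeff F j" by (simp add: w_def F_def poly_sum poly_monom coeff_sum mult.commute)
    hence "poly w (t 0) = 0" using \<open>F = 0\<close> by simp
    moreover have "w \<in> polys_over K" unfolding w_def
      using uK by (intro is_subring_sum is_subring_polys_over[OF R] monom_in_polys_over[OF R]) (auto simp: polys_over_def)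
    ultimately have "w = 0" using alg_indep_transcendental[OF R ind, of 0 w] by simp
    moreover have "coeff w k = coeff (u k) j" using u(1) by (simp add: w_def coeff_sum coeff_monom)
    ultimately show False using j by simp
  qed
  ultimately have "alg_over L x" unfolding alg_over_def polys_over_def by blast
  hence "adj K x \<subseteq> {y. alg_over L y}"
    using alg_over_self[OF Lf(1)] Lf(2) by (intro adj_facts(4)[OF K is_subfield_algebraics[OF Lf(1)]]) auto
  hence "alg_over {y. alg_over L y} (t 1)" using alg_over_mono conjunct2[OF alg] by blast
  hence "alg_over (adj K (t 0)) (t 1)" unfolding L_def[symmetric] by (rule alg_over_trans[OF Lf(1)])
  then obtain u N k where "\<forall>i. u i \<in> polys_over K" and u: "k \<le> N" "poly (u k) (t 0) \<noteq> 0"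
    "(\<Sum>i\<le>N. poly (u i) (t 0) * t 1 ^ i) = 0" by (drule_tac alg_over_adj[OF K]) (elim exE conjE)
  hence uK: "u i \<in> polys_over K" for i by simp
  define p where "p = (\<Sum>i\<le>N. poly (map_poly Cst (u i)) (Var 0) * Var 1 ^ i)"
  have ev: "ev id y p = (\<Sum>i\<le>N. poly (u i) (y 0) * y 1 ^ i)" for y :: "nat \<Rightarrow> 'a"
  proof -
    interpret e: rhom "ev id y" by (rule rhom.rhom_ev[OF rhom_id(1)])
    show ?thesis
      by (simp add: p_def e.sum ev_poly_Cst[OF rhom_id(1)] rhom.ev_Var[OF rhom_id(1)] map_poly_id)
  qed
  have "p \<in> mpols K 2" unfolding p_def
    using uK is_subring_mpols[OF R, of 2]
    by (intro is_subring_sum is_subringD(4,7) poly_in_mpols[OF R] Var_in_mpols[OF R]) auto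
  hence "p = 0" using ind u(3) by (simp add: alg_indep_def eval_mpol_ev(1) ev)
  define w where "w = (\<Sum>i\<le>N. monom (poly (u i) (t 0)) i)"
  have "poly w s = 0" for s
    using ev[of "t(1 := s)"] \<open>p = 0\<close> by (simp add: w_def poly_sum poly_monom rhom.zero[OF rhom.rhom_ev[OF rhom_id(1)]])
  hence "{s. poly w s = 0} = UNIV" by blast
  moreover have "w \<noteq> 0"
  proof
    assume "w = 0"
    moreover have "coeff w k = poly (u k) (t 0)" using u(1) by (simp add: w_def coeff_sum coeff_monom)
    ultimately show False using u(2) by simp
  qed
  ultimately show False using poly_roots_finite[of w] infinite_UNIV_alg_closed by metis
qed

subsection \<open>Extending specialisations of relations\<close>

text \<open>Equality of the relation ideals, that is, an isomorphism over the base between the rings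
  generated by \<open>u\<close> and by \<open>v\<close> when \<open>h1\<close> and \<open>h2\<close>
  are field embeddings. Galois automorphisms are encoded in this form, without constructing
  maps.\<close>

definition same_rel :: "('k::comm_ring_1 \<Rightarrow> 'a::field) \<Rightarrow> ('k \<Rightarrow> 'b::field) \<Rightarrow> nat \<Rightarrow> (nat \<Rightarrow> 'a) \<Rightarrow> (nat \<Rightarrow> 'b) \<Rightarrow> bool" where
  "same_rel h1 h2 n u v \<longleftrightarrow> (\<forall>p\<in>mpols UNIV n. ev h1 u p = 0 \<longleftrightarrow> ev h2 v p = 0)"

lemma same_rel_sym: "same_rel h1 h2 n u v \<Longrightarrow> same_rel h2 h1 n v u"
  unfolding same_rel_def by blast

lemma degree_eq_if_same_support:
  assumes "\<And>i. coeff p i = 0 \<longleftrightarrow> coeff q i = 0"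
  shows "degree p = degree q"
  unfolding degree_def using assms by simp

lemma same_rel_coeffs:
  assumes "rhom h1" "rhom h2" "same_rel h1 h2 n u v" "P \<in> polys_over (mpols UNIV n)"
  shows "coeff (map_poly (ev h1 u) P) i = 0 \<longleftrightarrow> coeff (map_poly (ev h2 v) P) i = 0"
    "degree (map_poly (ev h1 u) P) = degree (map_poly (ev h2 v) P)"
    "map_poly (ev h1 u) P = 0 \<longleftrightarrow> map_poly (ev h2 v) P = 0"
proof -
  show *: "coeff (map_poly (ev h1 u) P) i = 0 \<longleftrightarrow> coeff (map_poly (ev h2 v) P) i = 0" for i
    using assms by (simp add: rhom.coeff[OF rhom.rhom_ev] same_rel_def polys_over_def)
  show "degree (map_poly (ev h1 u) P) = degree (map_poly (ev h2 v) P)"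
    by (rule degree_eq_if_same_support[OF *])
  show "map_poly (ev h1 u) P = 0 \<longleftrightarrow> map_poly (ev h2 v) P = 0"
    using * by (simp add: poly_eq_iff)
qed

text \<open>\<open>P0\<close> evaluates to a minimal polynomial of \<open>y\<close>. Pseudo-division
  by it is an identity between polynomials in the generators, so it can be evaluated on both sides;
  the remainder vanishes on the first side, hence on the second.\<close>

lemma same_rel_half:
  fixes h1 :: "'k::comm_ring_1 \<Rightarrow> 'a::field" and h2 :: "'k \<Rightarrow> 'b::field"
  assumes h: "rhom h1" "rhom h2" and rel: "same_rel h1 h2 n u v"
    and P0: "P0 \<in> polys_over (mpols UNIV n)" "map_poly (ev h1 u) P0 \<noteq> 0"
    and minimal: "\<And>P. P \<in> polys_over (mpols UNIV n) \<Longrightarrow> map_poly (ev h1 u) P \<noteq> 0 \<Longrightarrow>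
      poly (map_poly (ev h1 u) P) y = 0 \<Longrightarrow> degree (map_poly (ev h1 u) P0) \<le> degree (map_poly (ev h1 u) P)"
    and roots: "poly (map_poly (ev h1 u) P0) y = 0" "poly (map_poly (ev h2 v) P0) z = 0"
    and P: "P \<in> polys_over (mpols UNIV n)" "poly (map_poly (ev h1 u) P) y = 0"
  shows "poly (map_poly (ev h2 v) P) z = 0"
proof -
  interpret e1: rhom "ev h1 u" by (rule rhom.rhom_ev[OF h(1)])
  interpret e2: rhom "ev h2 v" by (rule rhom.rhom_ev[OF h(2)])
  have M: "is_subring (mpols (UNIV :: 'k set) n)" by (rule is_subring_mpols) simp
  define D where "D = degree (map_poly (ev h1 u) P0)"
  \<comment> \<open>High coefficients of \<open>P0\<close> may be nonzero polynomials with value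
    zero; \<open>G\<close> drops them, so that its leading coefficient has a nonzero value on both
    sides.\<close>
  define G where "G = (\<Sum>i\<le>D. monom (coeff P0 i) i)"
  have cG: "coeff G i = (if i \<le> D then coeff P0 i else 0)" for i
    by (simp add: G_def coeff_sum coeff_monom)
  have GS: "G \<in> polys_over (mpols UNIV n)"
    using P0(1) is_subringD(1)[OF M] by (simp add: polys_over_def cG)
  have big: "ev h1 u (coeff P0 i) = 0" "ev h2 v (coeff P0 i) = 0" if "i > D" for i
  proof -
    show "ev h1 u (coeff P0 i) = 0" using that coeff_eq_0[of "map_poly (ev h1 u) P0" i] by (simp add: D_def)
    thus "ev h2 v (coeff P0 i) = 0" using rel P0(1) by (simp add: same_rel_def polys_over_def)
  qed
  have e1G: "map_poly (ev h1 u) G = map_poly (ev h1 u) P0"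
    by (rule poly_eqI) (auto simp: cG big not_le)
  have e2G: "map_poly (ev h2 v) G = map_poly (ev h2 v) P0"
    by (rule poly_eqI) (auto simp: cG big not_le)
  have lc: "ev h1 u (coeff P0 D) \<noteq> 0"
    using P0(2) leading_coeff_neq_0[of "map_poly (ev h1 u) P0"] by (simp add: D_def)
  have dG: "degree G = D"
    by (rule antisym[OF degree_le le_degree]) (use lc in \<open>auto simp: cG\<close>)
  have Gpos: "0 < degree G \<or> coeff G 0 \<noteq> 0" using lc dG by (cases "D = 0") (auto simp: cG)
  obtain N q r where qr: "q \<in> polys_over (mpols UNIV n)" "r \<in> polys_over (mpols UNIV n)"
    "smult (lead_coeff G ^ N) P = G * q + r" "r = 0 \<or> degree r < degree G"
    using pseudo_division[OF M GS Gpos P(1)] by blast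
  have dr: "r = 0 \<or> degree (map_poly (ev h1 u) r) < D"
    using qr(4) dG le_less_trans[OF map_poly_degree_leq[of "ev h1 u" r]] by auto
  have eqs: "smult (ev h1 u (lead_coeff G) ^ N) (map_poly (ev h1 u) P) =
      map_poly (ev h1 u) P0 * map_poly (ev h1 u) q + map_poly (ev h1 u) r"
    "smult (ev h2 v (lead_coeff G) ^ N) (map_poly (ev h2 v) P) =
      map_poly (ev h2 v) P0 * map_poly (ev h2 v) q + map_poly (ev h2 v) r"
    using arg_cong[OF qr(3), of "map_poly (ev h1 u)"] arg_cong[OF qr(3), of "map_poly (ev h2 v)"]
    by (simp_all add: e1G e2G)
  have "poly (map_poly (ev h1 u) r) y = 0"
    using arg_cong[OF eqs(1), of "\<lambda>p. poly p y"] P(2) roots(1) by simp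
  hence "map_poly (ev h1 u) r = 0"
    using minimal[OF qr(2)] dr by (fastforce simp: D_def)
  hence "map_poly (ev h2 v) r = 0" using same_rel_coeffs(3)[OF h rel qr(2)] by simp
  hence "ev h2 v (lead_coeff G) ^ N * poly (map_poly (ev h2 v) P) z = 0"
    using arg_cong[OF eqs(2), of "\<lambda>p. poly p z"] roots(2) by simp
  moreover have "ev h2 v (lead_coeff G) \<noteq> 0"
    using lc rel P0(1) by (simp add: dG cG same_rel_def polys_over_def)
  ultimately show ?thesis by simp
qed

text \<open>The element \<open>z\<close> is a root of the transported minimal relation
  \<open>P0\<close> of \<open>u n\<close>, so relations of \<open>u n\<close> pass to
  \<open>z\<close>. For the converse, a minimal relation \<open>P1\<close> of \<open>z\<close> is
  shown to hold for \<open>u n\<close>.\<close>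

lemma same_rel_step:
  fixes h1 :: "'k::comm_ring_1 \<Rightarrow> 'a::field" and v :: "nat \<Rightarrow> 'b::alg_closed_field"
  assumes h: "rhom h1" "rhom h2" and rel: "same_rel h1 h2 n u v"
    and alg: "Q \<in> polys_over (mpols UNIV n)" "map_poly (ev h1 u) Q \<noteq> 0" "poly (map_poly (ev h1 u) Q) (u n) = 0"
  obtains z where "same_rel h1 h2 (Suc n) u (v(n := z))"
proof -
  let ?S = "polys_over (mpols UNIV n)"
  let ?E1 = "map_poly (ev h1 u)" and ?E2 = "map_poly (ev h2 v)"
  interpret e1: rhom "ev h1 u" by (rule rhom.rhom_ev[OF h(1)])
  interpret e2: rhom "ev h2 v" by (rule rhom.rhom_ev[OF h(2)])
  have M: "is_subring (mpols (UNIV :: 'k set) n)" by (rule is_subring_mpols) simp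
  let ?P = "\<lambda>P. P \<in> ?S \<and> ?E1 P \<noteq> 0 \<and> poly (?E1 P) (u n) = 0"
  obtain P0 where P0: "?P P0" and min0: "\<And>P. ?P P \<Longrightarrow> degree (?E1 P0) \<le> degree (?E1 P)"
    using ex_has_least_nat[of ?P Q "\<lambda>P. degree (?E1 P)"] alg by blast
  have P0S: "P0 \<in> ?S" using P0 by blast
  have pos: "0 < degree (?E1 P0)"
    using P0 by (metis degree_eq_zeroE gr0I pCons_0_0 poly_const_conv)
  then obtain z where z: "poly (?E2 P0) z = 0"
    using alg_closed_imp_poly_has_root[of "?E2 P0"] same_rel_coeffs(2)[OF h rel P0S] by auto
  let ?P2 = "\<lambda>P. P \<in> ?S \<and> ?E2 P \<noteq> 0 \<and> poly (?E2 P) z = 0"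
  have "?P2 P0" using P0 z same_rel_coeffs(3)[OF h rel P0S] by simp
  then obtain P1 where P1: "?P2 P1" and min1: "\<And>P. ?P2 P \<Longrightarrow> degree (?E2 P1) \<le> degree (?E2 P)"
    using ex_has_least_nat[of ?P2 P0 "\<lambda>P. degree (?E2 P)"] by blast
  have P1S: "P1 \<in> ?S" using P1 by blast
  have fwd: "poly (?E2 P) z = 0" if "P \<in> ?S" "poly (?E1 P) (u n) = 0" for P
    by (rule same_rel_half[OF h rel P0S _ _ _ z that]) (use P0 min0 in auto)
  \<comment> \<open>Otherwise \<open>P0\<close> would be a product with factor \<open>P1\<close> on
    the side of \<open>u\<close>, up to a constant, and the cofactor \<open>q\<close> would be a
    relation of \<open>u n\<close> of smaller degree.\<close>
  have y1: "poly (?E1 P1) (u n) = 0"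
  proof (rule ccontr)
    assume n0: "poly (?E1 P1) (u n) \<noteq> 0"
    define D where "D = degree (?E2 P1)"
    have D1: "degree (?E1 P1) = D" using same_rel_coeffs(2)[OF h rel P1S] by (simp add: D_def)
    have Dpos: "0 < D" using P1 unfolding D_def by (metis degree_eq_zeroE gr0I pCons_0_0 poly_const_conv)
    define G where "G = (\<Sum>i\<le>D. monom (coeff P1 i) i)"
    have cG: "coeff G i = (if i \<le> D then coeff P1 i else 0)" for i
      by (simp add: G_def coeff_sum coeff_monom)
    have GS: "G \<in> ?S" using P1S is_subringD(1)[OF M] by (simp add: polys_over_def cG)
    have big: "ev h1 u (coeff P1 i) = 0" "ev h2 v (coeff P1 i) = 0" if "i > D" for i
      using that coeff_eq_0[of "?E1 P1" i] coeff_eq_0[of "?E2 P1" i] D1 by (simp_all add: D_def)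
    have e1G: "?E1 G = ?E1 P1" by (rule poly_eqI) (auto simp: cG big not_le)
    have e2G: "?E2 G = ?E2 P1" by (rule poly_eqI) (auto simp: cG big not_le)
    have lc: "ev h2 v (coeff P1 D) \<noteq> 0" "ev h1 u (coeff P1 D) \<noteq> 0"
      using P1 leading_coeff_neq_0[of "?E2 P1"] rel by (auto simp: D_def same_rel_def polys_over_def)
    have dG: "degree G = D"
      by (rule antisym[OF degree_le le_degree]) (use lc in \<open>auto simp: cG\<close>)
    have "0 < degree G \<or> coeff G 0 \<noteq> 0" using Dpos dG by simp
    then obtain N q r where qr: "q \<in> ?S" "r \<in> ?S" "smult (lead_coeff G ^ N) P0 = G * q + r" "r = 0 \<or> degree r < degree G"
      using pseudo_division[OF M GS _ P0S] by blast
    have eqs: "smult (ev h1 u (lead_coeff G) ^ N) (?E1 P0) = ?E1 P1 * ?E1 q + ?E1 r"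
      "smult (ev h2 v (lead_coeff G) ^ N) (?E2 P0) = ?E2 P1 * ?E2 q + ?E2 r"
      using arg_cong[OF qr(3), of ?E1] arg_cong[OF qr(3), of ?E2] by (simp_all add: e1G e2G)
    have "poly (?E2 r) z = 0"
      using arg_cong[OF eqs(2), of "\<lambda>p. poly p z"] P1 z by simp
    moreover have "r = 0 \<or> degree (?E2 r) < D"
      using qr(4) dG le_less_trans[OF map_poly_degree_leq[of "ev h2 v" r]] by auto
    ultimately have "?E2 r = 0" using min1[of r] qr(2) by (fastforce simp: D_def)
    hence r1: "?E1 r = 0" using same_rel_coeffs(3)[OF h rel qr(2)] by simp
    have lcG: "ev h1 u (lead_coeff G) ^ N \<noteq> 0" using lc(2) by (simp add: dG cG)
    have root: "poly (?E1 q) (u n) = 0"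
      using arg_cong[OF eqs(1), of "\<lambda>p. poly p (u n)"] P0 n0 r1 by simp
    have prod: "smult (ev h1 u (lead_coeff G) ^ N) (?E1 P0) = ?E1 P1 * ?E1 q" using eqs(1) r1 by simp
    hence "?E1 P1 * ?E1 q \<noteq> 0" using P0 lcG by (metis smult_eq_0_iff)
    hence nz: "?E1 P1 \<noteq> 0" "?E1 q \<noteq> 0" by auto
    have "degree (?E1 P0) = degree (?E1 P1) + degree (?E1 q)"
      using degree_mult_eq[OF nz] degree_smult_eq lcG prod by metis
    thus False using min0[of q] qr(1) D1 Dpos root nz by simp
  qed
  have bwd: "poly (?E1 P) (u n) = 0" if "P \<in> ?S" "poly (?E2 P) z = 0" for P
    by (rule same_rel_half[OF h(2,1) same_rel_sym[OF rel] P1S _ _ _ y1 that]) (use P1 min1 in auto)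
  have "same_rel h1 h2 (Suc n) u (v(n := z))"
    unfolding same_rel_def
  proof
    fix p :: "'k mpol" assume "p \<in> mpols UNIV (Suc n)"
    then obtain P where P: "P \<in> ?S" "p = poly P (Var n)" using mpols_Suc[OF _ is_subring_UNIV] by blast
    have "map_poly (ev h2 (v(n := z))) P = ?E2 P"
    proof (rule poly_eqI)
      fix i
      have "ev h2 (v(n := z)) (coeff P i) = ev h2 v (coeff P i)"
        by (rule ev_cong[of _ n]) (use P in \<open>auto simp: polys_over_def\<close>)
      thus "coeff (map_poly (ev h2 (v(n := z))) P) i = coeff (?E2 P) i"
        by (simp add: rhom.coeff[OF rhom.rhom_ev[OF h(2)]])
    qed
    hence "ev h2 (v(n := z)) p = poly (?E2 P) z" "ev h1 u p = poly (?E1 P) (u n)"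
      using P h by (simp_all add: ev_poly rhom.ev_Var)
    thus "ev h1 u p = 0 \<longleftrightarrow> ev h2 (v(n := z)) p = 0" using fwd[OF P(1)] bwd[OF P(1)] by auto
  qed
  thus ?thesis by (rule that)
qed

text \<open>The extension theorem for embeddings of algebraic extensions into an algebraically
  closed field, in the language of relations. Each step clears denominators and pulls the
  coefficients back to the base type.\<close>

lemma same_rel_extend:
  fixes u :: "nat \<Rightarrow> 'a::field" and v :: "nat \<Rightarrow> 'b::alg_closed_field" and h1 :: "'k::field \<Rightarrow> 'a"
  assumes h: "rhom h1" "rhom h2" and rel: "same_rel h1 h2 n u v" and "n \<le> N"
    and alg: "\<And>i. n \<le> i \<Longrightarrow> i < N \<Longrightarrow> alg_over (gen_field (range h1) n u) (u i)"
  shows "\<exists>v'. (\<forall>i<n. v' i = v i) \<and> same_rel h1 h2 N u v'"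
  using \<open>n \<le> N\<close> alg
proof (induction N rule: dec_induct)
  case base
  thus ?case using rel by blast
next
  case (step N)
  then obtain v' where v': "\<forall>i<n. v' i = v i" "same_rel h1 h2 N u v'" by fastforce
  have "alg_over (gen_field (range h1) n u) (u N)" using step by simp
  then obtain P where P: "P \<in> polys_over (mpols (range h1) n)" "map_poly (eval_mpol u) P \<noteq> 0"
    "poly (map_poly (eval_mpol u) P) (u N) = 0"
    using alg_over_gen_fieldE[OF is_subfield_range[OF h(1)]] by blast
  have "\<exists>q. q \<in> mpols UNIV n \<and> coeff P i = mapc h1 q" for i
    using mpols_range[OF h(1), of "coeff P i" n] P(1) unfolding polys_over_def by blast
  then obtain q where q: "\<And>i. q i \<in> mpols UNIV n" "\<And>i. coeff P i = mapc h1 (q i)" by metis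
  define Q where "Q = (\<Sum>i\<le>degree P. monom (q i) i)"
  have cQ: "coeff Q i = (if i \<le> degree P then q i else 0)" for i
    by (simp add: Q_def coeff_sum coeff_monom)
  have "map_poly (ev h1 u) Q = map_poly (eval_mpol u) P"
  proof (rule poly_eqI)
    fix i
    have "ev h1 u (q i) = eval_mpol u (coeff P i)"
      by (simp add: q(2) eval_mpol_ev(2) ev_mapc[OF rhom_id(2) h(1)])
    thus "coeff (map_poly (ev h1 u) Q) i = coeff (map_poly (eval_mpol u) P) i"
      unfolding eval_mpol_ev[abs_def] rhom.coeff[OF rhom.rhom_ev[OF h(1)]] rhom.coeff[OF rhom.rhom_ev[OF rhom_id(1)]]
      by (simp add: cQ coeff_eq_0 rhom.zero[OF rhom.rhom_ev[OF h(1)]] rhom.zero[OF rhom.rhom_ev[OF rhom_id(1)]])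
  qed
  moreover have "Q \<in> polys_over (mpols UNIV N)"
    using q(1) mpols_mono[of UNIV UNIV n N] step(1) is_subringD(1)[OF is_subring_mpols[OF is_subring_UNIV]]
    by (auto simp: polys_over_def cQ)
  ultimately obtain z where z: "same_rel h1 h2 (Suc N) u (v'(N := z))"
    using same_rel_step[OF h v'(2), of Q] P by metis
  show ?case using v'(1) step(1) z by (intro exI[of _ "v'(N := z)"]) (auto simp del: fun_upd_apply simp add: fun_upd_other)
qed

subsection \<open>The splitting algebra of a polynomial\<close>

definition is_ideal :: "'r::comm_ring_1 set \<Rightarrow> bool" where
  "is_ideal J \<longleftrightarrow> 0 \<in> J \<and> (\<forall>x\<in>J. \<forall>y\<in>J. x + y \<in> J) \<and> (\<forall>x\<in>J. \<forall>r. r * x \<in> J)"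

lemma is_idealD:
  assumes "is_ideal J"
  shows "0 \<in> J" "x \<in> J \<Longrightarrow> y \<in> J \<Longrightarrow> x + y \<in> J" "x \<in> J \<Longrightarrow> r * x \<in> J" "x \<in> J \<Longrightarrow> x * r \<in> J"
    "x \<in> J \<Longrightarrow> - x \<in> J" "x \<in> J \<Longrightarrow> y \<in> J \<Longrightarrow> x - y \<in> J"
proof -
  show *: "0 \<in> J" "x \<in> J \<Longrightarrow> y \<in> J \<Longrightarrow> x + y \<in> J" "x \<in> J \<Longrightarrow> r * x \<in> J" "x \<in> J \<Longrightarrow> x * r \<in> J" for x y r
    using assms by (auto simp: is_ideal_def mult.commute[of _ r])
  show **: "x \<in> J \<Longrightarrow> - x \<in> J" for x using *(3)[of x "- 1"] by simp
  show "x \<in> J \<Longrightarrow> y \<in> J \<Longrightarrow> x - y \<in> J" using *(2)[of x "- y"] ** by simp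
qed

lemma is_ideal_sum: "is_ideal J \<Longrightarrow> (\<And>i. i \<in> A \<Longrightarrow> f i \<in> J) \<Longrightarrow> sum f A \<in> J"
  by (induction A rule: infinite_finite_induct) (auto intro: is_idealD)

text \<open>Congruences modulo \<open>J\<close> replace a quotient ring. Since the root differences
  are invertible modulo \<open>J\<close>, linear factors split off as over a domain, and the roots
  stay distinct under every homomorphism into a domain that kills \<open>J\<close>.\<close>

locale splitting =
  fixes R0 J :: "'r::comm_ring_1 set" and f :: "'r poly" and Z :: "nat \<Rightarrow> 'r" and n :: nat
  assumes R0: "is_subring R0" and J: "is_ideal J"
    and f: "f \<in> polys_over R0" "lead_coeff f = 1" "degree f = n"
    and roots: "k < n \<Longrightarrow> poly f (Z k) \<in> J"
    and units: "i < n \<Longrightarrow> k < n \<Longrightarrow> i \<noteq> k \<Longrightarrow> \<exists>w. w * (Z i - Z k) - 1 \<in> J"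
begin

text \<open>The ring generated by \<open>R0\<close>, \<open>J\<close> and the first \<open>k\<close>
  roots, in the triangular normal form of the splitting algebra: the exponent of \<open>Z k\<close>
  stays below \<open>n - k\<close>, the degree of \<open>g k\<close>.\<close>

fun S :: "nat \<Rightarrow> 'r set" where
  "S 0 = {r + j | r j. r \<in> R0 \<and> j \<in> J}"
| "S (Suc k) = {\<Sum>i<n - k. F i * Z k ^ i | F. \<forall>i. F i \<in> S k}"

text \<open>The quotient of \<open>f\<close> by the first \<open>k\<close> linear factors; the
  remainders are dropped because they lie in \<open>J\<close>.\<close>

fun g :: "nat \<Rightarrow> 'r poly" where
  "g 0 = f"
| "g (Suc k) = synthetic_div (g k) (Z k)"

lemma g_monic: "k \<le> n \<Longrightarrow> degree (g k) = n - k \<and> lead_coeff (g k) = 1"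
proof (induction k)
  case (Suc k)
  let ?q = "synthetic_div (g k) (Z k)"
  have d: "degree ?q = n - Suc k" using Suc by (simp add: degree_synthetic_div)
  have "coeff (g k + smult (Z k) ?q) (n - k) = coeff (pCons (poly (g k) (Z k)) ?q) (n - k)"
    by (simp only: synthetic_div_correct)
  moreover have "n - k = Suc (n - Suc k)" using Suc.prems by simp
  ultimately have c: "coeff (g k) (n - k) = coeff ?q (n - Suc k)"
    using d by (simp add: coeff_eq_0)
  have "degree (g k) = n - k" "lead_coeff (g k) = 1" using Suc by auto
  hence "coeff (g k) (n - k) = 1" by simp
  thus ?case using c d by simp
qed (use f in auto)

text \<open>After division by X - Z_k, the new value at Z_m multiplied by Z_m - Z_k lies in
  \<open>J\<close>, and this factor is a unit modulo \<open>J\<close>.\<close>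

lemma g_roots: "k \<le> m \<Longrightarrow> m < n \<Longrightarrow> poly (g k) (Z m) \<in> J"
proof (induction k arbitrary: m)
  case (Suc k)
  have "poly ([:- Z k, 1:] * g (Suc k) + [:poly (g k) (Z k):]) (Z m) = poly (g k) (Z m)"
    by (simp only: g.simps synthetic_div_correct')
  hence "(Z m - Z k) * poly (g (Suc k)) (Z m) = poly (g k) (Z m) - poly (g k) (Z k)"
    by (simp add: algebra_simps)
  also have "\<dots> \<in> J" using Suc by (intro is_idealD[OF J]) auto
  finally have 1: "(Z m - Z k) * poly (g (Suc k)) (Z m) \<in> J" .
  obtain w where w: "w * (Z m - Z k) - 1 \<in> J" using units[of m k] Suc.prems by auto
  have "poly (g (Suc k)) (Z m) = w * ((Z m - Z k) * poly (g (Suc k)) (Z m))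
      - (w * (Z m - Z k) - 1) * poly (g (Suc k)) (Z m)" by (simp add: algebra_simps)
  also have "\<dots> \<in> J" by (rule is_idealD(6)[OF J is_idealD(3)[OF J 1] is_idealD(4)[OF J w]])
  finally show ?case .
qed (simp add: roots)

lemma synthetic_div_over:
  assumes "is_subring T" "p \<in> polys_over T" "c \<in> T"
  shows "synthetic_div p c \<in> polys_over T"
  using assms(2)
proof (induction p)
  case (pCons a p)
  hence "p \<in> polys_over T" by simp
  hence "poly p c \<in> T" by (intro is_subring_poly[OF assms(1) _ assms(3)]) (simp add: polys_over_def)
  thus ?case using pCons by simp
qed (simp add: zero_in_polys_over assms)

lemma J_S: "j \<in> J \<Longrightarrow> k \<le> n \<Longrightarrow> j \<in> S k"
  and R0_S: "r \<in> R0 \<Longrightarrow> k \<le> n \<Longrightarrow> r \<in> S k"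
proof -
  have "x \<in> S k" if "x \<in> S 0" "k \<le> n" for x
    using that(2)
  proof (induction k)
    case (Suc k)
    have 0: "0 \<in> S m" if "m \<le> n" for m
    proof (cases m)
      case 0
      thus ?thesis using is_subringD(1)[OF R0] is_idealD(1)[OF J] by auto (metis add.left_neutral)
    next
      case (Suc l)
      have "0 \<in> S l" if "l \<le> n"
        using that
      proof (induction l)
        case 0
        show ?case using is_subringD(1)[OF R0] is_idealD(1)[OF J] by auto (metis add.left_neutral)
      next
        case (Suc l)
        thus ?case by (auto intro!: exI[of _ "\<lambda>_. 0"])
      qed
      thus ?thesis using Suc that by (auto intro!: exI[of _ "\<lambda>_. 0"])
    qed
    have "x = (\<Sum>i<n - k. (if i = 0 then x else 0) * Z k ^ i)"
    proof -
      have "(\<Sum>i<n - k. (if i = 0 then x else 0) * Z k ^ i) = (\<Sum>i<n - k. if i = 0 then x else 0)"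
        by (intro sum.cong) auto
      thus ?thesis using Suc.prems by simp
    qed
    thus ?case using Suc 0[of k] by (auto intro!: exI[of _ "\<lambda>i. if i = 0 then x else 0"])
  qed (use that in simp)
  moreover have "j \<in> S 0" if "j \<in> J" for j
    using that is_subringD(1)[OF R0] by auto (metis add.left_neutral)
  moreover have "r \<in> S 0" if "r \<in> R0" for r
    using that is_idealD(1)[OF J] by auto (metis add.right_neutral)
  ultimately show "j \<in> J \<Longrightarrow> k \<le> n \<Longrightarrow> j \<in> S k" "r \<in> R0 \<Longrightarrow> k \<le> n \<Longrightarrow> r \<in> S k" by blast+
qed

text \<open>Closure under multiplication is the point: \<open>Z k ^ (n - k)\<close> is rewritten
  with the monic \<open>g k\<close>, up to the value of \<open>g k\<close> at \<open>Z k\<close>,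
  which lies in \<open>J\<close> and hence in \<open>S k\<close>.\<close>

lemma S_Suc_ring:
  assumes k: "k < n" and Sk: "is_subring (S k)" and gk: "g k \<in> polys_over (S k)"
  shows "S k \<subseteq> S (Suc k)" "Z k \<in> S (Suc k)" "is_subring (S (Suc k))"
proof -
  note D = is_subringD[OF Sk]
  show sub: "S k \<subseteq> S (Suc k)"
  proof
    fix x assume x: "x \<in> S k"
    have "(\<Sum>i<n - k. (if i = 0 then x else 0) * Z k ^ i) = (\<Sum>i<n - k. if i = 0 then x else 0)"
      by (intro sum.cong) auto
    hence "x = (\<Sum>i<n - k. (if i = 0 then x else 0) * Z k ^ i)" using k by simp
    thus "x \<in> S (Suc k)" using x D(1) by (auto intro!: exI[of _ "\<lambda>i. if i = 0 then x else 0"])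
  qed
  have add: "x + y \<in> S (Suc k)" if xy: "x \<in> S (Suc k)" "y \<in> S (Suc k)" for x y
  proof -
    obtain F G where "\<forall>i. F i \<in> S k" "\<forall>i. G i \<in> S k" "x = (\<Sum>i<n - k. F i * Z k ^ i)" "y = (\<Sum>i<n - k. G i * Z k ^ i)"
      using xy by auto
    thus ?thesis using D(3) by (auto intro!: exI[of _ "\<lambda>i. F i + G i"] simp: sum.distrib distrib_right)
  qed
  have scal: "c * x \<in> S (Suc k)" if cx: "c \<in> S k" "x \<in> S (Suc k)" for c x
  proof -
    obtain F where "\<forall>i. F i \<in> S k" "x = (\<Sum>i<n - k. F i * Z k ^ i)" using cx by auto
    thus ?thesis using D(4) cx by (auto intro!: exI[of _ "\<lambda>i. c * F i"] simp: sum_distrib_left mult.assoc)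
  qed
  have Zmult: "Z k * x \<in> S (Suc k)" if x: "x \<in> S (Suc k)" for x
  proof -
    obtain F where F: "\<And>i. F i \<in> S k" "x = (\<Sum>i<n - k. F i * Z k ^ i)" using x by auto
    obtain m where m: "n - k = Suc m" using k by (metis Suc_diff_Suc)
    define c where "c i = coeff (g k) i" for i
    have c: "c i \<in> S k" for i using gk by (simp add: c_def polys_over_def)
    have gm: "degree (g k) = Suc m" "c (Suc m) = 1" using g_monic[of k] k m by (auto simp: c_def)
    define e where "e = poly (g k) (Z k)"
    have e: "e \<in> S k" using g_roots[of k k] k J_S[of e k] by (simp add: e_def)
    have "e = (\<Sum>i\<le>Suc m. c i * Z k ^ i)" by (simp add: e_def poly_altdef gm(1) c_def)
    hence top: "Z k ^ Suc m = e - (\<Sum>i<Suc m. c i * Z k ^ i)"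
      using gm(2) by (simp add: lessThan_Suc_atMost)
    define G where "G i = (if i = 0 then F m * e else F (i - 1)) - F m * c i" for i
    have "Z k * x = (\<Sum>i<Suc m. F i * Z k ^ Suc i)"
      unfolding F(2) m sum_distrib_left by (intro sum.cong) (auto simp: ac_simps)
    also have "\<dots> = (\<Sum>i<m. F i * Z k ^ Suc i) + F m * (e - (\<Sum>i<Suc m. c i * Z k ^ i))"
      unfolding top[symmetric] by simp
    also have "\<dots> = (\<Sum>i<Suc m. G i * Z k ^ i)"
    proof -
      have "(\<Sum>i<Suc m. G i * Z k ^ i) = (\<Sum>i<Suc m. (if i = 0 then F m * e else F (i - 1)) * Z k ^ i)
          - F m * (\<Sum>i<Suc m. c i * Z k ^ i)"
        by (simp add: G_def left_diff_distrib sum_subtractf sum_distrib_left mult.assoc del: sum.lessThan_Suc)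
      also have "(\<Sum>i<Suc m. (if i = 0 then F m * e else F (i - 1)) * Z k ^ i) = F m * e + (\<Sum>i<m. F i * Z k ^ Suc i)"
        by (subst sum.lessThan_Suc_shift) simp
      finally show ?thesis by (simp add: algebra_simps)
    qed
    finally have "Z k * x = (\<Sum>i<n - k. G i * Z k ^ i)" by (simp add: m)
    moreover have "G i \<in> S k" for i using F(1) c e D by (simp add: G_def)
    ultimately show ?thesis by auto
  qed
  have zero: "0 \<in> S (Suc k)" and one: "1 \<in> S (Suc k)" using sub D by blast+
  show Z: "Z k \<in> S (Suc k)" using Zmult[OF one] by simp
  have powm: "Z k ^ i * x \<in> S (Suc k)" if "x \<in> S (Suc k)" for i x
    using that by (induction i) (auto simp: mult.assoc simp del: S.simps intro: Zmult)
  have sums: "sum h A \<in> S (Suc k)" if "\<And>i. i \<in> A \<Longrightarrow> h i \<in> S (Suc k)" for h and A :: "nat set"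
    using that by (induction A rule: infinite_finite_induct) (auto simp del: S.simps intro: add zero)
  have mult: "x * y \<in> S (Suc k)" if xy: "x \<in> S (Suc k)" "y \<in> S (Suc k)" for x y
  proof -
    obtain F where F: "\<And>i. F i \<in> S k" "x = (\<Sum>i<n - k. F i * Z k ^ i)" using xy(1) by auto
    have "x * y = (\<Sum>i<n - k. F i * (Z k ^ i * y))" by (simp add: F(2) sum_distrib_right mult.assoc)
    also have "\<dots> \<in> S (Suc k)" by (intro sums scal F powm xy)
    finally show ?thesis .
  qed
  have "- x \<in> S (Suc k)" if "x \<in> S (Suc k)" for x
    using scal[OF _ that, of "- 1"] D(2,5) by simp
  thus "is_subring (S (Suc k))" unfolding is_subring_def using add mult zero one by blast
qed

lemma S_ring: "k \<le> n \<Longrightarrow> is_subring (S k) \<and> g k \<in> polys_over (S k)"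
proof (induction k)
  case 0
  have "is_subring (S 0)"
  proof -
    note D = is_subringD[OF R0] is_idealD[OF J]
    have "x + y \<in> S 0 \<and> x * y \<in> S 0 \<and> - x \<in> S 0" if xy: "x \<in> S 0" "y \<in> S 0" for x y
    proof -
      obtain r j r' j' where *: "x = r + j" "y = r' + j'" "r \<in> R0" "r' \<in> R0" "j \<in> J" "j' \<in> J" using xy by auto
      have "x + y = (r + r') + (j + j')" "x * y = r * r' + (r * j' + j * r' + j * j')" "- x = - r + - j"
        using * by (auto simp: algebra_simps)
      moreover have "r + r' \<in> R0" "r * r' \<in> R0" "- r \<in> R0" using * D by auto
      moreover have "j + j' \<in> J" "r * j' + j * r' + j * j' \<in> J" "- j \<in> J" using * by (auto intro: D)
      ultimately show ?thesis unfolding S.simps by blast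
    qed
    thus ?thesis unfolding is_subring_def
      using R0_S[of 0 0] R0_S[of 1 0] D(1,2) by (auto simp del: S.simps)
  qed
  moreover have "f \<in> polys_over (S 0)" using f(1) R0_S[of _ 0] by (auto simp: polys_over_def simp del: S.simps)
  ultimately show ?case by simp
next
  case (Suc k)
  hence IH: "is_subring (S k)" "g k \<in> polys_over (S k)" "k < n" by auto
  note R = S_Suc_ring[OF IH(3,1,2)]
  have "g k \<in> polys_over (S (Suc k))" using IH(2) R(1) unfolding polys_over_def by blast
  thus ?case using synthetic_div_over[OF R(3) _ R(2)] R(3) by (simp del: S.simps)
qed

lemma S_mono: "k \<le> m \<Longrightarrow> m \<le> n \<Longrightarrow> S k \<subseteq> S m"
proof (induction m rule: dec_induct)
  case (step m)
  thus ?case using S_Suc_ring(1)[of m] S_ring[of m] by auto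
qed simp

lemma Z_in_S: "k < n \<Longrightarrow> Z k \<in> S n"
  using S_Suc_ring(2)[of k] S_ring[of k] S_mono[of "Suc k" n] by auto

lemma S_values:
  assumes "rhom e" "rhom d" "\<And>j. j \<in> J \<Longrightarrow> e j = 0 \<and> d j = 0" "\<And>r. r \<in> R0 \<Longrightarrow> e r = d r"
    "\<And>i. i < k \<Longrightarrow> e (Z i) = d (Z i)" "F \<in> S k"
  shows "e F = d F"
  using assms(5,6)
proof (induction k arbitrary: F)
  case 0
  then obtain r j where "F = r + j" "r \<in> R0" "j \<in> J" by auto
  thus ?case using assms(1-4) by (simp add: rhom.add)
next
  case (Suc k)
  then obtain G where "\<And>i. G i \<in> S k" "F = (\<Sum>i<n - k. G i * Z k ^ i)" by auto
  thus ?case using Suc by (simp add: rhom.sum[OF assms(1)] rhom.sum[OF assms(2)] rhom.mult[OF assms(1)]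
        rhom.mult[OF assms(2)] rhom.power[OF assms(1)] rhom.power[OF assms(2)])
qed

text \<open>As a polynomial in \<open>Z\<^sub>k\<close>, \<open>F\<close> has degree less than \<open>n - k\<close>, but the transpositions of \<open>k\<close> and
  \<open>m \<ge> k\<close> give it \<open>n - k\<close> roots.\<close>

lemma in_ideal_if_vanishing:
  fixes E :: "('r \<Rightarrow> 'e::idom) set"
  assumes E: "\<And>e. e \<in> E \<Longrightarrow> rhom e" "\<And>e j. e \<in> E \<Longrightarrow> j \<in> J \<Longrightarrow> e j = 0"
    and swap: "\<And>e k m. e \<in> E \<Longrightarrow> k \<le> m \<Longrightarrow> m < n \<Longrightarrow> \<exists>d\<in>E. (\<forall>r\<in>R0. d r = e r) \<and>
      (\<forall>i<n. d (Z i) = e (Z (transpose k m i)))"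
    and base: "\<And>r. r \<in> R0 \<Longrightarrow> (\<And>e. e \<in> E \<Longrightarrow> e r = 0) \<Longrightarrow> r \<in> J"
    and F: "F \<in> S k" "k \<le> n" "\<And>e. e \<in> E \<Longrightarrow> e F = 0"
  shows "F \<in> J"
  using F
proof (induction k arbitrary: F)
  case 0
  then obtain r j where rj: "F = r + j" "r \<in> R0" "j \<in> J" by auto
  hence "r \<in> J" using base[OF rj(2)] 0(3) E by (fastforce simp: rhom.add)
  thus ?case using rj is_idealD(2)[OF J] by blast
next
  case (Suc k)
  then obtain G where G: "\<And>i. G i \<in> S k" "F = (\<Sum>i<n - k. G i * Z k ^ i)" by auto
  have "e (G i) = 0" if e: "e \<in> E" and i: "i < n - k" for e i
  proof -
    interpret rhom e using E(1)[OF e] .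
    define P where "P = (\<Sum>i<n - k. monom (e (G i)) i)"
    have cP: "coeff P i = (if i < n - k then e (G i) else 0)" for i
      by (simp add: P_def coeff_sum coeff_monom)
    have root: "poly P (e (Z m)) = 0" if m: "k \<le> m" "m < n" for m
    proof -
      obtain d where d: "d \<in> E" "\<And>r. r \<in> R0 \<Longrightarrow> d r = e r"
        "\<And>i. i < n \<Longrightarrow> d (Z i) = e (Z (transpose k m i))" using swap[OF e m] by blast
      interpret d: rhom d using E(1)[OF d(1)] .
      \<comment> \<open>The transposition of \<open>k\<close> and \<open>m\<close> fixes the earlier
        roots, so the coefficients, which lie in \<open>S k\<close>, keep their values while
        \<open>Z k\<close> takes the value of \<open>Z m\<close>.\<close>
      have "d (G i) = e (G i)" for i
      proof (rule S_values[OF E(1)[OF d(1)] E(1)[OF e] _ d(2) _ G(1)])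
        fix l assume "l < k"
        hence "transpose k m l = l" using m by (auto simp: transpose_def)
        thus "d (Z l) = e (Z l)" using d(3)[of l] \<open>l < k\<close> m by simp
      qed (use E e d in auto)
      moreover have "d (Z k) = e (Z m)" using d(3)[of k] m by simp
      moreover have "d F = 0" using Suc.prems d(1) by blast
      ultimately show ?thesis by (simp add: P_def poly_sum poly_monom G(2) d.sum)
    qed
    \<comment> \<open>A unit modulo \<open>J\<close> cannot map to zero, so these are different
      roots of \<open>P\<close>.\<close>
    have inj: "inj_on (\<lambda>m. e (Z m)) {k..<n}"
    proof (rule inj_onI, rule ccontr)
      fix a b assume ab: "a \<in> {k..<n}" "b \<in> {k..<n}" "e (Z a) = e (Z b)" "a \<noteq> b"
      then obtain w where "w * (Z a - Z b) - 1 \<in> J" using units[of a b] by auto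
      from E(2)[OF e this] show False using ab by simp
    qed
    have "P = 0"
    proof (rule ccontr)
      assume "P \<noteq> 0"
      have "card {k..<n} \<le> card {x. poly P x = 0}"
        using root \<open>P \<noteq> 0\<close> by (intro card_inj_on_le[OF inj] poly_roots_finite) auto
      also have "\<dots> \<le> degree P" using \<open>P \<noteq> 0\<close> by (rule card_poly_roots_bound)
      also have "\<dots> < n - k"
        using Suc.prems(2) by (intro degree_lessI) (auto simp: cP)
      finally show False by simp
    qed
    hence "coeff P i = 0" by simp
    thus ?thesis using i by (simp add: cP)
  qed
  hence "G i \<in> J" if "i < n - k" for i using Suc.IH[OF G(1)] Suc.prems(2) that by auto
  thus ?case unfolding G(2) by (intro is_ideal_sum[OF J] is_idealD(4)[OF J]) auto
qed

end

subsection \<open>A two-parameter family\<close>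

definition fam_poly :: "'a::field poly \<Rightarrow> 'a poly \<Rightarrow> 'a \<Rightarrow> 'a \<Rightarrow> 'a \<Rightarrow> 'a poly" where
  "fam_poly A b \<xi> t0 t1 = A + b * [:t0 - t1 * \<xi>, t1:]"

lemma poly_fam_poly: "poly (fam_poly A b \<xi> t0 t1) x = poly A x + poly b x * (t0 + t1 * (x - \<xi>))"
  by (simp add: fam_poly_def algebra_simps)

lemma map_poly_fam_poly:
  assumes "rhom h"
  shows "map_poly h (fam_poly A b \<xi> t0 t1) = fam_poly (map_poly h A) (map_poly h b) (h \<xi>) (h t0) (h t1)"
proof -
  interpret rhom h by fact
  show ?thesis by (simp add: fam_poly_def)
qed

text \<open>Separability and coprimality are stated as Bezout identities, which survive every map of
  fields. By \<open>deg_b\<close> the perturbation b (t_0 + t_1 (X - \<xi>)) does not reach the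
  leading term of A.\<close>

locale family =
  fixes A b g :: "'a::field poly" and \<xi> :: 'a and n :: nat
  assumes A_eq: "A = [:- \<xi>, 1:] ^ 2 * g" and g_monic: "lead_coeff g = 1" and deg_A: "degree A = n"
    and deg_b: "degree b + 1 < n"
    and g_sqf: "\<exists>u v. u * g + v * pderiv g = 1" and g_\<xi>: "poly g \<xi> \<noteq> 0"
    and cop: "\<exists>u v. u * A + v * b = 1"
begin

lemma A_monic: "lead_coeff A = 1"
  unfolding A_eq using g_monic by (simp add: lead_coeff_mult lead_coeff_power del: mult_pCons_left)

lemma deg_g: "n = degree g + 2"
proof -
  have "g \<noteq> 0" using g_monic by auto
  have "degree ([:- \<xi>, 1:] ^ 2 * g) = degree ([:- \<xi>, 1:] ^ 2) + degree g"
    by (rule degree_mult_eq) (use \<open>g \<noteq> 0\<close> in auto)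
  thus ?thesis using deg_A by (simp add: A_eq degree_linear_power)
qed

lemma b_\<xi>: "poly b \<xi> \<noteq> 0"
proof
  assume "poly b \<xi> = 0"
  obtain u v where "u * A + v * b = 1" using cop by blast
  hence "poly (u * A + v * b) \<xi> = 1" by simp
  thus False using \<open>poly b \<xi> = 0\<close> by (simp add: A_eq)
qed

lemma fam_monic: "degree (fam_poly A b \<xi> t0 t1) = n" "lead_coeff (fam_poly A b \<xi> t0 t1) = 1"
proof -
  have "degree (b * [:t0 - t1 * \<xi>, t1:]) \<le> degree b + 1"
    by (rule order.trans[OF degree_mult_le]) simp
  hence *: "degree (b * [:t0 - t1 * \<xi>, t1:]) < n" using deg_b by simp
  thus "degree (fam_poly A b \<xi> t0 t1) = n" "lead_coeff (fam_poly A b \<xi> t0 t1) = 1"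
    unfolding fam_poly_def using deg_A A_monic coeff_eq_0[OF *]
    by (auto simp: degree_add_eq_left simp del: mult_pCons_right)
qed

lemma family_map:
  fixes h :: "'a \<Rightarrow> 'c::field"
  assumes "rhom h"
  shows "family (map_poly h A) (map_poly h b) (map_poly h g) (h \<xi>) n"
proof -
  interpret rhom h by fact
  have m1: "map_poly h 1 = 1" by simp
  obtain u v u' v' where uv: "u * g + v * pderiv g = 1" "u' * A + v' * b = 1" using g_sqf cop by blast
  show ?thesis
  proof
    show "map_poly h A = [:- h \<xi>, 1:] ^ 2 * map_poly h g"
      unfolding A_eq by (simp del: mult_pCons_left)
    show "lead_coeff (map_poly h g) = 1" using g_monic by (simp add: degree_map_poly_rhom[OF assms])
    show "degree (map_poly h A) = n" "degree (map_poly h b) + 1 < n"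
      using deg_A deg_b by (simp_all add: degree_map_poly_rhom[OF assms])
    have "map_poly h u * map_poly h g + map_poly h v * pderiv (map_poly h g) = 1"
      using arg_cong[OF uv(1), of "map_poly h"] by (simp add: map_poly_pderiv[OF assms])
    thus "\<exists>u v. u * map_poly h g + v * pderiv (map_poly h g) = 1" by blast
    have "map_poly h u' * map_poly h A + map_poly h v' * map_poly h b = 1"
      using arg_cong[OF uv(2), of "map_poly h"] by simp
    thus "\<exists>u v. u * map_poly h A + v * map_poly h b = 1" by blast
    show "poly (map_poly h g) (h \<xi>) \<noteq> 0" using g_\<xi> by (simp add: rhom_eq_0_iff[OF assms])
  qed
qed

lemma b_nonzero_at_root:
  assumes "poly (fam_poly A b \<xi> t0 t1) x = 0"
  shows "poly b x \<noteq> 0"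
proof
  assume b0: "poly b x = 0"
  hence "poly A x = 0" using assms by (simp add: poly_fam_poly)
  obtain u v where "u * A + v * b = 1" using cop by blast
  hence "poly (u * A + v * b) x = 1" by simp
  thus False using b0 \<open>poly A x = 0\<close> by simp
qed

text \<open>At a root, the linear polynomial t_0 + t_1 (X - \<xi>) takes the value -A/b; two values
  determine it.\<close>

lemma roots_determine_parameters:
  assumes "poly (fam_poly A b \<xi> t0 t1) x = 0" "poly (fam_poly A b \<xi> t0 t1) y = 0" "x \<noteq> y"
  shows "t1 = (poly A y / poly b y - poly A x / poly b x) / (x - y)"
    "t0 = - (poly A x / poly b x) - t1 * (x - \<xi>)"
proof -
  have *: "t0 + t1 * (z - \<xi>) = - (poly A z / poly b z)" if "poly (fam_poly A b \<xi> t0 t1) z = 0" for z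
    using that b_nonzero_at_root[OF that] by (simp add: poly_fam_poly field_simps add_eq_0_iff)
  from *[OF assms(1)] show "t0 = - (poly A x / poly b x) - t1 * (x - \<xi>)" by (simp add: algebra_simps)
  have "t1 * (x - y) = poly A y / poly b y - poly A x / poly b x"
  proof -
    have "t1 * (x - y) = (t0 + t1 * (x - \<xi>)) - (t0 + t1 * (y - \<xi>))" by (simp add: algebra_simps)
    thus ?thesis by (simp add: *[OF assms(1)] *[OF assms(2)])
  qed
  thus "t1 = (poly A y / poly b y - poly A x / poly b x) / (x - y)" using assms(3) by (simp add: field_simps)
qed

end

text \<open>A transcendence degree argument: if x_0 and x_1 were dependent, both would be algebraic
  over the field generated by one of them, and so would t_0 and t_1.\<close>

lemma alg_indep_pair:
  fixes t x :: "nat \<Rightarrow> 'a::alg_closed_field"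
  assumes K: "is_subfield K" and ind: "alg_indep K 2 t"
    and t: "t 0 \<in> gen_field K 2 x" "t 1 \<in> gen_field K 2 x"
  shows "alg_indep K 2 x"
  unfolding alg_indep_def
proof (intro ballI impI, rule ccontr)
  note R = is_subfield_subring[OF K]
  have key: False if "alg_over (adj K z) (x 0)" "alg_over (adj K z) (x 1)" for z
  proof -
    note Z = adj_facts[OF K, where y = z]
    have "x i \<in> {y. alg_over (adj K z) y}" if "i < 2" for i
      using that \<open>alg_over (adj K z) (x 0)\<close> \<open>alg_over (adj K z) (x 1)\<close> by (auto simp: less_2_cases_iff)
    moreover have "K \<subseteq> {y. alg_over (adj K z) y}" using alg_over_self[OF Z(1)] Z(2) by blast
    ultimately have "gen_field K 2 x \<subseteq> {y. alg_over (adj K z) y}"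
      by (intro gen_field_subset[OF K is_subfield_algebraics[OF Z(1)]]) auto
    thus False using alg_indep_exchange[OF K ind, of z] t by blast
  qed
  fix p assume p: "p \<in> mpols K 2" "eval_mpol x p = 0" "p \<noteq> 0"
  then obtain P where P: "P \<in> polys_over (mpols K 1)" "p = poly P (Var 1)"
    using mpols_Suc[of p K 1] R by (auto simp: numeral_2_eq_2)
  have h: "rhom (eval_mpol y)" for y :: "nat \<Rightarrow> 'a"
    unfolding eval_mpol_ev[abs_def] by (rule rhom.rhom_ev[OF rhom_id(1)])
  define Q where "Q = map_poly (eval_mpol x) P"
  have cQ: "coeff Q i = eval_mpol x (coeff P i)" for i by (simp add: Q_def rhom.coeff[OF h])
  have root: "poly Q (x 1) = 0"
    using p(2) unfolding P(2) Q_def rhom.poly[OF h, symmetric]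
    by (simp add: eval_mpol_ev rhom.ev_Var[OF rhom_id(1)])
  show False
  \<comment> \<open>Either the relation survives the substitution of \<open>x 0\<close>, and
    \<open>x 1\<close> is algebraic over \<open>K(x 0)\<close>, or every coefficient vanishes there
    and \<open>x 0\<close> is algebraic over \<open>K\<close>.\<close>
  proof (cases "Q = 0")
    case False
    note Z = adj_facts[OF K, where y = "x 0"]
    have "coeff Q i \<in> adj K (x 0)" for i
      unfolding cQ eval_mpol_ev
      by (rule ev_in_subring[OF is_subfield_subring[OF Z(1)] _ rhom_id(1), of _ K 1])
        (use P(1) is_subringD(1)[OF R] Z(2,3) in \<open>auto simp: polys_over_def\<close>)
    hence "alg_over (adj K (x 0)) (x 1)" using False root by (auto simp: alg_over_def)
    thus False using key[of "x 0"] alg_over_self[OF Z(1,3)] by blast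
  next
    case True
    note Z = adj_facts[OF K, where y = "x 1"]
    have "P \<noteq> 0" using p(3) P(2) by auto
    then obtain l where l: "coeff P l \<noteq> 0" by (metis leading_coeff_0_iff)
    have cl: "coeff P l \<in> mpols K 1" using P(1) by (simp add: polys_over_def)
    obtain u where u: "u \<in> polys_over K" "\<And>y. eval_mpol y (coeff P l) = poly u (y 0)"
      using mpols_one[OF R cl] by blast
    have "u \<noteq> 0"
    proof
      assume "u = 0"
      hence "ev id y (coeff P l) = 0" for y using u(2)[of y] by (simp add: eval_mpol_ev(1))
      moreover have "coeff P l \<in> mpols UNIV 1" using cl mpols_mono[of K UNIV 1 1] by blast
      ultimately have "coeff P l = 0"
        using mpols_eq_0I[OF _ rhom_id(1) infinite_UNIV_alg_closed] by blast
      thus False using l by simp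
    qed
    moreover have "poly u (x 0) = 0" using cQ[of l] True u(2)[of x] by simp
    ultimately have "alg_over K (x 0)" using u(1) by (auto simp: alg_over_def polys_over_def)
    hence "alg_over (adj K (x 1)) (x 0)" by (rule alg_over_mono[OF Z(2)])
    thus False using key[of "x 1"] alg_over_self[OF Z(1,3)] by blast
  qed
qed

context family
begin

text \<open>At a double root \<open>x\<close> the equation and its derivative can be solved for t_1
  and t_0 inside \<open>K(x)\<close>, against their independence.\<close>

lemma fam_rsquarefree:
  fixes h :: "'a \<Rightarrow> 'c::alg_closed_field" and t :: "nat \<Rightarrow> 'c"
  assumes h: "rhom h" and K: "is_subfield K" "range h \<subseteq> K" and ind: "alg_indep K 2 t"
  shows "rsquarefree (fam_poly (map_poly h A) (map_poly h b) (h \<xi>) (t 0) (t 1))"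
proof -
  interpret H: family "map_poly h A" "map_poly h b" "map_poly h g" "h \<xi>" n by (rule family_map[OF h])
  let ?A = "map_poly h A" and ?b = "map_poly h b"
  let ?f = "fam_poly ?A ?b (h \<xi>) (t 0) (t 1)"
  show ?thesis unfolding rsquarefree_iff_no_double_root
  proof (intro conjI allI notI)
    show "?f = 0 \<Longrightarrow> False" using H.fam_monic(2)[of "t 0" "t 1"] by simp
    fix x assume x: "poly ?f x = 0 \<and> poly (pderiv ?f) x = 0"
    have b0: "poly ?b x \<noteq> 0" using H.b_nonzero_at_root x by blast
    define L where "L = adj K x"
    note Lf = adj_facts[OF K(1), where y = x, folded L_def]
    note D = is_subringD[OF is_subfield_subring[OF Lf(1)]] is_subfieldD[OF Lf(1)]
    have "h c \<in> L" for c using K(2) Lf(2) by blast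
    hence pL: "poly (map_poly h w) x \<in> L" for w
      by (intro is_subring_poly[OF is_subfield_subring[OF Lf(1)] _ Lf(3)]) (simp add: rhom.coeff[OF h])
    have dL: "poly (pderiv (map_poly h w)) x \<in> L" for w
      using pL[of "pderiv w"] by (simp add: map_poly_pderiv[OF h])
    define c where "c = t 0 + t 1 * (x - h \<xi>)"
    have c: "c = - (poly ?A x / poly ?b x)" using x b0 by (simp add: poly_fam_poly c_def field_simps add_eq_0_iff)
    have cL: "c \<in> L" unfolding c by (intro D pL)
    have "poly (pderiv ?f) x = poly (pderiv ?A) x + poly (pderiv ?b) x * c + poly ?b x * t 1"
      by (simp add: fam_poly_def pderiv_add pderiv_mult pderiv_pCons c_def algebra_simps del: mult_pCons_right)
    hence "t 1 = - (poly (pderiv ?A) x + poly (pderiv ?b) x * c) / poly ?b x"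
      using x b0 by (simp add: field_simps add_eq_0_iff)
    also have "\<dots> \<in> L" by (intro D pL dL cL)
    finally have t1: "t 1 \<in> L" .
    have "t 0 = c - t 1 * (x - h \<xi>)" by (simp add: c_def)
    also have "\<dots> \<in> L" using K(2) Lf(2,3) by (intro D cL t1) auto
    finally have t0: "t 0 \<in> L" .
    show False using alg_indep_exchange[OF K(1) ind, of x] alg_over_self[OF Lf(1)] t0 t1 by (simp add: L_def)
  qed
qed

end

lemma enumerate_roots:
  fixes f :: "'a::alg_closed_field poly"
  assumes "rsquarefree f" "lead_coeff f = 1"
  obtains z where "inj_on z {..<degree f}" "f = (\<Prod>i<degree f. [:- z i, 1:])" "\<And>x. poly f x = 0 \<longleftrightarrow> (\<exists>i<degree f. x = z i)"
proof -
  let ?Z = "{x. poly f x = 0}"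
  have fin: "finite ?Z" using assms(2) by (intro poly_roots_finite) auto
  have card: "card ?Z = degree f" by (rule rsquarefree_factorization(1)[OF assms(1)])
  obtain z where z: "bij_betw z {..<degree f} ?Z"
    using ex_bij_betw_nat_finite[OF fin] card by (auto simp: atLeast0LessThan)
  have "f = (\<Prod>x\<in>?Z. [:- x, 1:])" using rsquarefree_factorization(2)[OF assms(1)] assms(2) by simp
  also have "\<dots> = (\<Prod>i<degree f. [:- z i, 1:])" by (rule prod.reindex_bij_betw[OF z, symmetric])
  finally have "f = (\<Prod>i<degree f. [:- z i, 1:])" .
  moreover have "poly f x = 0 \<longleftrightarrow> (\<exists>i<degree f. x = z i)" for x
    using bij_betw_imp_surj_on[OF z] by (auto simp: image_iff set_eq_iff)
  ultimately show ?thesis using that bij_betw_imp_inj_on[OF z] by blast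
qed

lemma ev_hom:
  assumes "rhom h" "rhom k"
  shows "h (ev k x p) = ev (\<lambda>c. h (k c)) (\<lambda>i. h (x i)) p"
proof -
  interpret rhom h by fact
  show ?thesis by (simp add: ev_def sum prod)
qed

subsection \<open>Power series roots\<close>

lemma poly_taylor:
  fixes F :: "'a::idom poly"
  shows "\<exists>q. poly F (r + d) = poly F r + d * poly (pderiv F) r + d ^ 2 * q"
proof (induction F)
  case (pCons a F)
  then obtain q where q: "poly F (r + d) = poly F r + d * poly (pderiv F) r + d ^ 2 * q" by blast
  have "poly (pCons a F) (r + d) = a + (r + d) * (poly F r + d * poly (pderiv F) r + d ^ 2 * q)"
    by (simp add: q)
  also have "\<dots> = poly (pCons a F) r + d * poly (pderiv (pCons a F)) r +
      d ^ 2 * (poly (pderiv F) r + (r + d) * q)"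
    by (simp add: pderiv_pCons algebra_simps power2_eq_square)
  finally have "poly (pCons a F) (r + d) = poly (pCons a F) r + d * poly (pderiv (pCons a F)) r +
      d ^ 2 * (poly (pderiv F) r + (r + d) * q)" .
  thus ?case by blast
qed auto

lemma poly_diff_dvd:
  fixes F :: "'a::comm_ring_1 poly"
  shows "\<exists>q. poly F x - poly F y = (x - y) * q"
proof (induction F)
  case (pCons a F)
  then obtain q where "poly F x - poly F y = (x - y) * q" by blast
  hence "poly F x = poly F y + (x - y) * q" by (simp add: algebra_simps)
  have "poly (pCons a F) x - poly (pCons a F) y = x * poly F x - y * poly F y" by simp
  also have "\<dots> = (x - y) * (poly F y + x * q)"
    unfolding \<open>poly F x = _\<close> by (simp add: algebra_simps)
  finally have "poly (pCons a F) x - poly (pCons a F) y = (x - y) * (poly F y + x * q)" .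
  thus ?case by blast
qed (auto intro: exI[of _ 0])

lemma rhom_fps_nth_0: "rhom (\<lambda>f :: 'a::comm_ring_1 fps. fps_nth f 0)"
  by unfold_locales simp_all

text \<open>Hensel's lemma, one coefficient at a time: a correction of order m + 1 changes the
  coefficient m + 1 of the value by \<open>d0\<close> times the correction, and the quadratic Taylor
  term has higher order.\<close>

lemma fps_root_exists:
  fixes F :: "'a::field fps poly"
  assumes r0: "poly (map_poly (\<lambda>f. fps_nth f 0) F) r0 = 0" "poly (pderiv (map_poly (\<lambda>f. fps_nth f 0) F)) r0 \<noteq> 0"
  obtains r where "fps_nth r 0 = r0" "poly F r = 0"
proof -
  interpret c0: rhom "\<lambda>f :: 'a fps. fps_nth f 0" by (rule rhom_fps_nth_0)
  define d0 where "d0 = poly (pderiv (map_poly (\<lambda>f. fps_nth f 0) F)) r0"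
  have d0: "d0 \<noteq> 0" using r0 by (simp add: d0_def)
  have F0: "fps_nth (poly F r) 0 = 0" if "fps_nth r 0 = r0" for r
    using r0(1) that c0.poly[of F r] by simp
  have F'0: "fps_nth (poly (pderiv F) r) 0 = d0" if "fps_nth r 0 = r0" for r
    using that c0.poly[of "pderiv F" r] by (simp add: d0_def map_poly_pderiv[OF rhom_fps_nth_0])
  define stp where "stp m r = r + fps_const (- fps_nth (poly F r) (Suc m) / d0) * fps_X ^ Suc m" for m r
  define s where "s = rec_nat (fps_const r0) stp"
  have s0: "s 0 = fps_const r0" and sS: "s (Suc m) = stp m (s m)" for m by (simp_all add: s_def)
  have inv: "fps_nth (s m) 0 = r0 \<and> (\<forall>i\<le>m. fps_nth (poly F (s m)) i = 0)" for m
  proof (induction m)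
    case 0
    thus ?case using F0[of "s 0"] by (simp add: s0)
  next
    case (Suc m)
    define d where "d = fps_const (- fps_nth (poly F (s m)) (Suc m) / d0) * fps_X ^ Suc m"
    have sd: "s (Suc m) = s m + d" by (simp add: sS stp_def d_def)
    obtain q where q: "poly F (s m + d) = poly F (s m) + d * poly (pderiv F) (s m) + d ^ 2 * q"
      using poly_taylor by blast
    have "fps_nth d 0 = 0" by (simp add: d_def)
    moreover have nd: "fps_nth (d * w) i = (if i \<le> m then 0 else - fps_nth (poly F (s m)) (Suc m) / d0 * fps_nth w (i - Suc m))" for w i
      by (simp add: d_def mult.assoc fps_X_power_mult_nth del: power_Suc)
    have "fps_nth (d ^ 2 * q) i = 0" if "i \<le> Suc m" for i
      using that nd[of "d * q" i] \<open>fps_nth d 0 = 0\<close> by (auto simp: power2_eq_square mult.assoc)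
    moreover have "fps_nth (poly F (s m)) i + fps_nth (d * poly (pderiv F) (s m)) i = 0" if "i \<le> Suc m" for i
      using that Suc F'0[of "s m"] d0 by (auto simp: nd le_Suc_eq)
    ultimately show ?case using Suc by (simp add: sd q)
  qed
  have stab: "fps_nth (s m) i = fps_nth (s i) i" if "i \<le> m" for m i
    using that
  proof (induction m rule: dec_induct)
    case (step m)
    thus ?case by (simp add: sS stp_def del: power_Suc)
  qed simp
  \<comment> \<open>The diagonal of the approximations; \<open>r\<close> and \<open>s i\<close>
    agree up to order \<open>i\<close>, and so do their values under \<open>F\<close>.\<close>
  define r where "r = Abs_fps (\<lambda>i. fps_nth (s i) i)"
  have rn: "fps_nth r i = fps_nth (s m) i" if "i \<le> m" for i m using stab[OF that] by (simp add: r_def)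
  have "fps_nth (poly F r) i = 0" for i
  proof -
    obtain q where "poly F r - poly F (s i) = (r - s i) * q" using poly_diff_dvd by blast
    hence "fps_nth (poly F r) i - fps_nth (poly F (s i)) i = fps_nth ((r - s i) * q) i" by (simp flip: fps_sub_nth)
    also have "\<dots> = 0" unfolding fps_mult_nth using rn by (intro sum.neutral) auto
    finally show ?thesis using inv[of i] by simp
  qed
  hence "poly F r = 0" by (intro fps_ext) simp
  moreover have "fps_nth r 0 = r0" using inv[of 0] by (simp add: r_def)
  ultimately show ?thesis using that by blast
qed

text \<open>The Taylor expansion between two roots has the factor \<open>r' - r\<close>, and the
  cofactor has the nonzero constant term of the derivative at \<open>r\<close>.\<close>

lemma fps_root_unique:
  fixes F :: "'a::field fps poly"
  assumes "poly F r = 0" "poly F r' = 0" "fps_nth r 0 = fps_nth r' 0"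
    "poly (pderiv (map_poly (\<lambda>f. fps_nth f 0) F)) (fps_nth r 0) \<noteq> 0"
  shows "r = r'"
proof (rule ccontr)
  interpret c0: rhom "\<lambda>f :: 'a fps. fps_nth f 0" by (rule rhom_fps_nth_0)
  assume ne: "r \<noteq> r'"
  obtain q where "poly F (r + (r' - r)) = poly F r + (r' - r) * poly (pderiv F) r + (r' - r) ^ 2 * q"
    using poly_taylor by blast
  hence "(r' - r) * (poly (pderiv F) r + (r' - r) * q) = 0" using assms(1,2) by (simp add: algebra_simps power2_eq_square)
  hence "poly (pderiv F) r + (r' - r) * q = 0" using ne by simp
  hence "fps_nth (poly (pderiv F) r + (r' - r) * q) 0 = 0" by simp
  hence "fps_nth (poly (pderiv F) r) 0 = 0" using assms(3) by simp
  thus False using assms(4) c0.poly[of "pderiv F" r] by (simp add: map_poly_pderiv[OF rhom_fps_nth_0])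
qed

lemma rhom_fps_to_fls: "rhom (fps_to_fls :: 'a::field fps \<Rightarrow> 'a fls)"
  by unfold_locales (simp_all add: fls_times_fps_to_fls)

text \<open>Power series are integrally closed: if \<open>\<rho>\<close> had a pole, multiplying the
  equation by a power of the inverse of \<open>\<rho>\<close> would leave a power series with
  constant term 1.\<close>

lemma fls_integral_root:
  fixes F :: "'a::field fps poly"
  assumes F: "lead_coeff F = 1" and \<rho>: "poly (map_poly fps_to_fls F) \<rho> = 0"
  obtains r where "\<rho> = fps_to_fls r"
proof (cases "fls_subdegree \<rho> \<ge> 0")
  case True
  hence "\<rho> = fps_to_fls (fls_regpart \<rho>)" by simp
  thus ?thesis using that by blast
next
  case False
  interpret f: rhom "fps_to_fls :: 'a fps \<Rightarrow> 'a fls" by (rule rhom_fps_to_fls)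
  have nz: "\<rho> \<noteq> 0" using False by auto
  define \<sigma> where "\<sigma> = inverse \<rho>"
  have "fls_subdegree \<sigma> > 0" using False nz by (simp add: \<sigma>_def)
  define w where "w = fls_regpart \<sigma>"
  have w: "fps_to_fls w = \<sigma>" "fps_nth w 0 = 0" using \<open>fls_subdegree \<sigma> > 0\<close> by (simp_all add: w_def)
  let ?d = "degree F"
  have "0 = \<sigma> ^ ?d * poly (map_poly fps_to_fls F) \<rho>" using \<rho> by simp
  also have "\<dots> = (\<Sum>i\<le>?d. fps_to_fls (coeff F i) * \<sigma> ^ (?d - i))"
  proof -
    have d: "degree (map_poly fps_to_fls F) = ?d"
      using F by (intro degree_map_poly) auto
    have "\<sigma> ^ ?d * \<rho> ^ i = \<sigma> ^ (?d - i)" if "i \<le> ?d" for i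
    proof -
      have "\<sigma> ^ ?d = \<sigma> ^ (?d - i) * \<sigma> ^ i" using that by (simp flip: power_add)
      moreover have "\<sigma> ^ i * \<rho> ^ i = 1" using nz by (simp add: \<sigma>_def flip: power_mult_distrib)
      ultimately show ?thesis by (simp add: mult.assoc)
    qed
    thus ?thesis unfolding poly_altdef d sum_distrib_left
      by (intro sum.cong) (auto simp: mult.left_commute)
  qed
  also have "\<dots> = fps_to_fls (\<Sum>i\<le>?d. coeff F i * w ^ (?d - i))"
    by (simp add: f.sum w(1) del: f.mult f.power add: f.mult f.power)
  finally have "(\<Sum>i\<le>?d. coeff F i * w ^ (?d - i)) = 0" by simp
  hence "0 = fps_nth (\<Sum>i\<le>?d. coeff F i * w ^ (?d - i)) 0" by simp
  also have "\<dots> = (\<Sum>i\<le>?d. if i = ?d then 1 else 0)"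
    unfolding fps_sum_nth using F w(2) by (intro sum.cong) (auto simp: fps_power_zeroth)
  finally show ?thesis by simp
qed

subsection \<open>A field of Laurent series\<close>

text \<open>The parameters are specialised to \<open>T\<^sub>0 = \<pi>\<close>, \<open>T\<^sub>1 = s \<pi>\<close> in the algebraic closure of \<open>k(s)((\<pi>))\<close>,
  where the family degenerates at \<open>\<pi> = 0\<close> to a polynomial with a single double root.\<close>

type_synonym 'k laurent_dom = "'k poly fract fls alg_closure"

text \<open>The constants of k(s); the indeterminate s is \<open>to_fract [:0, 1:]\<close>.\<close>

definition cl :: "'k::field \<Rightarrow> 'k poly fract" where "cl c = to_fract [:c:]"

definition cps :: "'k::field \<Rightarrow> 'k poly fract fps" where "cps c = fps_const (cl c)"

definition iota :: "'k::field poly fract fps \<Rightarrow> 'k laurent_dom" where "iota f = to_ac (fps_to_fls f)"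

definition emb :: "'k::field \<Rightarrow> 'k laurent_dom" where "emb c = iota (cps c)"

definition pps :: "nat \<Rightarrow> 'k::field poly fract fps" where
  "pps i = (if i = 0 then fps_X else if i = 1 then fps_const (to_fract [:0, 1:]) * fps_X else 0)"

definition par :: "nat \<Rightarrow> 'k::field laurent_dom" where "par i = iota (pps i)"

lemma rhom_to_ac: "rhom (to_ac :: 'a::field \<Rightarrow> _)"
  by unfold_locales simp_all

lemma rhom_cl: "rhom cl"
proof
  fix x y :: 'a
  have "[:x + y:] = [:x:] + [:y:]" "[:x * y:] = [:x:] * [:y:]" by simp_all
  thus "cl (x + y) = cl x + cl y" "cl (x * y) = cl x * cl y" unfolding cl_def by (simp_all only: to_fract_add to_fract_mult)
  have "[:1 :: 'a:] = 1" by simp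
  thus "cl (1 :: 'a) = 1" unfolding cl_def by (simp only: to_fract_1)
qed (simp add: cl_def)

lemma rhom_cps: "rhom cps"
proof -
  interpret rhom cl by (rule rhom_cl)
  show ?thesis by unfold_locales (simp_all add: cps_def)
qed

lemma rhom_iota: "rhom iota"
  unfolding iota_def by (rule rhom_comp[OF rhom_to_ac rhom_fps_to_fls])

lemma iota_eq_iff [simp]: "iota f = iota g \<longleftrightarrow> f = g"
  by (simp add: iota_def)

lemma rhom_emb: "rhom emb"
  unfolding emb_def by (rule rhom_comp[OF rhom_iota rhom_cps])

text \<open>A monomial with exponents i and l specialises to s^l \<pi>^(i+l): the power of \<pi>
  gives the total degree and the power of s the second exponent, so each coefficient of
  \<open>p\<close> can be read off.\<close>

lemma par_indep:
  fixes p :: "'k::field mpol"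
  assumes p: "p \<in> mpols UNIV 2" "ev emb par p = 0"
  shows "p = 0"
proof (rule ccontr)
  assume "p \<noteq> 0"
  then obtain m where m: "m \<in> Poly_Mapping.keys p" by fastforce
  let ?l = "Poly_Mapping.lookup"
  have two: "{0::nat, 1} = {..<2}" by (auto simp: less_2_cases_iff)
  define N where "N = ?l m 0 + ?l m 1"
  have "iota (ev cps pps p) = ev emb par p"
    by (simp add: ev_hom[OF rhom_iota rhom_cps] emb_def[abs_def] par_def[abs_def])
  hence "iota (ev cps pps p) = iota 0" using p(2) by (simp only: rhom.zero[OF rhom_iota])
  hence "ev cps pps p = 0" by simp
  hence "0 = fps_nth (ev cps pps p) N" by simp
  also have "\<dots> = (\<Sum>m\<in>Poly_Mapping.keys p. if ?l m 0 + ?l m 1 = N then to_fract (monom (?l p m) (?l m 1)) else 0)"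
    unfolding ev_def fps_sum_nth
  proof (intro sum.cong refl)
    fix m assume "m \<in> Poly_Mapping.keys p"
    hence sub: "Poly_Mapping.keys m \<subseteq> {0, 1}" using p(1) unfolding two by (auto simp: mpols_def)
    have "(\<Prod>i\<in>Poly_Mapping.keys m. pps i ^ ?l m i) = (\<Prod>i\<in>{0, 1}. (pps i :: 'k poly fract fps) ^ ?l m i)"
      using sub by (intro prod.mono_neutral_left) (auto simp: in_keys_iff)
    also have "\<dots> = fps_const (to_fract [:0, 1:] ^ ?l m 1) * fps_X ^ (?l m 0 + ?l m 1)"
      by (simp add: pps_def power_mult_distrib power_add fps_const_power mult_ac)
    finally have "cps (?l p m) * (\<Prod>i\<in>Poly_Mapping.keys m. pps i ^ ?l m i) =
        fps_const (cl (?l p m) * to_fract [:0, 1:] ^ ?l m 1) * fps_X ^ (?l m 0 + ?l m 1)"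
      by (simp add: cps_def flip: fps_const_mult mult.assoc)
    moreover have "cl c * to_fract [:0, 1:] ^ k = to_fract (monom c k)" for c :: 'k and k
    proof (induction k)
      case (Suc k)
      have "cl c * to_fract [:0, 1:] ^ Suc k = to_fract [:0, 1:] * to_fract (monom c k)"
        using Suc by (simp add: mult_ac)
      also have "\<dots> = to_fract ([:0, 1:] * monom c k)" by (rule to_fract_mult[symmetric])
      also have "[:0, 1:] * monom c k = monom c (Suc k)" by (simp add: monom_Suc)
      finally show ?case .
    qed (simp add: cl_def monom_0)
    ultimately show "fps_nth (cps (?l p m) * (\<Prod>i\<in>Poly_Mapping.keys m. pps i ^ ?l m i)) N =
        (if ?l m 0 + ?l m 1 = N then to_fract (monom (?l p m) (?l m 1)) else 0)"
      by (simp add: fps_X_power_nth)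
  qed
  also have "\<dots> = to_fract (\<Sum>m\<in>Poly_Mapping.keys p. if ?l m 0 + ?l m 1 = N then monom (?l p m) (?l m 1) else 0)"
    unfolding to_fract_sum by (intro sum.cong) auto
  finally have "to_fract (\<Sum>m\<in>Poly_Mapping.keys p. if ?l m 0 + ?l m 1 = N then monom (?l p m) (?l m 1) else 0) = 0"
    by (rule sym)
  hence "(\<Sum>m\<in>Poly_Mapping.keys p. if ?l m 0 + ?l m 1 = N then monom (?l p m) (?l m 1) else 0) = 0"
    by (simp only: to_fract_eq_0_iff)
  hence "0 = coeff (\<Sum>m\<in>Poly_Mapping.keys p. if ?l m 0 + ?l m 1 = N then monom (?l p m) (?l m 1) else 0) (?l m 1)"
    by simp
  also have "\<dots> = (\<Sum>m'\<in>Poly_Mapping.keys p. if m' = m then ?l p m else 0)"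
    unfolding coeff_sum
  proof (intro sum.cong refl)
    fix m' assume "m' \<in> Poly_Mapping.keys p"
    hence sub: "Poly_Mapping.keys m' \<subseteq> {0, 1}" "Poly_Mapping.keys m \<subseteq> {0, 1}"
      using p(1) m unfolding two by (auto simp: mpols_def)
    have "m' = m" if "?l m' 0 = ?l m 0" "?l m' 1 = ?l m 1"
    proof (rule poly_mapping_eqI)
      fix i show "?l m' i = ?l m i"
      proof (cases "i \<in> {0, 1}")
        case False
        hence "i \<notin> Poly_Mapping.keys m'" "i \<notin> Poly_Mapping.keys m" using sub by blast+
        thus ?thesis by (simp add: in_keys_iff)
      qed (use that in auto)
    qed
    thus "coeff (if ?l m' 0 + ?l m' 1 = N then monom (?l p m') (?l m' 1) else 0) (?l m 1) =
        (if m' = m then ?l p m else 0)"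
      by (auto simp: N_def coeff_monom)
  qed
  also have "\<dots> = ?l p m" using m by simp
  finally show False using m by (simp add: in_keys_iff)
qed

lemma par_alg_indep: "alg_indep (range emb) 2 par"
  unfolding alg_indep_def
proof (intro ballI impI)
  fix p :: "'a laurent_dom mpol" assume p: "p \<in> mpols (range emb) 2" "eval_mpol par p = 0"
  obtain q where q: "q \<in> mpols UNIV 2" "p = mapc emb q" using mpols_range[OF rhom_emb p(1)] .
  have "ev emb par q = 0" using p(2) by (simp add: q(2) eval_mpol_ev(2) ev_mapc[OF rhom_id(2) rhom_emb])
  thus "p = 0" using par_indep[OF q(1)] q(2) by (simp add: rhom.zero[OF rhom_mapc[OF rhom_emb]])
qed

text \<open>Pseudo-division of \<open>P * Q\<close> by \<open>P\<close> over \<open>K\<close> must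
  return \<open>Q\<close> up to a constant, since a nonzero remainder would be a multiple of
  \<open>P\<close> of smaller degree.\<close>

lemma quotient_in_polys_over:
  fixes P :: "'a::field poly"
  assumes K: "is_subfield K" and "P \<in> polys_over K" "P * Q \<in> polys_over K" "P \<noteq> 0"
  shows "Q \<in> polys_over K"
proof -
  note R = is_subfield_subring[OF K]
  define l where "l = lead_coeff P"
  have "0 < degree P \<or> coeff P 0 \<noteq> 0" using assms(4) by (cases "degree P") (auto elim!: degree_eq_zeroE)
  then obtain N q r where qr: "q \<in> polys_over K" "smult (l ^ N) (P * Q) = P * q + r" "r = 0 \<or> degree r < degree P"
    using pseudo_division[OF R assms(2) _ assms(3)] unfolding l_def by blast
  have l: "l \<noteq> 0" "l \<in> K" using assms(2,4) by (auto simp: l_def polys_over_def)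
  have "P * (smult (l ^ N) Q - q) = r" using qr(2) by (simp add: algebra_simps)
  hence "r = 0" using qr(3) assms(4) degree_mult_eq[of P "smult (l ^ N) Q - q"]
    by (cases "smult (l ^ N) Q - q = 0") auto
  hence "smult (l ^ N) Q - q = 0" using \<open>P * _ = r\<close> assms(4) by auto
  hence "Q = smult (inverse (l ^ N)) q" using l by auto
  moreover have "inverse (l ^ N) \<in> K" using l is_subringD(7)[OF R] is_subfieldD(1)[OF K] by blast
  ultimately show ?thesis using qr(1) is_subringD(4)[OF R] by (auto simp: polys_over_def)
qed

text \<open>Tuples (t_0, t_1, z_0, z_1, ...), the shape in which relations between parameters and
  roots are compared.\<close>

definition pt :: "(nat \<Rightarrow> 'a) \<Rightarrow> (nat \<Rightarrow> 'a) \<Rightarrow> nat \<Rightarrow> 'a" where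
  "pt t z i = (if i < 2 then t i else z (i - 2))"

locale family_ac = family A b g \<xi> n
  for A b g :: "'k::alg_closed_field poly" and \<xi> n
begin

text \<open>The family with power series coefficients, where reduction modulo \<pi> makes sense;
  \<open>FE\<close> is its image in the algebraic closure of the Laurent series.\<close>

definition FB :: "'k poly fract fps poly" where
  "FB = map_poly cps A + map_poly cps b * [:pps 0 - pps 1 * cps \<xi>, pps 1:]"

abbreviation FE :: "'k laurent_dom poly" where
  "FE \<equiv> fam_poly (map_poly emb A) (map_poly emb b) (emb \<xi>) (par 0) (par 1)"

lemma iota_FB: "map_poly iota FB = FE"
proof -
  interpret rhom iota by (rule rhom_iota)
  have "map_poly iota (map_poly cps w) = map_poly emb w" for w :: "'k poly"
    by (rule poly_eqI) (simp add: rhom.coeff[OF rhom_cps] rhom.coeff[OF rhom_emb] emb_def)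
  thus ?thesis by (simp add: FB_def fam_poly_def par_def emb_def)
qed

lemma poly_FB: "poly FB x = poly (map_poly cps A) x + poly (map_poly cps b) x * (pps 0 + pps 1 * (x - cps \<xi>))"
  by (simp add: FB_def algebra_simps)

lemma map_cps_0: "map_poly (\<lambda>f. fps_nth f 0) (map_poly cps w) = map_poly cl w"
  by (rule poly_eqI) (simp add: rhom.coeff[OF rhom_fps_nth_0] rhom.coeff[OF rhom_cps] rhom.coeff[OF rhom_cl] cps_def)

lemma map_FB_0: "map_poly (\<lambda>f. fps_nth f 0) FB = map_poly cl A"
proof -
  interpret rhom "\<lambda>f :: 'k poly fract fps. fps_nth f 0" by (rule rhom_fps_nth_0)
  show ?thesis unfolding FB_def map_poly_add map_poly_mult map_cps_0 by (simp add: pps_def)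
qed

text \<open>The simple roots of the reduction: modulo \<pi> the family becomes A, whose remaining
  root \<xi> is double.\<close>

definition R where "R = {l. poly g l = 0}"

lemma R_facts: "finite R" "card R = n - 2" "l \<in> R \<Longrightarrow> l \<noteq> \<xi>" "l \<in> R \<Longrightarrow> poly (pderiv A) l \<noteq> 0"
  "g = (\<Prod>l\<in>R. [:- l, 1:])"
proof -
  obtain u v where uv: "u * g + v * pderiv g = 1" using g_sqf by blast
  have sep: "poly (pderiv g) l \<noteq> 0" if "poly g l = 0" for l
    using arg_cong[OF uv, of "\<lambda>p. poly p l"] that by auto
  have "g \<noteq> 0" using g_monic by auto
  hence sqf: "rsquarefree g" using sep by (auto simp: rsquarefree_iff_no_double_root)
  show "finite R" using \<open>g \<noteq> 0\<close> by (simp add: R_def poly_roots_finite)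
  show "card R = n - 2" using rsquarefree_factorization(1)[OF sqf] deg_g by (simp add: R_def)
  show "l \<in> R \<Longrightarrow> l \<noteq> \<xi>" using g_\<xi> by (auto simp: R_def)
  thus "l \<in> R \<Longrightarrow> poly (pderiv A) l \<noteq> 0"
    using sep[of l] by (auto simp: R_def A_eq pderiv_mult simp del: mult_pCons_left)
  show "g = (\<Prod>l\<in>R. [:- l, 1:])" using rsquarefree_factorization(2)[OF sqf] g_monic by (simp add: R_def)
qed

lemma hensel_roots:
  assumes "l \<in> R"
  shows "\<exists>r. fps_nth r 0 = cl l \<and> poly FB r = 0"
proof -
  have "poly (map_poly cl A) (cl l) = 0"
    using assms by (simp add: rhom.poly[OF rhom_cl] R_def A_eq rhom.zero[OF rhom_cl])
  moreover have "poly (pderiv (map_poly cl A)) (cl l) \<noteq> 0"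
    using R_facts(4)[OF assms] by (simp add: rhom.poly[OF rhom_cl] rhom_eq_0_iff[OF rhom_cl] flip: map_poly_pderiv[OF rhom_cl])
  ultimately show ?thesis using fps_root_exists[of FB "cl l"] unfolding map_FB_0 by blast
qed

definition hr where "hr l = (SOME r. fps_nth r 0 = cl l \<and> poly FB r = 0)"

lemma hr: "l \<in> R \<Longrightarrow> fps_nth (hr l) 0 = cl l" "l \<in> R \<Longrightarrow> poly FB (hr l) = 0"
  using someI_ex[OF hensel_roots] unfolding hr_def by blast+

lemma FB_monic: "lead_coeff FB = 1"
proof -
  have inj: "map_poly iota FB = FE" by (rule iota_FB)
  have "degree FB = degree FE" unfolding inj[symmetric]
    by (rule degree_map_poly[symmetric]) (metis iota_eq_iff rhom.zero[OF rhom_iota])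
  moreover have "lead_coeff FE = 1" "FE = map_poly iota FB"
    using family.fam_monic(2)[OF family_map[OF rhom_emb]] inj by simp_all
  ultimately have "iota (lead_coeff FB) = iota 1"
    using rhom.coeff[OF rhom_iota, of FB "degree FB"] by (simp add: rhom.one[OF rhom_iota])
  thus ?thesis by simp
qed

text \<open>A root reducing to \<open>\<xi>\<close> would make \<open>\<pi>\<^sup>2\<close> divide \<open>\<pi> b(\<xi>) + \<dots>\<close>.\<close>

lemma laurent_roots:
  assumes "poly (map_poly fps_to_fls FB) \<rho> = 0"
  obtains l where "l \<in> R" "\<rho> = fps_to_fls (hr l)"
proof -
  interpret fl: rhom "fps_to_fls :: 'k poly fract fps \<Rightarrow> _" by (rule rhom_fps_to_fls)
  interpret c0: rhom "\<lambda>f :: 'k poly fract fps. fps_nth f 0" by (rule rhom_fps_nth_0)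
  interpret cl: rhom "cl :: 'k \<Rightarrow> _" by (rule rhom_cl)
  interpret cps: rhom "cps :: 'k \<Rightarrow> _" by (rule rhom_cps)
  obtain r where r: "\<rho> = fps_to_fls r" using fls_integral_root[OF FB_monic assms] .
  have root: "poly FB r = 0" using assms by (simp add: r)
  define r0 where "r0 = fps_nth r 0"
  have "poly (map_poly cl A) r0 = 0" using c0.poly[of FB r] root by (simp add: map_FB_0 r0_def)
  hence "(r0 - cl \<xi>) ^ 2 * poly (map_poly cl g) r0 = 0"
    by (simp add: A_eq del: mult_pCons_left)
  moreover have "r0 \<noteq> cl \<xi>"
  proof
    assume "r0 = cl \<xi>"
    hence "fps_nth (r - cps \<xi>) 0 = 0" by (simp add: r0_def cps_def)
    hence "r - cps \<xi> = fps_X * fps_shift 1 (r - cps \<xi>)" by (intro fps_ext) (auto simp: fps_X_mult_nth)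
    then obtain q where q: "r - cps \<xi> = fps_X * q" by blast
    have "poly (map_poly cps A) r = (r - cps \<xi>) ^ 2 * poly (map_poly cps g) r"
      by (simp add: A_eq del: mult_pCons_left)
    hence "0 = fps_X * (fps_X * q ^ 2 * poly (map_poly cps g) r + poly (map_poly cps b) r * (1 + fps_const (to_fract [:0, 1:]) * (r - cps \<xi>)))"
      using root unfolding poly_FB by (simp add: q pps_def algebra_simps power2_eq_square)
    hence "fps_X * q ^ 2 * poly (map_poly cps g) r + poly (map_poly cps b) r * (1 + fps_const (to_fract [:0, 1:]) * (r - cps \<xi>)) = 0"
      by simp
    hence "fps_nth (fps_X * q ^ 2 * poly (map_poly cps g) r + poly (map_poly cps b) r * (1 + fps_const (to_fract [:0, 1:]) * (r - cps \<xi>))) 0 = 0"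
      by simp
    hence "fps_nth (poly (map_poly cps b) r) 0 = 0"
      using \<open>fps_nth (r - cps \<xi>) 0 = 0\<close> by (simp add: mult.assoc)
    hence "poly (map_poly cl b) (cl \<xi>) = 0"
      using c0.poly[of "map_poly cps b" r] \<open>r0 = cl \<xi>\<close> by (simp add: map_cps_0 r0_def)
    thus False using b_\<xi> by (simp add: rhom_eq_0_iff[OF rhom_cl])
  qed
  ultimately have "poly (map_poly cl g) r0 = 0" by simp
  hence "(\<Prod>l\<in>R. r0 - cl l) = 0"
    by (subst (asm) R_facts(5)) (simp add: cl.map_poly_prod poly_prod)
  then obtain l where l: "l \<in> R" "r0 = cl l" using R_facts(1) by auto
  have "r = hr l"
    by (rule fps_root_unique[OF root hr(2)[OF l(1)]])
      (use l hr(1)[OF l(1)] R_facts(4)[OF l(1)] in \<open>simp_all add: map_FB_0 r0_def rhom_eq_0_iff[OF rhom_cl] flip: map_poly_pderiv[OF rhom_cl]\<close>)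
  thus ?thesis using that[OF l(1)] r by simp
qed

end

subsection \<open>The geometric Galois group is the symmetric group\<close>

lemma same_rel_subst:
  fixes h1 :: "'k::comm_ring_1 \<Rightarrow> 'a::field" and h2 :: "'k \<Rightarrow> 'b::field"
  assumes h: "rhom h1" "rhom h2" and rel: "same_rel h1 h2 N u v"
    and \<tau>: "\<And>i. i < n \<Longrightarrow> \<tau> i < N \<and> u' i = u (\<tau> i) \<and> v' i = v (\<tau> i)"
  shows "same_rel h1 h2 n u' v'"
  unfolding same_rel_def
proof
  fix p :: "'k mpol" assume p: "p \<in> mpols UNIV n"
  define q where "q = ev Cst (\<lambda>i. Var (\<tau> i)) p"
  have "q \<in> mpols UNIV N" unfolding q_def
    by (rule ev_in_subring[OF is_subring_mpols[OF is_subring_UNIV] p rhom_Cst])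
      (use \<tau> in \<open>auto intro: Cst_in_mpols Var_in_mpols\<close>)
  moreover have "ev h1 u q = ev h1 u' p"
    unfolding q_def ev_hom[OF rhom.rhom_ev[OF h(1)] rhom_Cst] rhom.ev_Cst[OF h(1)] rhom.ev_Var[OF h(1)]
    by (rule ev_cong[OF p]) (simp add: \<tau>)
  moreover have "ev h2 v q = ev h2 v' p"
    unfolding q_def ev_hom[OF rhom.rhom_ev[OF h(2)] rhom_Cst] rhom.ev_Cst[OF h(2)] rhom.ev_Var[OF h(2)]
    by (rule ev_cong[OF p]) (simp add: \<tau>)
  ultimately show "ev h1 u' p = 0 \<longleftrightarrow> ev h2 v' p = 0" using rel unfolding same_rel_def by metis
qed

lemma same_rel_trans: "same_rel h h' n u v \<Longrightarrow> same_rel h' h'' n v w \<Longrightarrow> same_rel h h'' n u w"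
  unfolding same_rel_def by blast

lemma mapc_eq_0_iff:
  fixes h :: "'k::field \<Rightarrow> 'a::field"
  assumes h: "rhom h"
  shows "mapc h q = 0 \<longleftrightarrow> q = 0"
proof
  assume q: "mapc h q = 0"
  have lk: "Poly_Mapping.lookup (mapc h q) m = h (Poly_Mapping.lookup q m)" for m
  proof -
    have "mapc h q = (\<Sum>m\<in>Poly_Mapping.keys q. Poly_Mapping.single m (h (Poly_Mapping.lookup q m)))"
      unfolding mapc_def ev_def single_eq_monomial[of _ "h _"] ..
    hence "Poly_Mapping.lookup (mapc h q) m =
        (\<Sum>m'\<in>Poly_Mapping.keys q. if m' = m then h (Poly_Mapping.lookup q m) else 0)"
      by (simp add: lookup_sum lookup_single when_def)
    thus ?thesis using h by (auto simp: in_keys_iff rhom.zero)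
  qed
  show "q = 0"
  proof (rule poly_mapping_eqI)
    fix m
    have "h (Poly_Mapping.lookup q m) = 0" using lk[of m] q by simp
    thus "Poly_Mapping.lookup q m = Poly_Mapping.lookup 0 m" by (simp add: rhom_eq_0_iff[OF h])
  qed
qed (simp add: rhom.zero[OF rhom_mapc[OF h]])

lemma ev_eq_0_iff_alg_indep:
  fixes h :: "'k::field \<Rightarrow> 'a::field"
  assumes "rhom h" "alg_indep (range h) n u" "p \<in> mpols UNIV n"
  shows "ev h u p = 0 \<longleftrightarrow> p = 0"
proof
  assume "ev h u p = 0"
  hence "eval_mpol u (mapc h p) = 0" by (simp add: eval_mpol_ev(2) ev_mapc[OF rhom_id(2) assms(1)])
  hence "mapc h p = 0" using assms(2) mapc_in_mpols[OF assms(1,3)] by (simp add: alg_indep_def)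
  thus "p = 0" by (simp add: mapc_eq_0_iff[OF assms(1)])
qed (use assms in \<open>simp add: rhom.zero[OF rhom.rhom_ev]\<close>)

lemma alg_indep_same_rel:
  fixes h1 :: "'k::field \<Rightarrow> 'a::field" and h2 :: "'k \<Rightarrow> 'b::field"
  assumes "rhom h1" "rhom h2" "alg_indep (range h1) n u" "alg_indep (range h2) n v"
  shows "same_rel h1 h2 n u v"
  unfolding same_rel_def
  by (simp add: ev_eq_0_iff_alg_indep[OF assms(1,3)] ev_eq_0_iff_alg_indep[OF assms(2,4)])

text \<open>The value of f_t at \<open>q\<close> as a polynomial in several variables, with the
  parameters among them; it turns being a root of f_t into a relation that \<open>same_rel\<close>
  transports.\<close>

definition rel_poly :: "'a::field poly \<Rightarrow> 'a poly \<Rightarrow> 'a \<Rightarrow> 'a mpol \<Rightarrow> 'a mpol \<Rightarrow> 'a mpol \<Rightarrow> 'a mpol" where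
  "rel_poly A b \<xi> p0 p1 q = poly (map_poly Cst A) q + poly (map_poly Cst b) q * (p0 + p1 * (q - Cst \<xi>))"

lemma ev_rel_poly:
  fixes h :: "'a::field \<Rightarrow> 'c::field"
  assumes "rhom h"
  shows "ev h y (rel_poly A b \<xi> p0 p1 q) =
    poly (fam_poly (map_poly h A) (map_poly h b) (h \<xi>) (ev h y p0) (ev h y p1)) (ev h y q)"
proof -
  interpret e: rhom "ev h y" by (rule rhom.rhom_ev[OF assms])
  show ?thesis by (simp add: rel_poly_def ev_poly_Cst[OF assms] poly_fam_poly rhom.ev_Cst[OF assms])
qed

lemma rel_poly_in_mpols:
  assumes "is_subring K" "A \<in> polys_over K" "b \<in> polys_over K" "\<xi> \<in> K"
    "p0 \<in> mpols K N" "p1 \<in> mpols K N" "q \<in> mpols K N"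
  shows "rel_poly A b \<xi> p0 p1 q \<in> mpols K N"
proof -
  note M = is_subring_mpols[OF assms(1), of N]
  have "poly (map_poly Cst w) q \<in> mpols K N" if "w \<in> polys_over K" for w
    by (rule is_subring_poly[OF M _ assms(7)])
      (use that in \<open>auto simp: rhom.coeff[OF rhom_Cst] polys_over_def intro: Cst_in_mpols\<close>)
  thus ?thesis unfolding rel_poly_def using assms by (intro is_subringD[OF M] Cst_in_mpols) auto
qed

context family_ac
begin

text \<open>The two roots outside the Laurent series field are conjugate over it: the other linear
  factors have coefficients in the field, so the product \<open>Q\<close> of the remaining two does
  as well, and it is irreducible because \<open>z i0\<close> is outside.\<close>

lemma swap_half:
  assumes z: "FE = (\<Prod>i<n. [:- z i, 1:])" and ij: "i0 < n" "j0 < n" "i0 \<noteq> j0"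
    and out: "z i0 \<notin> range to_ac" and ins: "\<And>i. i < n \<Longrightarrow> i \<noteq> i0 \<Longrightarrow> i \<noteq> j0 \<Longrightarrow> z i \<in> range to_ac"
    and p: "p \<in> mpols UNIV (n + 2)" "ev emb (pt par z) p = 0"
  shows "ev emb (pt par (z \<circ> transpose i0 j0)) p = 0"
proof -
  let ?K = "range (to_ac :: 'k poly fract fls \<Rightarrow> _)"
  have K: "is_subfield ?K" by (rule is_subfield_range[OF rhom_to_ac])
  note R = is_subfield_subring[OF K]
  note D = is_subringD[OF R]
  note DP = is_subringD[OF is_subring_polys_over[OF R]]
  have "coeff FE i \<in> ?K" for i
    unfolding iota_FB[symmetric] rhom.coeff[OF rhom_iota] by (simp add: iota_def)
  hence FK: "FE \<in> polys_over ?K" by (simp add: polys_over_def)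
  define P where "P = (\<Prod>i\<in>{..<n} - {i0, j0}. [:- z i, 1:])"
  define Q where "Q = [:- z i0, 1:] * [:- z j0, 1:]"
  have PK: "P \<in> polys_over ?K" unfolding P_def
    by (rule is_subring_prod[OF is_subring_polys_over[OF R]]) (use ins D zero_in_polys_over[OF R] in auto)
  have "FE = P * Q"
  proof -
    have "FE = (\<Prod>i\<in>{..<n} - {i0, j0}. [:- z i, 1:]) * (\<Prod>i\<in>{i0, j0}. [:- z i, 1:])"
      unfolding z using ij by (intro prod.subset_diff) auto
    thus ?thesis using ij(3) by (simp add: P_def Q_def)
  qed
  moreover have "P \<noteq> 0" by (simp add: P_def)
  ultimately have QK: "Q \<in> polys_over ?K" using quotient_in_polys_over[OF K PK, of Q] FK by simp
  define \<sigma> where "\<sigma> = z i0 + z j0"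
  have Q_eq: "Q = [:z i0 * z j0, - \<sigma>, 1:]" by (simp add: Q_def \<sigma>_def algebra_simps)
  have \<sigma>K: "\<sigma> \<in> ?K" using QK D(5)[of "- \<sigma>"] by (simp add: Q_eq)
  \<comment> \<open>As z_i0 + z_j0 = \<sigma> lies in the field, a relation among all roots becomes
    a relation \<open>G\<close> for a single unknown: the unknown stands for one of the two roots
    and \<sigma> minus the unknown for the other.\<close>
  define y where "y m = (if m = i0 + 2 then [:0, 1:] else if m = j0 + 2 then [:\<sigma>, - 1:] else [:pt par z m:])" for m
  have hc: "rhom (\<lambda>c :: 'k. [:emb c:])"
    using rhom_emb by (auto simp: rhom_def one_pCons)
  define G where "G = ev (\<lambda>c. [:emb c:]) y p"
  have hp: "rhom (\<lambda>p :: 'k laurent_dom poly. poly p t)" for t by unfold_locales simp_all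
  have pG: "poly G t = ev emb (\<lambda>m. poly (y m) t) p" for t
    unfolding G_def ev_hom[OF hp hc] by simp
  have embK: "emb c \<in> ?K" "iota w \<in> ?K" for c :: 'k and w by (auto simp: emb_def iota_def)
  have ptK: "pt par z m \<in> ?K" if "m < n + 2" "m \<noteq> i0 + 2" "m \<noteq> j0 + 2" for m
    using that ins[of "m - 2"] embK(2) by (auto simp: pt_def par_def)
  have GK: "G \<in> polys_over ?K" unfolding G_def
    by (rule ev_in_subring[OF is_subring_polys_over[OF R] p(1) hc])
      (use embK ptK D \<sigma>K zero_in_polys_over[OF R] in \<open>auto simp: y_def\<close>)
  have "(\<lambda>m. poly (y m) (z i0)) = pt par z"
    by (rule ext) (auto simp: y_def pt_def \<sigma>_def)
  hence G0: "poly G (z i0) = 0" using p(2) by (simp add: pG)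
  have y2: "(\<lambda>m. poly (y m) (z j0)) = pt par (z \<circ> transpose i0 j0)"
    using ij(3) by (intro ext) (auto simp: y_def pt_def \<sigma>_def transpose_def)
  have degQ: "degree Q = 2" "lead_coeff Q = 1" by (simp_all add: Q_eq)
  obtain N q r where qr: "q \<in> polys_over ?K" "r \<in> polys_over ?K" "smult (lead_coeff Q ^ N) G = Q * q + r"
    "r = 0 \<or> degree r < degree Q"
    using pseudo_division[OF R QK _ GK] degQ by auto
  have G: "G = Q * q + r" using qr(3) degQ by simp
  have "degree r \<le> 1" using qr(4) degQ by auto
  hence "r = [:coeff r 0, coeff r 1:]"
    by (intro poly_eqI) (auto simp: coeff_pCons coeff_eq_0 split: nat.split)
  then obtain u v where r: "r = [:u, v:]" by blast
  have uv: "u \<in> ?K" "v \<in> ?K" using qr(2) by (simp_all add: r)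
  have Q0: "poly Q (z i0) = 0" "poly Q (z j0) = 0" unfolding Q_def poly_mult by simp_all
  have "poly r (z i0) = 0" using G0 Q0 by (simp add: G)
  hence "u + v * z i0 = 0" by (simp add: r mult.commute)
  \<comment> \<open>The remainder modulo \<open>Q\<close> is linear; if it were not constant, its
    root \<open>z i0\<close> would lie in the field.\<close>
  have "v = 0"
  proof (rule ccontr)
    assume "v \<noteq> 0"
    hence "z i0 = - u / v" using \<open>u + v * z i0 = 0\<close> by (simp add: field_simps add_eq_0_iff)
    also have "\<dots> \<in> ?K" using uv D(5) is_subfieldD(2)[OF K] by blast
    finally show False using out by simp
  qed
  hence "r = 0" using \<open>u + v * z i0 = 0\<close> by (simp add: r)
  hence "poly G (z j0) = 0" using Q0 by (simp add: G)
  thus ?thesis by (simp add: pG y2)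
qed

context
  fixes z :: "nat \<Rightarrow> 'k laurent_dom"
  assumes inj: "inj_on z {..<n}" and prod: "FE = (\<Prod>i<n. [:- z i, 1:])"
begin

lemma root_iff: "poly FE x = 0 \<longleftrightarrow> (\<exists>i<n. x = z i)"
  unfolding prod poly_prod by (auto simp: prod_zero_iff)

text \<open>The roots in the Laurent series field are exactly the \<open>n - 2\<close> Hensel lifts
  of the roots of g, so precisely two roots lie outside and are exchanged.\<close>

lemma transposition_exists:
  "\<exists>i0 j0. i0 < n \<and> j0 < n \<and> i0 \<noteq> j0 \<and>
    same_rel emb emb (n + 2) (pt par z) (pt par (z \<circ> transpose i0 j0))"
proof -
  let ?K = "range (to_ac :: 'k poly fract fls \<Rightarrow> _)"
  let ?I = "{i. i < n \<and> z i \<in> ?K}"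
  have FE: "FE = map_poly to_ac (map_poly fps_to_fls FB)"
    unfolding iota_FB[symmetric] by (rule poly_eqI)
      (simp add: rhom.coeff[OF rhom_iota] rhom.coeff[OF rhom_to_ac] rhom.coeff[OF rhom_fps_to_fls] iota_def)
  have "inj_on (\<lambda>l. iota (hr l)) R"
    by (rule inj_onI) (metis hr(1) iota_eq_iff rhom_eq_iff[OF rhom_cl])
  moreover have "(\<lambda>l. iota (hr l)) ` R = z ` ?I"
  proof (intro equalityI subsetI)
    fix w assume "w \<in> (\<lambda>l. iota (hr l)) ` R"
    then obtain l where l: "l \<in> R" "w = iota (hr l)" by auto
    have "poly FE w = 0"
      unfolding iota_FB[symmetric] l(2) rhom.poly[OF rhom_iota] hr(2)[OF l(1)] by (rule rhom.zero[OF rhom_iota])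
    then obtain i where "i < n" "w = z i" using root_iff by auto
    moreover have "w \<in> ?K" using l(2) by (simp add: iota_def)
    ultimately show "w \<in> z ` ?I" by auto
  next
    fix w assume "w \<in> z ` ?I"
    then obtain i \<rho> where i: "i < n" "w = z i" "z i = to_ac \<rho>" by auto
    have "to_ac (poly (map_poly fps_to_fls FB) \<rho>) = 0"
    proof -
      have "poly FE (z i) = 0" using root_iff i(1) by blast
      thus ?thesis unfolding FE i(3) rhom.poly[OF rhom_to_ac] .
    qed
    hence "poly (map_poly fps_to_fls FB) \<rho> = 0" by simp
    then obtain l where "l \<in> R" "\<rho> = fps_to_fls (hr l)" by (rule laurent_roots)
    thus "w \<in> (\<lambda>l. iota (hr l)) ` R" using i by (auto simp: iota_def)
  qed
  moreover have "inj_on z ?I" using inj by (auto intro: inj_on_subset)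
  ultimately have "card ?I = card R" using card_image[of z ?I] card_image[of "\<lambda>l. iota (hr l)" R] by simp
  hence "card ?I = n - 2" using R_facts(2) by simp
  moreover have "2 \<le> n" using deg_g by simp
  moreover have "card ({..<n} - ?I) = n - card ?I"
    by (subst card_Diff_subset) auto
  ultimately have "card ({..<n} - ?I) = 2" by simp
  then obtain i0 j0 where ij: "{..<n} - ?I = {i0, j0}" "i0 \<noteq> j0" by (auto simp: card_2_iff)
  have i0: "i0 < n" "z i0 \<notin> ?K" and j0: "j0 < n" "z j0 \<notin> ?K" using ij(1) by blast+
  have oth: "z i \<in> ?K" if "i < n" "i \<noteq> i0" "i \<noteq> j0" for i using that ij(1) by blast
  let ?z = "z \<circ> transpose i0 j0"
  have pz: "FE = (\<Prod>i<n. [:- ?z i, 1:])"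
  proof -
    have "bij_betw (transpose i0 j0) {..<n} {..<n}"
      using permutes_imp_bij[OF permutes_swap_id[of i0 "{..<n}" j0]] i0 j0 by simp
    from prod.reindex_bij_betw[OF this, of "\<lambda>i. [:- z i, 1:]"] show ?thesis unfolding prod by simp
  qed
  have "same_rel emb emb (n + 2) (pt par z) (pt par ?z)"
    unfolding same_rel_def
  proof (intro ballI iffI)
    fix p :: "'k mpol" assume p: "p \<in> mpols UNIV (n + 2)"
    show "ev emb (pt par z) p = 0 \<Longrightarrow> ev emb (pt par ?z) p = 0"
      by (rule swap_half[OF prod i0(1) j0(1) ij(2) i0(2) oth p])
    assume 0: "ev emb (pt par ?z) p = 0"
    \<comment> \<open>The reverse implication is the same statement for the swapped numbering,
      swapped once more.\<close>
    have "ev emb (pt par (?z \<circ> transpose i0 j0)) p = 0"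
      by (rule swap_half[OF pz i0(1) j0(1) ij(2) _ _ p 0])
        (use j0 oth in \<open>auto simp: transpose_def\<close>)
    thus "ev emb (pt par z) p = 0" by (simp add: comp_assoc)
  qed
  thus ?thesis using i0 j0 ij by blast
qed

text \<open>Any two roots determine the parameters and are therefore independent, so two ordered
  pairs of roots satisfy the same relations, namely none. Extending this correspondence to the
  parameters and to all roots yields the permutation.\<close>

lemma two_transitive:
  assumes "i < n" "j < n" "i \<noteq> j" "i' < n" "j' < n" "i' \<noteq> j'"
  shows "\<exists>\<sigma>. \<sigma> permutes {..<n} \<and> \<sigma> i = i' \<and> \<sigma> j = j' \<and>
    same_rel emb emb (n + 2) (pt par z) (pt par (z \<circ> \<sigma>))"
proof -
  let ?K = "range (emb :: 'k \<Rightarrow> _)"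
  have K: "is_subfield ?K" by (rule is_subfield_range[OF rhom_emb])
  interpret H: family "map_poly emb A" "map_poly emb b" "map_poly emb g" "emb \<xi>" n by (rule family_map[OF rhom_emb])
  have zne: "z l \<noteq> z m" if "l < n" "m < n" "l \<noteq> m" for l m using inj that by (auto dest: inj_onD)
  have par_in: "par 0 \<in> gen_field ?K 2 w" "par 1 \<in> gen_field ?K 2 w"
    if w: "w 0 = z l" "w 1 = z m" "l < n" "m < n" "l \<noteq> m" for w l m
  proof -
    let ?L = "gen_field ?K 2 w"
    have L: "is_subfield ?L" by (rule is_subfield_gen_field[OF K])
    note D = is_subringD[OF is_subfield_subring[OF L]] is_subfieldD[OF L]
    have zL: "z l \<in> ?L" "z m \<in> ?L" using var_in_gen_field[OF K, of 0 2 w] var_in_gen_field[OF K, of 1 2 w] w by auto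
    have cL: "emb c \<in> ?L" for c using const_in_gen_field[OF K] by blast
    have pL: "poly (map_poly emb q) x \<in> ?L" if "x \<in> ?L" for q x
      by (rule is_subring_poly[OF is_subfield_subring[OF L] _ that]) (simp add: rhom.coeff[OF rhom_emb] cL)
    have r: "poly FE (z l) = 0" "poly FE (z m) = 0" using root_iff w by blast+
    note E = H.roots_determine_parameters[OF r zne[OF w(3-5)]]
    show "par 1 \<in> ?L" by (subst E(1)) (intro D pL zL)
    thus "par 0 \<in> ?L" by (subst E(2)) (intro D pL zL cL)
  qed
  \<comment> \<open>The chosen pair comes first as the independent base, then the two parameters and
    all roots; the pair thus occurs twice, which later shows where \<sigma> sends \<open>i\<close>
    and \<open>j\<close>.\<close>
  define u where "u m = (if m = 0 then z i else if m = 1 then z j else if m < 4 then par (m - 2) else z (m - 4))" for m :: nat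
  define v where "v m = (if m = 0 then z i' else z j')" for m :: nat
  have indu: "alg_indep ?K 2 u"
    by (rule alg_indep_pair[OF K par_alg_indep]) (rule par_in[of u i j]; use assms in \<open>simp add: u_def\<close>)+
  have indv: "alg_indep ?K 2 v"
    by (rule alg_indep_pair[OF K par_alg_indep]) (rule par_in[of v i' j']; use assms in \<open>simp add: v_def\<close>)+
  have rel2: "same_rel emb emb 2 u v" by (rule alg_indep_same_rel[OF rhom_emb rhom_emb indu indv])
  let ?L = "gen_field ?K 2 u"
  have L: "is_subfield ?L" by (rule is_subfield_gen_field[OF K])
  have pL: "par m \<in> ?L" if "m < 2" for m
    using par_in[of u i j] that assms by (auto simp: u_def less_2_cases_iff)
  have algz: "alg_over ?L (z m)" if "m < n" for m
  proof -
    note D = is_subringD[OF is_subfield_subring[OF L]]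
    have cL: "emb c \<in> ?L" for c using const_in_gen_field[OF K] by blast
    have "map_poly emb w \<in> polys_over ?L" for w by (simp add: polys_over_def rhom.coeff[OF rhom_emb] cL)
    moreover have "[:par 0 - par 1 * emb \<xi>, par 1:] \<in> polys_over ?L"
      using pL[of 0] pL[of 1] cL D zero_in_polys_over[OF is_subfield_subring[OF L]] by simp
    ultimately have "FE \<in> polys_over ?L" unfolding fam_poly_def
      by (intro is_subringD[OF is_subring_polys_over[OF is_subfield_subring[OF L]]])
    moreover have "poly FE (z m) = 0" using root_iff that by blast
    moreover have "FE \<noteq> 0" using H.fam_monic(2)[of "par 0" "par 1"] by auto
    ultimately show ?thesis unfolding alg_over_def polys_over_def by blast
  qed
  have "alg_over ?L (u m)" if "2 \<le> m" "m < n + 4" for m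
    using that algz[of "m - 4"] alg_over_self[OF L pL[of "m - 2"]] by (auto simp: u_def)
  then obtain w where w: "\<forall>m<2. w m = v m" "same_rel emb emb (n + 4) u w"
    using same_rel_extend[OF rhom_emb rhom_emb rel2, of "n + 4"] by auto
  have vars: "Var m \<in> mpols (UNIV :: 'k set) (n + 4)" if "m < n + 4" for m by (rule Var_in_mpols) (use that in auto)
  have M: "is_subring (mpols (UNIV :: 'k set) (n + 4))" by (rule is_subring_mpols) simp
  have relw: "poly (fam_poly (map_poly emb A) (map_poly emb b) (emb \<xi>) (w 2) (w 3)) (w m) = 0"
    if "m < n + 4" "m \<noteq> 2" "m \<noteq> 3" for m
  proof -
    let ?p = "rel_poly A b \<xi> (Var 2) (Var 3) (Var m)"
    have "?p \<in> mpols UNIV (n + 4)"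
      by (rule rel_poly_in_mpols) (use that in \<open>auto simp: polys_over_def intro: vars\<close>)
    moreover have "ev emb u ?p = 0"
    proof -
      have "\<exists>l<n. u m = z l"
      proof (cases "m < 4")
        case True
        hence "m = 0 \<or> m = 1" using that by auto
        thus ?thesis using assms by (auto simp: u_def)
      next
        case False
        hence "u m = z (m - 4)" "m - 4 < n" using that by (auto simp: u_def)
        thus ?thesis by blast
      qed
      hence "poly FE (u m) = 0" using root_iff by blast
      moreover have "u 2 = par 0" "u 3 = par 1" by (simp_all add: u_def)
      ultimately show ?thesis unfolding ev_rel_poly[OF rhom_emb] rhom.ev_Var[OF rhom_emb] by simp
    qed
    ultimately have "ev emb w ?p = 0" using w(2) by (simp add: same_rel_def)
    thus ?thesis by (simp add: ev_rel_poly[OF rhom_emb] rhom.ev_Var[OF rhom_emb])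
  qed
  have w01: "w 0 = z i'" "w 1 = z j'" using w(1) by (auto simp: v_def)
  have ri: "poly FE (z i') = 0" "poly FE (z j') = 0" using root_iff assms by blast+
  \<comment> \<open>The images of the parameters are determined by the roots \<open>z i'\<close> and
    \<open>z j'\<close> in the same way as the parameters themselves, so the correspondence fixes
    them.\<close>
  have ww: "w 3 = par 1" "w 2 = par 0"
    using H.roots_determine_parameters[OF relw[of 0, unfolded w01] relw[of 1, unfolded w01]]
      H.roots_determine_parameters[OF ri] zne[OF assms(4-6)] by auto
  have "\<exists>l<n. w (m + 4) = z l" if "m < n" for m
    using relw[of "m + 4"] that root_iff[of "w (m + 4)"] by (simp add: ww)
  then obtain s where s: "\<And>m. m < n \<Longrightarrow> s m < n \<and> w (m + 4) = z (s m)" by metis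
  define \<sigma> where "\<sigma> m = (if m < n then s m else m)" for m
  have diffw: "w l = w m \<longleftrightarrow> u l = u m" if "l < n + 4" "m < n + 4" for l m
  proof -
    interpret eu: rhom "ev emb u" by (rule rhom.rhom_ev[OF rhom_emb])
    interpret ew: rhom "ev emb w" by (rule rhom.rhom_ev[OF rhom_emb])
    have "Var l - Var m \<in> mpols (UNIV :: 'k set) (n + 4)" by (intro is_subringD[OF M] vars that)
    hence "ev emb u (Var l - Var m) = 0 \<longleftrightarrow> ev emb w (Var l - Var m) = 0"
      using w(2) by (simp add: same_rel_def del: eu.diff ew.diff)
    thus ?thesis by (auto simp: rhom.ev_Var[OF rhom_emb])
  qed
  have inj\<sigma>: "inj_on \<sigma> {..<n}"
  proof (rule inj_onI)
    fix l m assume lm: "l \<in> {..<n}" "m \<in> {..<n}" "\<sigma> l = \<sigma> m"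
    hence "w (l + 4) = w (m + 4)" using s[of l] s[of m] by (simp add: \<sigma>_def)
    hence "z l = z m" using diffw[of "l + 4" "m + 4"] lm by (simp add: u_def)
    thus "l = m" using zne lm by auto
  qed
  have "\<sigma> ` {..<n} \<subseteq> {..<n}" using s by (auto simp: \<sigma>_def)
  hence "\<sigma> ` {..<n} = {..<n}" using inj\<sigma> by (intro card_subset_eq) (auto simp: card_image)
  hence perm: "\<sigma> permutes {..<n}" using inj\<sigma> by (intro bij_imp_permutes) (auto simp: bij_betw_def \<sigma>_def)
  have "w 0 = w (i + 4)" "w 1 = w (j + 4)"
    using diffw[of 0 "i + 4"] diffw[of 1 "j + 4"] assms by (auto simp: u_def)
  hence "z (s i) = z i'" "z (s j) = z j'" using s[of i] s[of j] assms w01 by auto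
  hence ij: "\<sigma> i = i'" "\<sigma> j = j'" using zne s assms by (auto simp: \<sigma>_def)
  have "same_rel emb emb (n + 2) (pt par z) (pt par (z \<circ> \<sigma>))"
  proof (rule same_rel_subst[OF rhom_emb rhom_emb w(2), where \<tau> = "\<lambda>m. m + 2"])
    fix m assume m: "m < n + 2"
    have "pt par (z \<circ> \<sigma>) m = w (m + 2)"
    proof (cases "m < 2")
      case True
      hence "m = 0 \<or> m = 1" by auto
      thus ?thesis using ww by (auto simp: pt_def numeral_2_eq_2 numeral_3_eq_3)
    next
      case False
      then obtain l where "m = l + 2" by (metis add.commute le_Suc_ex not_less)
      hence "m + 2 = l + 4" by simp
      hence "w (m + 2) = w (l + 4)" by (rule arg_cong)
      thus ?thesis using s[of l] m \<open>m = l + 2\<close> by (simp add: pt_def \<sigma>_def)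
    qed
    moreover have "pt par z m = u (m + 2)" by (auto simp: pt_def u_def)
    ultimately show "m + 2 < n + 4 \<and> pt par z m = u (m + 2) \<and> pt par (z \<circ> \<sigma>) m = w (m + 2)"
      using m by simp
  qed
  thus ?thesis using perm ij by blast
qed

lemma same_rel_reindex:
  assumes "same_rel emb emb (n + 2) (pt par x) (pt par y)" "\<sigma> permutes {..<n}"
  shows "same_rel emb emb (n + 2) (pt par (x \<circ> \<sigma>)) (pt par (y \<circ> \<sigma>))"
proof (rule same_rel_subst[OF rhom_emb rhom_emb assms(1), where \<tau> = "\<lambda>m. if m < 2 then m else \<sigma> (m - 2) + 2"])
  fix m assume "m < n + 2"
  thus "(if m < 2 then m else \<sigma> (m - 2) + 2) < n + 2 \<and>
      pt par (x \<circ> \<sigma>) m = pt par x (if m < 2 then m else \<sigma> (m - 2) + 2) \<and>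
      pt par (y \<circ> \<sigma>) m = pt par y (if m < 2 then m else \<sigma> (m - 2) + 2)"
    using permutes_in_image[OF assms(2), of "m - 2"] by (auto simp: pt_def)
qed

text \<open>Conjugating the one available transposition by permutations from
  \<open>two_transitive\<close> gives every transposition, and these generate the symmetric
  group.\<close>

theorem all_permutations:
  assumes "\<rho> permutes {..<n}"
  shows "same_rel emb emb (n + 2) (pt par z) (pt par (z \<circ> \<rho>))"
proof -
  obtain i0 j0 where t: "i0 < n" "j0 < n" "i0 \<noteq> j0"
    "same_rel emb emb (n + 2) (pt par z) (pt par (z \<circ> transpose i0 j0))"
    using transposition_exists by blast
  have swp: "same_rel emb emb (n + 2) (pt par z) (pt par (z \<circ> transpose i j))"
    if ij: "i < n" "j < n" "i \<noteq> j" for i j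
  proof -
    obtain \<sigma> where \<sigma>: "\<sigma> permutes {..<n}" "\<sigma> i = i0" "\<sigma> j = j0"
      "same_rel emb emb (n + 2) (pt par z) (pt par (z \<circ> \<sigma>))"
      using two_transitive[OF ij t(1-3)] by blast
    have tr: "transpose i j permutes {..<n}" using ij by (simp add: permutes_swap_id)
    have eq: "transpose i0 j0 \<circ> \<sigma> = \<sigma> \<circ> transpose i j"
      using permutes_inj[OF \<sigma>(1)] \<sigma>(2,3) by (auto simp: fun_eq_iff transpose_def inj_def)
    have 1: "same_rel emb emb (n + 2) (pt par (z \<circ> \<sigma>)) (pt par (z \<circ> (\<sigma> \<circ> transpose i j)))"
      using same_rel_reindex[OF t(4) \<sigma>(1)] by (simp add: comp_assoc eq)
    have 2: "same_rel emb emb (n + 2) (pt par (z \<circ> transpose i j)) (pt par (z \<circ> (\<sigma> \<circ> transpose i j)))"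
      using same_rel_reindex[OF \<sigma>(4) tr] by (simp add: comp_assoc)
    show ?thesis by (rule same_rel_trans[OF same_rel_trans[OF \<sigma>(4) 1] same_rel_sym[OF 2]])
  qed
  have "finite {..<n}" by simp
  from assms this show ?thesis
  proof (induction rule: permutes_induct)
    case id
    show ?case by (simp add: same_rel_def)
  next
    case (swap a b p)
    have "same_rel emb emb (n + 2) (pt par z) (pt par (z \<circ> transpose a b))"
      using swap(1,2,3) by (intro swp) auto
    from same_rel_reindex[OF this swap(4)]
    have "same_rel emb emb (n + 2) (pt par (z \<circ> p)) (pt par (z \<circ> (transpose a b \<circ> p)))"
      by (simp add: comp_assoc)
    from same_rel_trans[OF swap(5) this] show ?case .
  qed
qed

end

end

subsection \<open>Interpolation\<close>

definition lagr :: "nat \<Rightarrow> (nat \<Rightarrow> 'a::field) \<Rightarrow> nat \<Rightarrow> 'a poly" where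
  "lagr n z k = (\<Prod>m\<in>{..<n} - {k}. smult (inverse (z k - z m)) [:- z m, 1:])"

lemma poly_eqI_points:
  fixes P Q :: "'a::idom poly"
  assumes "inj_on z {..<n}" "P = 0 \<or> degree P < n" "Q = 0 \<or> degree Q < n" "\<And>k. k < n \<Longrightarrow> poly P (z k) = poly Q (z k)"
  shows "P = Q"
proof (rule ccontr)
  assume "P \<noteq> Q"
  hence nz: "P - Q \<noteq> 0" by simp
  have "0 < n" using assms(2,3) \<open>P \<noteq> Q\<close> by auto
  hence "degree (P - Q) < n" using assms(2,3) by (intro degree_diff_less) auto
  moreover have "card {..<n} \<le> card {x. poly (P - Q) x = 0}"
    using assms(4) nz by (intro card_inj_on_le[OF assms(1)] poly_roots_finite) auto
  ultimately show False using card_poly_roots_bound[OF nz] by simp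
qed

lemma lagr:
  assumes inj: "inj_on z {..<n}" and k: "k < n"
  shows "m < n \<Longrightarrow> poly (lagr n z k) (z m) = (if m = k then 1 else 0)" "degree (lagr n z k) < n"
proof -
  have ne: "z k - z m \<noteq> 0" if "m \<in> {..<n} - {k}" for m using inj k that by (auto dest: inj_onD)
  show "poly (lagr n z k) (z m) = (if m = k then 1 else 0)" if "m < n"
  proof (cases "m = k")
    case True
    have "poly (smult (inverse (z k - z l)) [:- z l, 1:]) (z k) = 1" if "l \<in> {..<n} - {k}" for l
    proof -
      have "poly (smult (inverse (z k - z l)) [:- z l, 1:]) (z k) = inverse (z k - z l) * (z k - z l)"
        by (simp add: algebra_simps)
      thus ?thesis using ne[OF that] by simp
    qed
    thus ?thesis unfolding lagr_def poly_prod True by simp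
  next
    case False
    thus ?thesis unfolding lagr_def poly_prod using that by (auto intro!: prod_zero bexI[of _ m])
  qed
  have "degree (lagr n z k) \<le> (\<Sum>m\<in>{..<n} - {k}. 1)"
  proof -
    have "degree (smult c [:a, 1:]) \<le> 1" for a c :: 'a
      by (rule order.trans[OF degree_smult_le]) simp
    thus ?thesis unfolding lagr_def
      by (intro order.trans[OF degree_prod_sum_le sum_mono]) (auto simp del: smult_pCons)
  qed
  thus "degree (lagr n z k) < n" using k by simp
qed

lemma lagr_in_polys_over:
  assumes K: "is_subfield K" and "\<And>m. m < n \<Longrightarrow> z m \<in> K" "k < n"
  shows "lagr n z k \<in> polys_over K"
proof -
  note R = is_subfield_subring[OF K]
  note D = is_subringD[OF R] is_subfieldD[OF K]
  show ?thesis unfolding lagr_def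
  proof (rule is_subring_prod[OF is_subring_polys_over[OF R]])
    fix m assume "m \<in> {..<n} - {k}"
    hence "z m \<in> K" "z k \<in> K" using assms by auto
    moreover from this have "inverse (z k - z m) \<in> K" by (intro D)
    ultimately show "smult (inverse (z k - z m)) [:- z m, 1:] \<in> polys_over K"
      using D(4,5) zero_in_polys_over[OF R] by simp
  qed
qed

definition interp :: "nat \<Rightarrow> (nat \<Rightarrow> 'a::field) \<Rightarrow> (nat \<Rightarrow> 'a) \<Rightarrow> 'a poly" where
  "interp n z c = (\<Sum>k<n. smult (c k) (lagr n z k))"

lemma interp:
  assumes "inj_on z {..<n}"
  shows "m < n \<Longrightarrow> poly (interp n z c) (z m) = c m" "interp n z c = 0 \<or> degree (interp n z c) < n"
proof -
  show "poly (interp n z c) (z m) = c m" if "m < n"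
  proof -
    have "poly (interp n z c) (z m) = (\<Sum>k<n. if m = k then c k else 0)"
      unfolding interp_def poly_sum poly_smult using lagr(1)[OF assms _ that] by (intro sum.cong) auto
    thus ?thesis using that by simp
  qed
  show "interp n z c = 0 \<or> degree (interp n z c) < n"
  proof (cases "n = 0")
    case False
    have "degree (interp n z c) \<le> n - 1" unfolding interp_def
      by (intro degree_sum_le) (use lagr(2)[OF assms] in \<open>fastforce intro: order.trans[OF degree_smult_le]\<close>)+
    thus ?thesis using False by auto
  qed (simp add: interp_def)
qed

lemma interp_in_polys_over:
  assumes K: "is_subfield K" and "\<And>m. m < n \<Longrightarrow> z m \<in> K" "\<And>m. m < n \<Longrightarrow> c m \<in> K"
  shows "interp n z c \<in> polys_over K"
proof -
  note R = is_subfield_subring[OF K]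
  have "smult (c k) (lagr n z k) \<in> polys_over K" if "k < n" for k
    using lagr_in_polys_over[OF K assms(2) that] assms(3)[OF that] is_subringD(4)[OF R] by (simp add: polys_over_def)
  thus ?thesis unfolding interp_def by (intro is_subring_sum is_subring_polys_over[OF R]) auto
qed

text \<open>The coefficients of the Lagrange polynomials form the inverse of the Vandermonde matrix,
  because interpolation reproduces X^l.\<close>

lemma interp_coeff_formula:
  assumes "inj_on z {..<n}" "i < n" "l < n"
  shows "(\<Sum>k<n. z k ^ l * coeff (lagr n z k) i) = (if i = l then 1 else 0)"
proof -
  have "interp n z (\<lambda>k. z k ^ l) = monom 1 l"
    by (rule poly_eqI_points[OF assms(1) interp(2)[OF assms(1)]])
      (use assms interp(1)[OF assms(1)] in \<open>auto simp: poly_monom degree_monom_eq\<close>)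
  hence "coeff (interp n z (\<lambda>k. z k ^ l)) i = (if i = l then 1 else 0)" by auto
  thus ?thesis by (simp add: interp_def coeff_sum)
qed

lemma poly_as_sum_lt:
  fixes P :: "'a::comm_semiring_1 poly"
  assumes "P = 0 \<or> degree P < n"
  shows "poly P x = (\<Sum>i<n. coeff P i * x ^ i)"
proof (cases "P = 0")
  case False
  hence "(\<Sum>i\<le>degree P. coeff P i * x ^ i) = (\<Sum>i<n. coeff P i * x ^ i)"
    using assms by (intro sum.mono_neutral_left) (auto simp: coeff_eq_0)
  thus ?thesis by (simp add: poly_altdef)
qed simp

section \<open>Denominators in the splitting algebra\<close>

context splitting
begin

text \<open>The bound on the number of roots, modulo \<open>J\<close>: one root after another is
  divided out, which the unit differences allow.\<close>

lemma coeffs_in_ideal: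
  assumes "m \<le> n" "V = 0 \<or> degree V < m" "\<And>k. k < m \<Longrightarrow> poly V (Z k) \<in> J"
  shows "coeff V i \<in> J"
  using assms
proof (induction m arbitrary: V i)
  case 0
  thus ?case using is_idealD(1)[OF J] by simp
next
  case (Suc m)
  define W where "W = synthetic_div V (Z m)"
  have V: "V = [:- Z m, 1:] * W + [:poly V (Z m):]"
    unfolding W_def by (rule synthetic_div_correct'[symmetric])
  have "W = 0 \<or> degree W < m"
    using Suc.prems(2) by (cases m) (auto simp: W_def degree_synthetic_div synthetic_div_eq_0_iff)
  moreover have "poly W (Z k) \<in> J" if k: "k < m" for k
  proof -
    have "poly V (Z k) = (Z k - Z m) * poly W (Z k) + poly V (Z m)" by (subst V) (simp add: algebra_simps)
    hence "(Z k - Z m) * poly W (Z k) = poly V (Z k) - poly V (Z m)" by simp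
    also have "\<dots> \<in> J" using Suc.prems(3) k by (intro is_idealD(6)[OF J]) auto
    finally have 1: "(Z k - Z m) * poly W (Z k) \<in> J" .
    obtain w where w: "w * (Z k - Z m) - 1 \<in> J" using units[of k m] k Suc.prems(1) by auto
    have "poly W (Z k) = w * ((Z k - Z m) * poly W (Z k)) - (w * (Z k - Z m) - 1) * poly W (Z k)"
      by (simp add: algebra_simps)
    also have "\<dots> \<in> J" by (rule is_idealD(6)[OF J is_idealD(3)[OF J 1] is_idealD(4)[OF J w]])
    finally show ?thesis .
  qed
  ultimately have W: "coeff W i \<in> J" for i using Suc.IH[of W] Suc.prems(1) by simp
  have "coeff V i = coeff (pCons 0 W) i - Z m * coeff W i + coeff [:poly V (Z m):] i"
    by (subst V) simp
  also have "\<dots> \<in> J"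
    using W is_idealD[OF J] Suc.prems(3)[of m] by (auto simp: coeff_pCons split: nat.split)
  finally show ?case .
qed

lemma S_subset:
  assumes "is_subring T" "R0 \<subseteq> T" "J \<subseteq> T" "\<And>k. k < n \<Longrightarrow> Z k \<in> T" "k \<le> n"
  shows "S k \<subseteq> T"
  using assms(5)
proof (induction k)
  case 0
  show ?case using is_subringD(3)[OF assms(1)] assms(2,3) by (auto simp: subset_iff)
next
  case (Suc k)
  thus ?case using assms(4)[of k] by (auto intro!: is_subring_sum[OF assms(1)] is_subringD[OF assms(1)])
qed

text \<open>Elements that enter \<open>S n\<close> after multiplication by some
  \<open>d \<in> S n\<close> that is a unit modulo \<open>J\<close>; the inverse \<open>w\<close>
  need not lie in \<open>S n\<close>. The coefficients of U are of this kind.\<close>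

definition L :: "'r set" where
  "L = {F. \<exists>d w. w * d - 1 \<in> J \<and> d \<in> S n \<and> d * F \<in> S n}"

lemma unit_mult:
  assumes "w * d - 1 \<in> J" "w' * d' - 1 \<in> J"
  shows "(w * w') * (d * d') - 1 \<in> J"
proof -
  have "(w * w') * (d * d') - 1 = (w * d - 1) * (w' * d') + (w' * d' - 1)" by (simp add: algebra_simps)
  thus ?thesis using assms is_idealD[OF J] by metis
qed

lemma S_sub_L: "S n \<subseteq> L"
proof
  fix F assume "F \<in> S n"
  moreover have "1 * 1 - 1 \<in> J" using is_idealD(1)[OF J] by simp
  ultimately show "F \<in> L" unfolding L_def using is_subringD(2)[OF conjunct1[OF S_ring[of n]]]
    by (metis (mono_tags, lifting) mem_Collect_eq mult_1 order_refl)
qed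

lemma is_subring_L: "is_subring L"
proof -
  note D = is_subringD[OF conjunct1[OF S_ring[of n]], OF order_refl]
  have "F + G \<in> L \<and> F * G \<in> L" if FG: "F \<in> L" "G \<in> L" for F G
  proof -
    obtain d w where d: "w * d - 1 \<in> J" "d \<in> S n" "d * F \<in> S n" using FG(1) by (auto simp: L_def)
    obtain d' w' where d': "w' * d' - 1 \<in> J" "d' \<in> S n" "d' * G \<in> S n" using FG(2) by (auto simp: L_def)
    have "(d * d') * (F + G) = d' * (d * F) + d * (d' * G)" "(d * d') * (F * G) = (d * F) * (d' * G)"
      by (simp_all add: algebra_simps)
    moreover have "d' * (d * F) + d * (d' * G) \<in> S n" "(d * F) * (d' * G) \<in> S n" "d * d' \<in> S n"
      using d d' D(3,4) by auto
    ultimately have "(d * d') * (F + G) \<in> S n" "(d * d') * (F * G) \<in> S n" "d * d' \<in> S n" by metis+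
    thus ?thesis using unit_mult[OF d(1) d'(1)] by (auto simp: L_def)
  qed
  moreover have "- F \<in> L" if "F \<in> L" for F using that D(5) by (auto simp: L_def)
  moreover have "0 \<in> L" "1 \<in> L" using S_sub_L D(1,2) by auto
  ultimately show ?thesis by (auto simp: is_subring_def)
qed

text \<open>The denominator is multiplied in and cancelled at the end. The vanishing hypothesis
  concerns only multiples of \<open>F\<close> in \<open>S n\<close>, since these can be expressed
  through parameters and roots.\<close>

lemma in_ideal_if_vanishing_L:
  fixes E :: "('r \<Rightarrow> 'e::idom) set"
  assumes E: "\<And>e. e \<in> E \<Longrightarrow> rhom e" "\<And>e j. e \<in> E \<Longrightarrow> j \<in> J \<Longrightarrow> e j = 0"
    and swap: "\<And>e k m. e \<in> E \<Longrightarrow> k \<le> m \<Longrightarrow> m < n \<Longrightarrow> \<exists>d\<in>E. (\<forall>r\<in>R0. d r = e r) \<and>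
      (\<forall>i<n. d (Z i) = e (Z (transpose k m i)))"
    and base: "\<And>r. r \<in> R0 \<Longrightarrow> (\<And>e. e \<in> E \<Longrightarrow> e r = 0) \<Longrightarrow> r \<in> J"
    and F: "F \<in> L" "\<And>G e. e \<in> E \<Longrightarrow> G \<in> S n \<Longrightarrow> (\<exists>d. G = d * F) \<Longrightarrow> e G = 0"
  shows "F \<in> J"
proof -
  obtain d w where d: "w * d - 1 \<in> J" "d \<in> S n" "d * F \<in> S n" using F(1) by (auto simp: L_def)
  have "d * F \<in> J"
  proof (rule in_ideal_if_vanishing[of E])
    show "d * F \<in> S n" "n \<le> n" using d by auto
    show "e (d * F) = 0" if "e \<in> E" for e using F(2)[OF that d(3)] by blast
  qed (use E swap base in auto)
  moreover have "F = w * (d * F) - (w * d - 1) * F" by (simp add: algebra_simps)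
  ultimately show ?thesis using d(1) is_idealD[OF J] by metis
qed

text \<open>If \<open>U(Z\<^sub>k) \<equiv> c\<^sub>k\<close> modulo \<open>J\<close>, Lagrange interpolation expresses the coefficients of \<open>U\<close>.\<close>

lemma interpolated_in_L:
  assumes U: "U = 0 \<or> degree U < n" "\<And>k. k < n \<Longrightarrow> poly U (Z k) - c k \<in> J" "\<And>k. k < n \<Longrightarrow> c k \<in> S n"
  shows "coeff U i \<in> L"
proof -
  have Sn: "is_subring (S n)" using S_ring[of n] by simp
  note D = is_subringD[OF Sn]
  note DP = is_subringD[OF is_subring_polys_over[OF Sn]]
  have ZS: "k < n \<Longrightarrow> Z k \<in> S n" for k by (rule Z_in_S)
  define e where "e k = (\<Prod>m\<in>{..<n} - {k}. Z k - Z m)" for k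
  have eu: "\<exists>w. w * e k - 1 \<in> J" if "k < n" for k
  proof -
    have "\<exists>w. w * (\<Prod>m\<in>B. Z k - Z m) - 1 \<in> J" if "B \<subseteq> {..<n} - {k}" for B
    proof -
      have "finite B" using that finite_subset by blast
      thus ?thesis using that
    proof (induction B rule: finite_induct)
      case empty
      thus ?case using is_idealD(1)[OF J] by (intro exI[of _ 1]) simp
    next
      case (insert m B)
      then obtain w where "w * (\<Prod>m\<in>B. Z k - Z m) - 1 \<in> J" by auto
      moreover obtain w' where "w' * (Z k - Z m) - 1 \<in> J" using units[of k m] insert.prems \<open>k < n\<close> by auto
      ultimately have "(w' * w) * ((Z k - Z m) * (\<Prod>m\<in>B. Z k - Z m)) - 1 \<in> J" using unit_mult by blast
      thus ?case using insert.hyps by auto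
    qed
    qed
    thus ?thesis unfolding e_def by blast
  qed
  define d where "d = (\<Prod>k<n. e k)"
  have du: "\<exists>w. w * d - 1 \<in> J"
  proof -
    have "\<exists>w. w * (\<Prod>k<m. e k) - 1 \<in> J" if "m \<le> n" for m
      using that
    proof (induction m)
      case 0
      thus ?case using is_idealD(1)[OF J] by (intro exI[of _ 1]) simp
    next
      case (Suc m)
      then obtain w w' where "w * (\<Prod>k<m. e k) - 1 \<in> J" "w' * e m - 1 \<in> J" using eu[of m] by auto
      from unit_mult[OF this] show ?case by auto
    qed
    thus ?thesis unfolding d_def by blast
  qed
  have eS: "k < n \<Longrightarrow> e k \<in> S n" for k unfolding e_def by (rule is_subring_prod[OF Sn]) (auto intro: D ZS)
  have dS: "d \<in> S n" unfolding d_def by (rule is_subring_prod[OF Sn]) (auto intro: eS)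
  define lg where "lg k = (\<Prod>m\<in>{..<n} - {k}. [:- Z m, 1:])" for k
  \<comment> \<open>With \<open>e k\<close> the value of \<open>lg k\<close> at \<open>Z k\<close>
    and \<open>d\<close> the product of all \<open>e k\<close>, this is \<open>c k * d / e k\<close>
    without a division: Lagrange interpolation of the values \<open>c\<close> multiplied by
    \<open>d\<close>.\<close>
  define a where "a k = c k * (\<Prod>l\<in>{..<n} - {k}. e l)" for k
  define V where "V = smult d U - (\<Sum>k<n. smult (a k) (lg k))"
  have lgZ: "poly (lg k) (Z m) = (if m = k then e k else 0)" if "m < n" "k < n" for m k
    unfolding lg_def poly_prod e_def using that by (auto intro!: prod_zero bexI[of _ m])
  have "poly V (Z m) \<in> J" if m: "m < n" for m
  proof -
    have "(\<Sum>k<n. a k * poly (lg k) (Z m)) = (\<Sum>k<n. if m = k then a k * e k else 0)"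
      using lgZ[OF m] by (intro sum.cong) auto
    also have "\<dots> = c m * d" using m
      by (simp add: a_def d_def prod.remove[of "{..<n}" m e] mult_ac)
    finally have "poly V (Z m) = d * (poly U (Z m) - c m)"
      by (simp add: V_def poly_sum algebra_simps)
    thus ?thesis using U(2)[OF m] is_idealD(3)[OF J] by simp
  qed
  moreover have "V = 0 \<or> degree V < n"
  proof (cases "n = 0")
    case True
    thus ?thesis using U(1) by (simp add: V_def)
  next
    case False
    have "degree (lg k) \<le> n - 1" if "k < n" for k
      unfolding lg_def by (rule order.trans[OF degree_prod_sum_le]) (use that in auto)
    hence "degree (\<Sum>k<n. smult (a k) (lg k)) \<le> n - 1"
      by (intro degree_sum_le) (auto intro: order.trans[OF degree_smult_le])
    moreover have "degree (smult d U) \<le> n - 1"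
      by (rule order.trans[OF degree_smult_le]) (use U(1) in auto)
    ultimately have "degree V \<le> n - 1" unfolding V_def by (intro degree_diff_le)
    thus ?thesis using False by auto
  qed
  ultimately have "coeff V i \<in> J" using coeffs_in_ideal[of n V i] by simp
  hence VS: "coeff V i \<in> S n" using J_S by blast
  have "lg k \<in> polys_over (S n)" if "k < n" for k
    unfolding lg_def by (rule is_subring_prod[OF is_subring_polys_over[OF Sn]])
      (use D ZS zero_in_polys_over[OF Sn] in auto)
  moreover have "a k \<in> S n" if "k < n" for k
    unfolding a_def by (intro D U(3) that is_subring_prod[OF Sn]) (auto intro: eS)
  ultimately have "coeff (\<Sum>k<n. smult (a k) (lg k)) i \<in> S n"
    unfolding coeff_sum coeff_smult by (intro is_subring_sum[OF Sn] D) (auto simp: polys_over_def)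
  moreover have "d * coeff U i = coeff V i + coeff (\<Sum>k<n. smult (a k) (lg k)) i" by (simp add: V_def)
  ultimately have "d * coeff U i \<in> S n" using VS D(3) by simp
  thus ?thesis using du dS by (auto simp: L_def)
qed

end

section \<open>Bezout identities, and density of the parameters with squarefree fibre\<close>

lemma bezout_field_poly:
  fixes a b :: "'a::field poly"
  shows "\<exists>u v. (u * a + v * b) dvd a \<and> (u * a + v * b) dvd b"
\<comment> \<open>The zero polynomial and the nonzero constants have the same degree, so the measure
  separates them.\<close>
proof (induction "if b = 0 then 0 else Suc (degree b)" arbitrary: a b rule: less_induct)
  case less
  show ?case
  proof (cases "b = 0")
    case True
    thus ?thesis by (intro exI[of _ 1] exI[of _ 0]) simp
  next
    case False
    have "(if a mod b = 0 then 0 else Suc (degree (a mod b))) < (if b = 0 then 0 else Suc (degree b))"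
      using False degree_mod_less[of b a] by auto
    from less[OF this] obtain u v where d: "(u * b + v * (a mod b)) dvd b" "(u * b + v * (a mod b)) dvd a mod b" by blast
    have eq: "v * a + (u - v * (a div b)) * b = u * b + v * (a mod b)"
      by (simp add: minus_div_mult_eq_mod[symmetric] algebra_simps)
    have "(u * b + v * (a mod b)) dvd a" using d by (metis dvd_add dvd_mult mult_div_mod_eq mult.commute)
    thus ?thesis using d(1) eq by metis
  qed
qed

lemma coprime_bezout_field_poly:
  fixes a b :: "'a::field poly"
  assumes "coprime a b"
  shows "\<exists>u v. u * a + v * b = 1"
proof -
  obtain u v where d: "(u * a + v * b) dvd a" "(u * a + v * b) dvd b" using bezout_field_poly by blast
  hence "(u * a + v * b) dvd 1" using assms by (metis not_coprimeI)
  then obtain w where "1 = (u * a + v * b) * w" by blast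
  hence "(w * u) * a + (w * v) * b = 1" by (simp add: algebra_simps)
  thus ?thesis by blast
qed

context family_ac
begin

text \<open>For fixed t_1, a multiple root x of f_t is a root of \<open>W t1\<close> and determines
  t_0. Hence all but finitely many t_0 give a squarefree polynomial, provided \<open>W t1\<close> is
  not zero.\<close>

lemma parameters_dense:
  assumes r: "r \<in> mpols UNIV 2"
    and van: "\<And>t0 t1. rsquarefree (fam_poly A b \<xi> t0 t1) \<Longrightarrow> ev id (\<lambda>i. if i = 0 then t0 else t1) r = 0"
  shows "r = 0"
proof (rule ccontr)
  assume "r \<noteq> 0"
  define W where "W t1 = pderiv A * b - A * pderiv b + smult t1 (b ^ 2)" for t1
  have "b \<noteq> 0" using b_\<xi> by auto
  \<comment> \<open>Two of the polynomials \<open>W t1\<close> differ by a nonzero multiple of b^2,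
    so at most one of them vanishes.\<close>
  obtain \<tau> where \<tau>: "\<And>t1. t1 \<noteq> \<tau> \<Longrightarrow> W t1 \<noteq> 0"
  proof (cases "\<exists>\<tau>. W \<tau> = 0")
    case True
    then obtain \<tau> where "W \<tau> = 0" by blast
    have "W t1 \<noteq> 0" if "t1 \<noteq> \<tau>" for t1
    proof
      assume "W t1 = 0"
      hence "W t1 - W \<tau> = 0" using \<open>W \<tau> = 0\<close> by simp
      hence "smult (t1 - \<tau>) (b ^ 2) = 0" by (simp add: W_def smult_diff_left)
      thus False using that \<open>b \<noteq> 0\<close> by simp
    qed
    thus ?thesis using that by blast
  qed (use that in blast)
  \<comment> \<open>The additional factor makes the point found below avoid \<open>\<tau>\<close> in
    its second coordinate.\<close>
  let ?r = "r * (Var 1 - Cst \<tau>)"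
  have M: "is_subring (mpols (UNIV :: 'k set) 2)" by (rule is_subring_mpols) simp
  have rM: "?r \<in> mpols UNIV 2"
    by (intro is_subringD[OF M] r Var_in_mpols Cst_in_mpols) auto
  have "Var 1 - Cst \<tau> \<noteq> (0 :: 'k mpol)"
  proof
    assume "Var 1 - Cst \<tau> = (0 :: 'k mpol)"
    hence "ev id (\<lambda>_. \<tau> + 1) (Var 1 - Cst \<tau>) = 0" by (simp add: rhom.zero[OF rhom.rhom_ev[OF rhom_id(1)]])
    thus False by (simp add: rhom.diff[OF rhom.rhom_ev[OF rhom_id(1)]] rhom.ev_Var[OF rhom_id(1)] rhom.ev_Cst[OF rhom_id(1)])
  qed
  hence "?r \<noteq> 0" using \<open>r \<noteq> 0\<close> by simp
  then obtain s where "ev id s ?r \<noteq> 0"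
    using mpols_eq_0I[OF rM rhom_id(1) infinite_UNIV_alg_closed] by blast
  hence s: "ev id s r \<noteq> 0" "s 1 \<noteq> \<tau>"
    by (auto simp: rhom.mult[OF rhom.rhom_ev[OF rhom_id(1)]] rhom.diff[OF rhom.rhom_ev[OF rhom_id(1)]]
        rhom.ev_Var[OF rhom_id(1)] rhom.ev_Cst[OF rhom_id(1)])
  define t1 where "t1 = s 1"
  have hc: "rhom (\<lambda>c :: 'k. [:c:])" by unfold_locales (simp_all add: one_pCons)
  define q where "q = ev (\<lambda>c. [:c:]) (\<lambda>i. if i = (0 :: nat) then [:0, 1:] else [:t1:]) r"
  have hp: "rhom (\<lambda>p :: 'k poly. poly p t)" for t by unfold_locales simp_all
  have pq: "poly q t = ev id (\<lambda>i. if i = 0 then t else t1) r" for t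
  proof -
    have "(\<lambda>i. poly (if i = (0 :: nat) then [:0, 1:] else [:t1:]) t) = (\<lambda>i. if i = 0 then t else t1)"
      by auto
    thus ?thesis unfolding q_def ev_hom[OF hp hc] by (simp add: id_def)
  qed
  have "ev id (\<lambda>i. if i = 0 then s 0 else t1) r = ev id s r"
    by (rule ev_cong[OF r]) (auto simp: t1_def less_2_cases_iff)
  hence "poly q (s 0) \<noteq> 0" using s(1) pq by simp
  hence q0: "q \<noteq> 0" by auto
  let ?B = "(\<lambda>x. - (poly A x / poly b x) - t1 * (x - \<xi>)) ` {x. poly (W t1) x = 0}"
  have "finite ({t. poly q t = 0} \<union> ?B)"
    using q0 \<tau>[of t1] s(2) by (intro finite_UnI finite_imageI poly_roots_finite) (auto simp: t1_def)
  then obtain t0 where t0: "poly q t0 \<noteq> 0" "t0 \<notin> ?B"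
    using infinite_UNIV_alg_closed[where 'a = 'k] by (metis (mono_tags, lifting) UNIV_eq_I Un_iff mem_Collect_eq)
  have "rsquarefree (fam_poly A b \<xi> t0 t1)"
    unfolding rsquarefree_iff_no_double_root
  proof (intro conjI allI notI)
    show "fam_poly A b \<xi> t0 t1 = 0 \<Longrightarrow> False" using fam_monic(2)[of t0 t1] by simp
    fix x assume x: "poly (fam_poly A b \<xi> t0 t1) x = 0 \<and> poly (pderiv (fam_poly A b \<xi> t0 t1)) x = 0"
    define c where "c = t0 + t1 * (x - \<xi>)"
    have b0: "poly b x \<noteq> 0" using x b_nonzero_at_root by blast
    have c: "poly A x + poly b x * c = 0" using x by (simp add: poly_fam_poly c_def)
    have "poly (pderiv (fam_poly A b \<xi> t0 t1)) x = poly (pderiv A) x + poly (pderiv b) x * c + poly b x * t1"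
      by (simp add: fam_poly_def pderiv_add pderiv_mult pderiv_pCons c_def algebra_simps del: mult_pCons_right)
    hence d: "poly (pderiv A) x + poly (pderiv b) x * c + poly b x * t1 = 0" using x by simp
    have "poly (W t1) x = poly b x * (poly (pderiv A) x + poly (pderiv b) x * c + poly b x * t1)
        - poly (pderiv b) x * (poly A x + poly b x * c)"
      by (simp add: W_def algebra_simps power2_eq_square)
    hence "poly (W t1) x = 0" using c d by simp
    moreover have "c = - (poly A x / poly b x)" using c b0 by (simp add: field_simps add_eq_0_iff)
    hence "t0 = - (poly A x / poly b x) - t1 * (x - \<xi>)" by (simp add: c_def algebra_simps)
    ultimately show False using t0(2) by blast
  qed
  from van[OF this] show False using t0(1) pq by simp
qed

end

section \<open>The twisted form of the splitting cover, by equations\<close>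

lemma rhom_to_univ: "rhom (to_univ :: 'm::field \<Rightarrow> _)"
proof -
  have eq: "(to_univ :: 'm \<Rightarrow> _) = (\<lambda>c. to_ac (to_fract (Cst c)))"
    by (auto simp: to_univ_def to_fract_def Cst_def)
  have "rhom (to_fract :: 'm mpol \<Rightarrow> _)" by unfold_locales simp_all
  from rhom_comp[OF rhom_to_ac rhom_comp[OF this rhom_Cst]] show ?thesis unfolding eq .
qed

locale pac_variety = family A b g \<xi> n
  for A b g :: "'m::field poly" and \<xi> n +
  fixes p :: "'m poly" and \<theta> :: "nat \<Rightarrow> 'm univ_dom"
  assumes p_deg: "degree p = n" and p_irr: "irreducible p" and p_sep: "rsquarefree (map_poly to_univ p)"
    and \<theta>_inj: "inj_on \<theta> {..<n}" and \<theta>_root: "k < n \<Longrightarrow> poly (map_poly to_univ p) (\<theta> k) = 0"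
begin

text \<open>The coordinates are \<open>(t\<^sub>0, t\<^sub>1, y\<^sub>0, \<dots>, y\<^bsub>n-1\<^esub>, u\<^sub>0, \<dots>, u\<^bsub>n-1\<^esub>)\<close>. With \<open>Y = \<Sum> y\<^sub>i X\<^sup>i\<close> and
  \<open>U = \<Sum> u\<^sub>i X\<^sup>i\<close> the equations say that \<open>p\<close> divides \<open>f\<^sub>t(Y)\<close> and \<open>U(Y) - X\<close>: thus \<open>Y\<close> maps the roots
  \<open>\<theta>\<^sub>k\<close> of \<open>p\<close> to roots of \<open>f\<^sub>t\<close>, and these are distinct because \<open>U\<close> maps them back.\<close>

definition N where "N = 2 * n + 2"

definition fT :: "'m mpol poly" where
  "fT = map_poly Cst A + map_poly Cst b * [:Var 0 - Var 1 * Cst \<xi>, Var 1:]"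

definition Yp :: "'m mpol poly" where "Yp = (\<Sum>i<n. monom (Var (2 + i)) i)"

definition Up :: "'m mpol poly" where "Up = (\<Sum>i<n. monom (Var (2 + n + i)) i)"

text \<open>The i-th coefficient of the remainder of \<open>G\<close> modulo \<open>p\<close>, built
  by linearity from the remainders of the powers of X; division thus takes place over M
  only.\<close>

definition rm :: "'m mpol poly \<Rightarrow> nat \<Rightarrow> 'm mpol" where
  "rm G i = (\<Sum>m\<le>degree G. coeff G m * Cst (coeff (monom 1 m mod p) i))"

definition G1 where "G1 = pcompose fT Yp"
definition G2 where "G2 = pcompose Up Yp - [:0, 1:]"

definition Hm where "Hm = rm G1 ` {..<n} \<union> rm G2 ` {..<n}"

definition H where "H = mapc to_univ ` Hm"

lemma n_pos: "0 < n" using deg_g by simp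

lemma rm_eval:
  fixes \<eta> :: "'m mpol \<Rightarrow> 'r::comm_ring_1"
  assumes "rhom \<eta>" "poly (map_poly (\<lambda>c. \<eta> (Cst c)) p) t = 0"
  shows "(\<Sum>i<n. \<eta> (rm G i) * t ^ i) = poly (map_poly \<eta> G) t"
proof -
  interpret rhom \<eta> by fact
  interpret c: rhom "\<lambda>c. \<eta> (Cst c)" by (rule rhom_comp[OF assms(1) rhom_Cst])
  have tm: "(\<Sum>i<n. \<eta> (Cst (coeff (monom 1 m mod p) i)) * t ^ i) = t ^ m" for m
  proof -
    let ?r = "monom 1 m mod p"
    have p0: "p \<noteq> 0" using p_deg n_pos by auto
    have dr: "?r = 0 \<or> degree ?r < n" using degree_mod_less[OF p0, of "monom 1 m"] p_deg by simp
    have "map_poly (\<lambda>c. \<eta> (Cst c)) ?r = 0 \<or> degree (map_poly (\<lambda>c. \<eta> (Cst c)) ?r) < n"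
      using dr le_less_trans[OF map_poly_degree_leq] by auto
    hence "(\<Sum>i<n. \<eta> (Cst (coeff ?r i)) * t ^ i) = poly (map_poly (\<lambda>c. \<eta> (Cst c)) ?r) t"
      by (subst poly_as_sum_lt[of _ n]) simp_all
    also have "\<dots> = poly (map_poly (\<lambda>c. \<eta> (Cst c)) (p * (monom 1 m div p) + ?r)) t"
      by (simp only: c.map_poly_add c.map_poly_mult poly_add poly_mult assms(2)) simp
    also have "p * (monom 1 m div p) + ?r = monom 1 m" by simp
    finally show ?thesis by (simp add: poly_monom c.one)
  qed
  have "(\<Sum>i<n. \<eta> (rm G i) * t ^ i) = (\<Sum>i<n. \<Sum>m\<le>degree G. \<eta> (coeff G m) * (\<eta> (Cst (coeff (monom 1 m mod p) i)) * t ^ i))"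
    by (simp add: rm_def sum sum_distrib_right mult.assoc)
  also have "\<dots> = (\<Sum>m\<le>degree G. \<eta> (coeff G m) * (\<Sum>i<n. \<eta> (Cst (coeff (monom 1 m mod p) i)) * t ^ i))"
    by (subst sum.swap) (simp add: sum_distrib_left)
  also have "\<dots> = (\<Sum>m\<le>degree G. coeff (map_poly \<eta> G) m * t ^ m)" by (simp add: tm)
  also have "\<dots> = (\<Sum>m<Suc (degree G). coeff (map_poly \<eta> G) m * t ^ m)" by (simp only: lessThan_Suc_atMost)
  also have "\<dots> = poly (map_poly \<eta> G) t"
    by (rule poly_as_sum_lt[symmetric]) (simp add: le_imp_less_Suc map_poly_degree_leq)
  finally show ?thesis .
qed

lemma polys_in: "fT \<in> polys_over (mpols UNIV 2)" "fT \<in> polys_over (mpols UNIV N)"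
  "Yp \<in> polys_over (mpols UNIV N)" "Up \<in> polys_over (mpols UNIV N)"
  "G1 \<in> polys_over (mpols UNIV N)" "G2 \<in> polys_over (mpols UNIV N)"
proof -
  have M: "is_subring (mpols (UNIV :: 'm set) m)" for m by (rule is_subring_mpols) simp
  note P = is_subring_polys_over[OF M]
  note D = is_subringD[OF M] and DP = is_subringD[OF P]
  have V: "Var i \<in> mpols (UNIV :: 'm set) m" if "i < m" for i m by (rule Var_in_mpols) (use that in auto)
  have C: "Cst c \<in> mpols (UNIV :: 'm set) m" for c m by (rule Cst_in_mpols) simp
  have "map_poly Cst w \<in> polys_over (mpols (UNIV :: 'm set) m)" for w m
    by (simp add: polys_over_def rhom.coeff[OF rhom_Cst] C)
  moreover have "[:Var 0 - Var 1 * Cst \<xi>, Var 1:] \<in> polys_over (mpols UNIV 2)"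
    using D V C zero_in_polys_over[OF M, of 2] by simp
  ultimately show f2: "fT \<in> polys_over (mpols UNIV 2)" unfolding fT_def by (intro DP)
  have "2 \<le> N" by (simp add: N_def)
  thus fN: "fT \<in> polys_over (mpols UNIV N)" using f2 mpols_mono[of UNIV UNIV 2 N] by (auto simp: polys_over_def)
  show Y: "Yp \<in> polys_over (mpols UNIV N)" "Up \<in> polys_over (mpols UNIV N)"
    unfolding Yp_def Up_def by (intro is_subring_sum[OF P] monom_in_polys_over[OF M] V; simp add: N_def)+
  show "G1 \<in> polys_over (mpols UNIV N)" unfolding G1_def by (rule pcompose_in_polys_over[OF M fN Y(1)])
  have "[:0, 1:] \<in> polys_over (mpols (UNIV :: 'm set) N)" using D(1,2) zero_in_polys_over[OF M] by simp
  thus "G2 \<in> polys_over (mpols UNIV N)" unfolding G2_def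
    by (intro DP pcompose_in_polys_over[OF M Y(2,1)])
qed

lemma Hm_in: "h \<in> Hm \<Longrightarrow> h \<in> mpols UNIV N"
proof -
  have M: "is_subring (mpols (UNIV :: 'm set) N)" by (rule is_subring_mpols) simp
  have "rm G i \<in> mpols UNIV N" if "G \<in> polys_over (mpols UNIV N)" for G i
    unfolding rm_def using that
    by (intro is_subring_sum[OF M] is_subringD[OF M] Cst_in_mpols) (auto simp: polys_over_def)
  thus "h \<in> Hm \<Longrightarrow> h \<in> mpols UNIV N" using polys_in by (auto simp: Hm_def)
qed

lemma H_facts: "finite H" "h \<in> H \<Longrightarrow> h \<in> mpols (range to_univ) N" "h \<in> H \<Longrightarrow> h \<in> mpols UNIV N"
proof -
  show "finite H" by (simp add: H_def Hm_def)
  show *: "h \<in> H \<Longrightarrow> h \<in> mpols (range to_univ) N" using Hm_in mapc_in_mpols[OF rhom_to_univ _ UNIV_I] by (auto simp: H_def)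
  thus "h \<in> H \<Longrightarrow> h \<in> mpols UNIV N" using mpols_mono[of "range to_univ" UNIV N N] by blast
qed

subsection \<open>Zeros over an extension\<close>

text \<open>Points over an arbitrary extension of the universal domain: both that domain itself
  (\<open>e = id\<close>) and the Laurent series domain over it (\<open>e = emb\<close>)
  occur.\<close>

definition zeros :: "('m univ_dom \<Rightarrow> 'e::field) \<Rightarrow> (nat \<Rightarrow> 'e) set" where
  "zeros e = {x. \<forall>h\<in>H. ev e x h = 0}"

definition Zv :: "('m univ_dom \<Rightarrow> 'e::field) \<Rightarrow> (nat \<Rightarrow> 'e) \<Rightarrow> nat \<Rightarrow> 'e" where
  "Zv e x k = (\<Sum>i<n. x (2 + i) * e (\<theta> k) ^ i)"

definition Uv :: "(nat \<Rightarrow> 'e::field) \<Rightarrow> 'e \<Rightarrow> 'e" where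
  "Uv x t = (\<Sum>i<n. x (2 + n + i) * t ^ i)"

definition fE :: "('m univ_dom \<Rightarrow> 'e::field) \<Rightarrow> 'e \<Rightarrow> 'e \<Rightarrow> 'e poly" where
  "fE e t0 t1 = fam_poly (map_poly e (map_poly to_univ A)) (map_poly e (map_poly to_univ b)) (e (to_univ \<xi>)) t0 t1"

lemma fE_monic:
  fixes e :: "'m univ_dom \<Rightarrow> 'e::field"
  assumes "rhom e"
  shows "degree (fE e t0 t1) = n" "lead_coeff (fE e t0 t1) = 1"
proof -
  interpret a: family "map_poly to_univ A" "map_poly to_univ b" "map_poly to_univ g" "to_univ \<xi>" n
    by (rule family_map[OF rhom_to_univ])
  interpret c: family "map_poly e (map_poly to_univ A)" "map_poly e (map_poly to_univ b)"
    "map_poly e (map_poly to_univ g)" "e (to_univ \<xi>)" n by (rule a.family_map[OF assms])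
  show "degree (fE e t0 t1) = n" "lead_coeff (fE e t0 t1) = 1" unfolding fE_def by (rule c.fam_monic)+
qed

lemma poly_map_Yp_Up:
  fixes \<eta> :: "'m mpol \<Rightarrow> 'r::comm_ring_1"
  assumes "rhom \<eta>"
  shows "poly (map_poly \<eta> Yp) t = (\<Sum>i<n. \<eta> (Var (2 + i)) * t ^ i)"
    "poly (map_poly \<eta> Up) t = (\<Sum>i<n. \<eta> (Var (2 + n + i)) * t ^ i)"
  unfolding Yp_def Up_def rhom.map_poly_sum[OF assms] rhom.map_poly_monom[OF assms] poly_sum poly_monom by simp_all

lemma map_fT:
  fixes \<eta> :: "'m mpol \<Rightarrow> 'e::field"
  assumes "rhom \<eta>"
  shows "map_poly \<eta> fT = fam_poly (map_poly (\<lambda>c. \<eta> (Cst c)) A) (map_poly (\<lambda>c. \<eta> (Cst c)) b)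
    (\<eta> (Cst \<xi>)) (\<eta> (Var 0)) (\<eta> (Var 1))"
proof -
  interpret rhom \<eta> by fact
  have "map_poly \<eta> (map_poly Cst w) = map_poly (\<lambda>c. \<eta> (Cst c)) w" for w
    by (rule poly_eqI) (simp add: rhom.coeff[OF rhom_Cst] rhom.coeff[OF rhom_comp[OF assms rhom_Cst]])
  thus ?thesis unfolding fT_def fam_poly_def by simp
qed

lemma map_map_rhom:
  assumes "rhom e" "rhom h"
  shows "map_poly e (map_poly h w) = map_poly (\<lambda>c. e (h c)) w"
  by (rule poly_eqI) (simp add: rhom.coeff[OF assms(1)] rhom.coeff[OF assms(2)] rhom.coeff[OF rhom_comp[OF assms]])

text \<open>A remainder modulo \<open>p\<close> has degree below \<open>n\<close>, so it vanishes
  exactly when the polynomial vanishes at the \<open>n\<close> distinct roots of \<open>p\<close>.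
  Over the universal domain the twisted equations thus split into one pair of equations for each
  root.\<close>

lemma zeros_iff:
  fixes e :: "'m univ_dom \<Rightarrow> 'e::field"
  assumes e: "rhom e"
  shows "x \<in> zeros e \<longleftrightarrow> (\<forall>k<n. poly (fE e (x 0) (x 1)) (Zv e x k) = 0 \<and> Uv x (Zv e x k) = e (\<theta> k))"
proof -
  let ?h = "\<lambda>c. e (to_univ c)"
  have h: "rhom ?h" by (rule rhom_comp[OF e rhom_to_univ])
  define \<eta> where "\<eta> = ev ?h x"
  have \<eta>: "rhom \<eta>" unfolding \<eta>_def by (rule rhom.rhom_ev[OF h])
  interpret rhom \<eta> by (rule \<eta>)
  have \<eta>C: "\<eta> (Cst c) = ?h c" and \<eta>V: "\<eta> (Var i) = x i" for c i
    by (simp_all add: \<eta>_def rhom.ev_Cst[OF h] rhom.ev_Var[OF h])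
  have "x \<in> zeros e \<longleftrightarrow> (\<forall>h\<in>Hm. \<eta> h = 0)"
    by (simp add: zeros_def H_def \<eta>_def ev_mapc[OF e rhom_to_univ])
  also have "\<dots> \<longleftrightarrow> (\<forall>i<n. \<eta> (rm G1 i) = 0) \<and> (\<forall>i<n. \<eta> (rm G2 i) = 0)"
    by (auto simp: Hm_def)
  also have *: "(\<forall>i<n. \<eta> (rm G i) = 0) \<longleftrightarrow> (\<forall>k<n. poly (map_poly \<eta> G) (e (\<theta> k)) = 0)" for G
  proof -
    have root: "poly (map_poly (\<lambda>c. \<eta> (Cst c)) p) (e (\<theta> k)) = 0" if "k < n" for k
    proof -
      have "map_poly (\<lambda>c. \<eta> (Cst c)) p = map_poly e (map_poly to_univ p)"
        by (simp add: \<eta>C map_map_rhom[OF e rhom_to_univ])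
      thus ?thesis using rhom.poly[OF e, of "map_poly to_univ p" "\<theta> k"] \<theta>_root[OF that] by (simp add: rhom.zero[OF e])
    qed
    define c where "c = (\<Sum>i<n. monom (\<eta> (rm G i)) i)"
    have cc: "coeff c i = (if i < n then \<eta> (rm G i) else 0)" for i by (simp add: c_def coeff_sum coeff_monom)
    have pc: "poly c (e (\<theta> k)) = poly (map_poly \<eta> G) (e (\<theta> k))" if "k < n" for k
      using rm_eval[OF \<eta> root[OF that], of G] by (simp add: c_def poly_sum poly_monom)
    have inj: "inj_on (\<lambda>k. e (\<theta> k)) {..<n}"
      using \<theta>_inj by (simp add: inj_on_def rhom_eq_iff[OF e])
    have dc: "c = 0 \<or> degree c < n"
      using n_pos by (intro disjI2 degree_lessI) (auto simp: cc)
    show ?thesis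
    proof
      assume "\<forall>i<n. \<eta> (rm G i) = 0"
      hence "c = 0" by (simp add: poly_eq_iff cc)
      thus "\<forall>k<n. poly (map_poly \<eta> G) (e (\<theta> k)) = 0" using pc by auto
    next
      assume a: "\<forall>k<n. poly (map_poly \<eta> G) (e (\<theta> k)) = 0"
      have "c = 0" by (rule poly_eqI_points[OF inj dc]) (use a pc in auto)
      thus "\<forall>i<n. \<eta> (rm G i) = 0" using cc by (metis coeff_0)
    qed
  qed
  also note *
  also have "(\<forall>k<n. poly (map_poly \<eta> G1) (e (\<theta> k)) = 0) \<and> (\<forall>k<n. poly (map_poly \<eta> G2) (e (\<theta> k)) = 0)
     \<longleftrightarrow> (\<forall>k<n. poly (fE e (x 0) (x 1)) (Zv e x k) = 0 \<and> Uv x (Zv e x k) = e (\<theta> k))"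
  proof -
    have Y: "poly (map_poly \<eta> Yp) (e (\<theta> k)) = Zv e x k" for k
      unfolding poly_map_Yp_Up(1)[OF \<eta>] Zv_def \<eta>V ..
    have f: "map_poly \<eta> fT = fE e (x 0) (x 1)"
      unfolding map_fT[OF \<eta>] fE_def \<eta>C \<eta>V map_map_rhom[OF e rhom_to_univ] ..
    have "poly (map_poly \<eta> G1) (e (\<theta> k)) = poly (fE e (x 0) (x 1)) (Zv e x k)" for k
      unfolding G1_def map_poly_pcompose poly_pcompose Y f ..
    moreover have "poly (map_poly \<eta> G2) (e (\<theta> k)) = Uv x (Zv e x k) - e (\<theta> k)" for k
      unfolding G2_def map_poly_diff map_poly_pcompose poly_diff poly_pcompose Y poly_map_Yp_Up(2)[OF \<eta>] \<eta>V Uv_def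
      by simp
    ultimately show ?thesis by auto
  qed
  finally show ?thesis .
qed

text \<open>The point above (t0, t1) that belongs to a numbering \<open>z\<close> of the roots of
  f_t: Y interpolates \<theta>_k to z_k, and U interpolates back. The value \<open>undefined\<close>
  from \<open>N\<close> on makes it extensional.\<close>

definition point :: "('m univ_dom \<Rightarrow> 'e::field) \<Rightarrow> 'e \<Rightarrow> 'e \<Rightarrow> (nat \<Rightarrow> 'e) \<Rightarrow> nat \<Rightarrow> 'e" where
  "point e t0 t1 z i = (if i = 0 then t0 else if i = 1 then t1
     else if i < 2 + n then coeff (interp n (\<lambda>k. e (\<theta> k)) z) (i - 2)
     else if i < N then coeff (interp n z (\<lambda>k. e (\<theta> k))) (i - 2 - n) else undefined)"

lemma point:
  fixes e :: "'m univ_dom \<Rightarrow> 'e::field"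
  assumes e: "rhom e" and z: "inj_on z {..<n}" "\<And>k. k < n \<Longrightarrow> poly (fE e t0 t1) (z k) = 0"
  shows "point e t0 t1 z \<in> zeros e" "k < n \<Longrightarrow> Zv e (point e t0 t1 z) k = z k"
    "point e t0 t1 z 0 = t0" "point e t0 t1 z 1 = t1"
proof -
  let ?x = "point e t0 t1 z"
  have inj: "inj_on (\<lambda>k. e (\<theta> k)) {..<n}"
    using \<theta>_inj by (simp add: inj_on_def rhom_eq_iff[OF e])
  show Z: "Zv e ?x k = z k" if "k < n" for k
  proof -
    have "Zv e ?x k = (\<Sum>i<n. coeff (interp n (\<lambda>k. e (\<theta> k)) z) i * e (\<theta> k) ^ i)"
      unfolding Zv_def by (intro sum.cong) (auto simp: point_def)
    also have "\<dots> = poly (interp n (\<lambda>k. e (\<theta> k)) z) (e (\<theta> k))"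
      by (rule poly_as_sum_lt[symmetric, OF interp(2)[OF inj]])
    finally show ?thesis using interp(1)[OF inj that] by simp
  qed
  have U: "Uv ?x (z k) = e (\<theta> k)" if "k < n" for k
  proof -
    have "Uv ?x (z k) = (\<Sum>i<n. coeff (interp n z (\<lambda>k. e (\<theta> k))) i * z k ^ i)"
      unfolding Uv_def by (intro sum.cong) (auto simp: point_def N_def)
    also have "\<dots> = poly (interp n z (\<lambda>k. e (\<theta> k))) (z k)"
      by (rule poly_as_sum_lt[symmetric, OF interp(2)[OF z(1)]])
    finally show ?thesis using interp(1)[OF z(1) that] by simp
  qed
  show p01: "?x 0 = t0" "?x 1 = t1" by (simp_all add: point_def)
  show "?x \<in> zeros e" unfolding zeros_iff[OF e] p01 using Z U z(2) by simp
qed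

text \<open>U recovers \<theta>_k from the k-th root, so the roots found are distinct; being
  \<open>n\<close> in number, they are all the roots of the monic fibre polynomial.\<close>

lemma zeros_distinct:
  fixes e :: "'m univ_dom \<Rightarrow> 'e::field"
  assumes e: "rhom e" and x: "x \<in> zeros e"
  shows "inj_on (Zv e x) {..<n}" "fE e (x 0) (x 1) = (\<Prod>k<n. [:- Zv e x k, 1:])"
proof -
  have zx: "poly (fE e (x 0) (x 1)) (Zv e x k) = 0" "Uv x (Zv e x k) = e (\<theta> k)" if "k < n" for k
    using x that zeros_iff[OF e] by blast+
  show inj: "inj_on (Zv e x) {..<n}"
  proof (rule inj_onI)
    fix i k assume ik: "i \<in> {..<n}" "k \<in> {..<n}" "Zv e x i = Zv e x k"
    hence "e (\<theta> i) = e (\<theta> k)" using zx(2)[of i] zx(2)[of k] by simp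
    thus "i = k" using ik \<theta>_inj by (auto simp: rhom_eq_iff[OF e] dest: inj_onD)
  qed
  let ?f = "fE e (x 0) (x 1)" and ?P = "\<Prod>k<n. [:- Zv e x k, 1:]"
  have dP: "degree ?P = n" "lead_coeff ?P = 1"
    by (subst degree_prod_eq_sum_degree, simp, simp) (simp add: lead_coeff_prod)
  have "?f - ?P = 0 \<or> degree (?f - ?P) < n"
  proof -
    have "coeff (?f - ?P) n = 0" using fE_monic[OF e, of "x 0" "x 1"] dP by simp
    moreover have "degree (?f - ?P) \<le> n" using fE_monic(1)[OF e, of "x 0" "x 1"] dP by (intro degree_diff_le) auto
    ultimately show ?thesis by (metis leading_coeff_0_iff le_neq_implies_less)
  qed
  moreover have "poly (?f - ?P) (Zv e x k) = poly 0 (Zv e x k)" if "k < n" for k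
    using zx(1)[OF that] that by (auto simp: poly_prod intro!: prod_zero bexI[of _ k])
  ultimately have "?f - ?P = 0" using poly_eqI_points[OF inj, of "?f - ?P" 0] by blast
  thus "?f = ?P" by simp
qed

end

section \<open>The ideal of the equations as an instance of the splitting algebra\<close>

context pac_variety
begin

subsection \<open>The ideal of the variety\<close>

text \<open>The coefficients range over polynomials in all variables, which makes \<open>J\<close>
  an ideal of the whole ring; \<open>V_defined_over\<close> brings them down to \<open>N\<close>
  variables.\<close>

definition J :: "'m univ_dom mpol set" where
  "J = {\<Sum>h\<in>H. c h * h | c. True}"

text \<open>The value of Y at \<theta>_k as a polynomial function of the coordinates.\<close>

definition Zr :: "nat \<Rightarrow> 'm univ_dom mpol" where
  "Zr k = (\<Sum>i<n. Var (2 + i) * Cst (\<theta> k) ^ i)"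

definition fr :: "'m univ_dom mpol poly" where "fr = map_poly (mapc to_univ) fT"

lemma J_ideal: "is_ideal J"
proof -
  have "x + y \<in> J" if "x \<in> J" "y \<in> J" for x y
  proof -
    obtain c where "x = (\<Sum>h\<in>H. c h * h)" using \<open>x \<in> J\<close> unfolding J_def by blast
    moreover obtain d where "y = (\<Sum>h\<in>H. d h * h)" using \<open>y \<in> J\<close> unfolding J_def by blast
    ultimately have "x + y = (\<Sum>h\<in>H. (c h + d h) * h)" by (simp add: distrib_right sum.distrib)
    thus ?thesis by (auto simp: J_def)
  qed
  moreover have "r * x \<in> J" if "x \<in> J" for r x
  proof -
    obtain c where "x = (\<Sum>h\<in>H. c h * h)" using \<open>x \<in> J\<close> unfolding J_def by blast
    hence "r * x = (\<Sum>h\<in>H. (r * c h) * h)" by (simp add: sum_distrib_left mult.assoc)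
    thus ?thesis unfolding J_def by (intro CollectI exI[of _ "\<lambda>h. r * c h"]) simp
  qed
  moreover have "0 \<in> J" unfolding J_def by (rule CollectI, rule exI[of _ "\<lambda>_. 0"]) simp
  ultimately show ?thesis unfolding is_ideal_def by blast
qed

lemma H_in_J: "h \<in> H \<Longrightarrow> h \<in> J"
proof -
  assume h: "h \<in> H"
  have "(\<Sum>h'\<in>H. (if h' = h then 1 else 0) * h') = (\<Sum>h'\<in>H. if h' = h then h else 0)"
    by (intro sum.cong) auto
  also have "\<dots> = h" using h H_facts(1) by simp
  finally show ?thesis unfolding J_def by (intro CollectI exI[of _ "\<lambda>h'. if h' = h then 1 else 0"]) simp
qed

lemma J_zeros: "rhom e \<Longrightarrow> x \<in> zeros e \<Longrightarrow> F \<in> J \<Longrightarrow> ev e x F = 0"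
  by (auto simp: J_def zeros_def rhom.sum[OF rhom.rhom_ev] rhom.mult[OF rhom.rhom_ev])

lemma eta: "rhom (mapc to_univ :: 'm mpol \<Rightarrow> _)"
  by (rule rhom_mapc[OF rhom_to_univ])

lemma remainders_in_J:
  assumes k: "k < n"
  shows "poly (map_poly (mapc to_univ) G1) (Cst (\<theta> k)) \<in> J" "poly (map_poly (mapc to_univ) G2) (Cst (\<theta> k)) \<in> J"
proof -
  have eq: "map_poly (\<lambda>c. mapc to_univ (Cst c)) p = map_poly Cst (map_poly to_univ p)"
    by (simp add: rhom_to_univ map_map_rhom[OF rhom_Cst rhom_to_univ])
  have root: "poly (map_poly (\<lambda>c. mapc to_univ (Cst c)) p) (Cst (\<theta> k)) = 0"
    unfolding eq rhom.poly[OF rhom_Cst] \<theta>_root[OF k] by (rule rhom.zero[OF rhom_Cst])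
  have "(\<Sum>i<n. mapc to_univ (rm G i) * Cst (\<theta> k) ^ i) \<in> J" if "G = G1 \<or> G = G2" for G
    using that by (intro is_ideal_sum[OF J_ideal] is_idealD(4)[OF J_ideal] H_in_J) (auto simp: H_def Hm_def)
  thus "poly (map_poly (mapc to_univ) G1) (Cst (\<theta> k)) \<in> J" "poly (map_poly (mapc to_univ) G2) (Cst (\<theta> k)) \<in> J"
    unfolding rm_eval[OF eta root, symmetric] by blast+
qed

lemma poly_eta_Yp: "poly (map_poly (mapc to_univ) Yp) (Cst (\<theta> k)) = Zr k"
  unfolding poly_map_Yp_Up(1)[OF eta] Zr_def by (simp add: rhom_to_univ)

lemma U_relation:
  assumes "k < n"
  shows "poly (map_poly (mapc to_univ) Up) (Zr k) - Cst (\<theta> k) \<in> J"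
proof -
  have "poly (map_poly (mapc to_univ) G2) (Cst (\<theta> k)) = poly (map_poly (mapc to_univ) Up) (Zr k) - Cst (\<theta> k)"
    unfolding G2_def rhom.map_poly_diff[OF eta] rhom.map_poly_pcompose[OF eta] poly_diff poly_pcompose poly_eta_Yp
    by (simp add: rhom.map_poly_pCons'[OF eta] rhom.zero[OF eta] rhom.one[OF eta])
  thus ?thesis using remainders_in_J(2)[OF assms] by simp
qed

sublocale spl: splitting "mpols UNIV 2 :: 'm univ_dom mpol set" J fr Zr n
proof
  show "is_subring (mpols UNIV 2 :: 'm univ_dom mpol set)" by (rule is_subring_mpols) simp
  show "is_ideal J" by (rule J_ideal)
  show "fr \<in> polys_over (mpols UNIV 2)"
  proof -
    have "mapc to_univ (coeff fT i) \<in> mpols (range to_univ) 2" for i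
      using polys_in(1) by (intro mapc_in_mpols[OF rhom_to_univ, of _ UNIV]) (auto simp: polys_over_def)
    thus ?thesis using mpols_mono[of "range to_univ" UNIV 2 2]
      by (auto simp: fr_def polys_over_def rhom.coeff[OF eta])
  qed
  let ?A = "map_poly to_univ A" and ?b = "map_poly to_univ b"
  have mm: "map_poly (mapc to_univ) (map_poly Cst w) = map_poly Cst (map_poly to_univ w)" for w :: "'m poly"
    by (rule poly_eqI) (simp add: rhom.coeff[OF eta] rhom.coeff[OF rhom_Cst] rhom.coeff[OF rhom_to_univ] rhom_to_univ)
  have fr: "fr = map_poly Cst ?A + map_poly Cst ?b * map_poly (mapc to_univ) [:Var 0 - Var 1 * Cst \<xi>, Var 1:]"
    unfolding fr_def fT_def rhom.map_poly_add[OF eta] rhom.map_poly_mult[OF eta] mm ..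
  have "degree (map_poly Cst ?b * map_poly (mapc to_univ) [:Var 0 - Var 1 * Cst \<xi>, Var 1:]) \<le> degree b + 1"
  proof (rule order.trans[OF degree_mult_le add_mono])
    show "degree (map_poly Cst ?b) \<le> degree b"
      using map_poly_degree_leq[of Cst ?b] by (simp add: degree_map_poly_rhom[OF rhom_to_univ])
    show "degree (map_poly (mapc to_univ) [:Var 0 - Var 1 * Cst \<xi>, Var 1:]) \<le> 1"
      by (rule order.trans[OF map_poly_degree_leq]) simp
  qed
  hence small: "degree (map_poly Cst ?b * map_poly (mapc to_univ) [:Var 0 - Var 1 * Cst \<xi>, Var 1:]) < n"
    using deg_b by simp
  have dA: "degree (map_poly Cst ?A) \<le> n"
    using map_poly_degree_leq[of Cst ?A] deg_A by (simp add: degree_map_poly_rhom[OF rhom_to_univ])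
  have "coeff (map_poly Cst ?A) n = 1"
    using A_monic deg_A by (simp add: rhom.coeff[OF rhom_Cst] rhom.coeff[OF rhom_to_univ] rhom.one[OF rhom_to_univ] rhom.one[OF rhom_Cst])
  hence c: "coeff fr n = 1" unfolding fr using coeff_eq_0[OF small] by simp
  moreover have "degree fr \<le> n" unfolding fr using dA small by (intro degree_add_le) auto
  ultimately show "degree fr = n" by (intro antisym le_degree) auto
  thus "lead_coeff fr = 1" using c by simp
  show "poly fr (Zr k) \<in> J" if "k < n" for k
    using remainders_in_J(1)[OF that]
    unfolding G1_def rhom.map_poly_pcompose[OF eta] poly_pcompose poly_eta_Yp fr_def .
  \<comment> \<open>Z_i - Z_k divides U(Z_i) - U(Z_k), which is congruent to the nonzero constant
    \<theta>_i - \<theta>_k; so it is a unit modulo \<open>J\<close>.\<close>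
  show "\<exists>w. w * (Zr i - Zr k) - 1 \<in> J" if ik: "i < n" "k < n" "i \<noteq> k" for i k
  proof -
    let ?U = "map_poly (mapc to_univ) Up"
    obtain q where q: "poly ?U (Zr i) - poly ?U (Zr k) = (Zr i - Zr k) * q" using poly_diff_dvd by blast
    define c where "c = inverse (\<theta> i - \<theta> k)"
    have "\<theta> i \<noteq> \<theta> k" using ik \<theta>_inj by (auto dest: inj_onD)
    hence c: "Cst c * (Cst (\<theta> i) - Cst (\<theta> k)) = (1 :: 'm univ_dom mpol)"
      unfolding rhom.diff[OF rhom_Cst, symmetric] rhom.mult[OF rhom_Cst, symmetric] by (simp add: c_def rhom.one[OF rhom_Cst])
    have "(Cst c * q) * (Zr i - Zr k) - 1 = Cst c * (poly ?U (Zr i) - poly ?U (Zr k)) - Cst c * (Cst (\<theta> i) - Cst (\<theta> k))"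
      unfolding q c by (simp add: algebra_simps)
    also have "\<dots> = Cst c * (poly ?U (Zr i) - Cst (\<theta> i)) - Cst c * (poly ?U (Zr k) - Cst (\<theta> k))"
      by (simp add: algebra_simps)
    also have "\<dots> \<in> J"
      by (rule is_idealD(6)[OF J_ideal is_idealD(3)[OF J_ideal U_relation[OF ik(1)]] is_idealD(3)[OF J_ideal U_relation[OF ik(2)]]])
    finally show ?thesis by blast
  qed
qed

text \<open>The coefficients of Y are linear combinations of the Z_k by the inverse Vandermonde
  matrix of the \<theta>_k; those of U come from interpolation at the Z_k, whence the
  denominators.\<close>

lemma mpols_in_L: "F \<in> mpols UNIV N \<Longrightarrow> F \<in> spl.L"
proof -
  note L = is_subringD[OF spl.is_subring_L]
  have Sn: "is_subring (spl.S n)" using spl.S_ring[of n] by simp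
  have R0: "r \<in> mpols UNIV 2 \<Longrightarrow> r \<in> spl.S n" for r by (rule spl.R0_S) simp_all
  have C: "Cst c \<in> spl.S n" for c :: "'m univ_dom" by (rule R0[OF Cst_in_mpols]) simp
  have "Var i \<in> spl.L" if i: "i < N" for i
  proof -
    consider "i < 2" | "2 \<le> i" "i < 2 + n" | "2 + n \<le> i" by linarith
    thus ?thesis
    proof cases
      case 1
      have "Var i \<in> mpols (UNIV :: 'm univ_dom set) 2" by (rule Var_in_mpols) (use 1 in auto)
      thus ?thesis using R0 spl.S_sub_L by blast
    next
      case 2
      define l where "l = i - 2"
      have l: "i = 2 + l" "l < n" using 2 by (auto simp: l_def)
      have "(\<Sum>k<n. Cst (coeff (lagr n \<theta> k) l) * Zr k) =
          (\<Sum>k<n. \<Sum>m<n. Var (2 + m) * Cst (\<theta> k ^ m * coeff (lagr n \<theta> k) l))"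
        by (simp add: Zr_def sum_distrib_left rhom.mult[OF rhom_Cst] rhom.power[OF rhom_Cst] mult_ac)
      also have "\<dots> = (\<Sum>m<n. Var (2 + m) * Cst (\<Sum>k<n. \<theta> k ^ m * coeff (lagr n \<theta> k) l))"
        by (subst sum.swap) (simp add: sum_distrib_left rhom.sum[OF rhom_Cst])
      also have "\<dots> = (\<Sum>m<n. if l = m then Var (2 + m) else 0)"
        using interp_coeff_formula[OF \<theta>_inj l(2)]
        by (intro sum.cong) (auto simp: rhom.one[OF rhom_Cst] rhom.zero[OF rhom_Cst])
      also have "\<dots> = Var i" using l by simp
      finally have "Var i = (\<Sum>k<n. Cst (coeff (lagr n \<theta> k) l) * Zr k)" by simp
      also have "\<dots> \<in> spl.S n"
        by (intro is_subring_sum[OF Sn] is_subringD(4)[OF Sn] C spl.Z_in_S) auto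
      finally show ?thesis using spl.S_sub_L by blast
    next
      case 3
      define l where "l = i - 2 - n"
      have l: "i = 2 + n + l" "l < n" using 3 i by (auto simp: l_def N_def)
      let ?U = "map_poly (mapc to_univ) Up"
      have cU: "coeff ?U m = (if m < n then Var (2 + n + m) else 0)" for m
        unfolding Up_def rhom.map_poly_sum[OF eta] rhom.map_poly_monom[OF eta] coeff_sum coeff_monom
        by (simp add: rhom_to_univ)
      have "coeff ?U l \<in> spl.L"
      proof (rule spl.interpolated_in_L[where c = "\<lambda>k. Cst (\<theta> k)"])
        show "?U = 0 \<or> degree ?U < n" using n_pos by (intro disjI2 degree_lessI) (auto simp: cU)
      qed (use U_relation C in auto)
      thus ?thesis using l by (simp add: cU)
    qed
  qed
  moreover have "Cst c \<in> spl.L" for c using C spl.S_sub_L by blast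
  ultimately have VC: "i < N \<Longrightarrow> Var i \<in> spl.L" "Cst c \<in> spl.L" for i c by blast+
  assume "F \<in> mpols UNIV N"
  thus "F \<in> spl.L" using UNIV_I
    by (induction rule: mpols_induct) (auto intro: L VC)
qed

lemma ev_Zr: "rhom e \<Longrightarrow> ev e x (Zr k) = Zv e x k"
  unfolding Zr_def Zv_def
  by (simp add: rhom.sum[OF rhom.rhom_ev] rhom.mult[OF rhom.rhom_ev] rhom.power[OF rhom.rhom_ev] rhom.ev_Var rhom.ev_Cst)

text \<open>The symmetric group acts on the zeros over given parameters: the roots are permuted and
  Y, U interpolated anew.\<close>

lemma zeros_swap:
  fixes e :: "'m univ_dom \<Rightarrow> 'e::field"
  assumes e: "rhom e" and x: "x \<in> zeros e" and km: "k \<le> m" "m < n"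
  shows "\<exists>y\<in>zeros e. y 0 = x 0 \<and> y 1 = x 1 \<and> (\<forall>i<n. Zv e y i = Zv e x (transpose k m i))"
proof -
  define z where "z = Zv e x \<circ> transpose k m"
  have perm: "transpose k m permutes {..<n}" using km by (intro permutes_swap_id) auto
  have inj: "inj_on z {..<n}"
    using zeros_distinct(1)[OF e x] permutes_inj_on[OF perm] permutes_image[OF perm]
    unfolding z_def by (intro comp_inj_on) auto
  have roots: "poly (fE e (x 0) (x 1)) (z i) = 0" if "i < n" for i
    using x permutes_in_image[OF perm, of i] that unfolding zeros_iff[OF e] z_def by auto
  note pt = point[OF e inj roots]
  have "Zv e (point e (x 0) (x 1) z) i = Zv e x (transpose k m i)" if "i < n" for i
  proof -
    have "Zv e (point e (x 0) (x 1) z) i = z i" using pt(2)[of i] that by blast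
    thus ?thesis by (simp add: z_def)
  qed
  thus ?thesis using pt(1,3,4) by blast
qed

text \<open>The set \<open>B\<close> consists of full fibres, so it admits all exchanges of roots,
  and its parameters are dense. It is taken to be all zeros once, and once the single fibre over the
  transcendental parameters \<open>par\<close>.\<close>

lemma vanishing_in_J:
  fixes e :: "'m univ_dom \<Rightarrow> 'e::field" and B :: "(nat \<Rightarrow> 'e) set"
  assumes e: "rhom e" and B: "B \<subseteq> zeros e"
    and closed: "\<And>x y. x \<in> B \<Longrightarrow> y \<in> zeros e \<Longrightarrow> y 0 = x 0 \<Longrightarrow> y 1 = x 1 \<Longrightarrow> y \<in> B"
    and base: "\<And>r. r \<in> mpols UNIV 2 \<Longrightarrow> (\<And>x. x \<in> B \<Longrightarrow> ev e x r = 0) \<Longrightarrow> r = 0"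
    and F: "F \<in> mpols UNIV N" "\<And>G x. x \<in> B \<Longrightarrow> G \<in> spl.S n \<Longrightarrow> (\<exists>d. G = d * F) \<Longrightarrow> ev e x G = 0"
  shows "F \<in> J"
proof (rule spl.in_ideal_if_vanishing_L[of "ev e ` B"])
  show "rhom d" if "d \<in> ev e ` B" for d using that rhom.rhom_ev[OF e] by auto
  show "d j = 0" if "d \<in> ev e ` B" "j \<in> J" for d j using that B J_zeros[OF e] by auto
  show "\<exists>d\<in>ev e ` B. (\<forall>r\<in>mpols UNIV 2. d r = f r) \<and> (\<forall>i<n. d (Zr i) = f (Zr (transpose k m i)))"
    if f: "f \<in> ev e ` B" and km: "k \<le> m" "m < n" for f k m
  proof -
    obtain x where x: "x \<in> B" "f = ev e x" using f by auto
    obtain y where y: "y \<in> zeros e" "y 0 = x 0" "y 1 = x 1" "\<forall>i<n. Zv e y i = Zv e x (transpose k m i)"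
      using zeros_swap[OF e _ km] B x(1) by blast
    have "y \<in> B" using closed[OF x(1) y(1-3)] .
    moreover have "ev e y r = ev e x r" if "r \<in> mpols UNIV 2" for r
      by (rule ev_cong[OF that]) (use y in \<open>auto simp: less_2_cases_iff\<close>)
    ultimately show ?thesis using x(2) y(4) by (intro bexI[of _ "ev e y"]) (auto simp: ev_Zr[OF e])
  qed
  show "r \<in> J" if "r \<in> mpols UNIV 2" "\<And>d. d \<in> ev e ` B \<Longrightarrow> d r = 0" for r
    using base[OF that(1)] that(2) is_idealD(1)[OF J_ideal] by auto
  show "F \<in> spl.L" by (rule mpols_in_L[OF F(1)])
  show "d G = 0" if "d \<in> ev e ` B" "G \<in> spl.S n" "\<exists>d. G = d * F" for G d using F(2) that by auto
qed

section \<open>Membership in the ideal by vanishing at points\<close>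

lemma family_ac_univ: "family_ac (map_poly to_univ A) (map_poly to_univ b) (map_poly to_univ g) (to_univ \<xi>) n"
  unfolding family_ac_def by (rule family_map[OF rhom_to_univ])

text \<open>The Nullstellensatz for \<open>J\<close>, in particular its radicality: parameters with
  squarefree fibre are dense, and over each of them there is a zero.\<close>

lemma in_J_if_vanishing:
  assumes F: "F \<in> mpols UNIV N" "\<And>x. x \<in> zeros id \<Longrightarrow> eval_mpol x F = 0"
  shows "F \<in> J"
proof (rule vanishing_in_J[OF rhom_id(1), of "zeros id"])
  interpret u: family_ac "map_poly to_univ A" "map_poly to_univ b" "map_poly to_univ g" "to_univ \<xi>" n
    by (rule family_ac_univ)
  fix r :: "'m univ_dom mpol" assume r: "r \<in> mpols UNIV 2" "\<And>x. x \<in> zeros id \<Longrightarrow> ev id x r = 0"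
  show "r = 0"
  proof (rule u.parameters_dense[OF r(1)])
    fix t0 t1 assume sq: "rsquarefree (fam_poly (map_poly to_univ A) (map_poly to_univ b) (to_univ \<xi>) t0 t1)"
    obtain z where z: "inj_on z {..<n}"
      "\<And>x. poly (fam_poly (map_poly to_univ A) (map_poly to_univ b) (to_univ \<xi>) t0 t1) x = 0 \<longleftrightarrow> (\<exists>i<n. x = z i)"
      using enumerate_roots[OF sq u.fam_monic(2)] u.fam_monic(1) by metis
    have "poly (fE id t0 t1) (z k) = 0" if "k < n" for k
      using z(2)[of "z k"] that unfolding fE_def by (auto simp: map_poly_id)
    note pt = point[OF rhom_id(1) z(1) this]
    have "ev id (point id t0 t1 z) r = 0" by (rule r(2)[OF pt(1)])
    moreover have "ev id (point id t0 t1 z) r = ev id (\<lambda>i. if i = 0 then t0 else t1) r"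
      by (rule ev_cong[OF r(1)]) (use pt(3,4) in \<open>auto simp: less_2_cases_iff\<close>)
    ultimately show "ev id (\<lambda>i. if i = 0 then t0 else t1) r = 0" by simp
  qed
next
  fix G x assume "x \<in> zeros id" "\<exists>d. G = d * F"
  thus "ev id x G = 0" using F(2)[of x] by (auto simp: eval_mpol_ev(1) rhom.mult[OF rhom.rhom_ev[OF rhom_id(1)]])
qed (use F in auto)

text \<open>Modulo \<open>J\<close> the elements of \<open>S n\<close> are polynomials in the
  parameters and roots, the only functions to which the relations of \<open>all_permutations\<close>
  apply.\<close>

lemma S_as_polynomials:
  assumes "G \<in> spl.S n"
  shows "\<exists>q\<in>mpols UNIV (n + 2). G - ev Cst (pt Var Zr) q \<in> J"
proof -
  let ?T = "{G. \<exists>q\<in>mpols UNIV (n + 2). G - ev Cst (pt Var Zr) q \<in> J}"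
  have M: "is_subring (mpols (UNIV :: 'm univ_dom set) (n + 2))" by (rule is_subring_mpols) simp
  note D = is_subringD[OF M]
  interpret h: rhom "ev Cst (pt Var Zr) :: 'm univ_dom mpol \<Rightarrow> _" by (rule rhom.rhom_ev[OF rhom_Cst])
  have memI: "G \<in> ?T" if "q \<in> mpols UNIV (n + 2)" "G = ev Cst (pt Var Zr) q + j" "j \<in> J" for G q j
    using that by (auto intro!: bexI[of _ q])
  have memE: "\<exists>q j. q \<in> mpols UNIV (n + 2) \<and> j \<in> J \<and> G = ev Cst (pt Var Zr) q + j" if G: "G \<in> ?T" for G
  proof -
    obtain q where "q \<in> mpols UNIV (n + 2)" "G - ev Cst (pt Var Zr) q \<in> J" using G by blast
    thus ?thesis by (intro exI[of _ q] exI[of _ "G - ev Cst (pt Var Zr) q"]) auto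
  qed
  have "is_subring ?T"
    unfolding is_subring_def
  proof (intro conjI ballI)
    show "0 \<in> ?T" by (rule memI[OF D(1), of _ 0]) (use is_idealD(1)[OF J_ideal] in auto)
    show "1 \<in> ?T" by (rule memI[OF D(2), of _ 0]) (use is_idealD(1)[OF J_ideal] in auto)
    fix x y assume "x \<in> ?T" "y \<in> ?T"
    obtain q j where q: "q \<in> mpols UNIV (n + 2)" "j \<in> J" "x = ev Cst (pt Var Zr) q + j" using memE[OF \<open>x \<in> ?T\<close>] by blast
    obtain q' j' where q': "q' \<in> mpols UNIV (n + 2)" "j' \<in> J" "y = ev Cst (pt Var Zr) q' + j'" using memE[OF \<open>y \<in> ?T\<close>] by blast
    note I = is_idealD[OF J_ideal]
    show "x + y \<in> ?T"
      by (rule memI[OF D(3)[OF q(1) q'(1)] _ I(2)[OF q(2) q'(2)]]) (simp add: q q' algebra_simps)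
    have "j * y + ev Cst (pt Var Zr) q * j' \<in> J" by (intro I(2) I(3)[OF q'(2)] I(4)[OF q(2)])
    thus "x * y \<in> ?T"
      by (rule memI[OF D(4)[OF q(1) q'(1)], rotated]) (simp add: q(3) q'(3) algebra_simps)
  next
    fix x assume "x \<in> ?T"
    obtain q j where q: "q \<in> mpols UNIV (n + 2)" "j \<in> J" "x = ev Cst (pt Var Zr) q + j" using memE[OF \<open>x \<in> ?T\<close>] by blast
    show "- x \<in> ?T"
      by (rule memI[OF D(5)[OF q(1)] _ is_idealD(5)[OF J_ideal q(2)]]) (simp add: q)
  qed
  moreover have "mpols UNIV 2 \<subseteq> ?T"
  proof
    fix r :: "'m univ_dom mpol" assume r: "r \<in> mpols UNIV 2"
    have "ev Cst (pt Var Zr) r = ev Cst Var r"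
      by (rule ev_cong[OF r]) (simp add: pt_def)
    also have "\<dots> = r"
      by (rule rhom_mpols_cong[OF rhom.rhom_ev[OF rhom_Cst] rhom_id(2) r])
        (simp_all add: rhom.ev_Cst[OF rhom_Cst] rhom.ev_Var[OF rhom_Cst])
    finally have "r = ev Cst (pt Var Zr) r + 0" by simp
    moreover have "r \<in> mpols UNIV (n + 2)" using r mpols_mono[of UNIV UNIV 2 "n + 2"] by auto
    ultimately show "r \<in> ?T" using memI is_idealD(1)[OF J_ideal] by blast
  qed
  moreover have "J \<subseteq> ?T" using memI[OF D(1)] by auto
  moreover have "Zr k \<in> ?T" if "k < n" for k
  proof (rule memI[of "Var (k + 2)" _ 0])
    show "Var (k + 2) \<in> mpols (UNIV :: 'm univ_dom set) (n + 2)" by (rule Var_in_mpols) (use that in auto)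
  qed (use is_idealD(1)[OF J_ideal] in \<open>auto simp: rhom.ev_Var[OF rhom_Cst] pt_def\<close>)
  ultimately have "spl.S n \<subseteq> ?T" by (intro spl.S_subset) auto
  thus ?thesis using assms by blast
qed

text \<open>The zeros over the same parameters differ from \<open>v\<close> only by the numbering of
  the roots. As all permutations preserve relations, an element vanishing at \<open>v\<close>
  vanishes on the whole fibre, and the fibre over independent parameters decides.\<close>

lemma in_J_if_generic_zero:
  assumes v: "v \<in> zeros emb" "v 0 = par 0" "v 1 = par 1"
    and F: "F \<in> mpols UNIV N" "ev emb v F = 0"
  shows "F \<in> J"
proof (rule vanishing_in_J[OF rhom_emb, of "{x \<in> zeros emb. x 0 = par 0 \<and> x 1 = par 1}"])
  interpret u: family_ac "map_poly to_univ A" "map_poly to_univ b" "map_poly to_univ g" "to_univ \<xi>" n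
    by (rule family_ac_univ)
  show "r = 0" if "r \<in> mpols UNIV 2" "\<And>x. x \<in> {x \<in> zeros emb. x 0 = par 0 \<and> x 1 = par 1} \<Longrightarrow> ev emb x r = 0" for r
  proof (rule par_indep[OF that(1)])
    have "ev emb par r = ev emb v r"
      by (rule ev_cong[OF that(1)]) (use v in \<open>auto simp: less_2_cases_iff\<close>)
    thus "ev emb par r = 0" using that(2)[of v] v by simp
  qed
  fix G x assume x: "x \<in> {x \<in> zeros emb. x 0 = par 0 \<and> x 1 = par 1}" and G: "G \<in> spl.S n" "\<exists>d. G = d * F"
  obtain q where q: "q \<in> mpols UNIV (n + 2)" "G - ev Cst (pt Var Zr) q \<in> J" using S_as_polynomials[OF G(1)] by blast
  have evG: "ev emb y G = ev emb (pt par (Zv emb y)) q" if y: "y \<in> zeros emb" "y 0 = par 0" "y 1 = par 1" for y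
  proof -
    interpret e: rhom "ev emb y" by (rule rhom.rhom_ev[OF rhom_emb])
    have "ev emb y G - ev emb y (ev Cst (pt Var Zr) q) = 0" using J_zeros[OF rhom_emb y(1) q(2)] by simp
    hence "ev emb y G = ev emb y (ev Cst (pt Var Zr) q)" by simp
    also have "\<dots> = ev emb (\<lambda>i. ev emb y (pt Var Zr i)) q"
      unfolding ev_hom[OF e.rhom_axioms rhom_Cst] rhom.ev_Cst[OF rhom_emb] ..
    also have "\<dots> = ev emb (pt par (Zv emb y)) q"
      by (rule ev_cong[OF q(1)]) (use y in \<open>auto simp: pt_def rhom.ev_Var[OF rhom_emb] ev_Zr[OF rhom_emb] less_2_cases_iff\<close>)
    finally show ?thesis .
  qed
  have fE: "u.FE = fE emb (par 0) (par 1)" by (simp add: fE_def)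
  note zv = zeros_distinct[OF rhom_emb v(1)]
  have x': "x \<in> zeros emb" "x 0 = par 0" "x 1 = par 1" using x by auto
  note zx = zeros_distinct[OF rhom_emb x'(1)]
  have rv: "poly u.FE y = 0 \<longleftrightarrow> y \<in> Zv emb v ` {..<n}" for y
    unfolding fE using zv(2) v by (auto simp: poly_prod prod_zero_iff)
  have rx: "poly u.FE y = 0 \<longleftrightarrow> y \<in> Zv emb x ` {..<n}" for y
    unfolding fE using zx(2) x' by (auto simp: poly_prod prod_zero_iff)
  have im: "Zv emb x ` {..<n} = Zv emb v ` {..<n}" using rv rx by blast
  \<comment> \<open>The permutation that turns the numbering of the roots at \<open>v\<close> into
    that at \<open>x\<close>.\<close>
  define \<rho> where "\<rho> k = (if k < n then the_inv_into {..<n} (Zv emb v) (Zv emb x k) else k)" for k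
  have "bij_betw (Zv emb v) {..<n} (Zv emb v ` {..<n})" using zv(1) by (simp add: bij_betw_def)
  hence "bij_betw (the_inv_into {..<n} (Zv emb v)) (Zv emb v ` {..<n}) {..<n}" by (rule bij_betw_the_inv_into)
  moreover have "bij_betw (Zv emb x) {..<n} (Zv emb v ` {..<n})" using zx(1) im by (simp add: bij_betw_def)
  ultimately have "bij_betw (the_inv_into {..<n} (Zv emb v) \<circ> Zv emb x) {..<n} {..<n}"
    by (rule bij_betw_trans[rotated])
  hence "bij_betw \<rho> {..<n} {..<n}" by (rule bij_betw_cong[THEN iffD1, rotated]) (simp add: \<rho>_def)
  hence perm: "\<rho> permutes {..<n}" by (rule bij_imp_permutes) (simp add: \<rho>_def)
  have Zx: "Zv emb x k = (Zv emb v \<circ> \<rho>) k" if "k < n" for k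
    using that im by (auto simp: \<rho>_def intro!: f_the_inv_into_f[OF zv(1), symmetric])
  have "ev emb v G = 0" using G(2) F(2) by (auto simp: rhom.mult[OF rhom.rhom_ev[OF rhom_emb]])
  hence "ev emb (pt par (Zv emb v)) q = 0" using evG[OF v] by simp
  moreover have "u.FE = (\<Prod>i<n. [:- Zv emb v i, 1:])" unfolding fE using zv(2) v by simp
  ultimately have "ev emb (pt par (Zv emb v \<circ> \<rho>)) q = 0"
    using u.all_permutations[OF zv(1) _ perm] q(1) by (simp add: same_rel_def)
  also have "ev emb (pt par (Zv emb v \<circ> \<rho>)) q = ev emb (pt par (Zv emb x)) q"
    by (rule ev_cong[OF q(1)]) (use Zx in \<open>auto simp: pt_def\<close>)
  finally show "ev emb x G = 0" using evG[OF x'] by simp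
qed (use F v in auto)

end

section \<open>Generic points and values of rational functions\<close>

lemma alg_indep_cong:
  assumes "alg_indep K n t" "\<And>i. i < n \<Longrightarrow> t i = u i"
  shows "alg_indep K n u"
proof -
  have "eval_mpol u p = eval_mpol t p" if "p \<in> mpols K n" for p
    unfolding eval_mpol_ev by (rule ev_cong[of _ n]) (use that assms(2) mpols_mono[of K UNIV n n] in auto)
  thus ?thesis using assms(1) by (auto simp: alg_indep_def)
qed

lemma alg_indep_mono: "K \<subseteq> L \<Longrightarrow> alg_indep L n t \<Longrightarrow> alg_indep K n t"
  using mpols_mono[of K L n n] by (auto simp: alg_indep_def)

lemma irreducible_bezout_field_poly:
  fixes p q :: "'a::field poly"
  assumes "irreducible p" "\<not> p dvd q"
  shows "\<exists>u v. u * p + v * q = 1"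
proof -
  have "coprime p q" using assms by (metis coprimeI irreducibleD' dvd_trans)
  thus ?thesis by (rule coprime_bezout_field_poly)
qed

definition indet :: "nat \<Rightarrow> 'm::field univ_dom" where "indet i = to_ac (to_fract (Var i))"

lemma indet_alg_indep: "alg_indep (range to_univ) n (indet :: nat \<Rightarrow> 'm::field univ_dom)"
  unfolding alg_indep_def
proof (intro ballI impI)
  fix p :: "'m univ_dom mpol" assume p: "p \<in> mpols (range to_univ) n" "eval_mpol indet p = 0"
  obtain q where q: "q \<in> mpols UNIV n" "p = mapc to_univ q" using mpols_range[OF rhom_to_univ p(1)] .
  have fr: "rhom (\<lambda>c :: 'm mpol. to_ac (to_fract c))"
    by (rule rhom_comp[OF rhom_to_ac]) (unfold_locales, simp_all)
  have tu: "(to_univ :: 'm \<Rightarrow> _) = (\<lambda>c. to_ac (to_fract (Cst c)))"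
    by (auto simp: to_univ_def to_fract_def Cst_def)
  have "q = ev Cst Var q"
    by (rule rhom_mpols_cong[OF rhom_id(2) rhom.rhom_ev[OF rhom_Cst] q(1)])
      (simp_all add: rhom.ev_Cst[OF rhom_Cst] rhom.ev_Var[OF rhom_Cst])
  hence "to_ac (to_fract q) = to_ac (to_fract (ev Cst Var q))" by simp
  also have "\<dots> = ev to_univ indet q" unfolding ev_hom[OF fr rhom_Cst] tu indet_def[abs_def] ..
  also have "\<dots> = eval_mpol indet p"
    by (simp add: q(2) eval_mpol_ev(2) ev_mapc[OF rhom_id(2) rhom_to_univ])
  finally have "q = 0" using p(2) by simp
  thus "p = 0" by (simp add: q(2) rhom.zero[OF rhom_mapc[OF rhom_to_univ]])
qed

lemma separable_self:
  fixes y :: "'a::alg_closed_field"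
  assumes "is_subfield K" "y \<in> K"
  shows "separable_over K y"
  unfolding separable_over_def
proof (intro exI[of _ "[:- y, 1:]"] conjI allI)
  note D = is_subringD[OF is_subfield_subring[OF assms(1)]]
  show "coeff [:- y, 1:] i \<in> K" for i using D assms(2) by (auto simp: coeff_pCons split: nat.split)
  show "rsquarefree [:- y, 1:]" by (simp add: rsquarefree_iff_no_double_root pderiv_pCons)
qed simp

lemma rhom_eval_mpol: "rhom (eval_mpol x)"
  unfolding eval_mpol_ev(1)[abs_def] by (rule rhom.rhom_ev[OF rhom_id(1)])

lemmas eval_mpol_simps = rhom.zero[OF rhom_eval_mpol] rhom.one[OF rhom_eval_mpol] rhom.add[OF rhom_eval_mpol]
  rhom.mult[OF rhom_eval_mpol] rhom.diff[OF rhom_eval_mpol] rhom.prod[OF rhom_eval_mpol]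

lemma eval_mpol_Var_Cst: "eval_mpol x (Var i) = x i" "eval_mpol x (Cst c) = c"
  by (simp_all add: eval_mpol_ev(1) rhom.ev_Var[OF rhom_id(1)] rhom.ev_Cst[OF rhom_id(1)])

lemmas [simp] = eval_mpol_Var_Cst

lemma rat_value_coordinate:
  assumes "is_subring K" "i < n"
  shows "rat_value K n x a (x i) (a i)"
proof -
  have in_mpols: "Var i \<in> mpols K n" "1 \<in> mpols K n"
    using assms is_subringD(2)[OF is_subring_mpols[OF assms(1)]] Var_in_mpols by auto
  show ?thesis unfolding rat_value_def
    by (rule bexI[where x = "Var i"], rule bexI[where x = 1]) (simp_all add: eval_mpol_simps in_mpols)
qed

text \<open>The value may come from another representation as a quotient, so \<open>h\<close> may
  vanish at \<open>a\<close>. The two representations agree at the generic point, and the resulting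
  polynomial identity holds on all of \<open>V\<close>.\<close>

lemma rat_value_relation:
  assumes R: "is_subring K" and x: "generic_point K n V x" and a: "a \<in> V"
    and f: "f \<in> mpols K n" and h: "h \<in> mpols K n" "eval_mpol x h \<noteq> 0"
    and v: "rat_value K n x a (eval_mpol x f / eval_mpol x h) c"
  shows "c * eval_mpol a h = eval_mpol a f"
proof -
  obtain q r where qr: "q \<in> mpols K n" "r \<in> mpols K n" "eval_mpol x r \<noteq> 0"
    "eval_mpol x f / eval_mpol x h = eval_mpol x q / eval_mpol x r"
    "eval_mpol a r \<noteq> 0" "c = eval_mpol a q / eval_mpol a r" using v unfolding rat_value_def by blast
  have "f * r - h * q \<in> mpols K n" using qr f h by (intro is_subringD[OF is_subring_mpols[OF R]])
  moreover have "eval_mpol x (f * r - h * q) = 0" using qr(3,4) h(2) by (simp add: eval_mpol_simps field_simps)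
  ultimately have "eval_mpol a (f * r - h * q) = 0" using x a by (auto simp: generic_point_def vanishing_ideal_def)
  hence "eval_mpol a f * eval_mpol a r = eval_mpol a h * eval_mpol a q" by (simp add: eval_mpol_simps)
  moreover have "c * eval_mpol a r = eval_mpol a q" using qr(5,6) by simp
  ultimately have "eval_mpol a f * eval_mpol a r = (c * eval_mpol a h) * eval_mpol a r" by (simp add: ac_simps)
  thus ?thesis using qr(5) by simp
qed

section \<open>The variety satisfies the hypotheses of the PAC property\<close>

context pac_variety
begin

definition V :: "(nat \<Rightarrow> 'm univ_dom) set" where
  "V = {x \<in> {..<N} \<rightarrow>\<^sub>E UNIV. \<forall>h\<in>H. eval_mpol x h = 0}"

lemma V_zeros: "x \<in> V \<longleftrightarrow> x \<in> {..<N} \<rightarrow>\<^sub>E UNIV \<and> x \<in> zeros id"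
  by (auto simp: V_def zeros_def eval_mpol_ev(1))

lemma V_closed: "zariski_closed N V"
  unfolding zariski_closed_def V_def using H_facts(3) by (intro exI[of _ H]) auto

text \<open>Points of \<open>V\<close> are extensional while zeros are arbitrary sequences;
  restricting to the first \<open>N\<close> coordinates changes no value of a polynomial in these
  variables.\<close>

lemma vanishing_iff: "F \<in> vanishing_ideal N V \<longleftrightarrow> F \<in> mpols UNIV N \<and> F \<in> J"
proof
  assume F: "F \<in> vanishing_ideal N V"
  have "eval_mpol x F = 0" if x: "x \<in> zeros id" for x
  proof -
    have eq: "ev id (restrict x {..<N}) G = ev id x G" if "G \<in> mpols UNIV N" for G
      by (rule ev_cong[OF that]) simp
    have "restrict x {..<N} \<in> zeros id" using x H_facts(3) by (auto simp: zeros_def eq)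
    hence "restrict x {..<N} \<in> V" by (simp add: V_zeros)
    thus ?thesis using F eq[of F] by (auto simp: vanishing_ideal_def eval_mpol_ev(1))
  qed
  thus "F \<in> mpols UNIV N \<and> F \<in> J" using F in_J_if_vanishing by (auto simp: vanishing_ideal_def)
next
  assume "F \<in> mpols UNIV N \<and> F \<in> J"
  thus "F \<in> vanishing_ideal N V"
    using J_zeros[OF rhom_id(1)] by (auto simp: vanishing_ideal_def V_zeros eval_mpol_ev(1))
qed

lemma V_defined_over: "defined_over (range to_univ) N V"
  unfolding defined_over_def
proof
  fix F assume "F \<in> vanishing_ideal N V"
  hence F: "F \<in> mpols UNIV N" "F \<in> J" by (auto simp: vanishing_iff)
  then obtain c where c: "F = (\<Sum>h\<in>H. c h * h)" unfolding J_def by blast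
  \<comment> \<open>Setting the variables from \<open>N\<close> on to zero fixes \<open>F\<close>
    and the generators and moves the coefficients into the ring in \<open>N\<close>
    variables.\<close>
  define \<sigma> where "\<sigma> = ev Cst (\<lambda>i. if i < N then Var i else (0 :: 'm univ_dom mpol))"
  have \<sigma>: "rhom \<sigma>" unfolding \<sigma>_def by (rule rhom.rhom_ev[OF rhom_Cst])
  have fixed: "\<sigma> G = G" if "G \<in> mpols UNIV N" for G
    by (rule rhom_mpols_cong[OF \<sigma> rhom_id(2) that])
      (simp_all add: \<sigma>_def rhom.ev_Cst[OF rhom_Cst] rhom.ev_Var[OF rhom_Cst])
  have M: "is_subring (mpols (UNIV :: 'm univ_dom set) N)" by (rule is_subring_mpols) simp
  have "\<sigma> G \<in> mpols UNIV N" for G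
  proof -
    obtain m where "G \<in> mpols UNIV m" using mpols_UNIV_exists by blast
    thus ?thesis unfolding \<sigma>_def
      by (rule ev_in_subring[OF M _ rhom_Cst]) (auto intro: Cst_in_mpols Var_in_mpols is_subringD[OF M])
  qed
  moreover have "F = (\<Sum>h\<in>H. \<sigma> (c h) * h)"
  proof -
    have "F = \<sigma> F" using fixed[OF F(1)] by simp
    also have "\<dots> = (\<Sum>h\<in>H. \<sigma> (c h) * \<sigma> h)" by (simp add: c rhom.sum[OF \<sigma>] rhom.mult[OF \<sigma>])
    finally show ?thesis using fixed[OF H_facts(3)] by simp
  qed
  moreover have "H \<subseteq> vanishing_ideal N V \<inter> mpols (range to_univ) N"
    using H_in_J H_facts(2,3) by (auto simp: vanishing_iff)
  ultimately show "\<exists>H' g. finite H' \<and> H' \<subseteq> vanishing_ideal N V \<inter> mpols (range to_univ) N \<and>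
      (\<forall>h\<in>H'. g h \<in> mpols UNIV N) \<and> F = (\<Sum>h\<in>H'. g h * h)"
    using H_facts(1) by (intro exI[of _ H] exI[of _ "\<lambda>h. \<sigma> (c h)"]) auto
qed

lemma fE_id: "fE id t0 t1 = fam_poly (map_poly to_univ A) (map_poly to_univ b) (to_univ \<xi>) t0 t1"
  by (simp add: fE_def map_poly_id)

lemma zero_over_squarefree:
  fixes e :: "'m univ_dom \<Rightarrow> 'e::alg_closed_field"
  assumes e: "rhom e" and sq: "rsquarefree (fE e t0 t1)"
  obtains z where "inj_on z {..<n}" "\<And>k. k < n \<Longrightarrow> poly (fE e t0 t1) (z k) = 0"
proof -
  obtain z where "inj_on z {..<n}" "\<And>x. poly (fE e t0 t1) x = 0 \<longleftrightarrow> (\<exists>i<n. x = z i)"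
    using enumerate_roots[OF sq fE_monic(2)[OF e]] fE_monic(1)[OF e] by metis
  thus ?thesis using that by blast
qed

lemma generic_zero_exists: obtains v where "v \<in> zeros emb" "v 0 = par 0" "v 1 = par 1"
proof -
  interpret u: family_ac "map_poly to_univ A" "map_poly to_univ b" "map_poly to_univ g" "to_univ \<xi>" n
    by (rule family_ac_univ)
  have "rsquarefree (fE emb (par 0) (par 1))"
    unfolding fE_def by (rule u.fam_rsquarefree[OF rhom_emb is_subfield_range[OF rhom_emb] order_refl par_alg_indep])
  then obtain z where "inj_on z {..<n}" "\<And>k. k < n \<Longrightarrow> poly (fE emb (par 0) (par 1)) (z k) = 0"
    using zero_over_squarefree[OF rhom_emb] by blast
  from point[OF rhom_emb this] show ?thesis using that by blast
qed

definition roots_indet :: "nat \<Rightarrow> 'm univ_dom" where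
  "roots_indet = (SOME z. inj_on z {..<n} \<and> (\<forall>k<n. poly (fE id (indet 0) (indet 1)) (z k) = 0))"

lemma fE_indet_sqf: "rsquarefree (fE id (indet 0) (indet 1))"
  unfolding fE_id by (rule fam_rsquarefree[OF rhom_to_univ is_subfield_range[OF rhom_to_univ] order_refl indet_alg_indep])

lemma roots_indet: "inj_on roots_indet {..<n}" "k < n \<Longrightarrow> poly (fE id (indet 0) (indet 1)) (roots_indet k) = 0"
proof -
  have "\<exists>z. inj_on z {..<n} \<and> (\<forall>k<n. poly (fE id (indet 0) (indet 1)) (z k) = 0)"
    using zero_over_squarefree[OF rhom_id(1) fE_indet_sqf] by blast
  from someI_ex[OF this] show "inj_on roots_indet {..<n}"
    "k < n \<Longrightarrow> poly (fE id (indet 0) (indet 1)) (roots_indet k) = 0"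
    unfolding roots_indet_def by blast+
qed

text \<open>The parameters are the first two indeterminates of the universal domain; the remaining
  coordinates are algebraic over them.\<close>

definition x0 :: "nat \<Rightarrow> 'm univ_dom" where "x0 = point id (indet 0) (indet 1) roots_indet"

lemma x0: "x0 \<in> V" "x0 0 = indet 0" "x0 1 = indet 1" "x0 \<in> zeros id"
proof -
  note pt = point[OF rhom_id(1) roots_indet(1), of "indet 0" "indet 1"]
  show 1: "x0 \<in> zeros id" "x0 0 = indet 0" "x0 1 = indet 1"
    unfolding x0_def using pt roots_indet(2) by blast+
  have "x0 \<in> {..<N} \<rightarrow>\<^sub>E UNIV" by (auto simp: x0_def point_def PiE_def extensional_def N_def)
  thus "x0 \<in> V" using 1 by (simp add: V_zeros)
qed

lemma x0_indep: "alg_indep (range to_univ) 2 x0"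
  by (rule alg_indep_cong[OF indet_alg_indep]) (use x0(2,3) in \<open>auto simp: less_2_cases_iff\<close>)

text \<open>By interpolation the coordinates lie in the field generated over the parameter field by
  the roots of \<open>p\<close> and of the fibre polynomial, and both polynomials are
  separable.\<close>

lemma x0_separable:
  assumes "i < N"
  shows "separable_over (gen_field (range to_univ) 2 x0) (x0 i)"
proof -
  let ?K = "range (to_univ :: 'm \<Rightarrow> _)"
  have K: "is_subfield ?K" by (rule is_subfield_range[OF rhom_to_univ])
  let ?L = "gen_field ?K 2 x0"
  have L: "is_subfield ?L" by (rule is_subfield_gen_field[OF K])
  note D = is_subringD[OF is_subfield_subring[OF L]]
  have KL: "to_univ c \<in> ?L" for c using const_in_gen_field[OF K] by blast
  have TL: "indet 0 \<in> ?L" "indet 1 \<in> ?L"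
    using var_in_gen_field[OF K, of 0 2 x0] var_in_gen_field[OF K, of 1 2 x0] x0 by auto
  define \<gamma> where "\<gamma> i = (if i < n then \<theta> i else roots_indet (i - n))" for i
  have sep\<theta>: "separable_over ?L (\<theta> k)" if "k < n" for k
    unfolding separable_over_def using p_sep \<theta>_root[OF that] KL
    by (intro exI[of _ "map_poly to_univ p"]) (auto simp: rhom.coeff[OF rhom_to_univ])
  have "fE id (indet 0) (indet 1) \<in> polys_over ?L"
  proof -
    have "map_poly to_univ w \<in> polys_over ?L" for w by (simp add: polys_over_def rhom.coeff[OF rhom_to_univ] KL)
    moreover have "[:indet 0 - indet 1 * to_univ \<xi>, indet 1:] \<in> polys_over ?L"
      using TL KL D zero_in_polys_over[OF is_subfield_subring[OF L]] by simp
    ultimately show ?thesis unfolding fE_id fam_poly_def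
      by (intro is_subringD[OF is_subring_polys_over[OF is_subfield_subring[OF L]]])
  qed
  hence sepz: "separable_over ?L (roots_indet k)" if "k < n" for k
    unfolding separable_over_def polys_over_def using fE_indet_sqf roots_indet(2)[OF that] by blast
  have sep\<gamma>: "separable_over ?L (\<gamma> k)" if "k < 2 * n" for k
    using that sep\<theta>[of k] sepz[of "k - n"] by (auto simp: \<gamma>_def)
  let ?G = "gen_field ?L (2 * n) \<gamma>"
  have G: "is_subfield ?G" by (rule is_subfield_gen_field[OF L])
  have \<theta>G: "\<theta> k \<in> ?G" and zG: "roots_indet k \<in> ?G" if "k < n" for k
    using var_in_gen_field[OF L, of k "2 * n" \<gamma>] var_in_gen_field[OF L, of "k + n" "2 * n" \<gamma>] that
    by (auto simp: \<gamma>_def)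
  have "x0 i \<in> ?G"
  proof -
    have "coeff (interp n \<theta> roots_indet) l \<in> ?G" "coeff (interp n roots_indet \<theta>) l \<in> ?G" for l
      using interp_in_polys_over[OF G \<theta>G zG] interp_in_polys_over[OF G zG \<theta>G] by (simp_all add: polys_over_def)
    moreover have "indet 0 \<in> ?G" "indet 1 \<in> ?G" using const_in_gen_field[OF L] TL by blast+
    ultimately show ?thesis using assms by (simp add: x0_def point_def)
  qed
  with separable_gen_field[OF L, of "2 * n" \<gamma> "x0 i"] sep\<gamma> show ?thesis by blast
qed

lemma gen_field_separable:
  assumes "y \<in> gen_field (range to_univ) N x0"
  shows "separable_over (gen_field (range to_univ) 2 x0) y"
proof -
  have K: "is_subfield (range (to_univ :: 'm \<Rightarrow> _))" by (rule is_subfield_range[OF rhom_to_univ])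
  let ?L = "gen_field (range to_univ) 2 x0"
  have L: "is_subfield ?L" by (rule is_subfield_gen_field[OF K])
  have "gen_field (range to_univ) N x0 \<subseteq> gen_field ?L N x0"
    by (rule gen_field_subset[OF K is_subfield_gen_field[OF L]])
      (use const_in_gen_field[OF K] const_in_gen_field[OF L] var_in_gen_field[OF L] in blast)+
  thus ?thesis using separable_gen_field[OF L, of N x0 y] x0_separable assms by blast
qed

text \<open>The coordinates of \<open>x0\<close> are algebraic over two independent ones, so its
  relations over M are also satisfied by a point over the Laurent series domain with parameters
  \<open>par\<close>. That point is a zero, and \<open>in_J_if_generic_zero\<close> applies to
  it.\<close>

lemma x0_generic: "generic_point (range to_univ) N V x0"
  unfolding generic_point_def
proof (intro conjI ballI impI)
  show "x0 \<in> V" by (rule x0)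
  fix F assume F: "F \<in> mpols (range to_univ) N" "eval_mpol x0 F = 0"
  let ?h = "\<lambda>c :: 'm. emb (to_univ c)"
  have h: "rhom ?h" by (rule rhom_comp[OF rhom_emb rhom_to_univ])
  have "range ?h \<subseteq> range emb" by auto
  from alg_indep_mono[OF this par_alg_indep] have ind: "alg_indep (range ?h) 2 par" .
  have rel: "same_rel to_univ ?h 2 x0 par"
    by (rule alg_indep_same_rel[OF rhom_to_univ h x0_indep ind])
  have "2 \<le> N" by (simp add: N_def)
  from same_rel_extend[OF rhom_to_univ h rel this] separable_imp_alg[OF x0_separable]
  obtain v where v: "\<forall>i<2. v i = par i" "same_rel to_univ ?h N x0 v" by blast
  have transfer: "ev emb v G = 0" if G: "G \<in> mpols (range to_univ) N" "eval_mpol x0 G = 0" for G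
  proof -
    obtain q where q: "q \<in> mpols UNIV N" "G = mapc to_univ q" using mpols_range[OF rhom_to_univ G(1)] .
    have "ev to_univ x0 q = 0" using G(2) by (simp add: q(2) eval_mpol_ev(2) ev_mapc[OF rhom_id(2) rhom_to_univ])
    hence "ev ?h v q = 0" using v(2) q(1) by (simp add: same_rel_def)
    thus ?thesis by (simp add: q(2) ev_mapc[OF rhom_emb rhom_to_univ])
  qed
  have "v \<in> zeros emb" unfolding zeros_def
    using transfer H_facts(2) x0(1) by (auto simp: V_def)
  moreover have FN: "F \<in> mpols UNIV N" using F(1) mpols_mono[of "range to_univ" UNIV N N] by auto
  ultimately have "F \<in> J" using in_J_if_generic_zero[of v F] v(1) transfer[OF F] by simp
  thus "F \<in> vanishing_ideal N V" using FN by (simp add: vanishing_iff)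
qed

text \<open>Membership in \<open>J\<close> is tested at one point with coordinates in a field, so a
  product in \<open>J\<close> has a factor in \<open>J\<close>.\<close>

lemma V_irreducible: "zariski_irreducible N V"
  unfolding zariski_irreducible_def
proof (intro conjI allI impI)
  show "V \<noteq> {}" using x0(1) by blast
  fix B C assume BC: "zariski_closed N B \<and> zariski_closed N C \<and> V = B \<union> C"
  obtain S where S: "S \<subseteq> mpols UNIV N" "B = {x \<in> {..<N} \<rightarrow>\<^sub>E UNIV. \<forall>p\<in>S. eval_mpol x p = 0}"
    using BC unfolding zariski_closed_def by blast
  obtain T where T: "T \<subseteq> mpols UNIV N" "C = {x \<in> {..<N} \<rightarrow>\<^sub>E UNIV. \<forall>p\<in>T. eval_mpol x p = 0}"
    using BC unfolding zariski_closed_def by blast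
  show "V = B \<or> V = C"
  proof (rule ccontr)
    assume "\<not> (V = B \<or> V = C)"
    then obtain x y where xy: "x \<in> V" "x \<notin> B" "y \<in> V" "y \<notin> C" using BC by blast
    have ext: "x \<in> {..<N} \<rightarrow>\<^sub>E UNIV" "y \<in> {..<N} \<rightarrow>\<^sub>E UNIV" using xy by (auto simp: V_def)
    obtain p where p: "p \<in> S" "eval_mpol x p \<noteq> 0" using xy(2) ext(1) S(2) by blast
    obtain q where q: "q \<in> T" "eval_mpol y q \<noteq> 0" using xy(4) ext(2) T(2) by blast
    have pq: "p \<in> mpols UNIV N" "q \<in> mpols UNIV N" using p q S T by auto
    have ev_mult: "eval_mpol w (p * q) = eval_mpol w p * eval_mpol w q" for w
      by (simp add: eval_mpol_ev(1) rhom.ev_mult[OF rhom_id(1)])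
    have "eval_mpol w (p * q) = 0" if "w \<in> V" for w
      using that BC S(2) T(2) p(1) q(1) by (auto simp: ev_mult)
    moreover have "p * q \<in> mpols UNIV N" using is_subringD(4)[OF is_subring_mpols[OF is_subring_UNIV] pq] .
    ultimately have "p * q \<in> vanishing_ideal N V" by (simp add: vanishing_ideal_def)
    hence "p * q \<in> J" by (simp add: vanishing_iff)
    obtain v where v: "v \<in> zeros emb" "v 0 = par 0" "v 1 = par 1" by (rule generic_zero_exists)
    have "ev emb v p * ev emb v q = 0"
      using J_zeros[OF rhom_emb v(1) \<open>p * q \<in> J\<close>] by (simp add: rhom.ev_mult[OF rhom_emb])
    hence "p \<in> J \<or> q \<in> J" using in_J_if_generic_zero[OF v] pq by auto
    hence "p \<in> vanishing_ideal N V \<or> q \<in> vanishing_ideal N V" using pq by (simp add: vanishing_iff)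
    thus False using p(2) q(2) xy by (auto simp: vanishing_ideal_def)
  qed
qed

lemma rat_value_unique:
  assumes "rat_value (range to_univ) N x0 a (x0 i) c" "a \<in> V" "i < N"
  shows "c = a i"
proof -
  note R = is_subring_range[OF rhom_to_univ]
  have "c * eval_mpol a 1 = eval_mpol a (Var i)"
    by (rule rat_value_relation[OF R x0_generic assms(2)])
      (use assms Var_in_mpols[OF R] is_subringD(2)[OF is_subring_mpols[OF R]] in \<open>auto simp: eval_mpol_simps\<close>)
  thus ?thesis by (simp add: eval_mpol_simps)
qed

text \<open>The map is the projection to the first two coordinates of \<open>x0\<close>. Its image
  contains all parameters with squarefree fibre, and these are dense.\<close>

lemma V_dominating: "dominating (range to_univ) N V x0 2 x0"
  unfolding dominating_def
proof (intro allI impI)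
  interpret u: family_ac "map_poly to_univ A" "map_poly to_univ b" "map_poly to_univ g" "to_univ \<xi>" n
    by (rule family_ac_univ)
  fix W assume W: "zariski_closed 2 W \<and> {b \<in> {..<2} \<rightarrow>\<^sub>E UNIV. \<exists>a\<in>V. rat_map_value (range to_univ) N x0 2 x0 a b} \<subseteq> W"
  obtain S where S: "S \<subseteq> mpols UNIV 2" "W = {x \<in> {..<2} \<rightarrow>\<^sub>E UNIV. \<forall>p\<in>S. eval_mpol x p = 0}"
    using W unfolding zariski_closed_def by blast
  have "r = 0" if r: "r \<in> S" for r
  proof (rule u.parameters_dense)
    show rM: "r \<in> mpols UNIV 2" using r S by auto
    fix t0 t1 assume "rsquarefree (fam_poly (map_poly to_univ A) (map_poly to_univ b) (to_univ \<xi>) t0 t1)"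
    then obtain z where z: "inj_on z {..<n}" "\<And>k. k < n \<Longrightarrow> poly (fE id t0 t1) (z k) = 0"
      using zero_over_squarefree[OF rhom_id(1)] unfolding fE_id by blast
    note pt = point[OF rhom_id(1) z]
    let ?a = "point id t0 t1 z"
    have "?a \<in> {..<N} \<rightarrow>\<^sub>E UNIV" by (auto simp: point_def PiE_def extensional_def N_def)
    hence aV: "?a \<in> V" using pt(1) by (simp add: V_zeros)
    let ?b = "restrict ?a {..<2}"
    have "rat_map_value (range to_univ) N x0 2 x0 ?a ?b"
      unfolding rat_map_value_def
    proof (intro allI impI)
      fix i :: nat assume "i < 2"
      thus "rat_value (range to_univ) N x0 ?a (x0 i) (?b i)" using rat_value_coordinate[OF is_subring_range[OF rhom_to_univ], of i N x0 ?a] by (simp add: N_def)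
    qed
    hence "?b \<in> W" using W aV by (intro subsetD[OF conjunct2[OF W]] CollectI conjI) auto
    hence "ev id ?b r = 0" using S(2) r by (auto simp: eval_mpol_ev(1))
    also have "ev id ?b r = ev id (\<lambda>i. if i = 0 then t0 else t1) r"
      by (rule ev_cong[OF rM]) (use pt(3,4) in \<open>auto simp: less_2_cases_iff\<close>)
    finally show "ev id (\<lambda>i. if i = 0 then t0 else t1) r = 0" .
  qed
  hence S0: "r = 0" if "r \<in> S" for r using that by blast
  have "eval_mpol x r = 0" if "r \<in> S" for x r unfolding S0[OF that] by (simp add: eval_mpol_def)
  thus "W = {..<2} \<rightarrow>\<^sub>E UNIV" unfolding S(2) by blast
qed

section \<open>The rational point and the irreducibility of its fibre\<close>

lemma rational_point:
  fixes j :: "'f::field \<Rightarrow> 'm"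
  assumes pac: "pac_extension j"
  obtains a and c :: "nat \<Rightarrow> 'f" where "a \<in> V" "\<And>i. i < N \<Longrightarrow> a i \<in> range to_univ" "a 0 = to_univ (j (c 0))" "a 1 = to_univ (j (c 1))"
proof -
  let ?K = "range (to_univ :: 'm \<Rightarrow> _)"
  have K: "is_subfield ?K" by (rule is_subfield_range[OF rhom_to_univ])
  have N2: "i < N" if "i < 2" for i using that by (simp add: N_def)
  have "variety_over ?K N V" unfolding variety_over_def using V_closed V_irreducible V_defined_over by blast
  moreover have "has_trdeg ?K (gen_field ?K N x0) 2"
    unfolding has_trdeg_def
    by (intro exI[of _ x0] conjI allI impI ballI var_in_gen_field[OF K] x0_indep separable_imp_alg gen_field_separable N2)
  moreover have "rat_map ?K N x0 2 x0"
    unfolding rat_map_def using var_in_gen_field[OF K] N2 by blast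
  moreover have "separable_map ?K N x0 2 x0"
    unfolding separable_map_def using gen_field_separable by blast
  ultimately have "\<exists>a\<in>V. (\<forall>i<N. a i \<in> ?K) \<and> (\<exists>c. rat_map_value ?K N x0 2 x0 a (\<lambda>i. to_univ (j (c i))))"
    using conjunct2[OF pac[unfolded pac_extension_def]] x0_generic V_dominating by blast
  then obtain a c where a: "a \<in> V" "\<forall>i<N. a i \<in> ?K" "rat_map_value ?K N x0 2 x0 a (\<lambda>i. to_univ (j (c i)))" by blast
  have "to_univ (j (c i)) = a i" if "i < 2" for i
    by (rule rat_value_unique[OF _ a(1) N2[OF that]]) (use a(3) that in \<open>auto simp: rat_map_value_def\<close>)
  thus ?thesis using that[of a c] a by auto
qed

text \<open>At a rational point, \<open>Y\<close> maps the conjugates of \<open>\<theta>\<close> to the roots of the fibre, so the irreducibility of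
  \<open>p\<close> forces a factor with one root to have all of them.\<close>

lemma fibre_irreducible:
  assumes a: "a \<in> V" "\<And>i. i < N \<Longrightarrow> a i \<in> range to_univ" "a 0 = to_univ s0" "a 1 = to_univ s1"
    and fac: "fam_poly A b \<xi> s0 s1 = u * w"
  shows "degree u = 0 \<or> degree w = 0"
proof -
  have z: "a \<in> zeros id" using a(1) by (simp add: V_zeros)
  note zd = zeros_distinct[OF rhom_id(1) z]
  have "\<exists>y. \<forall>i<n. a (2 + i) = to_univ (y i)"
  proof -
    have "a (2 + i) \<in> range to_univ" if "i < n" for i
      by (rule a(2)) (use that in \<open>simp add: N_def\<close>)
    hence "\<forall>i\<in>{..<n}. \<exists>c. a (2 + i) = to_univ c" by blast
    from bchoice[OF this] show ?thesis by blast
  qed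
  then obtain y where y: "\<And>i. i < n \<Longrightarrow> a (2 + i) = to_univ (y i)" by blast
  define Y where "Y = (\<Sum>i<n. monom (y i) i)"
  have Z: "Zv id a k = poly (map_poly to_univ Y) (\<theta> k)" for k
    by (simp add: Zv_def Y_def rhom.map_poly_sum[OF rhom_to_univ] rhom.map_poly_monom[OF rhom_to_univ] poly_sum poly_monom y del: add_2_eq_Suc)
  have f: "map_poly to_univ (fam_poly A b \<xi> s0 s1) = fE id (a 0) (a 1)"
    by (simp add: fE_id map_poly_fam_poly[OF rhom_to_univ] a del: One_nat_def)
  have f0: "fam_poly A b \<xi> s0 s1 \<noteq> 0" using fam_monic(2)[of s0 s1] by auto
  have deg: "degree u + degree w = n" using fam_monic(1)[of s0 s1] fac f0 by (auto simp: degree_mult_eq)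
  have all: "n \<le> degree q" if q: "poly (map_poly to_univ q) (Zv id a 0) = 0" "q \<noteq> 0" for q :: "'m poly"
  proof -
    let ?c = "pcompose q Y"
    have ev: "poly (map_poly to_univ ?c) (\<theta> k) = poly (map_poly to_univ q) (Zv id a k)" for k
      by (simp add: rhom.map_poly_pcompose[OF rhom_to_univ] poly_pcompose Z)
    have "p dvd ?c"
    proof (rule ccontr)
      assume "\<not> p dvd ?c"
      then obtain r s where "r * p + s * ?c = 1" using irreducible_bezout_field_poly[OF p_irr] by blast
      hence "poly (map_poly to_univ (r * p + s * ?c)) (\<theta> 0) = 1"
        by (simp only: rhom.map_poly_one[OF rhom_to_univ] poly_1)
      thus False using \<theta>_root[OF n_pos] ev[of 0] q(1)
        by (simp add: rhom.map_poly_add[OF rhom_to_univ] rhom.map_poly_mult[OF rhom_to_univ])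
    qed
    then obtain r where "?c = p * r" by blast
    hence "poly (map_poly to_univ q) (Zv id a k) = 0" if "k < n" for k
      using ev[of k] \<theta>_root[OF that] by (simp add: rhom.map_poly_mult[OF rhom_to_univ])
    moreover have nz: "map_poly to_univ q \<noteq> 0" using q(2) by (simp add: map_poly_rhom_eq_0_iff[OF rhom_to_univ])
    ultimately have "card {..<n} \<le> card {x. poly (map_poly to_univ q) x = 0}"
      by (intro card_inj_on_le[OF zd(1)] poly_roots_finite) auto
    thus ?thesis using card_poly_roots_bound[OF nz] by (simp add: degree_map_poly_rhom[OF rhom_to_univ])
  qed
  have "poly (map_poly to_univ (u * w)) (Zv id a 0) = 0"
    unfolding fac[symmetric] f zd(2) poly_prod using n_pos by (auto intro!: prod_zero bexI[of _ 0])
  hence "poly (map_poly to_univ u) (Zv id a 0) = 0 \<or> poly (map_poly to_univ w) (Zv id a 0) = 0"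
    by (simp add: rhom.map_poly_mult[OF rhom_to_univ])
  thus ?thesis using all[of u] all[of w] fac f0 deg by auto
qed

end

subsection \<open>Primitive elements\<close>

locale extension = rhom h for h :: "'k::field \<Rightarrow> 'e::field"
begin

lemma rhom_h: "rhom h" by unfold_locales

sublocale vs: vector_space "\<lambda>c y. h c * y"
  by unfold_locales (simp_all add: algebra_simps)

lemma coeffs_in_range:
  assumes "\<And>i. coeff P i \<in> range h"
  obtains p where "P = map_poly h p"
proof -
  let ?k = "inv_into UNIV h"
  have inv0: "?k 0 = 0" using rhom_eq_iff[OF rhom_h] by (intro inv_f_eq) (auto simp: inj_def)
  have "coeff P i = coeff (map_poly h (map_poly ?k P)) i" for i
    using assms[of i] by (simp add: coeff_map_poly inv0 f_inv_into_f)
  thus ?thesis using that poly_eqI by blast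
qed

text \<open>The minimal polynomial lives over the base type, where \<open>irreducible\<close> refers
  to the base field.\<close>

lemma base_min_poly:
  assumes "alg_over (range h) y"
  obtains q where "irreducible q" "lead_coeff q = 1" "poly (map_poly h q) y = 0"
    "\<And>r. poly (map_poly h r) y = 0 \<Longrightarrow> q dvd r"
proof -
  let ?P = "\<lambda>q. q \<noteq> 0 \<and> poly (map_poly h q) y = 0"
  obtain Q where Q: "\<And>i. coeff Q i \<in> range h" "Q \<noteq> 0" "poly Q y = 0" using assms by (auto simp: alg_over_def)
  obtain q0 where "Q = map_poly h q0" using coeffs_in_range[OF Q(1)] .
  hence "?P q0" using Q by auto
  from ex_has_least_nat[of ?P, OF this, of degree]
  obtain q1 where q1: "?P q1" and least: "\<And>r. ?P r \<Longrightarrow> degree q1 \<le> degree r" by blast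
  define q where "q = smult (inverse (lead_coeff q1)) q1"
  have q: "lead_coeff q = 1" "poly (map_poly h q) y = 0" "degree q = degree q1" "q \<noteq> 0"
    using q1 by (simp_all add: q_def)
  have dv: "q dvd r" if "poly (map_poly h r) y = 0" for r
  proof (rule ccontr)
    assume n: "\<not> q dvd r"
    have "poly (map_poly h (q * (r div q) + r mod q)) y = 0" using that by simp
    hence "poly (map_poly h (r mod q)) y = 0" unfolding map_poly_add map_poly_mult using q(2) by simp
    moreover have "r mod q \<noteq> 0" using n by (simp add: mod_eq_0_iff_dvd)
    ultimately show False using least[of "r mod q"] degree_mod_less[OF q(4), of r] q(3) by auto
  qed
  have "irreducible q"
  proof (rule irreducibleI)
    show "q \<noteq> 0" by (rule q)
    show "\<not> q dvd 1"
    proof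
      assume "q dvd 1"
      then obtain s where "1 = q * s" by blast
      hence "poly (map_poly h (q * s)) y = 1" by (metis map_poly_one poly_1)
      thus False using q(2) by simp
    qed
    fix u w assume uw: "q = u * w"
    hence nz: "u \<noteq> 0" "w \<noteq> 0" using q(4) by auto
    have "poly (map_poly h u) y = 0 \<or> poly (map_poly h w) y = 0" using q(2) by (simp add: uw)
    hence "q dvd u \<or> q dvd w" using dv by blast
    hence "degree q \<le> degree u \<or> degree q \<le> degree w" using nz dvd_imp_degree_le by blast
    hence "degree w = 0 \<or> degree u = 0" using nz by (auto simp: uw degree_mult_eq)
    thus "u dvd 1 \<or> w dvd 1" using nz by (auto simp: is_unit_iff_degree)
  qed
  thus ?thesis using that q dv by blast
qed

abbreviation powers :: "'e \<Rightarrow> nat \<Rightarrow> 'e set" where "powers y d \<equiv> (\<lambda>i. y ^ i) ` {..<d}"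

lemma eval_in_span_powers:
  assumes "poly (map_poly h q) y = 0" "q \<noteq> 0"
  shows "poly (map_poly h r) y \<in> vs.span (powers y (degree q))"
proof -
  have "poly (map_poly h r) y = poly (map_poly h (q * (r div q) + r mod q)) y" by simp
  also have "\<dots> = poly (map_poly h (r mod q)) y" unfolding map_poly_add map_poly_mult using assms by simp
  also have "\<dots> = (\<Sum>i<degree q. coeff (map_poly h (r mod q)) i * y ^ i)"
  proof (rule poly_as_sum_lt)
    show "map_poly h (r mod q) = 0 \<or> degree (map_poly h (r mod q)) < degree q"
      using degree_mod_less[OF assms(2), of r] degree_map_poly_rhom[OF rhom_h] by auto
  qed
  also have "\<dots> \<in> vs.span (powers y (degree q))"
    unfolding coeff by (intro vs.span_sum vs.span_scale vs.span_base) auto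
  finally show ?thesis .
qed

lemma powers_independent:
  assumes dv: "\<And>r. poly (map_poly h r) y = 0 \<Longrightarrow> q dvd r" and "q \<noteq> 0"
  shows "card (powers y (degree q)) = degree q" "vs.independent (powers y (degree q))"
proof -
  have small: "r = 0" if "poly (map_poly h r) y = 0" "degree r < degree q" for r
    using dvd_imp_degree_le[OF dv[OF that(1)]] that(2) by linarith
  have inj: "inj_on (\<lambda>i. y ^ i) {..<degree q}"
  proof (rule inj_onI, rule ccontr)
    fix i k assume *: "i \<in> {..<degree q}" "k \<in> {..<degree q}" "y ^ i = y ^ k" "i \<noteq> k"
    let ?r = "monom 1 i - monom 1 k :: 'k poly"
    have "degree ?r < degree q" using * by (intro degree_diff_less) (auto simp: degree_monom_eq)
    moreover have "poly (map_poly h ?r) y = 0" using * by (simp add: poly_monom)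
    ultimately have "?r = 0" using small by blast
    thus False using *(4) by (auto dest: arg_cong[of _ _ "\<lambda>p. coeff p i"] simp: coeff_monom)
  qed
  show "card (powers y (degree q)) = degree q" by (simp add: card_image[OF inj])
  have "u (y ^ k) = 0" if u: "(\<Sum>v\<in>powers y (degree q). h (u v) * v) = 0" and k: "k < degree q" for u k
  proof -
    define r where "r = (\<Sum>i<degree q. monom (u (y ^ i)) i)"
    have c: "coeff r i = (if i < degree q then u (y ^ i) else 0)" for i by (simp add: r_def coeff_sum coeff_monom)
    have "poly (map_poly h r) y = (\<Sum>i<degree q. h (u (y ^ i)) * y ^ i)"
      by (simp add: r_def map_poly_sum poly_sum poly_monom)
    also have "\<dots> = 0" using u by (simp add: sum.reindex[OF inj] o_def)
    finally have "r = 0 \<or> degree r < degree q \<Longrightarrow> r = 0" using small by blast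
    moreover have "degree r < degree q" using k c by (intro degree_lessI) auto
    ultimately have "r = 0" by blast
    thus ?thesis using c[of k] k by simp
  qed
  thus "vs.independent (powers y (degree q))" by (subst vs.dependent_finite) auto
qed

lemma adj_in_span_powers:
  assumes "irreducible q" "poly (map_poly h q) y = 0"
  shows "adj (range h) y \<subseteq> vs.span (powers y (degree q))"
proof
  fix z assume "z \<in> adj (range h) y"
  then obtain U W where UW: "U \<in> polys_over (range h)" "W \<in> polys_over (range h)" "poly W y \<noteq> 0" "z = poly U y / poly W y"
    using in_adjE[OF is_subfield_range[OF rhom_h]] by blast
  obtain u where u: "U = map_poly h u" by (rule coeffs_in_range[of U]) (use UW in \<open>auto simp: polys_over_def\<close>)
  obtain w where w: "W = map_poly h w" by (rule coeffs_in_range[of W]) (use UW in \<open>auto simp: polys_over_def\<close>)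
  have "\<not> q dvd w" using UW(3) assms(2) by (auto simp: w)
  then obtain r s where rs: "r * q + s * w = 1"
    using irreducible_bezout_field_poly[OF assms(1)] by blast
  hence "poly (map_poly h (r * q + s * w)) y = 1" by simp
  hence "poly (map_poly h s) y * poly W y = 1" by (simp add: assms(2) w)
  hence z: "z = poly (map_poly h (u * s)) y" using UW(3) by (simp add: UW(4) u field_simps)
  have "q \<noteq> 0" using assms(1) by (auto simp: irreducible_def)
  thus "z \<in> vs.span (powers y (degree q))" unfolding z by (rule eval_in_span_powers[OF assms(2)])
qed

end

lemma rsquarefree_dvd:
  fixes p q :: "'a::field poly"
  assumes "rsquarefree p" "q dvd p"
  shows "rsquarefree q"
proof -
  obtain r where r: "p = q * r" using assms(2) by blast
  show ?thesis using assms(1) unfolding rsquarefree_iff_no_double_root by (auto simp: r pderiv_mult)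
qed

text \<open>Over the field generated by y + c z, the minimal polynomial of \<open>z\<close> divides
  both \<open>g\<close> and \<open>f\<close> at y + c z - c X. For all but finitely many
  \<open>c\<close> their only common root is \<open>z\<close>, and as \<open>g\<close> is
  squarefree, that minimal polynomial is linear.\<close>

lemma primitive_element_two:
  fixes y z :: "'e::alg_closed_field"
  assumes K: "is_subfield K" "infinite K" and y: "separable_over K y" and z: "separable_over K z"
  obtains c where "c \<in> K" "y \<in> adj K (y + c * z)" "z \<in> adj K (y + c * z)"
proof -
  obtain f where f: "\<forall>i. coeff f i \<in> K" "rsquarefree f" "poly f y = 0" using y unfolding separable_over_def by blast
  obtain g where g: "\<forall>i. coeff g i \<in> K" "rsquarefree g" "poly g z = 0" using z unfolding separable_over_def by blast
  have nz: "f \<noteq> 0" "g \<noteq> 0" using f g by (auto simp: rsquarefree_def)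
  \<comment> \<open>The values of \<open>c\<close> for which y + c z equals y' + c z' with
    conjugates y' of \<open>y\<close> and z' different from \<open>z\<close>. Pairs with z' = z
    contribute only 0, the value of a division by zero.\<close>
  let ?B = "(\<lambda>(y', z'). (y' - y) / (z - z')) ` ({t. poly f t = 0} \<times> {t. poly g t = 0})"
  have "finite ?B" using nz by (intro finite_imageI finite_cartesian_product poly_roots_finite)
  hence "\<not> K \<subseteq> ?B" using K(2) finite_subset by blast
  then obtain c where c: "c \<in> K" "c \<notin> ?B" by blast
  let ?e = "y + c * z"
  let ?L = "adj K ?e"
  note L = adj_facts[OF K(1), where y = ?e]
  note D = is_subringD[OF is_subfield_subring[OF L(1)]]
  have eL: "?e \<in> ?L" by (rule L(3))
  have cL: "c \<in> ?L" using L(2) c(1) by blast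
  have gL: "g \<in> polys_over ?L" and fL: "f \<in> polys_over ?L" using f(1) g(1) L(2) by (auto simp: polys_over_def)
  have "[:?e, - c:] \<in> polys_over ?L" using eL D(5)[OF cL] zero_in_polys_over[OF is_subfield_subring[OF L(1)]] by simp
  hence hL: "pcompose f [:?e, - c:] \<in> polys_over ?L" by (rule pcompose_in_polys_over[OF is_subfield_subring[OF L(1)] fL])
  have "alg_over ?L z" using gL g(3) nz by (auto simp: alg_over_def polys_over_def)
  from min_poly_exists[OF L(1) this]
  obtain m where m: "m \<in> polys_over ?L" "lead_coeff m = 1" "poly m z = 0" "0 < degree m"
    "\<And>q. q \<in> polys_over ?L \<Longrightarrow> poly q z = 0 \<Longrightarrow> \<exists>s\<in>polys_over ?L. q = m * s" by metis
  have "m dvd g" "m dvd pcompose f [:?e, - c:]"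
    using m(5)[OF gL g(3)] m(5)[OF hL] f(3) by (auto simp: poly_pcompose algebra_simps)
  hence common: "poly g t = 0" "poly f (?e - c * t) = 0" if "poly m t = 0" for t
  proof -
    obtain r s where "g = m * r" "pcompose f [:?e, - c:] = m * s" using \<open>m dvd g\<close> \<open>m dvd pcompose f _\<close> by blast
    moreover have "poly f (?e - c * t) = poly (pcompose f [:?e, - c:]) t" by (simp add: poly_pcompose algebra_simps)
    ultimately show "poly g t = 0" "poly f (?e - c * t) = 0" using that by simp_all
  qed
  have "{t. poly m t = 0} = {z}"
  proof (intro equalityI subsetI)
    fix t assume t: "t \<in> {t. poly m t = 0}"
    show "t \<in> {z}"
    proof (rule ccontr)
      assume "t \<notin> {z}"
      hence "c = ((?e - c * t) - y) / (z - t)" by (simp add: field_simps)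
      hence "c \<in> ?B" using common t by (intro image_eqI[of _ _ "(?e - c * t, t)"]) auto
      thus False using c(2) by blast
    qed
  qed (use m(3) in auto)
  hence d1: "degree m = 1" using rsquarefree_factorization(1)[OF rsquarefree_dvd[OF g(2) \<open>m dvd g\<close>]] by simp
  have "poly m z = coeff m 0 + coeff m 1 * z" by (simp add: poly_altdef d1)
  hence "z = - coeff m 0" using m(2,3) d1 by (simp add: eq_neg_iff_add_eq_0 add.commute)
  hence zL: "z \<in> ?L" using m(1) D(5) by (simp add: polys_over_def)
  have "y = ?e - c * z" by simp
  also have "\<dots> \<in> ?L" by (intro D eL cL zL)
  finally show ?thesis using that[OF c(1)] zL by blast
qed

text \<open>Degrees of elements of \<open>L\<close> are bounded by \<open>n\<close>; an element
  \<open>y\<close> of maximal degree \<open>d\<close> generates. Otherwise some \<open>z\<close> is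
  independent of the powers of \<open>y\<close>, and a primitive element for \<open>y\<close> and
  \<open>z\<close> would have degree above \<open>d\<close>.\<close>

lemma primitive_element:
  fixes h :: "'k::field \<Rightarrow> 'e::alg_closed_field"
  assumes h: "rhom h" and inf: "infinite (UNIV :: 'k set)" and L: "is_subfield L" "range h \<subseteq> L"
    and sep: "\<And>y. y \<in> L \<Longrightarrow> separable_over (range h) y"
    and dim: "vector_space.dim (\<lambda>c y. h c * y) L = n" "0 < n"
  obtains q y where "irreducible q" "lead_coeff q = 1" "degree q = n" "poly (map_poly h q) y = 0" "y \<in> L"
proof -
  interpret extension h by (rule extension.intro[OF h])
  note D = is_subringD[OF is_subfield_subring[OF L(1)]]
  have K: "is_subfield (range h)" "infinite (range h)"
    using is_subfield_range[OF h] inf rhom_eq_iff[OF h] by (auto simp: finite_image_iff inj_def)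
  let ?mp = "\<lambda>q y. irreducible q \<and> lead_coeff q = 1 \<and> poly (map_poly h q) y = 0 \<and>
    (\<forall>r. poly (map_poly h r) y = 0 \<longrightarrow> q dvd r)"
  have mp: "\<exists>q. ?mp q y" if "y \<in> L" for y
    using base_min_poly[OF separable_imp_alg[OF sep[OF that]]] by metis
  obtain B where B: "B \<subseteq> L" "vs.independent B" "L \<subseteq> vs.span B" "card B = n"
    using vs.basis_exists[of L] dim(1) by metis
  have finB: "finite B" using B(4) dim(2) card_gt_0_iff by blast
  have ind: "card (powers y (degree q)) = degree q" "vs.independent (powers y (degree q))" if "?mp q y" for q y
    using powers_independent[of y q] that by (auto simp: irreducible_def)
  have pL: "powers y d \<subseteq> L" if "y \<in> L" for y d using that D(7) by auto
  have bound: "degree q \<le> n" if "?mp q y" "y \<in> L" for q y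
    using vs.independent_span_bound[OF finB ind(2)[OF that(1)]] pL[OF that(2), of "degree q"] B(3,4) ind(1)[OF that(1)] by auto
  let ?Q = "\<lambda>d. \<exists>q y. y \<in> L \<and> ?mp q y \<and> degree q = d"
  have "\<exists>d. ?Q d" using mp[OF D(1)] D(1) by blast
  moreover have "\<forall>d. ?Q d \<longrightarrow> d \<le> n" using bound by blast
  ultimately obtain d where d: "?Q d" and max: "\<And>d'. ?Q d' \<Longrightarrow> d' \<le> d"
    using GreatestI_ex_nat[of ?Q n] Greatest_le_nat[of ?Q _ n] by blast
  then obtain q y where qy: "y \<in> L" "?mp q y" "degree q = d" by blast
  have "z \<in> vs.span (powers y d)" if z: "z \<in> L" for z
  proof (rule ccontr)
    assume nz: "z \<notin> vs.span (powers y d)"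
    obtain c where c: "c \<in> range h" "y \<in> adj (range h) (y + c * z)" "z \<in> adj (range h) (y + c * z)"
      using primitive_element_two[OF K sep[OF qy(1)] sep[OF z]] .
    let ?e = "y + c * z"
    note E = adj_facts[OF K(1), where y = ?e]
    have "?e \<in> L" using c(1) L(2) qy(1) z by (intro D) auto
    then obtain q' where q': "?mp q' ?e" using mp by blast
    have "degree q' \<le> d" using max q' \<open>?e \<in> L\<close> by blast
    have "insert z (powers y d) \<subseteq> adj (range h) ?e"
      using c(2,3) is_subringD(7)[OF is_subfield_subring[OF E(1)]] by auto
    also have "\<dots> \<subseteq> vs.span (powers ?e (degree q'))" using adj_in_span_powers q' by blast
    finally have sub: "insert z (powers y d) \<subseteq> vs.span (powers ?e (degree q'))" .
    have "vs.independent (insert z (powers y d))"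
      using vs.independent_insertI[OF nz] ind(2)[OF qy(2)] qy(3) by simp
    have fin: "finite (powers ?e (degree q'))" by simp
    have "card (insert z (powers y d)) \<le> card (powers ?e (degree q'))"
      using vs.independent_span_bound[OF fin \<open>vs.independent (insert z _)\<close> sub] by (rule conjunct2)
    moreover have "z \<notin> powers y d" by (rule contrapos_nn[OF nz vs.span_base])
    moreover have "card (powers y d) = d" using ind(1)[OF qy(2)] qy(3) by (simp only:)
    ultimately show False using ind(1)[OF q'] \<open>degree q' \<le> d\<close> by simp
  qed
  hence "card (powers y d) = vs.dim L"
    using vs.basis_card_eq_dim[of "powers y d" L] pL[OF qy(1)] ind(2)[OF qy(2), unfolded qy(3)] by blast
  hence "d = n" using ind(1)[OF qy(2)] qy(3) dim(1) by (simp only:)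
  thus ?thesis using that[of q y] qy by blast
qed

text \<open>Separability leaves in Bezout form, which does not depend on a surrounding field: it is
  obtained in the algebraic closure of M and applied in the universal domain.\<close>

lemma separable_degree_poly:
  assumes n: "n \<in> separable_degrees TYPE('m::field)" and inf: "infinite (UNIV :: 'm::field set)"
  obtains q :: "'m::field poly" and u v where "irreducible q" "lead_coeff q = 1" "degree q = n" "u * q + v * pderiv q = 1"
proof -
  note h = rhom_to_ac[where 'a = 'm]
  obtain L :: "'m alg_closure set" where L: "0 < n" "subfield L ring_of_type_algebra" "range to_ac \<subseteq> L"
    "\<forall>y\<in>L. separable_over (range to_ac) y" "vector_space.dim (\<lambda>(c::'m) y. to_ac c * y) L = n"
    using n unfolding separable_degrees_def by blast
  obtain q y where q: "irreducible q" "lead_coeff q = 1" "degree q = n" "poly (map_poly to_ac q) y = 0" "y \<in> L"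
    using primitive_element[OF h inf _ L(3) _ L(5,1)] L(2,4) unfolding subfield_iff_is_subfield by blast
  interpret extension "to_ac :: 'm \<Rightarrow> _" by (rule extension.intro[OF h])
  obtain P where P: "\<And>i. coeff P i \<in> range to_ac" "rsquarefree P" "poly P y = 0"
    using L(4) q(5) unfolding separable_over_def by blast
  obtain p where p: "P = map_poly to_ac p" using coeffs_in_range[OF P(1)] .
  have "\<not> q dvd pderiv q"
  proof
    assume "q dvd pderiv q"
    then obtain s where s: "pderiv q = q * s" by blast
    have "q dvd p"
    proof (rule ccontr)
      assume "\<not> q dvd p"
      then obtain u v where "u * q + v * p = 1" using irreducible_bezout_field_poly[OF q(1)] by blast
      hence "poly (map_poly to_ac (u * q + v * p)) y = 1" by simp
      thus False using P(3) q(4) by (simp add: p)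
    qed
    then obtain r where "p = q * r" by blast
    hence "rsquarefree (map_poly to_ac q)" using rsquarefree_dvd[OF P(2)] by (simp add: p)
    moreover have "poly (pderiv (map_poly to_ac q)) y = 0"
      using q(4) by (simp add: map_poly_pderiv[OF h, symmetric] s)
    ultimately show False using q(4) by (auto simp: rsquarefree_iff_no_double_root)
  qed
  from irreducible_bezout_field_poly[OF q(1) this] show ?thesis using that q by blast
qed

subsection \<open>The base field is infinite\<close>

lemma affine_space_closed: "zariski_closed n ({..<n} \<rightarrow>\<^sub>E UNIV)"
  unfolding zariski_closed_def by (intro exI[of _ "{}"]) auto

lemma mpol_eq_0_if_vanishing:
  fixes p :: "'u::alg_closed_field mpol"
  assumes p: "p \<in> mpols UNIV n" and van: "\<And>x. x \<in> {..<n} \<rightarrow>\<^sub>E UNIV \<Longrightarrow> eval_mpol x p = 0"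
  shows "p = 0"
proof (rule mpols_eq_0I[OF p rhom_id(1) infinite_UNIV_alg_closed])
  fix x :: "nat \<Rightarrow> 'u"
  have "ev id x p = ev id (restrict x {..<n}) p" by (rule ev_cong[OF p]) simp
  thus "ev id x p = 0" using van[of "restrict x {..<n}"] by (simp add: eval_mpol_ev(1))
qed

lemma vanishing_ideal_affine_space:
  fixes p :: "'u::alg_closed_field mpol"
  shows "p \<in> vanishing_ideal n ({..<n} \<rightarrow>\<^sub>E UNIV) \<longleftrightarrow> p = 0"
  using mpol_eq_0_if_vanishing[of p n] is_subringD(1)[OF is_subring_mpols[OF is_subring_UNIV]]
  by (auto simp: vanishing_ideal_def eval_mpol_simps)

lemma affine_space_variety: "variety_over K n ({..<n} \<rightarrow>\<^sub>E (UNIV :: 'u::alg_closed_field set))"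
  unfolding variety_over_def
proof (intro conjI affine_space_closed)
  let ?V = "{..<n} \<rightarrow>\<^sub>E (UNIV :: 'u set)"
  show "defined_over K n ?V" unfolding defined_over_def
    by (simp add: vanishing_ideal_affine_space exI[of _ "{}"])
  show "zariski_irreducible n ?V" unfolding zariski_irreducible_def
  proof (intro conjI allI impI)
    show "?V \<noteq> {}" by (simp add: PiE_eq_empty_iff)
    fix B C assume BC: "zariski_closed n B \<and> zariski_closed n C \<and> ?V = B \<union> C"
    obtain S where S: "S \<subseteq> mpols UNIV n" "B = {x \<in> ?V. \<forall>p\<in>S. eval_mpol x p = 0}"
      using BC unfolding zariski_closed_def by blast
    obtain T where T: "T \<subseteq> mpols UNIV n" "C = {x \<in> ?V. \<forall>p\<in>T. eval_mpol x p = 0}"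
      using BC unfolding zariski_closed_def by blast
    show "?V = B \<or> ?V = C"
    proof (rule ccontr)
      assume "\<not> (?V = B \<or> ?V = C)"
      then obtain x y where xy: "x \<in> ?V" "x \<notin> B" "y \<in> ?V" "y \<notin> C" using BC by blast
      obtain p where p: "p \<in> S" "eval_mpol x p \<noteq> 0" using xy S(2) by blast
      obtain q where q: "q \<in> T" "eval_mpol y q \<noteq> 0" using xy T(2) by blast
      have pq: "p \<in> mpols UNIV n" "q \<in> mpols UNIV n" using p q S T by auto
      have "p * q = 0"
      proof (rule mpol_eq_0_if_vanishing)
        show "p * q \<in> mpols UNIV n" by (rule is_subringD(4)[OF is_subring_mpols[OF is_subring_UNIV] pq])
        fix w :: "nat \<Rightarrow> 'u" assume "w \<in> ?V"
        hence "w \<in> B \<or> w \<in> C" using BC by blast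
        thus "eval_mpol w (p * q) = 0" using S(2) T(2) p(1) q(1) by (auto simp: eval_mpol_simps)
      qed
      hence "p = 0 \<or> q = 0" by simp
      thus False using p(2) q(2) by (auto simp: eval_mpol_simps)
    qed
  qed
qed

text \<open>For finite \<open>F\<close> apply the PAC property to \<open>(x, y) \<mapsto> (x, y + 1 / \<Prod>\<^bsub>e \<in> F\<^esub> (x - e))\<close> on the affine plane,
  which is not defined at points with \<open>x \<in> F\<close>.\<close>

lemma pac_extension_infinite:
  fixes j :: "'f::field \<Rightarrow> 'm::field"
  assumes pac: "pac_extension j"
  shows "infinite (UNIV :: 'f set)"
proof
  assume fin: "finite (UNIV :: 'f set)"
  let ?K = "range (to_univ :: 'm \<Rightarrow> _)"
  have K: "is_subfield ?K" by (rule is_subfield_range[OF rhom_to_univ])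
  note R = is_subfield_subring[OF K]
  let ?V = "{..<2::nat} \<rightarrow>\<^sub>E (UNIV :: 'm univ_dom set)"
  define x where "x = restrict (indet :: nat \<Rightarrow> 'm univ_dom) {..<2}"
  have ind: "alg_indep ?K 2 x" by (rule alg_indep_cong[OF indet_alg_indep]) (simp add: x_def)
  define Hp where "Hp = (\<Prod>e\<in>(UNIV :: 'f set). Var 0 - Cst (to_univ (j e)))"
  have M: "is_subring (mpols ?K 2)" by (rule is_subring_mpols[OF R])
  have v01: "Var 0 \<in> mpols ?K 2" "Var 1 \<in> mpols ?K 2" by (rule Var_in_mpols[OF R]; simp)+
  have HpM: "Hp \<in> mpols ?K 2"
    unfolding Hp_def by (intro is_subring_prod[OF M] is_subringD[OF M] v01 Cst_in_mpols) auto
  have Hp_eval: "eval_mpol y Hp = (\<Prod>e\<in>UNIV. y 0 - to_univ (j e))" for y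
    by (simp add: Hp_def eval_mpol_simps)
  have Hp0: "Hp \<noteq> 0"
  proof
    obtain s :: "'m univ_dom" where "s \<notin> range (\<lambda>e. to_univ (j e))"
      using infinite_UNIV_alg_closed[where 'a = "'m univ_dom"] fin by (metis finite_imageI UNIV_eq_I)
    hence "eval_mpol (\<lambda>_. s) Hp \<noteq> 0" using fin by (auto simp: Hp_eval)
    moreover assume "Hp = 0"
    ultimately show False by (simp add: eval_mpol_simps)
  qed
  have Hpx: "eval_mpol x Hp \<noteq> 0" using ind Hp0 HpM by (auto simp: alg_indep_def)
  define \<phi> where "\<phi> i = (if i = 0 then x 0 else eval_mpol x (Var 1 * Hp + 1) / eval_mpol x Hp)" for i :: nat
  have f_eval: "eval_mpol y (Var 1 * Hp + 1) = y 1 * eval_mpol y Hp + 1" for y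
    by (simp only: eval_mpol_simps eval_mpol_Var_Cst)
  have \<phi>1: "\<phi> 1 = x 1 + 1 / eval_mpol x Hp" unfolding \<phi>_def f_eval using Hpx by (simp add: add_divide_distrib)
  have fM: "Var 1 * Hp + 1 \<in> mpols ?K 2" by (intro is_subringD[OF M] v01 HpM)
  have gen: "generic_point ?K 2 ?V x"
    unfolding generic_point_def using ind by (auto simp: alg_indep_def vanishing_ideal_affine_space x_def)
  have "has_trdeg ?K (gen_field ?K 2 x) 2"
    unfolding has_trdeg_def using var_in_gen_field[OF K] ind alg_over_self[OF is_subfield_gen_field[OF K]] by blast
  moreover have "rat_map ?K 2 x 2 \<phi>"
  proof -
    have "\<phi> 0 \<in> gen_field ?K 2 x" using var_in_gen_field[OF K, of 0 2 x] by (simp add: \<phi>_def)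
    moreover have "\<phi> 1 \<in> gen_field ?K 2 x" unfolding \<phi>_def using gen_fieldI[OF K fM HpM Hpx] by simp
    ultimately show ?thesis unfolding rat_map_def by (auto simp: less_2_cases_iff)
  qed
  moreover have "dominating ?K 2 ?V x 2 \<phi>"
    unfolding dominating_def
  proof (intro allI impI)
    fix W assume W: "zariski_closed 2 W \<and> {b \<in> ?V. \<exists>a\<in>?V. rat_map_value ?K 2 x 2 \<phi> a b} \<subseteq> W"
    obtain S where S: "S \<subseteq> mpols UNIV 2" "W = {x \<in> ?V. \<forall>p\<in>S. eval_mpol x p = 0}"
      using W unfolding zariski_closed_def by blast
    have S0: "r = 0" if r: "r \<in> S" for r
    proof -
      \<comment> \<open>The factor \<open>Hp\<close> disposes of the points with first coordinate in
        F, which the image does not reach.\<close>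
      have "r * Hp = 0"
      proof (rule mpol_eq_0_if_vanishing)
        show "r * Hp \<in> mpols UNIV 2"
          using r S HpM mpols_mono[of ?K UNIV 2 2] by (intro is_subringD(4)[OF is_subring_mpols[OF is_subring_UNIV]]) auto
        fix b assume b: "b \<in> ?V"
        show "eval_mpol b (r * Hp) = 0"
        proof (cases "eval_mpol b Hp = 0")
          case False
          \<comment> \<open>The preimage of \<open>b\<close>: \<open>Hp\<close> depends on the first
            coordinate only, so the added term can be subtracted.\<close>
          define a where "a = (\<lambda>i. if i = 1 then b 1 - 1 / eval_mpol b Hp else b i)"
          have aV: "a \<in> ?V" using b by (auto simp: a_def PiE_def extensional_def)
          have Ha: "eval_mpol a Hp = eval_mpol b Hp" by (simp add: Hp_eval a_def)
          have "rat_value ?K 2 x a (\<phi> 0) (b 0)"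
            using rat_value_coordinate[OF R, of 0 2 x a] by (simp add: \<phi>_def a_def)
          moreover have Fa: "eval_mpol a Hp \<noteq> 0" using False by (simp add: Ha)
          have b1: "b 1 = eval_mpol a (Var 1 * Hp + 1) / eval_mpol a Hp"
            unfolding f_eval Ha using False by (simp add: a_def add_divide_distrib)
          have \<phi>1': "\<phi> 1 = eval_mpol x (Var 1 * Hp + 1) / eval_mpol x Hp" by (simp add: \<phi>_def)
          have "rat_value ?K 2 x a (\<phi> 1) (b 1)"
            unfolding rat_value_def
            by (rule bexI[OF bexI[OF _ HpM] fM]) (intro conjI Hpx \<phi>1' b1 Fa)
          ultimately have "rat_map_value ?K 2 x 2 \<phi> a b"
            unfolding rat_map_value_def by (auto simp: less_2_cases_iff)
          hence "b \<in> W" using W aV b by blast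
          thus ?thesis using S(2) r by (simp add: eval_mpol_simps)
        qed (simp add: eval_mpol_simps)
      qed
      thus ?thesis using Hp0 by simp
    qed
    have "eval_mpol y r = 0" if "r \<in> S" for y r unfolding S0[OF that] by (simp add: eval_mpol_simps)
    thus "W = ?V" unfolding S(2) by blast
  qed
  moreover have "separable_map ?K 2 x 2 \<phi>"
    unfolding separable_map_def
  proof
    let ?G = "gen_field ?K 2 \<phi>"
    have G: "is_subfield ?G" by (rule is_subfield_gen_field[OF K])
    note D = is_subringD[OF is_subfield_subring[OF G]] is_subfieldD[OF G]
    have KG: "c \<in> ?G" if "c \<in> ?K" for c using const_in_gen_field[OF K that] .
    have x0: "x 0 \<in> ?G" using var_in_gen_field[OF K, of 0 2 \<phi>] by (simp add: \<phi>_def)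
    have "eval_mpol x Hp \<in> ?G" unfolding Hp_eval
      by (intro is_subring_prod[OF is_subfield_subring[OF G]] D x0 KG) auto
    moreover have "\<phi> 1 \<in> ?G" using var_in_gen_field[OF K, of 1 2 \<phi>] by simp
    moreover have "x 1 = \<phi> 1 - 1 / eval_mpol x Hp" unfolding \<phi>1 by simp
    ultimately have x1: "x 1 \<in> ?G" by (metis D(2,6,9))
    have sub: "gen_field ?K 2 x \<subseteq> ?G"
      by (rule gen_field_subset[OF K G]) (use KG x0 x1 in \<open>auto simp: less_2_cases_iff\<close>)
    fix y assume "y \<in> gen_field ?K 2 x"
    thus "separable_over ?G y" using sub separable_self[OF G] by blast
  qed
  ultimately have "\<exists>a\<in>?V. (\<forall>i<2. a i \<in> ?K) \<and> (\<exists>c. rat_map_value ?K 2 x 2 \<phi> a (\<lambda>i. to_univ (j (c i))))"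
    using conjunct2[OF pac[unfolded pac_extension_def]] gen affine_space_variety[of ?K 2] by blast
  then obtain a c where a: "a \<in> ?V" "rat_map_value ?K 2 x 2 \<phi> a (\<lambda>i. to_univ (j (c i)))" by blast
  have val: "rat_value ?K 2 x a (\<phi> i) (to_univ (j (c i)))" if "i < 2" for i
    using a(2) that unfolding rat_map_value_def by blast
  have "\<phi> 0 = eval_mpol x (Var 0) / eval_mpol x 1" by (simp add: \<phi>_def eval_mpol_simps)
  hence "rat_value ?K 2 x a (eval_mpol x (Var 0) / eval_mpol x 1) (to_univ (j (c 0)))" using val[of 0] by simp
  from rat_value_relation[OF R gen a(1) v01(1) is_subringD(2)[OF M] _ this]
  have a0: "a 0 = to_univ (j (c 0))" by (simp add: eval_mpol_simps)
  \<comment> \<open>The first value lies in F, so \<open>Hp\<close> vanishes at \<open>a\<close>;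
    the relation for the second value then reads 0 = 1.\<close>
  hence "eval_mpol a Hp = 0" using fin by (auto simp: Hp_eval)
  moreover have "\<phi> 1 = eval_mpol x (Var 1 * Hp + 1) / eval_mpol x Hp" by (simp add: \<phi>_def)
  hence "rat_value ?K 2 x a (eval_mpol x (Var 1 * Hp + 1) / eval_mpol x Hp) (to_univ (j (c 1)))"
    using val[of 1] by (simp del: One_nat_def)
  from rat_value_relation[OF R gen a(1) fM HpM Hpx this]
  have "to_univ (j (c 1)) * eval_mpol a Hp = eval_mpol a (Var 1 * Hp + 1)" .
  ultimately show False unfolding f_eval by simp
qed

lemma pac_extension_rhom:
  fixes j :: "'f::field \<Rightarrow> 'm::field"
  assumes "pac_extension j"
  shows "rhom j"
proof (rule rhom_iff_ring_hom)
  show h: "j \<in> ring_hom ring_of_type_algebra ring_of_type_algebra" using assms by (simp add: pac_extension_def)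
  have "j (0 + 0) = j 0 + j 0" using ring_hom_add[OF h, of 0 0] by (simp add: ring_of_type_algebra_def)
  thus "j 0 = 0" by (metis add_0 add_cancel_right_right)
qed

subsection \<open>Choice of the family\<close>

lemma poly_root_alg_closure:
  fixes p :: "'k::field poly"
  assumes "degree p > 0"
  obtains x where "poly (map_poly to_ac p) x = 0"
proof -
  have "degree (map_poly to_ac p) > 0" using assms by (simp add: degree_map_poly_rhom[OF rhom_to_ac])
  thus ?thesis using that alg_closed_imp_poly_has_root by blast
qed

text \<open>A Bezout combination that divides both polynomials would, if not constant, have a root
  in the algebraic closure common to both.\<close>

lemma bezout_if_no_common_root:
  fixes p q :: "'k::field poly"
  assumes "p \<noteq> 0" "\<And>x. poly (map_poly to_ac p) x = 0 \<Longrightarrow> poly (map_poly to_ac q) x \<noteq> 0"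
  shows "\<exists>u v. u * p + v * q = 1"
proof -
  obtain u v where d: "(u * p + v * q) dvd p" "(u * p + v * q) dvd q" using bezout_field_poly by blast
  let ?d = "u * p + v * q"
  have "degree ?d = 0"
  proof (rule ccontr)
    assume "degree ?d \<noteq> 0"
    then obtain x where x: "poly (map_poly to_ac ?d) x = 0" using poly_root_alg_closure by blast
    obtain r s where "p = ?d * r" "q = ?d * s" using d by blast
    hence "map_poly to_ac p = map_poly to_ac ?d * map_poly to_ac r" "map_poly to_ac q = map_poly to_ac ?d * map_poly to_ac s"
      by (metis rhom.map_poly_mult[OF rhom_to_ac])+
    thus False using assms(2)[of x] x by simp
  qed
  then obtain c where c: "?d = [:c:]" using degree_eq_zeroE by blast
  have "c \<noteq> 0" using d(1) assms(1) c by auto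
  hence "(smult (inverse c) u) * p + (smult (inverse c) v) * q = 1"
    using arg_cong[OF c, of "smult (inverse c)"] by (simp add: smult_add_right one_pCons)
  thus ?thesis by blast
qed

text \<open>The polynomial \<open>W = G' \<beta> - G \<beta>'\<close> does not change when \<open>G\<close> is replaced by \<open>G + s \<beta>\<close>, and every multiple root
  of \<open>G + s \<beta>\<close> is a root of \<open>W\<close>, where it determines \<open>s\<close>.\<close>

lemma finite_bad_shifts:
  fixes G \<beta> :: "'k::field poly"
  assumes W: "pderiv G * \<beta> - G * pderiv \<beta> \<noteq> 0" and cop: "\<exists>u v. u * G + v * \<beta> = 1"
  shows "finite {s. \<not> (\<exists>u v. u * (G + smult s \<beta>) + v * pderiv (G + smult s \<beta>) = 1)}" (is "finite ?B")
proof -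
  let ?m = "map_poly (to_ac :: 'k \<Rightarrow> _)"
  interpret rhom "to_ac :: 'k \<Rightarrow> _" by (rule rhom_to_ac)
  let ?W = "?m (pderiv G * \<beta> - G * pderiv \<beta>)"
  let ?Z = "{x. poly ?W x = 0}"
  \<comment> \<open>The inserted 0 accounts for G + s \<beta> = 0, where s times \<open>W\<close>
    vanishes and hence s = 0.\<close>
  have "to_ac ` ?B \<subseteq> insert (to_ac 0) ((\<lambda>x. - poly (?m G) x / poly (?m \<beta>) x) ` ?Z)"
  proof (rule image_subsetI)
    fix s assume "s \<in> ?B"
    let ?g = "G + smult s \<beta>"
    show "to_ac s \<in> insert (to_ac 0) ((\<lambda>x. - poly (?m G) x / poly (?m \<beta>) x) ` ?Z)"
    proof (cases "?g = 0")
      case True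
      have "smult s (pderiv \<beta>) = - pderiv G" "smult s \<beta> = - G"
        using True pderiv_add[of G "smult s \<beta>"] by (simp_all add: pderiv_smult eq_neg_iff_add_eq_0 add.commute)
      hence "smult s (pderiv G * \<beta> - G * pderiv \<beta>) = 0"
        by (simp add: smult_diff_right mult_smult_right[symmetric] del: mult_smult_right)
      thus ?thesis using W by simp
    next
      case False
      then obtain x where x: "poly (?m ?g) x = 0" "poly (?m (pderiv ?g)) x = 0"
        using bezout_if_no_common_root[of ?g "pderiv ?g"] \<open>s \<in> ?B\<close> by blast
      obtain u v where "u * G + v * \<beta> = 1" using cop by blast
      hence "poly (?m (u * G + v * \<beta>)) x = 1" by simp
      hence "poly (?m \<beta>) x \<noteq> 0" using x(1) by auto
      hence "to_ac s = - poly (?m G) x / poly (?m \<beta>) x" using x(1) by (simp add: field_simps eq_neg_iff_add_eq_0)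
      moreover have "pderiv G * \<beta> - G * pderiv \<beta> = pderiv ?g * \<beta> - ?g * pderiv \<beta>"
        by (simp add: pderiv_add pderiv_smult algebra_simps)
      hence "poly ?W x = 0" using x by (simp only: map_poly_diff map_poly_mult poly_diff poly_mult) simp
      ultimately show ?thesis by blast
    qed
  qed
  moreover have "finite ?Z" using W by (intro poly_roots_finite) (simp only: map_poly_rhom_eq_0_iff[OF rhom_to_ac], simp)
  ultimately have "finite (to_ac ` ?B)" by (meson finite_imageI finite_insert finite_subset)
  thus ?thesis by (rule finite_imageD) (simp add: inj_on_def)
qed

text \<open>The family is moved to M, where the PAC point gives an irreducible fibre with parameters
  from F; a factorization over F is also one over M, with the same degrees.\<close>

lemma (in family) specialization_irreducible:
  fixes j :: "'a \<Rightarrow> 'm::field"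
  assumes pac: "pac_extension j" and n: "n \<in> separable_degrees TYPE('m)"
  shows "\<exists>t0 t1. irreducible (fam_poly A b \<xi> t0 t1)"
proof -
  have j: "rhom j" by (rule pac_extension_rhom[OF pac])
  have "infinite (UNIV :: 'm set)"
    using pac_extension_infinite[OF pac] finite_imageD[of j UNIV] rhom_eq_iff[OF j]
    by (metis finite_subset inj_onI subset_UNIV)
  then obtain q :: "'m poly" and u v where q: "irreducible q" "lead_coeff q = 1" "degree q = n" "u * q + v * pderiv q = 1"
    using separable_degree_poly[OF n] by blast
  let ?q = "map_poly (to_univ :: 'm \<Rightarrow> _) q"
  have deg: "degree ?q = n" "lead_coeff ?q = 1"
    using q(2,3) by (simp_all add: degree_map_poly_rhom[OF rhom_to_univ] rhom.coeff[OF rhom_to_univ] rhom.one[OF rhom_to_univ])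
  have sqf: "rsquarefree ?q"
    unfolding rsquarefree_iff_no_double_root
  proof (intro conjI allI notI)
    show "?q = 0 \<Longrightarrow> False" using deg(2) by auto
    fix x assume x: "poly ?q x = 0 \<and> poly (pderiv ?q) x = 0"
    have "poly (map_poly to_univ (u * q + v * pderiv q)) x = 1"
      unfolding q(4) by (simp add: rhom.map_poly_one[OF rhom_to_univ])
    thus False using x
      by (simp add: rhom.map_poly_add[OF rhom_to_univ] rhom.map_poly_mult[OF rhom_to_univ] map_poly_pderiv[OF rhom_to_univ])
  qed
  obtain \<theta> where \<theta>: "inj_on \<theta> {..<n}" "\<And>x. poly ?q x = 0 \<longleftrightarrow> (\<exists>i<n. x = \<theta> i)"
    using enumerate_roots[OF sqf deg(2)] unfolding deg(1) by metis
  interpret m: family "map_poly j A" "map_poly j b" "map_poly j g" "j \<xi>" n by (rule family_map[OF j])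
  interpret pac_variety "map_poly j A" "map_poly j b" "map_poly j g" "j \<xi>" n q \<theta>
    by unfold_locales (use q(1,3) sqf \<theta> in auto)
  obtain a and c :: "nat \<Rightarrow> 'a" where a: "a \<in> V" "\<And>i. i < N \<Longrightarrow> a i \<in> range to_univ"
    "a 0 = to_univ (j (c 0))" "a 1 = to_univ (j (c 1))" using rational_point[OF pac] by blast
  let ?f = "fam_poly A b \<xi> (c 0) (c 1)"
  note deg_f = fam_monic[of "c 0" "c 1"]
  have f0: "?f \<noteq> 0" using deg_f(2) by auto
  have "irreducible ?f"
  proof (rule irreducibleI)
    show "?f \<noteq> 0" by (rule f0)
    show "\<not> ?f dvd 1" using f0 deg_f(1) n_pos by (simp add: is_unit_iff_degree)
    fix u w assume uw: "?f = u * w"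
    have nz: "u \<noteq> 0" "w \<noteq> 0" using f0 uw by auto
    have "fam_poly (map_poly j A) (map_poly j b) (j \<xi>) (j (c 0)) (j (c 1)) = map_poly j u * map_poly j w"
      unfolding map_poly_fam_poly[OF j, symmetric] uw by (rule rhom.map_poly_mult[OF j])
    from fibre_irreducible[OF a this] have "degree u = 0 \<or> degree w = 0"
      by (simp add: degree_map_poly_rhom[OF j])
    thus "u dvd 1 \<or> w dvd 1" using nz by (auto simp: is_unit_iff_degree)
  qed
  thus ?thesis by blast
qed

section \<open>Infinitely many admissible choices of g\<close>

lemma coprime_linear_power:
  fixes b :: "'k::field poly"
  assumes "poly b \<xi> \<noteq> 0"
  shows "\<exists>u v. u * [:- \<xi>, 1:] ^ k + v * b = 1"
proof -
  let ?c = "map_poly (to_ac :: 'k \<Rightarrow> _)"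
  have "\<exists>u v. u * ([:- \<xi>, 1:] ^ k) + v * b = 1"
  proof (rule bezout_if_no_common_root)
    fix x assume x: "poly (?c ([:- \<xi>, 1:] ^ k)) x = 0"
    have "?c ([:- \<xi>, 1:] ^ k) = [:- to_ac \<xi>, 1:] ^ k"
      by (simp add: rhom.map_poly_power[OF rhom_to_ac] rhom.map_poly_pCons'[OF rhom_to_ac])
    hence "x = to_ac \<xi>" using x by simp
    thus "poly (?c b) x \<noteq> 0" using assms by (simp add: rhom.poly[OF rhom_to_ac])
  qed simp
  thus ?thesis .
qed

lemma bezout_transfer:
  fixes a b :: "'k::field poly"
  assumes "\<exists>u v. u * a + v * b = 1" "b dvd c - a"
  shows "\<exists>u v. u * c + v * b = 1"
proof -
  obtain u v where uv: "u * a + v * b = 1" using assms(1) by blast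
  obtain w where w: "c - a = b * w" using assms(2) by blast
  have "u * c + (v - u * w) * b = u * (c - a) + u * a + v * b - u * (b * w)" by (simp add: algebra_simps)
  also have "\<dots> = 1" using uv by (simp add: w)
  finally show ?thesis by blast
qed

text \<open>Changing g by multiples of \<open>b\<close> preserves (X - \<xi>)^2 g modulo
  \<open>b\<close>. A constant multiple, with factor \<open>s\<close>, is the free parameter, and
  all but finitely many \<open>s\<close> make g separable with g(\<xi>) not 0.\<close>

lemma families_exist:
  fixes a b :: "'k::field poly"
  assumes inf: "infinite (UNIV :: 'k set)" and cop: "coprime a b" and b0: "b \<noteq> 0" and n: "degree b + 4 \<le> n"
  obtains \<xi> G \<kappa> S where "infinite S" "\<kappa> \<noteq> 0"
    "\<forall>s\<in>S. family ([:- \<xi>, 1:] ^ 2 * (G + smult (s * \<kappa>) b)) b (G + smult (s * \<kappa>) b) \<xi> n"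
    "b dvd [:- \<xi>, 1:] ^ 2 * G - a"
proof -
  have "{x. poly b x = 0} \<noteq> UNIV" using inf poly_roots_finite[OF b0] by auto
  then obtain \<xi> where \<xi>: "poly b \<xi> \<noteq> 0" by blast
  let ?l = "[:- \<xi>, 1:] ^ 2"
  define \<kappa> where "\<kappa> = inverse (lead_coeff b)"
  define \<beta> where "\<beta> = smult \<kappa> b"
  have \<kappa>: "\<kappa> \<noteq> 0" and \<beta>: "lead_coeff \<beta> = 1" "degree \<beta> = degree b" "\<beta> \<noteq> 0" using b0 by (auto simp: \<kappa>_def \<beta>_def)
  obtain u v where uv: "u * ?l + v * b = 1" using coprime_linear_power[OF \<xi>] by blast
  \<comment> \<open>As \<open>u\<close> inverts (X - \<xi>)^2 modulo \<open>b\<close>, this is the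
    residue of a / (X - \<xi>)^2.\<close>
  define g0 where "g0 = (u * a) mod b"
  have g0: "g0 = 0 \<or> degree g0 < degree b" unfolding g0_def by (rule degree_mod_less[OF b0])
  have g0a: "b dvd ?l * g0 - a"
  proof -
    have "?l * g0 - a = ?l * (u * a - b * ((u * a) div b)) - a * (u * ?l + v * b)"
      unfolding uv g0_def by (simp add: minus_mult_div_eq_mod)
    also have "\<dots> = b * (- (?l * ((u * a) div b)) - a * v)" by (simp add: algebra_simps del: mult_pCons_left mult_pCons_right)
    finally show ?thesis by simp
  qed
  \<comment> \<open>The exponent for which \<beta> X^m has degree n - 2. The bound on
    \<open>n\<close> gives m \<ge> 2, so linear polynomials stay below X^m.\<close>
  define m where "m = n - 2 - degree b"
  define k where "k e = monom 1 m + [:0, e:]" for e :: 'k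
  define W where "W e = pderiv (g0 + \<beta> * k e) * \<beta> - (g0 + \<beta> * k e) * pderiv \<beta>" for e
  \<comment> \<open>Hence one of e = 0 and e = 1 makes \<open>W e\<close> nonzero, in every
    characteristic.\<close>
  have "W 1 - W 0 = \<beta> ^ 2"
    by (simp add: W_def k_def pderiv_add pderiv_mult pderiv_pCons power2_eq_square algebra_simps)
  then obtain e where e: "W e \<noteq> 0" using \<beta>(3) by force
  define G where "G = g0 + \<beta> * k e"
  have m: "2 \<le> m" "degree b + m = n - 2" using n by (auto simp: m_def)
  have lin: "degree [:c, e:] < m" for c :: 'k using m(1) by auto
  have GB: "G + smult s \<beta> = g0 + \<beta> * (monom 1 m + [:s, e:])" for s
  proof -
    have "[:s, e:] = [:0, e:] + [:s:]" by simp
    thus ?thesis by (simp add: G_def k_def algebra_simps)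
  qed
  have G_deg: "degree (G + smult s \<beta>) = n - 2" "lead_coeff (G + smult s \<beta>) = 1" for s
  proof -
    define k where "k = monom 1 m + [:s, e:]"
    have "degree k = m" unfolding k_def
      by (subst degree_add_eq_left) (use lin[of s] in \<open>simp_all add: degree_monom_eq\<close>)
    moreover have "coeff k m = 1" using coeff_eq_0[OF lin[of s]] by (simp add: k_def)
    ultimately have k: "degree k = m" "lead_coeff k = 1" by simp_all
    hence "k \<noteq> 0" by auto
    hence bk: "degree (\<beta> * k) = n - 2" "lead_coeff (\<beta> * k) = 1"
      unfolding lead_coeff_mult using k \<beta> m(2) by (simp_all add: degree_mult_eq)
    have lt: "degree g0 < degree (\<beta> * k)" using g0 m bk(1) by auto
    show "degree (G + smult s \<beta>) = n - 2" "lead_coeff (G + smult s \<beta>) = 1"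
      unfolding GB k_def[symmetric] using degree_add_eq_right[OF lt] coeff_eq_0[OF lt] bk by simp_all
  qed
  have "\<beta> dvd G - g0" by (simp add: G_def)
  hence bG: "b dvd G - g0" using \<kappa> by (simp add: \<beta>_def smult_dvd_iff)
  have "?l * G - a = ?l * (G - g0) + (?l * g0 - a)" by (simp add: algebra_simps del: mult_pCons_left)
  hence Ga: "b dvd ?l * G - a" using bG g0a by (metis dvd_add dvd_mult)
  have cop_ab: "\<exists>u v. u * a + v * b = 1" by (rule coprime_bezout_field_poly[OF cop])
  have copA: "\<exists>u v. u * (?l * (G + smult t b)) + v * b = 1" for t
  proof (rule bezout_transfer[OF cop_ab])
    have "?l * (G + smult t b) - a = (?l * G - a) + b * smult t ?l" by (simp add: algebra_simps del: mult_pCons_left mult_pCons_right)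
    thus "b dvd ?l * (G + smult t b) - a" using Ga by (metis dvd_add dvd_triv_left)
  qed
  have "\<exists>u v. u * G + v * \<beta> = 1"
  proof -
    obtain u v where "u * (?l * (G + smult 0 b)) + v * b = 1" using copA by blast
    hence "(u * ?l) * G + (smult (inverse \<kappa>) v) * \<beta> = 1" using \<kappa> by (simp add: \<beta>_def mult.assoc del: mult_pCons_left)
    thus ?thesis by blast
  qed
  hence fin: "finite {s. \<not> (\<exists>u v. u * (G + smult s \<beta>) + v * pderiv (G + smult s \<beta>) = 1)}"
    by (intro finite_bad_shifts) (use e in \<open>simp_all add: W_def G_def\<close>)
  define S where "S = {s. (\<exists>u v. u * (G + smult s \<beta>) + v * pderiv (G + smult s \<beta>) = 1) \<and> poly (G + smult s \<beta>) \<xi> \<noteq> 0}"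
  have "poly \<beta> \<xi> \<noteq> 0" using \<xi> \<kappa> by (simp add: \<beta>_def)
  hence "{s. poly (G + smult s \<beta>) \<xi> = 0} \<subseteq> {- poly G \<xi> / poly \<beta> \<xi>}"
    by (auto simp: field_simps eq_neg_iff_add_eq_0)
  hence "finite {s. poly (G + smult s \<beta>) \<xi> = 0}" by (rule finite_subset) simp
  moreover have "- S = {s. \<not> (\<exists>u v. u * (G + smult s \<beta>) + v * pderiv (G + smult s \<beta>) = 1)} \<union> {s. poly (G + smult s \<beta>) \<xi> = 0}"
    by (auto simp: S_def)
  ultimately have "finite (- S)" using fin by simp
  hence "infinite S" using inf finite_Un[of S "- S"] by (simp add: Compl_partition)
  moreover have "family (?l * (G + smult (s * \<kappa>) b)) b (G + smult (s * \<kappa>) b) \<xi> n" if s: "s \<in> S" for s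
  proof -
    have eq: "smult (s * \<kappa>) b = smult s \<beta>" by (simp add: \<beta>_def)
    have nz: "G + smult s \<beta> \<noteq> 0" using G_deg(2)[of s] by (metis leading_coeff_0_iff zero_neq_one)
    show ?thesis
    proof
      show "degree (?l * (G + smult (s * \<kappa>) b)) = n"
        unfolding eq using nz G_deg(1)[of s] n by (subst degree_mult_eq) (auto simp: degree_linear_power simp del: mult_pCons_left)
      show "lead_coeff (G + smult (s * \<kappa>) b) = 1" unfolding eq by (rule G_deg)
      show "\<exists>u v. u * (G + smult (s * \<kappa>) b) + v * pderiv (G + smult (s * \<kappa>) b) = 1"
        "poly (G + smult (s * \<kappa>) b) \<xi> \<noteq> 0" unfolding eq using s by (auto simp: S_def)
      show "\<exists>u v. u * (?l * (G + smult (s * \<kappa>) b)) + v * b = 1" by (rule copA)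
    qed (use n in simp_all)
  qed
  ultimately show ?thesis using that[of S \<kappa> \<xi> G] \<kappa> Ga by blast
qed

theorem theorem3p1:
  fixes j :: "'f::field \<Rightarrow> 'm::field"
    and a b :: "'f poly"
  assumes "pac_extension j"
    and "coprime a b"
    and "b \<noteq> 0"
  shows "\<exists>n0>0. \<forall>n\<ge>n0. n \<in> separable_degrees TYPE('m) \<longrightarrow>
           infinite {c :: 'f poly. irreducible (a + b * c) \<and> degree (a + b * c) = n}"
proof (intro exI[of _ "degree b + 4"] conjI allI impI)
  \<comment> \<open>The bound \<open>degree b + 4\<close> leaves room for a monic g of degree n - 2
    whose cofactor of \<beta> has freely chosen constant and linear terms.\<close>
  fix n assume n: "degree b + 4 \<le> n" "n \<in> separable_degrees TYPE('m)"
  let ?C = "{c :: 'f poly. irreducible (a + b * c) \<and> degree (a + b * c) = n}"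
  obtain \<xi> G \<kappa> S where S: "infinite S" "\<kappa> \<noteq> 0"
    "\<forall>s\<in>S. family ([:- \<xi>, 1:] ^ 2 * (G + smult (s * \<kappa>) b)) b (G + smult (s * \<kappa>) b) \<xi> n"
    "b dvd [:- \<xi>, 1:] ^ 2 * G - a"
    using families_exist[OF pac_extension_infinite[OF assms(1)] assms(2,3) n(1)] .
  let ?l = "[:- \<xi>, 1:] ^ 2"
  obtain w where w: "?l * G - a = b * w" using S(4) by blast
  \<comment> \<open>The parameters found depend on \<open>s\<close> in an unknown way, but they
    change c only by a linear polynomial. The coefficient of X^2 still recovers \<open>s\<close>, so
    different \<open>s\<close> give different c.\<close>
  have "\<forall>s\<in>S. \<exists>l. coeff l 2 = 0 \<and> w + smult (s * \<kappa>) ?l + l \<in> ?C"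
  proof
    fix s assume s: "s \<in> S"
    interpret family "?l * (G + smult (s * \<kappa>) b)" b "G + smult (s * \<kappa>) b" \<xi> n by (rule bspec[OF S(3) s])
    obtain t0 t1 where irr: "irreducible (fam_poly (?l * (G + smult (s * \<kappa>) b)) b \<xi> t0 t1)"
      using specialization_irreducible[OF assms(1) n(2)] by blast
    have "a + b * (w + smult (s * \<kappa>) ?l + [:t0 - t1 * \<xi>, t1:]) =
        a + b * w + (b * smult (s * \<kappa>) ?l + b * [:t0 - t1 * \<xi>, t1:])"
      by (simp only: distrib_left add.assoc)
    also have "a + b * w = ?l * G" unfolding w[symmetric] by simp
    also have "b * smult (s * \<kappa>) ?l = ?l * smult (s * \<kappa>) b" by (simp only: mult_smult_right) (simp only: mult.commute)
    finally have "a + b * (w + smult (s * \<kappa>) ?l + [:t0 - t1 * \<xi>, t1:]) =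
        fam_poly (?l * (G + smult (s * \<kappa>) b)) b \<xi> t0 t1"
      by (simp only: fam_poly_def distrib_left add.assoc)
    hence "w + smult (s * \<kappa>) ?l + [:t0 - t1 * \<xi>, t1:] \<in> ?C"
      unfolding mem_Collect_eq using irr fam_monic(1)[of t0 t1] by (simp only: simp_thms)
    moreover have "coeff [:t0 - t1 * \<xi>, t1:] 2 = 0" by (simp add: numeral_2_eq_2)
    ultimately show "\<exists>l. coeff l 2 = 0 \<and> w + smult (s * \<kappa>) ?l + l \<in> ?C" by blast
  qed
  from bchoice[OF this] obtain l where l: "\<forall>s\<in>S. coeff (l s) 2 = 0 \<and> w + smult (s * \<kappa>) ?l + l s \<in> ?C" ..
  let ?c = "\<lambda>s. w + smult (s * \<kappa>) ?l + l s"
  have c2: "coeff (?c s) 2 = coeff w 2 + s * \<kappa>" if "s \<in> S" for s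
    using l that by (simp add: power2_eq_square numeral_2_eq_2)
  have "s = s'" if "s \<in> S" "s' \<in> S" "?c s = ?c s'" for s s'
    using c2[OF that(1)] c2[OF that(2)] S(2) unfolding that(3) by simp
  hence "inj_on ?c S" by (rule inj_onI)
  hence "infinite (?c ` S)" using S(1) finite_imageD by blast
  moreover have "?c ` S \<subseteq> ?C" using l by blast
  ultimately show "infinite ?C" using finite_subset by blast
qed simp

end
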